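(* Let $X$ be a scheme, let $\mathscr{O}_Y$ be a quadratic $\mathscr{O}_X$-algebra, and let $\mathscr{I},\mathscr{I}'$ be pseudoregular $\mathscr{O}_Y$-modules. The tensor product $\mathscr{I}\otimes_{\mathscr{O}_Y}\mathscr{I}'$ is locally free of rank $2$ as an $\mathscr{O}_X$-module if and only if $\mathscr{I}$ and $\mathscr{I}'$ are coprimitive.
   Context: A quadratic $\mathscr{O}_X$-algebra is an $\mathscr{O}_X$-algebra locally free of rank $2$ as an $\mathscr{O}_X$-module. An $\mathscr{O}_Y$-module $\mathscr{I}$ is pseudoregular if it is locally free of rank $2$ as an $\mathscr{O}_X$-module and for every affine open $U\subseteq X$ and $\alpha\in\mathscr{O}_Y(U)$, the characteristic polynomials over $\mathscr{O}_X(U)$ of multiplication by $\alpha$ on $\mathscr{O}_Y(U)$ and on $\mathscr{I}(U)$ are equal. Coprimitive, local case: let $S$ be a free quadratic $R$-algebra and $I,I'$ pseudoregular $S$-modules free of rank $2$ over $R$. A good frame $\alpha,e_1,e_2$ for $S$ and $I$ consists of an $R$-basis $1,\alpha$ of $S$ and an $R$-basis $e_1,e_2$ of $I$ with $\alpha e_2\in Re_1$; then $\alpha e_1=be_1-ae_2$, $\alpha e_2=ce_1$ and $\alpha^2-b\alpha+ac=0$ for some $a,b,c\in R$. Good frames always exist, and one can choose good frames $\alpha,e_1,e_2$ for $S,I$ and $\alpha',e_1',e_2'$ for $S,I'$ with $\alpha'=\alpha+r$ for some $r\in R$ (a unital pair); let $a',b',c'$ be the corresponding elements for $I'$. Then $I,I'$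 are coprimitive if $\langle a,b,c,a',b',c',r\rangle=R$ (independent of the choice of unital pair of good frames). In general $\mathscr{I},\mathscr{I}'$ are coprimitive if there is an affine open cover $X=\bigcup_iU_i$ (with all modules free on each $U_i$) such that $\mathscr{I}(U_i)$ and $\mathscr{I}'(U_i)$ are coprimitive over $\mathscr{O}_Y(U_i)$ for all $i$. *)

theory Defs
  imports "HOL-Analysis.Abstract_Topology" "HOL-Algebra.QuotRing" "HOL-Algebra.Module"
    "HOL-Algebra.Free_Abelian_Groups"
begin

section \<open>Presheaves and sheaves\<close>

text \<open>
  A presheaf on a topological space assigns a structure (a ring, a module, an algebra record, ...)
  to every open set.  Its elements over the various open sets share one HOL type, and only its
  values on open sets and on elements of carriers are meaningful.
\<close>

record ('x, 'o, 'e) presheaf =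
  sections :: "'x set \<Rightarrow> 'o"
  restr :: "'x set \<Rightarrow> 'x set \<Rightarrow> 'e \<Rightarrow> 'e"

definition is_presheaf ::
    "'x topology \<Rightarrow> ('x, ('e, 'z) partial_object_scheme, 'e) presheaf \<Rightarrow> bool" where
  "is_presheaf X F \<longleftrightarrow>
     (\<forall>U V. openin X U \<and> openin X V \<and> V \<subseteq> U \<longrightarrow>
        (\<forall>s\<in>carrier (sections F U). restr F U V s \<in> carrier (sections F V))) \<and>
     (\<forall>U. openin X U \<longrightarrow> (\<forall>s\<in>carrier (sections F U). restr F U U s = s)) \<and>
     (\<forall>U V W. openin X U \<and> openin X V \<and> openin X W \<and> W \<subseteq> V \<and> V \<subseteq> U \<longrightarrow>
        (\<forall>s\<in>carrier (sections F U). restr F V W (restr F U V s) = restr F U W s))"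

text \<open>The empty cover of the empty set is allowed, so a sheaf has exactly one section over it.\<close>

definition is_sheaf ::
    "'x topology \<Rightarrow> ('x, ('e, 'z) partial_object_scheme, 'e) presheaf \<Rightarrow> bool" where
  "is_sheaf X F \<longleftrightarrow> is_presheaf X F \<and>
     (\<forall>\<U>. (\<forall>U\<in>\<U>. openin X U) \<longrightarrow>
        (\<forall>s\<in>carrier (sections F (\<Union>\<U>)). \<forall>t\<in>carrier (sections F (\<Union>\<U>)).
           (\<forall>U\<in>\<U>. restr F (\<Union>\<U>) U s = restr F (\<Union>\<U>) U t) \<longrightarrow> s = t) \<and>
        (\<forall>\<sigma>. (\<forall>U\<in>\<U>. \<sigma> U \<in> carrier (sections F U)) \<and>
             (\<forall>U\<in>\<U>. \<forall>V\<in>\<U>. restr F U (U \<inter> V) (\<sigma> U) = restr F V (U \<inter> V) (\<sigma> V)) \<longrightarrow>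
           (\<exists>s\<in>carrier (sections F (\<Union>\<U>)). \<forall>U\<in>\<U>. restr F (\<Union>\<U>) U s = \<sigma> U)))"

definition ring_sheaf ::
    "'x topology \<Rightarrow> ('x, ('r, 'z) ring_scheme, 'r) presheaf \<Rightarrow> bool" where
  "ring_sheaf X R \<longleftrightarrow> is_sheaf X R \<and>
     (\<forall>U. openin X U \<longrightarrow> cring (sections R U)) \<and>
     (\<forall>U V. openin X U \<and> openin X V \<and> V \<subseteq> U \<longrightarrow>
        restr R U V \<in> ring_hom (sections R U) (sections R V))"

definition module_sheaf ::
    "'x topology \<Rightarrow> ('x, ('r, 'z) ring_scheme, 'r) presheaf \<Rightarrow>
     ('x, ('r, 'm, 'w) module_scheme, 'm) presheaf \<Rightarrow> bool" where
  "module_sheaf X R M \<longleftrightarrow> is_sheaf X M \<and>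
     (\<forall>U. openin X U \<longrightarrow> Module.module (sections R U) (sections M U)) \<and>
     (\<forall>U V. openin X U \<and> openin X V \<and> V \<subseteq> U \<longrightarrow>
        (\<forall>x\<in>carrier (sections M U). \<forall>y\<in>carrier (sections M U).
           restr M U V (x \<oplus>\<^bsub>sections M U\<^esub> y) = restr M U V x \<oplus>\<^bsub>sections M V\<^esub> restr M U V y) \<and>
        (\<forall>r\<in>carrier (sections R U). \<forall>x\<in>carrier (sections M U).
           restr M U V (r \<odot>\<^bsub>sections M U\<^esub> x) = restr R U V r \<odot>\<^bsub>sections M V\<^esub> restr M U V x))"

definition algebra_sheaf ::
    "'x topology \<Rightarrow> ('x, ('r, 'z) ring_scheme, 'r) presheaf \<Rightarrow>
     ('x, ('r, 's, 'w) module_scheme, 's) presheaf \<Rightarrow> bool" where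
  "algebra_sheaf X R S \<longleftrightarrow> ring_sheaf X S \<and> module_sheaf X R S \<and>
     (\<forall>U. openin X U \<longrightarrow> Module.algebra (sections R U) (sections S U))"


subsection \<open>Germs and stalks\<close>

definition germ ::
    "'x topology \<Rightarrow> ('x, ('e, 'z) partial_object_scheme, 'e) presheaf \<Rightarrow>
     'x \<Rightarrow> 'x set \<Rightarrow> 'e \<Rightarrow> ('x set \<times> 'e) set" where
  "germ X F x U s =
     {(V, t). openin X V \<and> x \<in> V \<and> t \<in> carrier (sections F V) \<and>
        (\<exists>W. openin X W \<and> x \<in> W \<and> W \<subseteq> U \<inter> V \<and> restr F U W s = restr F V W t)}"

definition stalk_carrier ::
    "'x topology \<Rightarrow> ('x, ('e, 'z) partial_object_scheme, 'e) presheaf \<Rightarrow>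
     'x \<Rightarrow> ('x set \<times> 'e) set set" where
  "stalk_carrier X F x =
     {germ X F x U s | U s. openin X U \<and> x \<in> U \<and> s \<in> carrier (sections F U)}"

text \<open>
  The operation induced on germs by binary operations \<open>f W\<close> on the sections over the open sets
  \<open>W\<close>.  The union runs over all representatives, which all contribute the same class when
  \<open>f\<close> commutes with restriction.
\<close>

definition stalk_op ::
    "'x topology \<Rightarrow> ('x, ('e, 'z) partial_object_scheme, 'e) presheaf \<Rightarrow> 'x \<Rightarrow>
     ('x set \<Rightarrow> 'e \<Rightarrow> 'e \<Rightarrow> 'e) \<Rightarrow>
     ('x set \<times> 'e) set \<Rightarrow> ('x set \<times> 'e) set \<Rightarrow> ('x set \<times> 'e) set" where
  "stalk_op X F x f A B =
     (\<Union>(U, s)\<in>A. \<Union>(V, t)\<in>B.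
        germ X F x (U \<inter> V) (f (U \<inter> V) (restr F U (U \<inter> V) s) (restr F V (U \<inter> V) t)))"

definition stalk ::
    "'x topology \<Rightarrow> ('x, ('r, 'z) ring_scheme, 'r) presheaf \<Rightarrow> 'x \<Rightarrow> ('x set \<times> 'r) set ring" where
  "stalk X R x =
     \<lparr>carrier = stalk_carrier X R x,
      monoid.mult = stalk_op X R x (\<lambda>W. monoid.mult (sections R W)),
      monoid.one = germ X R x (topspace X) \<one>\<^bsub>sections R (topspace X)\<^esub>,
      ring.zero = germ X R x (topspace X) \<zero>\<^bsub>sections R (topspace X)\<^esub>,
      ring.add = stalk_op X R x (\<lambda>W. ring.add (sections R W))\<rparr>"


section \<open>Schemes\<close>

definition local_ring :: "('r, 'z) ring_scheme \<Rightarrow> bool" where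
  "local_ring R \<longleftrightarrow> cring R \<and> (\<exists>!\<mm>. maximalideal \<mm> R)"

definition locally_ringed_space ::
    "'x topology \<Rightarrow> ('x, ('r, 'z) ring_scheme, 'r) presheaf \<Rightarrow> bool" where
  "locally_ringed_space X \<O> \<longleftrightarrow>
     ring_sheaf X \<O> \<and> (\<forall>x\<in>topspace X. local_ring (stalk X \<O> x))"

text \<open>
  Isomorphisms of ringed spaces.  Between locally ringed spaces these are the same as
  isomorphisms of locally ringed spaces, because an isomorphism of local rings is a local
  homomorphism.
\<close>

definition ringed_space_iso ::
    "'x topology \<Rightarrow> ('x, ('r, 'z) ring_scheme, 'r) presheaf \<Rightarrow>
     'y topology \<Rightarrow> ('y, ('q, 'w) ring_scheme, 'q) presheaf \<Rightarrow> bool" where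
  "ringed_space_iso X \<O> Y \<P> \<longleftrightarrow>
     (\<exists>f \<phi>. homeomorphic_map X Y f \<and>
        (\<forall>V. openin Y V \<longrightarrow>
           \<phi> V \<in> ring_iso (sections \<P> V) (sections \<O> {x\<in>topspace X. f x \<in> V})) \<and>
        (\<forall>V W. openin Y V \<and> openin Y W \<and> W \<subseteq> V \<longrightarrow>
           (\<forall>s\<in>carrier (sections \<P> V).
              restr \<O> {x\<in>topspace X. f x \<in> V} {x\<in>topspace X. f x \<in> W} (\<phi> V s) =
              \<phi> W (restr \<P> V W s))))"


subsection \<open>The spectrum of a ring\<close>

definition spec_open :: "('r, 'z) ring_scheme \<Rightarrow> 'r set \<Rightarrow> 'r set set" where
  "spec_open A E = {\<pp>. primeideal \<pp> A \<and> \<not> E \<subseteq> \<pp>}"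

definition spec_topology :: "('r, 'z) ring_scheme \<Rightarrow> 'r set topology" where
  "spec_topology A = topology (\<lambda>U. \<exists>E \<subseteq> carrier A. U = spec_open A E)"

lemma openin_spec_topology:
  assumes "cring A"
  shows "openin (spec_topology A) U \<longleftrightarrow> (\<exists>E \<subseteq> carrier A. U = spec_open A E)"
proof -
  interpret cring A by fact
  have inter: "spec_open A E \<inter> spec_open A E' =
      spec_open A {x \<otimes>\<^bsub>A\<^esub> y | x y. x \<in> E \<and> y \<in> E'}" (is "_ = spec_open A ?P")
    if E: "E \<subseteq> carrier A" and E': "E' \<subseteq> carrier A" for E E'
  proof -
    have eq: "\<not> ?P \<subseteq> \<pp> \<longleftrightarrow> \<not> E \<subseteq> \<pp> \<and> \<not> E' \<subseteq> \<pp>" if "primeideal \<pp> A" for \<pp>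
    proof -
      interpret primeideal \<pp> A by fact
      have *: "x \<otimes>\<^bsub>A\<^esub> y \<in> \<pp> \<longleftrightarrow> x \<in> \<pp> \<or> y \<in> \<pp>" if "x \<in> E" "y \<in> E'" for x y
      proof -
        have "x \<in> carrier A" "y \<in> carrier A"
          using that E E' by blast+
        then show ?thesis
          by (meson I_prime I_l_closed I_r_closed)
      qed
      have "?P \<subseteq> \<pp> \<longleftrightarrow> (\<forall>x\<in>E. \<forall>y\<in>E'. x \<otimes>\<^bsub>A\<^esub> y \<in> \<pp>)"
        by blast
      also have "\<dots> \<longleftrightarrow> (\<forall>x\<in>E. \<forall>y\<in>E'. x \<in> \<pp> \<or> y \<in> \<pp>)"
        using * by simp
      also have "\<dots> \<longleftrightarrow> E \<subseteq> \<pp> \<or> E' \<subseteq> \<pp>"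
        by blast
      finally show ?thesis
        by simp
    qed
    show ?thesis
      unfolding spec_open_def
      by (rule Set.set_eqI) (simp only: Int_iff mem_Collect_eq eq cong: conj_cong, blast)
  qed
  have union: "(\<Union>K\<in>\<K>. spec_open A (e K)) = spec_open A (\<Union>K\<in>\<K>. e K)"
    for \<K> and e :: "'a set set \<Rightarrow> 'a set"
    unfolding spec_open_def UN_subset_iff by blast
  have "istopology (\<lambda>U. \<exists>E \<subseteq> carrier A. U = spec_open A E)"
    unfolding istopology_def
  proof (intro conjI allI impI)
    fix S T
    assume "\<exists>E \<subseteq> carrier A. S = spec_open A E" "\<exists>E \<subseteq> carrier A. T = spec_open A E"
    then obtain E E' where E: "E \<subseteq> carrier A" "E' \<subseteq> carrier A"
      and ST: "S = spec_open A E" "T = spec_open A E'"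
      by metis
    have "{x \<otimes>\<^bsub>A\<^esub> y | x y. x \<in> E \<and> y \<in> E'} \<subseteq> carrier A"
      using E by auto
    then show "\<exists>E \<subseteq> carrier A. S \<inter> T = spec_open A E"
      unfolding ST inter[OF E] by (metis (no_types, lifting))
  next
    fix \<K>
    assume "\<forall>K\<in>\<K>. \<exists>E \<subseteq> carrier A. K = spec_open A E"
    then obtain e where e: "\<And>K. K \<in> \<K> \<Longrightarrow> e K \<subseteq> carrier A"
        "\<And>K. K \<in> \<K> \<Longrightarrow> spec_open A (e K) = K"
      by metis
    have "(\<Union>K\<in>\<K>. spec_open A (e K)) = \<Union>\<K>"
      using e(2) by simp
    then have "\<Union>\<K> = spec_open A (\<Union>K\<in>\<K>. e K)"
      by (simp add: union)
    moreover have "(\<Union>K\<in>\<K>. e K) \<subseteq> carrier A"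
      using e(1) by (rule UN_least)
    ultimately show "\<exists>E \<subseteq> carrier A. \<Union>\<K> = spec_open A E"
      by metis
  qed
  then show ?thesis
    by (simp add: spec_topology_def)
qed

text \<open>The fraction \<open>a / s\<close> in the localization of \<open>A\<close> at the prime ideal \<open>\<pp>\<close>, where \<open>s \<notin> \<pp>\<close>.\<close>

definition fraction :: "('r, 'z) ring_scheme \<Rightarrow> 'r set \<Rightarrow> 'r \<Rightarrow> 'r \<Rightarrow> ('r \<times> 'r) set" where
  "fraction A \<pp> a s =
     {(b, t). b \<in> carrier A \<and> t \<in> carrier A - \<pp> \<and>
        (\<exists>u\<in>carrier A - \<pp>. u \<otimes>\<^bsub>A\<^esub> (a \<otimes>\<^bsub>A\<^esub> t \<ominus>\<^bsub>A\<^esub> b \<otimes>\<^bsub>A\<^esub> s) = \<zero>\<^bsub>A\<^esub>)}"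

definition localization :: "('r, 'z) ring_scheme \<Rightarrow> 'r set \<Rightarrow> ('r \<times> 'r) set ring" where
  "localization A \<pp> =
     \<lparr>carrier = {fraction A \<pp> a s | a s. a \<in> carrier A \<and> s \<in> carrier A - \<pp>},
      monoid.mult = (\<lambda>x y. \<Union>(a, s)\<in>x. \<Union>(b, t)\<in>y. fraction A \<pp> (a \<otimes>\<^bsub>A\<^esub> b) (s \<otimes>\<^bsub>A\<^esub> t)),
      monoid.one = fraction A \<pp> \<one>\<^bsub>A\<^esub> \<one>\<^bsub>A\<^esub>,
      ring.zero = fraction A \<pp> \<zero>\<^bsub>A\<^esub> \<one>\<^bsub>A\<^esub>,
      ring.add = (\<lambda>x y. \<Union>(a, s)\<in>x. \<Union>(b, t)\<in>y.
               fraction A \<pp> (a \<otimes>\<^bsub>A\<^esub> t \<oplus>\<^bsub>A\<^esub> b \<otimes>\<^bsub>A\<^esub> s) (s \<otimes>\<^bsub>A\<^esub> t))\<rparr>"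

text \<open>
  Sections over \<open>U\<close> are the functions assigning to each prime \<open>\<pp> \<in> U\<close> an element of the
  localization at \<open>\<pp>\<close> which are locally given by a single fraction.
\<close>

definition spec_sheaf ::
    "('r, 'z) ring_scheme \<Rightarrow> ('r set, ('r set \<Rightarrow> ('r \<times> 'r) set) ring, 'r set \<Rightarrow> ('r \<times> 'r) set) presheaf"
  where
  "spec_sheaf A =
     \<lparr>sections = (\<lambda>U.
        \<lparr>carrier = {\<sigma>\<in>extensional U. \<forall>\<pp>\<in>U. \<exists>V a f.
             openin (spec_topology A) V \<and> \<pp> \<in> V \<and> V \<subseteq> U \<and> a \<in> carrier A \<and> f \<in> carrier A \<and>
             (\<forall>\<qq>\<in>V. f \<notin> \<qq> \<and> \<sigma> \<qq> = fraction A \<qq> a f)},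
         monoid.mult = (\<lambda>\<sigma> \<tau>. \<lambda>\<pp>\<in>U. \<sigma> \<pp> \<otimes>\<^bsub>localization A \<pp>\<^esub> \<tau> \<pp>),
         monoid.one = (\<lambda>\<pp>\<in>U. \<one>\<^bsub>localization A \<pp>\<^esub>),
         ring.zero = (\<lambda>\<pp>\<in>U. \<zero>\<^bsub>localization A \<pp>\<^esub>),
         ring.add = (\<lambda>\<sigma> \<tau>. \<lambda>\<pp>\<in>U. \<sigma> \<pp> \<oplus>\<^bsub>localization A \<pp>\<^esub> \<tau> \<pp>)\<rparr>),
      restr = (\<lambda>U V \<sigma>. restrict \<sigma> V)\<rparr>"


subsection \<open>Affine open sets and schemes\<close>

text \<open>
  An affine open set is the spectrum of its ring of sections, so it is no restriction that \<open>A\<close>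
  ranges over the rings on the type of sections.
\<close>

definition affine_open ::
    "'x topology \<Rightarrow> ('x, 'r ring, 'r) presheaf \<Rightarrow> 'x set \<Rightarrow> bool" where
  "affine_open X \<O> U \<longleftrightarrow> openin X U \<and>
     (\<exists>A :: 'r ring. cring A \<and>
        ringed_space_iso (subtopology X U) \<O> (spec_topology A) (spec_sheaf A))"

definition scheme :: "'x topology \<Rightarrow> ('x, 'r ring, 'r) presheaf \<Rightarrow> bool" where
  "scheme X \<O> \<longleftrightarrow> locally_ringed_space X \<O> \<and>
     (\<forall>x\<in>topspace X. \<exists>U. x \<in> U \<and> affine_open X \<O> U)"


section \<open>Locally free modules of rank 2\<close>

definition module_sheaf_iso ::
    "'x topology \<Rightarrow> ('x, ('r, 'z) ring_scheme, 'r) presheaf \<Rightarrow>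
     ('x, ('r, 'm, 'w) module_scheme, 'm) presheaf \<Rightarrow>
     ('x, ('r, 'n, 'v) module_scheme, 'n) presheaf \<Rightarrow> bool" where
  "module_sheaf_iso X R M N \<longleftrightarrow>
     (\<exists>\<phi>. (\<forall>U. openin X U \<longrightarrow>
            bij_betw (\<phi> U) (carrier (sections M U)) (carrier (sections N U)) \<and>
            (\<forall>x\<in>carrier (sections M U). \<forall>y\<in>carrier (sections M U).
               \<phi> U (x \<oplus>\<^bsub>sections M U\<^esub> y) = \<phi> U x \<oplus>\<^bsub>sections N U\<^esub> \<phi> U y) \<and>
            (\<forall>r\<in>carrier (sections R U). \<forall>x\<in>carrier (sections M U).
               \<phi> U (r \<odot>\<^bsub>sections M U\<^esub> x) = r \<odot>\<^bsub>sections N U\<^esub> \<phi> U x)) \<and>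
          (\<forall>U V. openin X U \<and> openin X V \<and> V \<subseteq> U \<longrightarrow>
            (\<forall>x\<in>carrier (sections M U). restr N U V (\<phi> U x) = \<phi> V (restr M U V x))))"

text \<open>
  The free module of rank 2.  The multiplication and unit of a module record play no role for
  modules and are left undefined, here and below.
\<close>

definition free2_module :: "('r, 'z) ring_scheme \<Rightarrow> ('r, 'r \<times> 'r) module" where
  "free2_module R =
     \<lparr>carrier = carrier R \<times> carrier R, monoid.mult = undefined, monoid.one = undefined,
      ring.zero = (\<zero>\<^bsub>R\<^esub>, \<zero>\<^bsub>R\<^esub>),
      ring.add = (\<lambda>(x, y) (x', y'). (x \<oplus>\<^bsub>R\<^esub> x', y \<oplus>\<^bsub>R\<^esub> y')),
      smult = (\<lambda>r (x, y). (r \<otimes>\<^bsub>R\<^esub> x, r \<otimes>\<^bsub>R\<^esub> y))\<rparr>"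

definition free2_sheaf ::
    "('x, ('r, 'z) ring_scheme, 'r) presheaf \<Rightarrow> ('x, ('r, 'r \<times> 'r) module, 'r \<times> 'r) presheaf" where
  "free2_sheaf R =
     \<lparr>sections = (\<lambda>U. free2_module (sections R U)),
      restr = (\<lambda>U V (x, y). (restr R U V x, restr R U V y))\<rparr>"

definition free2_on ::
    "'x topology \<Rightarrow> ('x, ('r, 'z) ring_scheme, 'r) presheaf \<Rightarrow>
     ('x, ('r, 'm, 'w) module_scheme, 'm) presheaf \<Rightarrow> 'x set \<Rightarrow> bool" where
  "free2_on X R M U \<longleftrightarrow> module_sheaf_iso (subtopology X U) R (free2_sheaf R) M"

definition locally_free2 ::
    "'x topology \<Rightarrow> ('x, ('r, 'z) ring_scheme, 'r) presheaf \<Rightarrow>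
     ('x, ('r, 'm, 'w) module_scheme, 'm) presheaf \<Rightarrow> bool" where
  "locally_free2 X R M \<longleftrightarrow> module_sheaf X R M \<and>
     (\<forall>x\<in>topspace X. \<exists>U. openin X U \<and> x \<in> U \<and> free2_on X R M U)"

definition quadratic_algebra ::
    "'x topology \<Rightarrow> ('x, ('r, 'z) ring_scheme, 'r) presheaf \<Rightarrow>
     ('x, ('r, 's, 'w) module_scheme, 's) presheaf \<Rightarrow> bool" where
  "quadratic_algebra X R S \<longleftrightarrow> algebra_sheaf X R S \<and> locally_free2 X R S"


subsection \<open>Restriction of scalars along the structure map of an algebra\<close>

definition scalar_restriction ::
    "('r, 's, 'w) module_scheme \<Rightarrow> ('s, 'm, 'v) module_scheme \<Rightarrow> ('r, 'm) module" where
  "scalar_restriction S M =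
     \<lparr>carrier = carrier M, monoid.mult = monoid.mult M, monoid.one = monoid.one M,
      ring.zero = ring.zero M, ring.add = ring.add M,
      smult = (\<lambda>r m. (r \<odot>\<^bsub>S\<^esub> \<one>\<^bsub>S\<^esub>) \<odot>\<^bsub>M\<^esub> m)\<rparr>"

definition scalar_restriction_sheaf ::
    "('x, ('r, 's, 'w) module_scheme, 's) presheaf \<Rightarrow>
     ('x, ('s, 'm, 'v) module_scheme, 'm) presheaf \<Rightarrow> ('x, ('r, 'm) module, 'm) presheaf" where
  "scalar_restriction_sheaf S M =
     \<lparr>sections = (\<lambda>U. scalar_restriction (sections S U) (sections M U)), restr = restr M\<rparr>"


subsection \<open>Characteristic polynomials\<close>

definition basis2 ::
    "('r, 'z) ring_scheme \<Rightarrow> ('r, 'm, 'w) module_scheme \<Rightarrow> 'm \<Rightarrow> 'm \<Rightarrow> bool" where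
  "basis2 R M e\<^sub>1 e\<^sub>2 \<longleftrightarrow> e\<^sub>1 \<in> carrier M \<and> e\<^sub>2 \<in> carrier M \<and>
     bij_betw (\<lambda>(x, y). x \<odot>\<^bsub>M\<^esub> e\<^sub>1 \<oplus>\<^bsub>M\<^esub> y \<odot>\<^bsub>M\<^esub> e\<^sub>2) (carrier R \<times> carrier R) (carrier M)"

definition sheaf_basis2 ::
    "'x topology \<Rightarrow> ('x, ('r, 'z) ring_scheme, 'r) presheaf \<Rightarrow>
     ('x, ('r, 'm, 'w) module_scheme, 'm) presheaf \<Rightarrow> 'x set \<Rightarrow> 'm \<Rightarrow> 'm \<Rightarrow> bool" where
  "sheaf_basis2 X R M U e\<^sub>1 e\<^sub>2 \<longleftrightarrow>
     e\<^sub>1 \<in> carrier (sections M U) \<and> e\<^sub>2 \<in> carrier (sections M U) \<and>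
     (\<forall>V. openin X V \<and> V \<subseteq> U \<longrightarrow>
        basis2 (sections R V) (sections M V) (restr M U V e\<^sub>1) (restr M U V e\<^sub>2))"

text \<open>
  The coefficients, highest degree first, of the characteristic polynomial
  \<open>T\<^sup>2 - (p + s) T + (p s - q r)\<close> of the matrix with rows \<open>(p, q)\<close> and \<open>(r, s)\<close>.
\<close>

definition char_poly_matrix2 :: "('r, 'z) ring_scheme \<Rightarrow> 'r \<Rightarrow> 'r \<Rightarrow> 'r \<Rightarrow> 'r \<Rightarrow> 'r list" where
  "char_poly_matrix2 R p q r s =
     [\<one>\<^bsub>R\<^esub>, \<ominus>\<^bsub>R\<^esub> (p \<oplus>\<^bsub>R\<^esub> s), (p \<otimes>\<^bsub>R\<^esub> s) \<ominus>\<^bsub>R\<^esub> (q \<otimes>\<^bsub>R\<^esub> r)]"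

text \<open>
  The characteristic polynomial over the ring of sections on \<open>U\<close> of an endomorphism \<open>f\<close>
  (given by maps \<open>f V\<close> for \<open>V \<subseteq> U\<close>) of a module \<open>M\<close> that is locally free of rank 2.
  The sections over \<open>U\<close> need not have a basis, so the polynomial is obtained by gluing the
  characteristic polynomials of the matrices of \<open>f\<close> on the open subsets on which \<open>M\<close> has a
  basis.  These do not depend on the basis, and the sheaf property gives existence and uniqueness.
\<close>

definition sheaf_char_poly ::
    "'x topology \<Rightarrow> ('x, ('r, 'z) ring_scheme, 'r) presheaf \<Rightarrow>
     ('x, ('r, 'm, 'w) module_scheme, 'm) presheaf \<Rightarrow> 'x set \<Rightarrow> ('x set \<Rightarrow> 'm \<Rightarrow> 'm) \<Rightarrow> 'r list" where
  "sheaf_char_poly X R M U f = (THE P. set P \<subseteq> carrier (sections R U) \<and>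
     (\<forall>V e\<^sub>1 e\<^sub>2 p q r s.
        openin X V \<and> V \<subseteq> U \<and> sheaf_basis2 X R M V e\<^sub>1 e\<^sub>2 \<and>
        {p, q, r, s} \<subseteq> carrier (sections R V) \<and>
        f V e\<^sub>1 = p \<odot>\<^bsub>sections M V\<^esub> e\<^sub>1 \<oplus>\<^bsub>sections M V\<^esub> r \<odot>\<^bsub>sections M V\<^esub> e\<^sub>2 \<and>
        f V e\<^sub>2 = q \<odot>\<^bsub>sections M V\<^esub> e\<^sub>1 \<oplus>\<^bsub>sections M V\<^esub> s \<odot>\<^bsub>sections M V\<^esub> e\<^sub>2 \<longrightarrow>
        map (restr R U V) P = char_poly_matrix2 (sections R V) p q r s))"


section \<open>Pseudoregular modules\<close>

definition pseudoregular ::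
    "'x topology \<Rightarrow> ('x, 'r ring, 'r) presheaf \<Rightarrow> ('x, ('r, 's) module, 's) presheaf \<Rightarrow>
     ('x, ('s, 'm) module, 'm) presheaf \<Rightarrow> bool" where
  "pseudoregular X \<O> S M \<longleftrightarrow> module_sheaf X S M \<and>
     locally_free2 X \<O> (scalar_restriction_sheaf S M) \<and>
     (\<forall>U \<alpha>. affine_open X \<O> U \<and> \<alpha> \<in> carrier (sections S U) \<longrightarrow>
        sheaf_char_poly X \<O> S U (\<lambda>V y. restr S U V \<alpha> \<otimes>\<^bsub>sections S V\<^esub> y) =
        sheaf_char_poly X \<O> (scalar_restriction_sheaf S M) U
          (\<lambda>V m. restr S U V \<alpha> \<odot>\<^bsub>sections M V\<^esub> m))"


section \<open>Tensor products\<close>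

text \<open>
  The tensor product of two modules is the quotient of the free abelian group on pairs by the
  subgroup generated by the usual relations; its elements are cosets.
\<close>

definition tensor_relations ::
    "('s, 'z) ring_scheme \<Rightarrow> ('s, 'm, 'w) module_scheme \<Rightarrow> ('s, 'n, 'v) module_scheme \<Rightarrow>
     ('m \<times> 'n \<Rightarrow>\<^sub>0 int) set" where
  "tensor_relations S M N =
     {frag_of (m \<oplus>\<^bsub>M\<^esub> m', n) - frag_of (m, n) - frag_of (m', n) | m m' n.
        m \<in> carrier M \<and> m' \<in> carrier M \<and> n \<in> carrier N} \<union>
     {frag_of (m, n \<oplus>\<^bsub>N\<^esub> n') - frag_of (m, n) - frag_of (m, n') | m n n'.
        m \<in> carrier M \<and> n \<in> carrier N \<and> n' \<in> carrier N} \<union>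
     {frag_of (s \<odot>\<^bsub>M\<^esub> m, n) - frag_of (m, s \<odot>\<^bsub>N\<^esub> n) | s m n.
        s \<in> carrier S \<and> m \<in> carrier M \<and> n \<in> carrier N}"

definition tensor_free ::
    "('s, 'm, 'w) module_scheme \<Rightarrow> ('s, 'n, 'v) module_scheme \<Rightarrow> ('m \<times> 'n \<Rightarrow>\<^sub>0 int) monoid" where
  "tensor_free M N = free_Abelian_group (carrier M \<times> carrier N)"

definition tensor_kernel ::
    "('s, 'z) ring_scheme \<Rightarrow> ('s, 'm, 'w) module_scheme \<Rightarrow> ('s, 'n, 'v) module_scheme \<Rightarrow>
     ('m \<times> 'n \<Rightarrow>\<^sub>0 int) set" where
  "tensor_kernel S M N = generate (tensor_free M N) (tensor_relations S M N)"

text \<open>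
  As for stalks, the unions over the elements of a coset \<open>C\<close> are unions of identical cosets.
\<close>

definition tensor_module ::
    "('s, 'z) ring_scheme \<Rightarrow> ('s, 'm, 'w) module_scheme \<Rightarrow> ('s, 'n, 'v) module_scheme \<Rightarrow>
     ('s, ('m \<times> 'n \<Rightarrow>\<^sub>0 int) set) module" where
  "tensor_module S M N =
     \<lparr>carrier = carrier (tensor_free M N Mod tensor_kernel S M N),
      monoid.mult = undefined, monoid.one = undefined,
      ring.zero = \<one>\<^bsub>tensor_free M N Mod tensor_kernel S M N\<^esub>,
      ring.add = monoid.mult (tensor_free M N Mod tensor_kernel S M N),
      smult = (\<lambda>s C. \<Union>c\<in>C. tensor_kernel S M N #>\<^bsub>tensor_free M N\<^esub>
                        frag_extend (\<lambda>(m, n). frag_of (s \<odot>\<^bsub>M\<^esub> m, n)) c)\<rparr>"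

definition tensor_presheaf ::
    "('x, ('s, 'z) ring_scheme, 's) presheaf \<Rightarrow> ('x, ('s, 'm, 'w) module_scheme, 'm) presheaf \<Rightarrow>
     ('x, ('s, 'n, 'v) module_scheme, 'n) presheaf \<Rightarrow>
     ('x, ('s, ('m \<times> 'n \<Rightarrow>\<^sub>0 int) set) module, ('m \<times> 'n \<Rightarrow>\<^sub>0 int) set) presheaf" where
  "tensor_presheaf S M N =
     \<lparr>sections = (\<lambda>U. tensor_module (sections S U) (sections M U) (sections N U)),
      restr = (\<lambda>U V C. \<Union>c\<in>C.
        tensor_kernel (sections S V) (sections M V) (sections N V)
          #>\<^bsub>tensor_free (sections M V) (sections N V)\<^esub>
        frag_extend (\<lambda>(m, n). frag_of (restr M U V m, restr N U V n)) c)\<rparr>"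

text \<open>
  The sheafification of a presheaf \<open>F\<close> of \<open>S\<close>-modules: sections over \<open>U\<close> are the functions
  assigning to each \<open>x \<in> U\<close> an element of the stalk of \<open>F\<close> at \<open>x\<close> which are locally given by
  the germs of a single section of \<open>F\<close>.
\<close>

definition sheafification ::
    "'x topology \<Rightarrow> ('x, ('s, 'z) ring_scheme, 's) presheaf \<Rightarrow>
     ('x, ('s, 't, 'w) module_scheme, 't) presheaf \<Rightarrow>
     ('x, ('s, 'x \<Rightarrow> ('x set \<times> 't) set) module, 'x \<Rightarrow> ('x set \<times> 't) set) presheaf" where
  "sheafification X S F =
     \<lparr>sections = (\<lambda>U.
        \<lparr>carrier = {\<sigma>\<in>extensional U. \<forall>x\<in>U. \<exists>V t.
             openin X V \<and> x \<in> V \<and> V \<subseteq> U \<and> t \<in> carrier (sections F V) \<and>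
             (\<forall>y\<in>V. \<sigma> y = germ X F y V t)},
         monoid.mult = undefined, monoid.one = undefined,
         ring.zero = (\<lambda>x\<in>U. germ X F x U \<zero>\<^bsub>sections F U\<^esub>),
         ring.add = (\<lambda>\<sigma> \<tau>. \<lambda>x\<in>U. stalk_op X F x (\<lambda>W. ring.add (sections F W)) (\<sigma> x) (\<tau> x)),
         smult = (\<lambda>s \<sigma>. \<lambda>x\<in>U. \<Union>(V, t)\<in>\<sigma> x.
           germ X F x (U \<inter> V) (restr S U (U \<inter> V) s \<odot>\<^bsub>sections F (U \<inter> V)\<^esub> restr F V (U \<inter> V) t))\<rparr>),
      restr = (\<lambda>U V \<sigma>. restrict \<sigma> V)\<rparr>"

definition tensor_sheaf ::
    "'x topology \<Rightarrow> ('x, ('s, 'z) ring_scheme, 's) presheaf \<Rightarrow>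
     ('x, ('s, 'm, 'w) module_scheme, 'm) presheaf \<Rightarrow>
     ('x, ('s, 'n, 'v) module_scheme, 'n) presheaf \<Rightarrow>
     ('x, ('s, 'x \<Rightarrow> ('x set \<times> ('m \<times> 'n \<Rightarrow>\<^sub>0 int) set) set) module,
       'x \<Rightarrow> ('x set \<times> ('m \<times> 'n \<Rightarrow>\<^sub>0 int) set) set) presheaf" where
  "tensor_sheaf X S M N = sheafification X S (tensor_presheaf S M N)"


section \<open>Coprimitive modules\<close>

definition good_frame ::
    "('r, 'z) ring_scheme \<Rightarrow> ('r, 's, 'w) module_scheme \<Rightarrow> ('s, 'm, 'v) module_scheme \<Rightarrow>
     's \<Rightarrow> 'm \<Rightarrow> 'm \<Rightarrow> bool" where
  "good_frame R S M \<alpha> e\<^sub>1 e\<^sub>2 \<longleftrightarrow>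
     basis2 R S \<one>\<^bsub>S\<^esub> \<alpha> \<and> basis2 R (scalar_restriction S M) e\<^sub>1 e\<^sub>2 \<and>
     (\<exists>c\<in>carrier R. \<alpha> \<odot>\<^bsub>M\<^esub> e\<^sub>2 = c \<odot>\<^bsub>scalar_restriction S M\<^esub> e\<^sub>1)"

text \<open>
  The elements \<open>a, b, c\<close> of \<open>R\<close> attached to a good frame.  They are unique, and for
  pseudoregular \<open>M\<close> they satisfy \<open>\<alpha>\<^sup>2 - b \<alpha> + a c = 0\<close>.
\<close>

definition frame_coeffs ::
    "('r, 'z) ring_scheme \<Rightarrow> ('r, 's, 'w) module_scheme \<Rightarrow> ('s, 'm, 'v) module_scheme \<Rightarrow>
     's \<Rightarrow> 'm \<Rightarrow> 'm \<Rightarrow> 'r \<Rightarrow> 'r \<Rightarrow> 'r \<Rightarrow> bool" where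
  "frame_coeffs R S M \<alpha> e\<^sub>1 e\<^sub>2 a b c \<longleftrightarrow> {a, b, c} \<subseteq> carrier R \<and>
     \<alpha> \<odot>\<^bsub>M\<^esub> e\<^sub>1 = (b \<odot>\<^bsub>scalar_restriction S M\<^esub> e\<^sub>1) \<ominus>\<^bsub>M\<^esub> (a \<odot>\<^bsub>scalar_restriction S M\<^esub> e\<^sub>2) \<and>
     \<alpha> \<odot>\<^bsub>M\<^esub> e\<^sub>2 = c \<odot>\<^bsub>scalar_restriction S M\<^esub> e\<^sub>1"

text \<open>
  For pseudoregular modules the condition below does not depend on the choice of the unital pair
  of good frames, and unital pairs exist.
\<close>

definition coprimitive_modules ::
    "('r, 'z) ring_scheme \<Rightarrow> ('r, 's, 'w) module_scheme \<Rightarrow>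
     ('s, 'm, 'v) module_scheme \<Rightarrow> ('s, 'n, 'u) module_scheme \<Rightarrow> bool" where
  "coprimitive_modules R S M M' \<longleftrightarrow>
     (\<exists>\<alpha> e\<^sub>1 e\<^sub>2 \<alpha>' e\<^sub>1' e\<^sub>2' r a b c a' b' c'.
        good_frame R S M \<alpha> e\<^sub>1 e\<^sub>2 \<and> good_frame R S M' \<alpha>' e\<^sub>1' e\<^sub>2' \<and>
        r \<in> carrier R \<and> \<alpha>' = \<alpha> \<oplus>\<^bsub>S\<^esub> r \<odot>\<^bsub>S\<^esub> \<one>\<^bsub>S\<^esub> \<and>
        frame_coeffs R S M \<alpha> e\<^sub>1 e\<^sub>2 a b c \<and> frame_coeffs R S M' \<alpha>' e\<^sub>1' e\<^sub>2' a' b' c' \<and>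
        Idl\<^bsub>R\<^esub> {a, b, c, a', b', c', r} = carrier R)"

definition coprimitive ::
    "'x topology \<Rightarrow> ('x, 'r ring, 'r) presheaf \<Rightarrow> ('x, ('r, 's) module, 's) presheaf \<Rightarrow>
     ('x, ('s, 'm) module, 'm) presheaf \<Rightarrow> ('x, ('s, 'n) module, 'n) presheaf \<Rightarrow> bool" where
  "coprimitive X \<O> S M M' \<longleftrightarrow>
     (\<exists>\<U>. \<Union>\<U> = topspace X \<and>
        (\<forall>U\<in>\<U>. affine_open X \<O> U \<and>
           free2_on X \<O> S U \<and>
           free2_on X \<O> (scalar_restriction_sheaf S M) U \<and>
           free2_on X \<O> (scalar_restriction_sheaf S M') U \<and>
           coprimitive_modules (sections \<O> U) (sections S U) (sections M U) (sections M' U)))"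

end

theory Submission
  imports Defs "HOL-Algebra.Subrings" "HOL-Algebra.Ring_Divisibility"
begin

text \<open>
  Locally there are frames with \<open>\<alpha> e\<^sub>1 = b e\<^sub>1 - a e\<^sub>2\<close>, \<open>\<alpha> e\<^sub>2 = c e\<^sub>1\<close> and, writing \<open>\<alpha> = \<alpha>' - r\<close>
  and \<open>d = b' - r\<close>, \<open>\<alpha> f\<^sub>1 = d f\<^sub>1 - a' f\<^sub>2\<close>, \<open>\<alpha> f\<^sub>2 = c' f\<^sub>1 - r f\<^sub>2\<close>.  The equality of the
  characteristic polynomials means that \<open>d = b + r\<close> and \<open>a c = a' c' - r d\<close>.  The tensor product is
  generated by the four elements \<open>e\<^sub>i \<otimes> f\<^sub>j\<close>.  Their relations are the rows of an alternating
  \<open>4 \<times> 4\<close> matrix with entries \<open>\<plusminus>a, \<plusminus>a', \<plusminus>d, \<plusminus>r, \<plusminus>c', \<plusminus>c\<close>, and the last equation says that its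
  Pfaffian vanishes, so that the rows of the dual alternating matrix define functionals on the
  tensor product.  If one of the entries is a unit, which holds locally if they generate the unit ideal, then
  these functionals show that two of the four generators form a basis.  Conversely, modulo the
  ideal \<open>J\<close> generated by the entries, there are no relations and the tensor product is free on
  the four generators.  If it is also generated by two elements, then \<open>R / J = 0\<close>.
\<close>

section \<open>Tensor products of modules\<close>

text \<open>Pseudoregularity compares characteristic polynomials over affine open sets only, while
  everything else is local. Hence affine open sets must be found inside arbitrary neighbourhoods,
  which is why basic open subsets of a spectrum are shown to be spectra again. The identities
  \<open>d = b + r\<close> and \<open>a c = a' c' - r d\<close> found there are mere equations and
  restrict to all smaller open sets. The element \<open>b\<close> is no entry of the alternating
  matrix, but \<open>b = d - r\<close> and \<open>b' = d + r\<close>, so the seven elements of the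
  coprimitivity condition and the six entries generate the same ideal; the local rings of the scheme
  turn "generate the unit ideal" into "one entry is a unit near the point". In the other direction
  the obstacle is sheafification: sections of the tensor sheaf are tensors only germwise, so a basis
  expresses the \<open>e\<^sub>i \<otimes> f\<^sub>j\<close> through two elements of the presheaf
  only after shrinking around a point. Three of the four generators are then enough, since the 3 x 3
  identity matrix does not factor through rank 2 over a nonzero ring.\<close>

definition pure_tensor ::
    "('s, 'z) ring_scheme \<Rightarrow> ('s, 'm, 'w) module_scheme \<Rightarrow> ('s, 'n, 'v) module_scheme \<Rightarrow>
     'm \<Rightarrow> 'n \<Rightarrow> ('m \<times> 'n \<Rightarrow>\<^sub>0 int) set" where
  "pure_tensor S M N m n = tensor_kernel S M N #>\<^bsub>tensor_free M N\<^esub> frag_of (m, n)"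

text \<open>Middle linear maps. The target is a ring record used only through its addition, because
  it is a tensor module in one use and a commutative ring in another.\<close>

definition balanced_map ::
    "('s, 'z) ring_scheme \<Rightarrow> ('s, 'm, 'w) module_scheme \<Rightarrow> ('s, 'n, 'v) module_scheme \<Rightarrow>
     ('b, 'u) ring_scheme \<Rightarrow> ('m \<Rightarrow> 'n \<Rightarrow> 'b) \<Rightarrow> bool" where
  "balanced_map S M N B \<beta> \<longleftrightarrow>
     (\<forall>m\<in>carrier M. \<forall>n\<in>carrier N. \<beta> m n \<in> carrier B) \<and>
     (\<forall>m\<in>carrier M. \<forall>m'\<in>carrier M. \<forall>n\<in>carrier N.
        \<beta> (m \<oplus>\<^bsub>M\<^esub> m') n = \<beta> m n \<oplus>\<^bsub>B\<^esub> \<beta> m' n) \<and>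
     (\<forall>m\<in>carrier M. \<forall>n\<in>carrier N. \<forall>n'\<in>carrier N.
        \<beta> m (n \<oplus>\<^bsub>N\<^esub> n') = \<beta> m n \<oplus>\<^bsub>B\<^esub> \<beta> m n') \<and>
     (\<forall>s\<in>carrier S. \<forall>m\<in>carrier M. \<forall>n\<in>carrier N. \<beta> (s \<odot>\<^bsub>M\<^esub> m) n = \<beta> m (s \<odot>\<^bsub>N\<^esub> n))"

lemma balanced_mapI:
  assumes "\<And>m n. m \<in> carrier M \<Longrightarrow> n \<in> carrier N \<Longrightarrow> \<beta> m n \<in> carrier B"
    and "\<And>m m' n. m \<in> carrier M \<Longrightarrow> m' \<in> carrier M \<Longrightarrow> n \<in> carrier N \<Longrightarrow>
      \<beta> (m \<oplus>\<^bsub>M\<^esub> m') n = \<beta> m n \<oplus>\<^bsub>B\<^esub> \<beta> m' n"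
    and "\<And>m n n'. m \<in> carrier M \<Longrightarrow> n \<in> carrier N \<Longrightarrow> n' \<in> carrier N \<Longrightarrow>
      \<beta> m (n \<oplus>\<^bsub>N\<^esub> n') = \<beta> m n \<oplus>\<^bsub>B\<^esub> \<beta> m n'"
    and "\<And>s m n. s \<in> carrier S \<Longrightarrow> m \<in> carrier M \<Longrightarrow> n \<in> carrier N \<Longrightarrow>
      \<beta> (s \<odot>\<^bsub>M\<^esub> m) n = \<beta> m (s \<odot>\<^bsub>N\<^esub> n)"
  shows "balanced_map S M N B \<beta>"
  using assms unfolding balanced_map_def by blast

locale tensor_pair =
  fixes S :: "('s, 'z) ring_scheme" and M :: "('s, 'm, 'w) module_scheme"
    and N :: "('s, 'n, 'v) module_scheme"
  assumes module_M: "Module.module S M" and module_N: "Module.module S N"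
begin

interpretation M: Module.module S M by (rule module_M)
interpretation N: Module.module S N by (rule module_N)

abbreviation (input) "G \<equiv> tensor_free M N"
abbreviation (input) "K \<equiv> tensor_kernel S M N"
abbreviation (input) "T \<equiv> tensor_module S M N"
abbreviation (input) "pt \<equiv> pure_tensor S M N"

lemma comm_group_free: "comm_group G"
  unfolding tensor_free_def by (rule abelian_free_Abelian_group)

interpretation G: comm_group G by (rule comm_group_free)

lemma mult_free [simp]: "x \<otimes>\<^bsub>G\<^esub> y = x + y"
  by (simp add: tensor_free_def)

lemma tensor_relations_closed: "tensor_relations S M N \<subseteq> carrier G"
proof -
  have of: "frag_of p \<in> carrier G" if "p \<in> carrier M \<times> carrier N" for p
    using that by (simp add: tensor_free_def keys_frag_of)
  have diff: "x - y \<in> carrier G" if "x \<in> carrier G" "y \<in> carrier G" for x y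
    using that keys_diff[of x y] unfolding tensor_free_def by fastforce
  show ?thesis
    unfolding tensor_relations_def
    by (intro Un_least subsetI) (auto intro!: diff of)
qed

lemma subgroup_kernel: "subgroup K G"
  unfolding tensor_kernel_def by (rule G.generate_is_subgroup[OF tensor_relations_closed])

lemma normal_kernel: "K \<lhd> G"
  by (simp add: G.normal_iff_subgroup subgroup_kernel)

text \<open>The addition of the tensor module is the multiplication of the quotient group, so the
  axioms are those of \<open>G Mod K\<close> read additively.\<close>

lemma abelian_group_tensor: "abelian_group T"
proof -
  interpret Q: comm_group "G Mod K"
    by (rule G.abelian_FactGroup[OF subgroup_kernel])
  have T: "carrier T = carrier (G Mod K)" "ring.add T = monoid.mult (G Mod K)"
      "\<zero>\<^bsub>T\<^esub> = \<one>\<^bsub>G Mod K\<^esub>"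
    by (simp_all add: tensor_module_def)
  show ?thesis
    by (rule abelian_groupI, unfold T)
      (simp_all add: Q.m_assoc Q.l_inv_ex del: mult_FactGroup one_FactGroup, rule Q.m_comm)
qed

interpretation T: abelian_group T by (rule abelian_group_tensor)

lemma carrier_tensor: "carrier T = (\<lambda>c. K #>\<^bsub>G\<^esub> c) ` carrier G"
  by (auto simp: tensor_module_def carrier_FactGroup)

lemma frag_of_in_free:
  "m \<in> carrier M \<Longrightarrow> n \<in> carrier N \<Longrightarrow> frag_of (m, n) \<in> carrier G"
  by (simp add: tensor_free_def keys_frag_of)

lemma pure_tensor_closed [intro, simp]:
  "m \<in> carrier M \<Longrightarrow> n \<in> carrier N \<Longrightarrow> pt m n \<in> carrier T"
  unfolding pure_tensor_def carrier_tensor by (intro imageI frag_of_in_free)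

lemma coset_add:
  "x \<in> carrier G \<Longrightarrow> y \<in> carrier G \<Longrightarrow>
    (K #>\<^bsub>G\<^esub> x) \<oplus>\<^bsub>T\<^esub> (K #>\<^bsub>G\<^esub> y) = K #>\<^bsub>G\<^esub> (x + y)"
  using normal.rcos_sum[OF normal_kernel, of x y] by (simp add: tensor_module_def)

lemma coset_eq:
  assumes "x - y \<in> K" "x \<in> carrier G" "y \<in> carrier G"
  shows "K #>\<^bsub>G\<^esub> x = K #>\<^bsub>G\<^esub> y"
proof -
  have "x \<in> K #>\<^bsub>G\<^esub> y"
    using assms(1) by (force simp: r_coset_def)
  then show ?thesis
    using G.repr_independence[OF _ assms(3) subgroup_kernel] by simp
qed

lemma relation_in_kernel: "x \<in> tensor_relations S M N \<Longrightarrow> x \<in> K"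
  unfolding tensor_kernel_def by (rule generate.incl)

lemma add_in_free: "x \<in> carrier G \<Longrightarrow> y \<in> carrier G \<Longrightarrow> x + y \<in> carrier G"
  using G.m_closed[of x y] by simp

lemma balanced_pure_tensor: "balanced_map S M N T pt"
proof (rule balanced_mapI)
  fix m m' n assume *: "m \<in> carrier M" "m' \<in> carrier M" "n \<in> carrier N"
  then have "frag_of (m \<oplus>\<^bsub>M\<^esub> m', n) - frag_of (m, n) - frag_of (m', n) \<in> K"
    by (intro relation_in_kernel) (auto simp: tensor_relations_def)
  then have "frag_of (m \<oplus>\<^bsub>M\<^esub> m', n) - (frag_of (m, n) + frag_of (m', n)) \<in> K"
    by (simp add: algebra_simps)
  then show "pt (m \<oplus>\<^bsub>M\<^esub> m') n = pt m n \<oplus>\<^bsub>T\<^esub> pt m' n"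
    using * by (simp add: pure_tensor_def coset_add frag_of_in_free coset_eq add_in_free)
next
  fix m n n' assume *: "m \<in> carrier M" "n \<in> carrier N" "n' \<in> carrier N"
  then have "frag_of (m, n \<oplus>\<^bsub>N\<^esub> n') - frag_of (m, n) - frag_of (m, n') \<in> K"
    by (intro relation_in_kernel) (auto simp: tensor_relations_def)
  then have "frag_of (m, n \<oplus>\<^bsub>N\<^esub> n') - (frag_of (m, n) + frag_of (m, n')) \<in> K"
    by (simp add: algebra_simps)
  then show "pt m (n \<oplus>\<^bsub>N\<^esub> n') = pt m n \<oplus>\<^bsub>T\<^esub> pt m n'"
    using * by (simp add: pure_tensor_def coset_add frag_of_in_free coset_eq add_in_free)
next
  fix s m n assume *: "s \<in> carrier S" "m \<in> carrier M" "n \<in> carrier N"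
  then have "frag_of (s \<odot>\<^bsub>M\<^esub> m, n) - frag_of (m, s \<odot>\<^bsub>N\<^esub> n) \<in> K"
    by (intro relation_in_kernel) (auto simp: tensor_relations_def)
  then show "pt (s \<odot>\<^bsub>M\<^esub> m) n = pt m (s \<odot>\<^bsub>N\<^esub> n)"
    using * by (simp add: pure_tensor_def frag_of_in_free coset_eq)
qed auto

lemma pure_tensor_add_left:
  "m \<in> carrier M \<Longrightarrow> m' \<in> carrier M \<Longrightarrow> n \<in> carrier N \<Longrightarrow>
    pt (m \<oplus>\<^bsub>M\<^esub> m') n = pt m n \<oplus>\<^bsub>T\<^esub> pt m' n"
  using balanced_pure_tensor unfolding balanced_map_def by blast

lemma pure_tensor_add_right:
  "m \<in> carrier M \<Longrightarrow> n \<in> carrier N \<Longrightarrow> n' \<in> carrier N \<Longrightarrow>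
    pt m (n \<oplus>\<^bsub>N\<^esub> n') = pt m n \<oplus>\<^bsub>T\<^esub> pt m n'"
  using balanced_pure_tensor unfolding balanced_map_def by blast

lemma pure_tensor_balanced:
  "s \<in> carrier S \<Longrightarrow> m \<in> carrier M \<Longrightarrow> n \<in> carrier N \<Longrightarrow>
    pt (s \<odot>\<^bsub>M\<^esub> m) n = pt m (s \<odot>\<^bsub>N\<^esub> n)"
  using balanced_pure_tensor unfolding balanced_map_def by blast

text \<open>The free abelian group on pairs maps to \<open>B\<close>. Additivity and balancedness of
  \<beta> say that this map kills the generating relations, hence the whole kernel, so it factors
  through the quotient group. Every map out of a tensor product below comes from here.\<close>

lemma tensor_universal:
  assumes B: "abelian_group B" and \<beta>: "balanced_map S M N B \<beta>"
  obtains h where "\<And>x. x \<in> carrier T \<Longrightarrow> h x \<in> carrier B"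
    and "\<And>x y. x \<in> carrier T \<Longrightarrow> y \<in> carrier T \<Longrightarrow> h (x \<oplus>\<^bsub>T\<^esub> y) = h x \<oplus>\<^bsub>B\<^esub> h y"
    and "\<And>m n. m \<in> carrier M \<Longrightarrow> n \<in> carrier N \<Longrightarrow> h (pt m n) = \<beta> m n"
proof -
  interpret B: abelian_group B by fact
  have closed: "\<beta> m n \<in> carrier B" if "m \<in> carrier M" "n \<in> carrier N" for m n
    using \<beta> that unfolding balanced_map_def by blast
  have "(\<lambda>(m, n). \<beta> m n) ` (carrier M \<times> carrier N) \<subseteq> carrier (add_monoid B)"
    using closed by auto
  then obtain h0 where h0: "h0 \<in> hom G (add_monoid B)"
      "\<And>x. x \<in> carrier M \<times> carrier N \<Longrightarrow> h0 (frag_of x) = (\<lambda>(m, n). \<beta> m n) x"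
    using comm_group.free_Abelian_group_universal[OF B.a_comm_group] unfolding tensor_free_def
    by (metis (no_types, lifting))
  have h0_closed: "h0 x \<in> carrier B" if "x \<in> carrier G" for x
    using hom_in_carrier[OF h0(1) that] by simp
  have h0_add: "h0 (x + y) = h0 x \<oplus>\<^bsub>B\<^esub> h0 y" if "x \<in> carrier G" "y \<in> carrier G" for x y
    using hom_mult[OF h0(1) that] by simp
  have diff_closed: "x - y \<in> carrier G" if "x \<in> carrier G" "y \<in> carrier G" for x y
    using that keys_diff[of x y] unfolding tensor_free_def by fastforce
  have h0_diff: "h0 (x - y) = h0 x \<ominus>\<^bsub>B\<^esub> h0 y" if xy: "x \<in> carrier G" "y \<in> carrier G" for x y
  proof -
    have "h0 x = h0 (x - y) \<oplus>\<^bsub>B\<^esub> h0 y"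
      using h0_add[OF diff_closed[OF xy] xy(2)] by simp
    then show ?thesis
      using h0_closed diff_closed xy
      by (metis a_minus_def B.add.inv_solve_right)
  qed
  have sum_diff: "(x \<oplus>\<^bsub>B\<^esub> y) \<ominus>\<^bsub>B\<^esub> x \<ominus>\<^bsub>B\<^esub> y = \<zero>\<^bsub>B\<^esub>" if xy: "x \<in> carrier B" "y \<in> carrier B" for x y
  proof -
    have "(x \<oplus>\<^bsub>B\<^esub> y) \<ominus>\<^bsub>B\<^esub> x \<ominus>\<^bsub>B\<^esub> y = (x \<oplus>\<^bsub>B\<^esub> y) \<oplus>\<^bsub>B\<^esub> \<ominus>\<^bsub>B\<^esub> (x \<oplus>\<^bsub>B\<^esub> y)"
      using xy by (simp add: a_minus_def B.minus_add B.a_assoc)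
    then show ?thesis
      using xy by (simp add: B.r_neg)
  qed
  have relations: "h0 x = \<zero>\<^bsub>B\<^esub>" if "x \<in> tensor_relations S M N" for x
  proof -
    have 1: "h0 (frag_of (m \<oplus>\<^bsub>M\<^esub> m', n) - frag_of (m, n) - frag_of (m', n)) = \<zero>\<^bsub>B\<^esub>"
      if "m \<in> carrier M" "m' \<in> carrier M" "n \<in> carrier N" for m m' n
    proof -
      have "\<beta> (m \<oplus>\<^bsub>M\<^esub> m') n = \<beta> m n \<oplus>\<^bsub>B\<^esub> \<beta> m' n"
        using \<beta> that unfolding balanced_map_def by blast
      then show ?thesis
        using that closed
        by (simp add: h0_diff diff_closed frag_of_in_free h0(2) sum_diff)
    qed
    have 2: "h0 (frag_of (m, n \<oplus>\<^bsub>N\<^esub> n') - frag_of (m, n) - frag_of (m, n')) = \<zero>\<^bsub>B\<^esub>"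
      if "m \<in> carrier M" "n \<in> carrier N" "n' \<in> carrier N" for m n n'
    proof -
      have "\<beta> m (n \<oplus>\<^bsub>N\<^esub> n') = \<beta> m n \<oplus>\<^bsub>B\<^esub> \<beta> m n'"
        using \<beta> that unfolding balanced_map_def by blast
      then show ?thesis
        using that closed
        by (simp add: h0_diff diff_closed frag_of_in_free h0(2) sum_diff)
    qed
    have 3: "h0 (frag_of (s \<odot>\<^bsub>M\<^esub> m, n) - frag_of (m, s \<odot>\<^bsub>N\<^esub> n)) = \<zero>\<^bsub>B\<^esub>"
      if "s \<in> carrier S" "m \<in> carrier M" "n \<in> carrier N" for s m n
    proof -
      have "\<beta> (s \<odot>\<^bsub>M\<^esub> m) n = \<beta> m (s \<odot>\<^bsub>N\<^esub> n)"
        using \<beta> that unfolding balanced_map_def by blast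
      then show ?thesis
        using that closed by (simp add: h0_diff frag_of_in_free h0(2) B.r_neg B.minus_eq)
    qed
    from that show ?thesis
      unfolding tensor_relations_def by (elim UnE CollectE exE conjE) (simp_all add: 1 2 3)
  qed
  \<comment> \<open>Membership in the group is proved along with vanishing, because additivity of
    \<open>h0\<close> is known only there.\<close>
  have kernel: "x \<in> carrier G \<and> h0 x = \<zero>\<^bsub>B\<^esub>" if "x \<in> K" for x
    using that unfolding tensor_kernel_def
  proof (induction rule: generate.induct)
    case one
    have "h0 \<one>\<^bsub>G\<^esub> \<oplus>\<^bsub>B\<^esub> h0 \<one>\<^bsub>G\<^esub> = h0 \<one>\<^bsub>G\<^esub>"
      using h0_add[of "\<one>\<^bsub>G\<^esub>" "\<one>\<^bsub>G\<^esub>"] G.l_one[of "\<one>\<^bsub>G\<^esub>"] by simp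
    then show ?case
      using h0_closed[of "\<one>\<^bsub>G\<^esub>"] by (metis B.add.l_cancel_one G.one_closed)
  next
    case (incl h)
    then show ?case
      using relations tensor_relations_closed by blast
  next
    case (inv h)
    then have h: "h \<in> carrier G" "h0 h = \<zero>\<^bsub>B\<^esub>"
      using relations tensor_relations_closed by blast+
    have "h0 (h \<otimes>\<^bsub>G\<^esub> inv\<^bsub>G\<^esub> h) = h0 h \<oplus>\<^bsub>B\<^esub> h0 (inv\<^bsub>G\<^esub> h)"
      using h0_add[of h "inv\<^bsub>G\<^esub> h"] h(1) by simp
    moreover have "h \<otimes>\<^bsub>G\<^esub> inv\<^bsub>G\<^esub> h = h - h"
      using h(1) G.r_inv[OF h(1)] by (simp add: tensor_free_def)
    moreover have "h0 (h - h) = \<zero>\<^bsub>B\<^esub>"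
      using h0_diff[OF h(1) h(1)] h by (simp add: B.minus_eq B.r_neg)
    ultimately show ?case
      using h h0_closed[of "inv\<^bsub>G\<^esub> h"] by simp
  next
    case (eng h1 h2)
    then show ?case
      by (simp add: h0_add add_in_free)
  qed
  \<comment> \<open>Two representatives of one coset differ by an element of the kernel, so
    \<open>h0\<close> descends to the quotient.\<close>
  have same: "h0 x = h0 y" if "x \<in> carrier G" "y \<in> carrier G" "K #>\<^bsub>G\<^esub> x = K #>\<^bsub>G\<^esub> y" for x y
  proof -
    have "x \<in> K #>\<^bsub>G\<^esub> y"
      using G.rcos_self[OF that(1) subgroup_kernel] that(3) by simp
    then obtain k where "k \<in> K" "x = k + y"
      by (auto simp: r_coset_def)
    then show ?thesis
      using kernel[of k] h0_add[of k y] that(2) h0_closed[OF that(2)] by simp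
  qed
  obtain h where h: "h \<in> hom (G Mod K) (add_monoid B)" "\<And>x. x \<in> carrier G \<Longrightarrow> h (K #>\<^bsub>G\<^esub> x) = h0 x"
    using FactGroup_universal[OF h0(1) normal_kernel same] by blast
  show thesis
  proof
    show "h x \<in> carrier B" if "x \<in> carrier T" for x
      using that h0_closed by (auto simp: carrier_tensor h(2))
    show "h (x \<oplus>\<^bsub>T\<^esub> y) = h x \<oplus>\<^bsub>B\<^esub> h y" if "x \<in> carrier T" "y \<in> carrier T" for x y
      using that by (auto simp: carrier_tensor coset_add h(2) h0_add add_in_free)
    show "h (pt m n) = \<beta> m n" if "m \<in> carrier M" "n \<in> carrier N" for m n
      using that by (simp add: pure_tensor_def h(2) frag_of_in_free h0(2))
  qed
qed

lemma pure_tensor_zero_left: "n \<in> carrier N \<Longrightarrow> pt \<zero>\<^bsub>M\<^esub> n = \<zero>\<^bsub>T\<^esub>"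
  using pure_tensor_add_left[of "\<zero>\<^bsub>M\<^esub>" "\<zero>\<^bsub>M\<^esub>" n] by simp

lemma pure_tensor_minus_left:
  "m \<in> carrier M \<Longrightarrow> n \<in> carrier N \<Longrightarrow> pt (\<ominus>\<^bsub>M\<^esub> m) n = \<ominus>\<^bsub>T\<^esub> pt m n"
  using pure_tensor_add_left[of "\<ominus>\<^bsub>M\<^esub> m" m n]
  by (simp add: M.M.l_neg pure_tensor_zero_left T.add.inv_equality)

lemma coset_zero: "K #>\<^bsub>G\<^esub> 0 = \<zero>\<^bsub>T\<^esub>"
proof -
  have "0 = \<one>\<^bsub>G\<^esub>" by (simp add: tensor_free_def)
  then show ?thesis
    using G.coset_join2[OF G.one_closed subgroup_kernel subgroup.one_closed[OF subgroup_kernel]]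
    by (simp add: tensor_module_def)
qed

lemma coset_minus:
  assumes x: "x \<in> carrier G" shows "K #>\<^bsub>G\<^esub> (- x) = \<ominus>\<^bsub>T\<^esub> (K #>\<^bsub>G\<^esub> x)"
proof -
  have x': "- x \<in> carrier G"
    using x by (simp add: tensor_free_def)
  have "(K #>\<^bsub>G\<^esub> (- x)) \<oplus>\<^bsub>T\<^esub> (K #>\<^bsub>G\<^esub> x) = \<zero>\<^bsub>T\<^esub>"
    using coset_add[OF x' x] by (simp add: coset_zero)
  moreover have "K #>\<^bsub>G\<^esub> (- x) \<in> carrier T" "K #>\<^bsub>G\<^esub> x \<in> carrier T"
    using x x' by (auto simp: carrier_tensor)
  ultimately show ?thesis
    by (metis T.add.inv_equality a_inv_def)
qed

text \<open>Pure tensors generate under addition alone, since \<ominus> (m \<otimes> n) = (\<ominus>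
  m) \<otimes> n is again pure and the zero tensor is 0 \<otimes> 0.\<close>

lemma tensor_induct [consumes 1, case_names pure add]:
  assumes x: "x \<in> carrier T"
    and pure: "\<And>m n. m \<in> carrier M \<Longrightarrow> n \<in> carrier N \<Longrightarrow> P (pt m n)"
    and add: "\<And>x y. x \<in> carrier T \<Longrightarrow> y \<in> carrier T \<Longrightarrow> P x \<Longrightarrow> P y \<Longrightarrow> P (x \<oplus>\<^bsub>T\<^esub> y)"
  shows "P x"
proof -
  obtain c where c: "c \<in> carrier G" "x = K #>\<^bsub>G\<^esub> c"
    using x by (auto simp: carrier_tensor)
  have "Poly_Mapping.keys c \<subseteq> carrier M \<times> carrier N"
    using c(1) by (simp add: tensor_free_def)
  \<comment> \<open>The induction rule for free abelian groups closes under differences, while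
    \<open>P\<close> is only closed under sums; carrying the negative of the coset along repairs
    this.\<close>
  then have "P (K #>\<^bsub>G\<^esub> c) \<and> P (\<ominus>\<^bsub>T\<^esub> (K #>\<^bsub>G\<^esub> c))"
  proof (induction rule: free_Abelian_group_induct[consumes 1, case_names zero diff gen])
    case zero
    have "P (pt \<zero>\<^bsub>M\<^esub> \<zero>\<^bsub>N\<^esub>)" by (rule pure) auto
    moreover have "\<ominus>\<^bsub>T\<^esub> \<zero>\<^bsub>T\<^esub> = \<zero>\<^bsub>T\<^esub>"
      by (rule T.minus_equality) simp_all
    ultimately show ?case
      using pure_tensor_zero_left[of "\<zero>\<^bsub>N\<^esub>"] coset_zero by (metis N.M.zero_closed)
  next
    case (diff x y)
    have xy: "x \<in> carrier G" "y \<in> carrier G" "- y \<in> carrier G"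
      using diff(1,2) by (simp_all add: tensor_free_def)
    from xy have X: "K #>\<^bsub>G\<^esub> x \<in> carrier T" "K #>\<^bsub>G\<^esub> y \<in> carrier T"
      by (auto simp: carrier_tensor)
    have eq: "K #>\<^bsub>G\<^esub> (x - y) = (K #>\<^bsub>G\<^esub> x) \<oplus>\<^bsub>T\<^esub> \<ominus>\<^bsub>T\<^esub> (K #>\<^bsub>G\<^esub> y)"
      using coset_add[OF xy(1,3)] coset_minus[OF xy(2)] by simp
    have "\<ominus>\<^bsub>T\<^esub> (K #>\<^bsub>G\<^esub> (x - y)) = \<ominus>\<^bsub>T\<^esub> (K #>\<^bsub>G\<^esub> x) \<oplus>\<^bsub>T\<^esub> (K #>\<^bsub>G\<^esub> y)"
      using X by (simp add: eq T.minus_add)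
    with eq diff(3,4) X show ?case
      by (simp add: add)
  next
    case (gen a)
    obtain m n where a: "a = (m, n)" "m \<in> carrier M" "n \<in> carrier N"
      using gen by auto
    have "\<ominus>\<^bsub>T\<^esub> (pt m n) = pt (\<ominus>\<^bsub>M\<^esub> m) n"
      using a by (simp add: pure_tensor_minus_left)
    then show ?case
      using pure[of m n] pure[of "\<ominus>\<^bsub>M\<^esub> m" n] a by (simp add: pure_tensor_def)
  qed
  then show ?thesis using c(2) by simp
qed

end

text \<open>
  Both the scalar multiplication and the restriction maps of tensor products are unions over the
  representatives of a coset, of the following shape.
\<close>

lemma tensor_map_exists:
  assumes MN: "tensor_pair S M N" and MN': "tensor_pair S' M' N'"
    and g: "balanced_map S M N (tensor_module S' M' N') (\<lambda>m n. pure_tensor S' M' N' (f m) (g n))"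
    and closed: "\<And>m. m \<in> carrier M \<Longrightarrow> f m \<in> carrier M'" "\<And>n. n \<in> carrier N \<Longrightarrow> g n \<in> carrier N'"
    and def: "h = (\<lambda>C. \<Union>c\<in>C. tensor_kernel S' M' N' #>\<^bsub>tensor_free M' N'\<^esub>
      frag_extend (\<lambda>(m, n). frag_of (f m, g n)) c)"
  shows "\<And>x. x \<in> carrier (tensor_module S M N) \<Longrightarrow> h x \<in> carrier (tensor_module S' M' N')"
    and "\<And>x y. x \<in> carrier (tensor_module S M N) \<Longrightarrow> y \<in> carrier (tensor_module S M N) \<Longrightarrow>
      h (x \<oplus>\<^bsub>tensor_module S M N\<^esub> y) = h x \<oplus>\<^bsub>tensor_module S' M' N'\<^esub> h y"
    and "\<And>m n. m \<in> carrier M \<Longrightarrow> n \<in> carrier N \<Longrightarrow>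
      h (pure_tensor S M N m n) = pure_tensor S' M' N' (f m) (g n)"
proof -
  interpret A: tensor_pair S M N by fact
  interpret B: tensor_pair S' M' N' by fact
  let ?T = "tensor_module S M N" and ?T' = "tensor_module S' M' N'"
  let ?K = "tensor_kernel S M N" and ?K' = "tensor_kernel S' M' N'"
  let ?G = "tensor_free M N" and ?G' = "tensor_free M' N'"
  let ?fe = "frag_extend (\<lambda>(m, n). frag_of (f m, g n))"
  interpret G: comm_group ?G by (rule A.comm_group_free)
  interpret T: abelian_group ?T by (rule A.abelian_group_tensor)
  interpret T': abelian_group ?T' by (rule B.abelian_group_tensor)
  obtain u where u: "\<And>x. x \<in> carrier ?T \<Longrightarrow> u x \<in> carrier ?T'"
     "\<And>x y. x \<in> carrier ?T \<Longrightarrow> y \<in> carrier ?T \<Longrightarrow> u (x \<oplus>\<^bsub>?T\<^esub> y) = u x \<oplus>\<^bsub>?T'\<^esub> u y"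
     "\<And>m n. m \<in> carrier M \<Longrightarrow> n \<in> carrier N \<Longrightarrow>
       u (pure_tensor S M N m n) = pure_tensor S' M' N' (f m) (g n)"
    using A.tensor_universal[OF B.abelian_group_tensor g] by blast
  have u0: "u \<zero>\<^bsub>?T\<^esub> = \<zero>\<^bsub>?T'\<^esub>"
    using u(2)[of "\<zero>\<^bsub>?T\<^esub>" "\<zero>\<^bsub>?T\<^esub>"] u(1)[of "\<zero>\<^bsub>?T\<^esub>"] by simp
  have u_minus: "u (\<ominus>\<^bsub>?T\<^esub> x) = \<ominus>\<^bsub>?T'\<^esub> u x" if "x \<in> carrier ?T" for x
  proof -
    have "u (\<ominus>\<^bsub>?T\<^esub> x) \<oplus>\<^bsub>?T'\<^esub> u x = \<zero>\<^bsub>?T'\<^esub>"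
      using u(2)[of "\<ominus>\<^bsub>?T\<^esub> x" x] that u0 by (simp add: T.l_neg)
    then show ?thesis
      using T'.add.inv_equality[of "u (\<ominus>\<^bsub>?T\<^esub> x)" "u x"] u(1) that by simp
  qed
  \<comment> \<open>On representatives, \<open>u\<close> is given by the extension of the map on
    generators. The induction runs over formal combinations of pairs, and the generator case is the
    value of \<open>u\<close> on pure tensors.\<close>
  have rep: "?fe c \<in> carrier ?G' \<and> u (?K #>\<^bsub>?G\<^esub> c) = ?K' #>\<^bsub>?G'\<^esub> ?fe c" if "c \<in> carrier ?G" for c
  proof -
    have "Poly_Mapping.keys c \<subseteq> carrier M \<times> carrier N"
      using that by (simp add: tensor_free_def)
    then show ?thesis
    proof (induction rule: free_Abelian_group_induct[consumes 1, case_names zero diff gen])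
      case zero
      then show ?case by (simp add: A.coset_zero B.coset_zero u0) (simp add: tensor_free_def)
    next
      case (diff x y)
      have xy: "x \<in> carrier ?G" "y \<in> carrier ?G" "- y \<in> carrier ?G"
        using diff(1,2) by (simp_all add: tensor_free_def)
      have fxy: "?fe x \<in> carrier ?G'" "?fe y \<in> carrier ?G'" "- ?fe y \<in> carrier ?G'"
        using diff(3,4) by (simp_all add: tensor_free_def)
      have X: "?K #>\<^bsub>?G\<^esub> x \<in> carrier ?T" "?K #>\<^bsub>?G\<^esub> y \<in> carrier ?T"
        using xy by (auto simp: A.carrier_tensor)
      have "u (?K #>\<^bsub>?G\<^esub> (x - y)) = u (?K #>\<^bsub>?G\<^esub> x) \<oplus>\<^bsub>?T'\<^esub> \<ominus>\<^bsub>?T'\<^esub> u (?K #>\<^bsub>?G\<^esub> y)"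
        using A.coset_add[OF xy(1,3)] A.coset_minus[OF xy(2)] X u(2)[OF X(1) T.a_inv_closed[OF X(2)]]
        by (simp add: u_minus)
      also have "\<dots> = ?K' #>\<^bsub>?G'\<^esub> (?fe x - ?fe y)"
        using diff(3,4) B.coset_add[OF fxy(1,3)] B.coset_minus[OF fxy(2)] by simp
      finally show ?case
        using B.add_in_free[OF fxy(1,3)] by (simp add: frag_extend_diff)
    next
      case (gen a)
      obtain m n where a: "a = (m, n)" "m \<in> carrier M" "n \<in> carrier N"
        using gen by auto
      then show ?case
        using u(3)[of m n] by (simp add: pure_tensor_def B.frag_of_in_free closed)
    qed
  qed
  \<comment> \<open>Each coset in the union defining \<open>h x\<close> equals \<open>u x\<close>:
    every element \<open>d\<close> of \<open>x\<close> names the same coset, and \<open>rep\<close>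
    computes \<open>u\<close> from any representative.\<close>
  have h: "h x = u x" if x: "x \<in> carrier ?T" for x
  proof -
    obtain c where c: "c \<in> carrier ?G" "x = ?K #>\<^bsub>?G\<^esub> c"
      using x by (auto simp: A.carrier_tensor)
    have "?K' #>\<^bsub>?G'\<^esub> ?fe d = u x" if "d \<in> x" for d
    proof -
      have d: "d \<in> carrier ?G"
        using that c subgroup.subset[OF A.subgroup_kernel] G.r_coset_subset_G by blast
      have "x = ?K #>\<^bsub>?G\<^esub> d"
        using G.repr_independence[OF _ c(1) A.subgroup_kernel] that c(2) by simp
      then show ?thesis
        using rep[OF d] by simp
    qed
    moreover have "x \<noteq> {}"
      using G.rcos_self[OF c(1) A.subgroup_kernel] c(2) by blast
    ultimately show ?thesis
      unfolding def by auto
  qed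
  show "\<And>x. x \<in> carrier ?T \<Longrightarrow> h x \<in> carrier ?T'"
    by (simp add: h u)
  show "\<And>x y. x \<in> carrier ?T \<Longrightarrow> y \<in> carrier ?T \<Longrightarrow> h (x \<oplus>\<^bsub>?T\<^esub> y) = h x \<oplus>\<^bsub>?T'\<^esub> h y"
    by (simp add: h u)
  show "\<And>m n. m \<in> carrier M \<Longrightarrow> n \<in> carrier N \<Longrightarrow>
      h (pure_tensor S M N m n) = pure_tensor S' M' N' (f m) (g n)"
    by (simp add: h u)
qed

context tensor_pair
begin

interpretation M: Module.module S M by (rule module_M)
interpretation N: Module.module S N by (rule module_N)
interpretation T: abelian_group T by (rule abelian_group_tensor)

text \<open>The case of \<open>tensor_map_exists\<close> where the left factor is multiplied by
  \<open>s\<close> and the right factor is fixed. Commutativity of \<open>S\<close> makes this map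
  balanced.\<close>

lemma tensor_smult:
  assumes s: "s \<in> carrier S"
  shows "\<And>x. x \<in> carrier T \<Longrightarrow> s \<odot>\<^bsub>T\<^esub> x \<in> carrier T"
    and "\<And>x y. x \<in> carrier T \<Longrightarrow> y \<in> carrier T \<Longrightarrow>
      s \<odot>\<^bsub>T\<^esub> (x \<oplus>\<^bsub>T\<^esub> y) = (s \<odot>\<^bsub>T\<^esub> x) \<oplus>\<^bsub>T\<^esub> (s \<odot>\<^bsub>T\<^esub> y)"
    and "\<And>m n. m \<in> carrier M \<Longrightarrow> n \<in> carrier N \<Longrightarrow> s \<odot>\<^bsub>T\<^esub> pt m n = pt (s \<odot>\<^bsub>M\<^esub> m) n"
proof -
  have b: "balanced_map S M N T (\<lambda>m n. pt (s \<odot>\<^bsub>M\<^esub> m) n)"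
  proof (rule balanced_mapI)
    fix s' m n assume *: "s' \<in> carrier S" "m \<in> carrier M" "n \<in> carrier N"
    have "s \<odot>\<^bsub>M\<^esub> (s' \<odot>\<^bsub>M\<^esub> m) = s' \<odot>\<^bsub>M\<^esub> (s \<odot>\<^bsub>M\<^esub> m)"
      using * s by (metis M.R.m_comm M.smult_assoc1)
    then show "pt (s \<odot>\<^bsub>M\<^esub> (s' \<odot>\<^bsub>M\<^esub> m)) n = pt (s \<odot>\<^bsub>M\<^esub> m) (s' \<odot>\<^bsub>N\<^esub> n)"
      using * s by (simp add: pure_tensor_balanced)
  qed (use s in \<open>auto simp: pure_tensor_add_left pure_tensor_add_right M.smult_r_distr\<close>)
  have pair: "tensor_pair S M N" by unfold_locales
  have def: "smult T s = (\<lambda>C. \<Union>c\<in>C. K #>\<^bsub>G\<^esub> frag_extend (\<lambda>(m, n). frag_of (s \<odot>\<^bsub>M\<^esub> m, n)) c)"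
    by (simp add: tensor_module_def)
  note * = tensor_map_exists[OF pair pair b M.smult_closed[OF s] _ def]
  show "\<And>x. x \<in> carrier T \<Longrightarrow> s \<odot>\<^bsub>T\<^esub> x \<in> carrier T"
    and "\<And>x y. x \<in> carrier T \<Longrightarrow> y \<in> carrier T \<Longrightarrow>
      s \<odot>\<^bsub>T\<^esub> (x \<oplus>\<^bsub>T\<^esub> y) = (s \<odot>\<^bsub>T\<^esub> x) \<oplus>\<^bsub>T\<^esub> (s \<odot>\<^bsub>T\<^esub> y)"
    and "\<And>m n. m \<in> carrier M \<Longrightarrow> n \<in> carrier N \<Longrightarrow> s \<odot>\<^bsub>T\<^esub> pt m n = pt (s \<odot>\<^bsub>M\<^esub> m) n"
    by (rule *; simp)+
qed

lemma module_tensor: "Module.module S T"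
proof (rule Module.moduleI)
  show "cring S" by (rule M.is_cring)
  show "abelian_group T" by (rule abelian_group_tensor)
  show "a \<odot>\<^bsub>T\<^esub> x \<in> carrier T" if "a \<in> carrier S" "x \<in> carrier T" for a x
    using that by (rule tensor_smult)
  show "a \<odot>\<^bsub>T\<^esub> (x \<oplus>\<^bsub>T\<^esub> y) = a \<odot>\<^bsub>T\<^esub> x \<oplus>\<^bsub>T\<^esub> a \<odot>\<^bsub>T\<^esub> y"
    if "a \<in> carrier S" "x \<in> carrier T" "y \<in> carrier T" for a x y
    using that by (rule tensor_smult)
  show "(a \<oplus>\<^bsub>S\<^esub> b) \<odot>\<^bsub>T\<^esub> x = a \<odot>\<^bsub>T\<^esub> x \<oplus>\<^bsub>T\<^esub> b \<odot>\<^bsub>T\<^esub> x"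
    if "a \<in> carrier S" "b \<in> carrier S" "x \<in> carrier T" for a b x
    using that(3)
  proof (induction rule: tensor_induct)
    case (pure m n)
    then show ?case
      using that by (simp add: tensor_smult M.smult_l_distr pure_tensor_add_left)
  next
    case (add x y)
    then show ?case
      using that by (simp add: tensor_smult T.a_ac)
  qed
  show "(a \<otimes>\<^bsub>S\<^esub> b) \<odot>\<^bsub>T\<^esub> x = a \<odot>\<^bsub>T\<^esub> (b \<odot>\<^bsub>T\<^esub> x)"
    if "a \<in> carrier S" "b \<in> carrier S" "x \<in> carrier T" for a b x
    using that(3)
  proof (induction rule: tensor_induct)
    case (pure m n)
    then show ?case
      using that by (simp add: tensor_smult M.smult_assoc1)
  next
    case (add x y)
    then show ?case
      using that by (simp add: tensor_smult)
  qed
  show "\<one>\<^bsub>S\<^esub> \<odot>\<^bsub>T\<^esub> x = x" if "x \<in> carrier T" for x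
    using that by (induction rule: tensor_induct) (simp_all add: tensor_smult)
qed

end

section \<open>Germs\<close>

locale presheaf_on =
  fixes X :: "'x topology" and F :: "('x, ('e, 'z) partial_object_scheme, 'e) presheaf"
  assumes is_presheaf: "is_presheaf X F"
begin

lemma restr_closed:
  "openin X U \<Longrightarrow> openin X V \<Longrightarrow> V \<subseteq> U \<Longrightarrow> s \<in> carrier (sections F U) \<Longrightarrow>
    restr F U V s \<in> carrier (sections F V)"
  using is_presheaf unfolding is_presheaf_def by simp

lemma restr_id: "openin X U \<Longrightarrow> s \<in> carrier (sections F U) \<Longrightarrow> restr F U U s = s"
  using is_presheaf unfolding is_presheaf_def by simp

lemma restr_restr:
  "openin X U \<Longrightarrow> openin X V \<Longrightarrow> openin X W \<Longrightarrow> W \<subseteq> V \<Longrightarrow> V \<subseteq> U \<Longrightarrow>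
    s \<in> carrier (sections F U) \<Longrightarrow> restr F V W (restr F U V s) = restr F U W s"
  using is_presheaf unfolding is_presheaf_def by simp

lemma germ_self:
  assumes "openin X U" "x \<in> U" "s \<in> carrier (sections F U)"
  shows "(U, s) \<in> germ X F x U s"
  using assms unfolding germ_def by blast

text \<open>Agreement near \<open>x\<close> is transitive: the two neighbourhoods on which agreement
  holds are replaced by their intersection.\<close>

lemma germ_subset:
  assumes U: "openin X U" "x \<in> U" "s \<in> carrier (sections F U)"
    and V: "openin X V" "x \<in> V" "t \<in> carrier (sections F V)"
    and W: "openin X W" "x \<in> W" "W \<subseteq> U \<inter> V" "restr F U W s = restr F V W t"
  shows "germ X F x U s \<subseteq> germ X F x V t"
proof
  fix p assume "p \<in> germ X F x U s"
  then obtain U' s' W' where p: "p = (U', s')" "openin X U'" "x \<in> U'" "s' \<in> carrier (sections F U')"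
    and W': "openin X W'" "x \<in> W'" "W' \<subseteq> U \<inter> U'" "restr F U W' s = restr F U' W' s'"
    unfolding germ_def by blast
  have o: "openin X (W \<inter> W')" using W W' by blast
  have "restr F V (W \<inter> W') t = restr F W (W \<inter> W') (restr F V W t)"
    using restr_restr[OF V(1) W(1) o _ _ V(3)] W by auto
  also have "\<dots> = restr F U (W \<inter> W') s"
    using restr_restr[OF U(1) W(1) o _ _ U(3)] W by auto
  also have "\<dots> = restr F W' (W \<inter> W') (restr F U W' s)"
    using restr_restr[OF U(1) W'(1) o _ _ U(3)] W' by auto
  also have "\<dots> = restr F U' (W \<inter> W') s'"
    using restr_restr[OF p(2) W'(1) o _ _ p(4)] W' by auto
  finally have "restr F V (W \<inter> W') t = restr F U' (W \<inter> W') s'" .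
  moreover have "x \<in> W \<inter> W'" "W \<inter> W' \<subseteq> V \<inter> U'" using W W' by auto
  ultimately show "p \<in> germ X F x V t"
    using p o unfolding germ_def by blast
qed

lemma germ_eqI:
  assumes U: "openin X U" "x \<in> U" "s \<in> carrier (sections F U)"
    and V: "openin X V" "x \<in> V" "t \<in> carrier (sections F V)"
    and W: "openin X W" "x \<in> W" "W \<subseteq> U \<inter> V" "restr F U W s = restr F V W t"
  shows "germ X F x U s = germ X F x V t"
proof
  show "germ X F x U s \<subseteq> germ X F x V t"
    using assms by (rule germ_subset)
  have "W \<subseteq> V \<inter> U" using W by auto
  then show "germ X F x V t \<subseteq> germ X F x U s"
    using assms by (intro germ_subset[where W = W]) auto
qed

lemma germ_eqD:
  assumes "germ X F x U s = germ X F x V t"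
    and "openin X V" "x \<in> V" "t \<in> carrier (sections F V)"
  obtains W where "openin X W" "x \<in> W" "W \<subseteq> U \<inter> V" "restr F U W s = restr F V W t"
proof -
  have "(V, t) \<in> germ X F x U s"
    using germ_self[OF assms(2-4)] assms(1) by simp
  then obtain W where "openin X W" "x \<in> W" "W \<subseteq> U \<inter> V" "restr F U W s = restr F V W t"
    unfolding germ_def by blast
  then show thesis by (rule that)
qed

lemma in_germD:
  assumes "(V, t) \<in> germ X F x U s" "openin X U" "x \<in> U" "s \<in> carrier (sections F U)"
  shows "openin X V" "x \<in> V" "t \<in> carrier (sections F V)" "germ X F x V t = germ X F x U s"
proof -
  show V: "openin X V" "x \<in> V" "t \<in> carrier (sections F V)"
    using assms(1) unfolding germ_def by auto
  obtain W where "openin X W" "x \<in> W" "W \<subseteq> U \<inter> V" "restr F U W s = restr F V W t"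
    using assms(1) unfolding germ_def by blast
  then show "germ X F x V t = germ X F x U s"
    using germ_eqI[OF assms(2-4) V] by simp
qed

lemma germ_restr:
  assumes "openin X U" "openin X V" "V \<subseteq> U" "x \<in> V" "s \<in> carrier (sections F U)"
  shows "germ X F x V (restr F U V s) = germ X F x U s"
  by (rule germ_eqI[where W = V]) (use assms restr_closed restr_id in auto)

text \<open>Operations on stalks are defined as unions over all representatives of a germ. Such a
  union collapses to one class once all representatives contribute the same set, and it is not empty
  because a germ contains its own representative.\<close>

lemma Union_germ_const:
  assumes U: "openin X U" "x \<in> U" "s \<in> carrier (sections F U)"
    and c: "\<And>V t. openin X V \<Longrightarrow> x \<in> V \<Longrightarrow> t \<in> carrier (sections F V) \<Longrightarrow>
      germ X F x V t = germ X F x U s \<Longrightarrow> h V t = C"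
  shows "(\<Union>(V, t)\<in>germ X F x U s. h V t) = C"
proof -
  have "h V t = C" if "(V, t) \<in> germ X F x U s" for V t
    using in_germD[OF that U] c by blast
  moreover have "(U, s) \<in> germ X F x U s"
    by (rule germ_self[OF U])
  ultimately show ?thesis by fastforce
qed

text \<open>Other representatives agree with \<open>s\<close> and \<open>t\<close> on a common
  smaller neighbourhood, and \<open>f\<close> commutes with restriction, so the germ of the result
  does not change. One open set \<open>U\<close> for both arguments is enough, because two germs at
  a point can always be restricted to a common neighbourhood.\<close>

lemma stalk_op_germ:
  assumes closed: "\<And>W s t. openin X W \<Longrightarrow> s \<in> carrier (sections F W) \<Longrightarrow> t \<in> carrier (sections F W) \<Longrightarrow>
      f W s t \<in> carrier (sections F W)"
    and restr: "\<And>U W s t. openin X U \<Longrightarrow> openin X W \<Longrightarrow> W \<subseteq> U \<Longrightarrow> s \<in> carrier (sections F U) \<Longrightarrow>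
      t \<in> carrier (sections F U) \<Longrightarrow> restr F U W (f U s t) = f W (restr F U W s) (restr F U W t)"
    and U: "openin X U" "x \<in> U" "s \<in> carrier (sections F U)" "t \<in> carrier (sections F U)"
  shows "stalk_op X F x f (germ X F x U s) (germ X F x U t) = germ X F x U (f U s t)"
proof -
  have *: "germ X F x (V \<inter> V') (f (V \<inter> V') (restr F V (V \<inter> V') s') (restr F V' (V \<inter> V') t')) =
      germ X F x U (f U s t)"
    if V: "openin X V" "x \<in> V" "s' \<in> carrier (sections F V)" "germ X F x V s' = germ X F x U s"
      and V': "openin X V'" "x \<in> V'" "t' \<in> carrier (sections F V')" "germ X F x V' t' = germ X F x U t"
    for V s' V' t'
  proof -
    obtain W where W: "openin X W" "x \<in> W" "W \<subseteq> V \<inter> U" "restr F V W s' = restr F U W s"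
      using germ_eqD[OF V(4) U(1-3)] by blast
    obtain W' where W': "openin X W'" "x \<in> W'" "W' \<subseteq> V' \<inter> U" "restr F V' W' t' = restr F U W' t"
      using germ_eqD[OF V'(4) U(1,2,4)] by blast
    have o: "openin X (W \<inter> W')" "openin X (V \<inter> V')" using W W' V V' by blast+
    have sub: "W \<inter> W' \<subseteq> V \<inter> V'" "W \<inter> W' \<subseteq> U" "W \<inter> W' \<subseteq> W" "W \<inter> W' \<subseteq> W'"
      using W W' by auto
    have s: "restr F V (W \<inter> W') s' = restr F U (W \<inter> W') s"
      using restr_restr[OF V(1) W(1) o(1) sub(3) _ V(3)] restr_restr[OF U(1) W(1) o(1) sub(3) _ U(3)] W
      by auto
    have t: "restr F V' (W \<inter> W') t' = restr F U (W \<inter> W') t"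
      using restr_restr[OF V'(1) W'(1) o(1) sub(4) _ V'(3)] restr_restr[OF U(1) W'(1) o(1) sub(4) _ U(4)] W'
      by auto
    have c: "restr F V (V \<inter> V') s' \<in> carrier (sections F (V \<inter> V'))"
        "restr F V' (V \<inter> V') t' \<in> carrier (sections F (V \<inter> V'))"
      using restr_closed V V' o by auto
    have "restr F (V \<inter> V') (W \<inter> W') (f (V \<inter> V') (restr F V (V \<inter> V') s') (restr F V' (V \<inter> V') t'))
        = f (W \<inter> W') (restr F V (W \<inter> W') s') (restr F V' (W \<inter> W') t')"
      using restr[OF o(2,1) sub(1) c] restr_restr[OF V(1) o(2,1) sub(1) _ V(3)]
        restr_restr[OF V'(1) o(2,1) sub(1) _ V'(3)] by simp
    also have "\<dots> = restr F U (W \<inter> W') (f U s t)"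
      using restr[OF U(1) o(1) sub(2) U(3,4)] s t by simp
    finally show ?thesis
      using sub U V V' W W'
      by (intro germ_eqI[OF o(2) _ closed[OF o(2) c] U(1) _ closed[OF U(1,3,4)] o(1)]) auto
  qed
  show ?thesis
    unfolding stalk_op_def
    by (intro Union_germ_const[OF U(1-3)] Union_germ_const[OF U(1,2,4)] *)
qed

end

section \<open>Sheafification of presheaves of modules\<close>

lemma ring_sheaf_presheaf: "ring_sheaf X R \<Longrightarrow> presheaf_on X R"
  by (simp add: presheaf_on_def ring_sheaf_def is_sheaf_def)

lemma module_sheaf_presheaf: "module_sheaf X R M \<Longrightarrow> presheaf_on X M"
  by (simp add: presheaf_on_def module_sheaf_def is_sheaf_def)

text \<open>Gluing is demanded of the scalars \<open>S\<close> only, not of \<open>F\<close>: the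
  presheaf of tensor products has to be an instance, and it is in general not a sheaf.\<close>

locale module_presheaf = presheaf_on X F for
    X :: "'x topology" and F :: "('x, ('s, 't, 'w) module_scheme, 't) presheaf" +
  fixes S :: "('x, ('s, 'z) ring_scheme, 's) presheaf"
  assumes ring_sheaf: "ring_sheaf X S"
    and module: "openin X U \<Longrightarrow> Module.module (sections S U) (sections F U)"
    and restr_add: "openin X U \<Longrightarrow> openin X V \<Longrightarrow> V \<subseteq> U \<Longrightarrow>
      x \<in> carrier (sections F U) \<Longrightarrow> y \<in> carrier (sections F U) \<Longrightarrow>
      restr F U V (x \<oplus>\<^bsub>sections F U\<^esub> y) = restr F U V x \<oplus>\<^bsub>sections F V\<^esub> restr F U V y"
    and restr_smult: "openin X U \<Longrightarrow> openin X V \<Longrightarrow> V \<subseteq> U \<Longrightarrow>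
      r \<in> carrier (sections S U) \<Longrightarrow> x \<in> carrier (sections F U) \<Longrightarrow>
      restr F U V (r \<odot>\<^bsub>sections F U\<^esub> x) = restr S U V r \<odot>\<^bsub>sections F V\<^esub> restr F U V x"
begin

lemma S_restr_closed:
  "openin X U \<Longrightarrow> openin X V \<Longrightarrow> V \<subseteq> U \<Longrightarrow> r \<in> carrier (sections S U) \<Longrightarrow>
    restr S U V r \<in> carrier (sections S V)"
  using presheaf_on.restr_closed[OF ring_sheaf_presheaf[OF ring_sheaf]] .

lemma S_restr_restr:
  "openin X U \<Longrightarrow> openin X V \<Longrightarrow> openin X W \<Longrightarrow> W \<subseteq> V \<Longrightarrow> V \<subseteq> U \<Longrightarrow>
    s \<in> carrier (sections S U) \<Longrightarrow> restr S V W (restr S U V s) = restr S U W s"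
  using presheaf_on.restr_restr[OF ring_sheaf_presheaf[OF ring_sheaf]] .

lemma S_restr_hom:
  "openin X U \<Longrightarrow> openin X V \<Longrightarrow> V \<subseteq> U \<Longrightarrow> restr S U V \<in> ring_hom (sections S U) (sections S V)"
  using ring_sheaf unfolding ring_sheaf_def by blast

lemma abelian_group: "openin X U \<Longrightarrow> abelian_group (sections F U)"
  using module Module.module.axioms(2) by blast

lemma add_closed:
  "openin X U \<Longrightarrow> x \<in> carrier (sections F U) \<Longrightarrow> y \<in> carrier (sections F U) \<Longrightarrow>
    x \<oplus>\<^bsub>sections F U\<^esub> y \<in> carrier (sections F U)"
  using abelian_monoid.a_closed abelian_group abelian_group.axioms(1) by metis

lemma zero_closed: "openin X U \<Longrightarrow> \<zero>\<^bsub>sections F U\<^esub> \<in> carrier (sections F U)"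
  using abelian_monoid.zero_closed abelian_group abelian_group.axioms(1) by metis

lemma smult_closed:
  "openin X U \<Longrightarrow> r \<in> carrier (sections S U) \<Longrightarrow> x \<in> carrier (sections F U) \<Longrightarrow>
    r \<odot>\<^bsub>sections F U\<^esub> x \<in> carrier (sections F U)"
  using Module.module.smult_closed[OF module] .

lemma restr_zero:
  assumes "openin X U" "openin X V" "V \<subseteq> U"
  shows "restr F U V \<zero>\<^bsub>sections F U\<^esub> = \<zero>\<^bsub>sections F V\<^esub>"
proof -
  interpret U: abelian_group "sections F U" by (rule abelian_group[OF assms(1)])
  interpret V: abelian_group "sections F V" by (rule abelian_group[OF assms(2)])
  show ?thesis
    using restr_add[OF assms, of "\<zero>\<^bsub>sections F U\<^esub>" "\<zero>\<^bsub>sections F U\<^esub>"]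
      restr_closed[OF assms, of "\<zero>\<^bsub>sections F U\<^esub>"] by simp
qed

abbreviation (input) "F' \<equiv> sheafification X S F"

lemma sheafification_restr [simp]: "restr F' U V \<sigma> = restrict \<sigma> V"
  by (simp add: sheafification_def)

lemma sheafificationI:
  assumes "\<sigma> \<in> extensional U"
    and "\<And>x. x \<in> U \<Longrightarrow> \<exists>V t. openin X V \<and> x \<in> V \<and> V \<subseteq> U \<and> t \<in> carrier (sections F V) \<and>
      (\<forall>y\<in>V. \<sigma> y = germ X F y V t)"
  shows "\<sigma> \<in> carrier (sections F' U)"
  using assms by (simp add: sheafification_def)

lemma sheafification_extensional: "\<sigma> \<in> carrier (sections F' U) \<Longrightarrow> \<sigma> \<in> extensional U"
  by (simp add: sheafification_def)

lemma sheafification_local: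
  assumes "\<sigma> \<in> carrier (sections F' U)" "x \<in> U"
  obtains V t where "openin X V" "x \<in> V" "V \<subseteq> U" "t \<in> carrier (sections F V)"
    "\<forall>y\<in>V. \<sigma> y = germ X F y V t"
  using assms unfolding sheafification_def by auto

lemma sheafification_local2:
  assumes "\<sigma> \<in> carrier (sections F' U)" "\<tau> \<in> carrier (sections F' U)" "x \<in> U"
  obtains V s t where "openin X V" "x \<in> V" "V \<subseteq> U" "s \<in> carrier (sections F V)"
    "t \<in> carrier (sections F V)" "\<forall>y\<in>V. \<sigma> y = germ X F y V s"
    "\<forall>y\<in>V. \<tau> y = germ X F y V t"
proof -
  obtain V s where V: "openin X V" "x \<in> V" "V \<subseteq> U" "s \<in> carrier (sections F V)"
    "\<forall>y\<in>V. \<sigma> y = germ X F y V s"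
    using sheafification_local[OF assms(1,3)] by blast
  obtain W t where W: "openin X W" "x \<in> W" "W \<subseteq> U" "t \<in> carrier (sections F W)"
    "\<forall>y\<in>W. \<tau> y = germ X F y W t"
    using sheafification_local[OF assms(2,3)] by blast
  have o: "openin X (V \<inter> W)" using V W by blast
  show thesis
    by (rule that[OF o, of "restr F V (V \<inter> W) s" "restr F W (V \<inter> W) t"])
      (use V W o restr_closed[OF V(1) o _ V(4)] restr_closed[OF W(1) o _ W(4)]
        germ_restr[OF V(1) o _ _ V(4)] germ_restr[OF W(1) o _ _ W(4)] in auto)
qed

lemma sheafification_eqI:
  assumes "\<sigma> \<in> carrier (sections F' U)" "\<tau> \<in> carrier (sections F' U)"
    and "\<And>x. x \<in> U \<Longrightarrow> \<sigma> x = \<tau> x"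
  shows "\<sigma> = \<tau>"
  using assms sheafification_extensional by (intro extensionalityI[where A = U]) auto

text \<open>Only the values at the single point \<open>y\<close> are prescribed, so the rule applies
  to sections known merely through one germ there.\<close>

lemma sheafification_add_germ:
  assumes "openin X V" "V \<subseteq> U" "y \<in> V" "s \<in> carrier (sections F V)" "t \<in> carrier (sections F V)"
    and "\<sigma> y = germ X F y V s" "\<tau> y = germ X F y V t"
  shows "(\<sigma> \<oplus>\<^bsub>sections F' U\<^esub> \<tau>) y = germ X F y V (s \<oplus>\<^bsub>sections F V\<^esub> t)"
proof -
  have "y \<in> U" using assms(2,3) by blast
  then have "(\<sigma> \<oplus>\<^bsub>sections F' U\<^esub> \<tau>) y =
      stalk_op X F y (\<lambda>W. ring.add (sections F W)) (germ X F y V s) (germ X F y V t)"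
    using assms(6,7) by (simp add: sheafification_def)
  also have "\<dots> = germ X F y V (s \<oplus>\<^bsub>sections F V\<^esub> t)"
    by (rule stalk_op_germ) (simp_all add: assms add_closed restr_add)
  finally show ?thesis .
qed

lemma sheafification_zero_germ:
  assumes "openin X U" "openin X V" "V \<subseteq> U" "y \<in> V"
  shows "\<zero>\<^bsub>sections F' U\<^esub> y = germ X F y V \<zero>\<^bsub>sections F V\<^esub>"
proof -
  have "y \<in> U" using assms(3,4) by blast
  then have "\<zero>\<^bsub>sections F' U\<^esub> y = germ X F y U \<zero>\<^bsub>sections F U\<^esub>"
    by (simp add: sheafification_def)
  then show ?thesis
    using germ_restr[OF assms zero_closed[OF assms(1)]] restr_zero[OF assms(1-3)] by simp
qed

text \<open>The union defining the scalar multiple runs over representatives on other open sets;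
  each of them agrees with \<open>s\<close> on some smaller \<open>W\<close> around
  \<open>y\<close>, and restriction to \<open>W\<close> commutes with scalar multiplication.\<close>

lemma sheafification_smult_germ:
  assumes U: "openin X U" and V: "openin X V" "V \<subseteq> U" "y \<in> V" and s: "s \<in> carrier (sections F V)"
    and r: "r \<in> carrier (sections S U)" and eq: "\<sigma> y = germ X F y V s"
  shows "(r \<odot>\<^bsub>sections F' U\<^esub> \<sigma>) y = germ X F y V (restr S U V r \<odot>\<^bsub>sections F V\<^esub> s)"
proof -
  have y: "y \<in> U" using V by blast
  have rV: "restr S U V r \<in> carrier (sections S V)" by (rule S_restr_closed[OF U V(1,2) r])
  have "(r \<odot>\<^bsub>sections F' U\<^esub> \<sigma>) y = (\<Union>(V', t)\<in>germ X F y V s.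
      germ X F y (U \<inter> V') (restr S U (U \<inter> V') r \<odot>\<^bsub>sections F (U \<inter> V')\<^esub> restr F V' (U \<inter> V') t))"
    using y eq by (simp add: sheafification_def)
  also have "\<dots> = germ X F y V (restr S U V r \<odot>\<^bsub>sections F V\<^esub> s)"
  proof (rule Union_germ_const[OF V(1,3) s])
    fix V' t assume V': "openin X V'" "y \<in> V'" "t \<in> carrier (sections F V')"
      and "germ X F y V' t = germ X F y V s"
    then obtain W where W: "openin X W" "y \<in> W" "W \<subseteq> V' \<inter> V" "restr F V' W t = restr F V W s"
      using germ_eqD[OF _ V(1,3) s] by metis
    have o: "openin X (U \<inter> V')" using U V' by blast
    have sub: "W \<subseteq> U \<inter> V'" "W \<subseteq> V" using W V by auto
    have c: "restr S U (U \<inter> V') r \<in> carrier (sections S (U \<inter> V'))"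
        "restr F V' (U \<inter> V') t \<in> carrier (sections F (U \<inter> V'))"
      by (simp_all add: S_restr_closed[OF U o _ r] restr_closed[OF V'(1) o _ V'(3)])
    have "restr F (U \<inter> V') W (restr S U (U \<inter> V') r \<odot>\<^bsub>sections F (U \<inter> V')\<^esub> restr F V' (U \<inter> V') t)
        = restr S U W r \<odot>\<^bsub>sections F W\<^esub> restr F V' W t"
      using restr_smult[OF o W(1) sub(1) c] S_restr_restr[OF U o W(1) sub(1) _ r]
        restr_restr[OF V'(1) o W(1) sub(1) _ V'(3)] by simp
    also have "\<dots> = restr F V W (restr S U V r \<odot>\<^bsub>sections F V\<^esub> s)"
      using restr_smult[OF V(1) W(1) sub(2) rV s] S_restr_restr[OF U V(1) W(1) sub(2) V(2) r] W(4)
      by simp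
    finally have eq: "restr F (U \<inter> V') W (restr S U (U \<inter> V') r \<odot>\<^bsub>sections F (U \<inter> V')\<^esub> restr F V' (U \<inter> V') t)
        = restr F V W (restr S U V r \<odot>\<^bsub>sections F V\<^esub> s)" .
    show "germ X F y (U \<inter> V') (restr S U (U \<inter> V') r \<odot>\<^bsub>sections F (U \<inter> V')\<^esub> restr F V' (U \<inter> V') t) =
        germ X F y V (restr S U V r \<odot>\<^bsub>sections F V\<^esub> s)"
      using y V'(2) V(3) W(2) sub
      by (intro germ_eqI[OF o _ smult_closed[OF o c] V(1) _ smult_closed[OF V(1) rV s] W(1) _ _ eq]) auto
  qed
  finally show ?thesis .
qed

lemma sheafification_add_closed:
  assumes "\<sigma> \<in> carrier (sections F' U)" "\<tau> \<in> carrier (sections F' U)"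
  shows "\<sigma> \<oplus>\<^bsub>sections F' U\<^esub> \<tau> \<in> carrier (sections F' U)"
proof (rule sheafificationI)
  show "\<sigma> \<oplus>\<^bsub>sections F' U\<^esub> \<tau> \<in> extensional U"
    by (simp add: sheafification_def)
  fix x assume "x \<in> U"
  then obtain V s t where "openin X V" "x \<in> V" "V \<subseteq> U" "s \<in> carrier (sections F V)"
    "t \<in> carrier (sections F V)" "\<forall>y\<in>V. \<sigma> y = germ X F y V s"
    "\<forall>y\<in>V. \<tau> y = germ X F y V t"
    using sheafification_local2[OF assms] by blast
  then show "\<exists>V t. openin X V \<and> x \<in> V \<and> V \<subseteq> U \<and> t \<in> carrier (sections F V) \<and>
      (\<forall>y\<in>V. (\<sigma> \<oplus>\<^bsub>sections F' U\<^esub> \<tau>) y = germ X F y V t)"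
    by (intro exI[of _ V] exI[of _ "s \<oplus>\<^bsub>sections F V\<^esub> t"]) (simp add: add_closed sheafification_add_germ)
qed

lemma sheafification_zero_closed:
  assumes "openin X U" shows "\<zero>\<^bsub>sections F' U\<^esub> \<in> carrier (sections F' U)"
proof (rule sheafificationI)
  show "\<zero>\<^bsub>sections F' U\<^esub> \<in> extensional U"
    by (simp add: sheafification_def)
  fix x assume "x \<in> U"
  then show "\<exists>V t. openin X V \<and> x \<in> V \<and> V \<subseteq> U \<and> t \<in> carrier (sections F V) \<and>
      (\<forall>y\<in>V. \<zero>\<^bsub>sections F' U\<^esub> y = germ X F y V t)"
    by (intro exI[of _ U] exI[of _ "\<zero>\<^bsub>sections F U\<^esub>"]) (simp add: assms zero_closed sheafification_zero_germ)
qed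

lemma sheafification_smult_closed:
  assumes "openin X U" "r \<in> carrier (sections S U)" "\<sigma> \<in> carrier (sections F' U)"
  shows "r \<odot>\<^bsub>sections F' U\<^esub> \<sigma> \<in> carrier (sections F' U)"
proof (rule sheafificationI)
  show "r \<odot>\<^bsub>sections F' U\<^esub> \<sigma> \<in> extensional U"
    by (simp add: sheafification_def)
  fix x assume "x \<in> U"
  then obtain V s where "openin X V" "x \<in> V" "V \<subseteq> U" "s \<in> carrier (sections F V)"
    "\<forall>y\<in>V. \<sigma> y = germ X F y V s"
    using sheafification_local[OF assms(3)] by blast
  then show "\<exists>V t. openin X V \<and> x \<in> V \<and> V \<subseteq> U \<and> t \<in> carrier (sections F V) \<and>
      (\<forall>y\<in>V. (r \<odot>\<^bsub>sections F' U\<^esub> \<sigma>) y = germ X F y V t)"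
    by (intro exI[of _ V] exI[of _ "restr S U V r \<odot>\<^bsub>sections F V\<^esub> s"])
      (simp add: smult_closed sheafification_smult_germ S_restr_closed assms)
qed

text \<open>Near each point finitely many sections are germs of elements of one module F(V), so
  every axiom is inherited pointwise from that module, and \<open>sheafification_eqI\<close> lifts
  pointwise equality.\<close>

lemma module_sheafification:
  assumes U: "openin X U"
  shows "Module.module (sections S U) (sections F' U)"
proof -
  interpret SU: cring "sections S U"
    using ring_sheaf U unfolding ring_sheaf_def by blast
  let ?add = "\<lambda>\<sigma> \<tau>. \<sigma> \<oplus>\<^bsub>sections F' U\<^esub> \<tau>" and ?smult = "\<lambda>r \<sigma>. r \<odot>\<^bsub>sections F' U\<^esub> \<sigma>"
  note [simp] = sheafification_add_closed sheafification_zero_closed[OF U] sheafification_smult_closed[OF U]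
  note [simp] = sheafification_add_germ sheafification_zero_germ[OF U] sheafification_smult_germ[OF U]
    S_restr_closed[OF U] smult_closed add_closed zero_closed
  have hom: "restr S U V (a \<oplus>\<^bsub>sections S U\<^esub> b) = restr S U V a \<oplus>\<^bsub>sections S V\<^esub> restr S U V b"
      "restr S U V (a \<otimes>\<^bsub>sections S U\<^esub> b) = restr S U V a \<otimes>\<^bsub>sections S V\<^esub> restr S U V b"
      "restr S U V \<one>\<^bsub>sections S U\<^esub> = \<one>\<^bsub>sections S V\<^esub>"
    if "openin X V" "V \<subseteq> U" "a \<in> carrier (sections S U)" "b \<in> carrier (sections S U)" for V a b
    using ring_hom_add[OF S_restr_hom[OF U that(1,2)] that(3,4)]
      ring_hom_mult[OF S_restr_hom[OF U that(1,2)] that(3,4)]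
      ring_hom_one[OF S_restr_hom[OF U that(1,2)]] by simp_all
  have smult_l: "?smult (a \<oplus>\<^bsub>sections S U\<^esub> b) \<sigma> = ?add (?smult a \<sigma>) (?smult b \<sigma>)"
    if ab: "a \<in> carrier (sections S U)" "b \<in> carrier (sections S U)"
      and \<sigma>: "\<sigma> \<in> carrier (sections F' U)" for a b \<sigma>
  proof (rule sheafification_eqI)
    fix x assume x: "x \<in> U"
    from sheafification_local[OF \<sigma> x] obtain V s where V: "openin X V" "x \<in> V" "V \<subseteq> U"
      "s \<in> carrier (sections F V)" "\<forall>y\<in>V. \<sigma> y = germ X F y V s" by blast
    interpret V: Module.module "sections S V" "sections F V" by (rule module[OF V(1)])
    have eqs: "?smult a \<sigma> x = germ X F x V (restr S U V a \<odot>\<^bsub>sections F V\<^esub> s)"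
        "?smult b \<sigma> x = germ X F x V (restr S U V b \<odot>\<^bsub>sections F V\<^esub> s)"
      using V ab by simp_all
    have "?add (?smult a \<sigma>) (?smult b \<sigma>) x = germ X F x V
        ((restr S U V a \<odot>\<^bsub>sections F V\<^esub> s) \<oplus>\<^bsub>sections F V\<^esub> (restr S U V b \<odot>\<^bsub>sections F V\<^esub> s))"
      by (rule sheafification_add_germ[where \<sigma> = "?smult a \<sigma>" and \<tau> = "?smult b \<sigma>",
            OF V(1,3,2) _ _ eqs]) (use V ab in simp_all)
    moreover have "?smult (a \<oplus>\<^bsub>sections S U\<^esub> b) \<sigma> x = germ X F x V
        ((restr S U V a \<odot>\<^bsub>sections F V\<^esub> s) \<oplus>\<^bsub>sections F V\<^esub> (restr S U V b \<odot>\<^bsub>sections F V\<^esub> s))"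
      using V ab by (simp add: hom V.smult_l_distr)
    ultimately show "?smult (a \<oplus>\<^bsub>sections S U\<^esub> b) \<sigma> x = ?add (?smult a \<sigma>) (?smult b \<sigma>) x"
      by (rule trans[OF _ sym, rotated])
  qed (use ab \<sigma> in auto)
  have zero: "?add \<zero>\<^bsub>sections F' U\<^esub> \<sigma> = \<sigma>" if \<sigma>: "\<sigma> \<in> carrier (sections F' U)" for \<sigma>
  proof (rule sheafification_eqI)
    fix x assume x: "x \<in> U"
    from sheafification_local[OF \<sigma> x] obtain V s where V: "openin X V" "x \<in> V" "V \<subseteq> U"
      "s \<in> carrier (sections F V)" "\<forall>y\<in>V. \<sigma> y = germ X F y V s" by blast
    interpret V: Module.module "sections S V" "sections F V" by (rule module[OF V(1)])
    have "?add \<zero>\<^bsub>sections F' U\<^esub> \<sigma> x = germ X F x V (\<zero>\<^bsub>sections F V\<^esub> \<oplus>\<^bsub>sections F V\<^esub> s)"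
      by (rule sheafification_add_germ[OF V(1,3,2) V.M.zero_closed V(4)])
        (use V U in \<open>auto intro: sheafification_zero_germ\<close>)
    then show "?add \<zero>\<^bsub>sections F' U\<^esub> \<sigma> x = \<sigma> x"
      using V(2,4,5) V.M.l_zero by metis
  qed (use \<sigma> in auto)
  have smult_one: "?smult \<one>\<^bsub>sections S U\<^esub> \<sigma> = \<sigma>" if \<sigma>: "\<sigma> \<in> carrier (sections F' U)" for \<sigma>
  proof (rule sheafification_eqI)
    fix x assume x: "x \<in> U"
    from sheafification_local[OF \<sigma> x] obtain V s where V: "openin X V" "x \<in> V" "V \<subseteq> U"
      "s \<in> carrier (sections F V)" "\<forall>y\<in>V. \<sigma> y = germ X F y V s" by blast
    interpret V: Module.module "sections S V" "sections F V" by (rule module[OF V(1)])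
    show "?smult \<one>\<^bsub>sections S U\<^esub> \<sigma> x = \<sigma> x"
      using V by (simp add: hom(3)[OF _ _ SU.one_closed SU.one_closed])
  qed (use \<sigma> in auto)
  have smult_zero: "?smult \<zero>\<^bsub>sections S U\<^esub> \<sigma> = \<zero>\<^bsub>sections F' U\<^esub>" if \<sigma>: "\<sigma> \<in> carrier (sections F' U)" for \<sigma>
  proof (rule sheafification_eqI)
    fix x assume x: "x \<in> U"
    from sheafification_local[OF \<sigma> x] obtain V s where V: "openin X V" "x \<in> V" "V \<subseteq> U"
      "s \<in> carrier (sections F V)" "\<forall>y\<in>V. \<sigma> y = germ X F y V s" by blast
    interpret V: Module.module "sections S V" "sections F V" by (rule module[OF V(1)])
    have "restr S U V \<zero>\<^bsub>sections S U\<^esub> = \<zero>\<^bsub>sections S V\<^esub>"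
      using ring_hom_zero[OF S_restr_hom[OF U V(1,3)]] SU.ring_axioms V.R.ring_axioms by simp
    then show "?smult \<zero>\<^bsub>sections S U\<^esub> \<sigma> x = \<zero>\<^bsub>sections F' U\<^esub> x"
      using V by simp
  qed (use \<sigma> in auto)
  show ?thesis
  proof (rule Module.moduleI)
    show "cring (sections S U)" by (rule SU.is_cring)
    show "abelian_group (sections F' U)"
    proof (rule abelian_groupI)
      fix \<sigma> \<tau> assume c: "\<sigma> \<in> carrier (sections F' U)" "\<tau> \<in> carrier (sections F' U)"
      show "?add \<sigma> \<tau> = ?add \<tau> \<sigma>"
      proof (rule sheafification_eqI)
        fix x assume x: "x \<in> U"
        from sheafification_local2[OF c x] obtain V s t where V: "openin X V" "x \<in> V" "V \<subseteq> U"
          "s \<in> carrier (sections F V)" "t \<in> carrier (sections F V)"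
          "\<forall>y\<in>V. \<sigma> y = germ X F y V s" "\<forall>y\<in>V. \<tau> y = germ X F y V t" by blast
        interpret V: Module.module "sections S V" "sections F V" by (rule module[OF V(1)])
        show "?add \<sigma> \<tau> x = ?add \<tau> \<sigma> x"
          using V by (simp add: V.M.a_comm)
      qed (use c in auto)
      fix \<rho> assume c': "\<rho> \<in> carrier (sections F' U)"
      show "?add (?add \<sigma> \<tau>) \<rho> = ?add \<sigma> (?add \<tau> \<rho>)"
      proof (rule sheafification_eqI)
        fix x assume x: "x \<in> U"
        from sheafification_local2[OF c x] obtain V s t where V: "openin X V" "x \<in> V" "V \<subseteq> U"
          "s \<in> carrier (sections F V)" "t \<in> carrier (sections F V)"
          "\<forall>y\<in>V. \<sigma> y = germ X F y V s" "\<forall>y\<in>V. \<tau> y = germ X F y V t" by blast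
        from sheafification_local[OF c' x] obtain W u where W: "openin X W" "x \<in> W" "W \<subseteq> U"
          "u \<in> carrier (sections F W)" "\<forall>y\<in>W. \<rho> y = germ X F y W u" by blast
        \<comment> \<open>Three sections need a further intersection, as
          \<open>sheafification_local2\<close> aligns only two.\<close>
        have o: "openin X (V \<inter> W)" "V \<inter> W \<subseteq> V" "V \<inter> W \<subseteq> W" "V \<inter> W \<subseteq> U" "x \<in> V \<inter> W"
          using V W by blast+
        interpret VW: Module.module "sections S (V \<inter> W)" "sections F (V \<inter> W)" by (rule module[OF o(1)])
        let ?s = "restr F V (V \<inter> W) s" and ?t = "restr F V (V \<inter> W) t" and ?u = "restr F W (V \<inter> W) u"
        have eqs: "\<sigma> x = germ X F x (V \<inter> W) ?s" "\<tau> x = germ X F x (V \<inter> W) ?t"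
            "\<rho> x = germ X F x (V \<inter> W) ?u"
          using V W o germ_restr by auto
        have cl: "?s \<in> carrier (sections F (V \<inter> W))" "?t \<in> carrier (sections F (V \<inter> W))"
            "?u \<in> carrier (sections F (V \<inter> W))"
          using V W o restr_closed by auto
        have st: "?add \<sigma> \<tau> x = germ X F x (V \<inter> W) (?s \<oplus>\<^bsub>sections F (V \<inter> W)\<^esub> ?t)"
          by (rule sheafification_add_germ) (use o cl eqs in auto)
        have tu: "?add \<tau> \<rho> x = germ X F x (V \<inter> W) (?t \<oplus>\<^bsub>sections F (V \<inter> W)\<^esub> ?u)"
          by (rule sheafification_add_germ) (use o cl eqs in auto)
        have "?add (?add \<sigma> \<tau>) \<rho> x = germ X F x (V \<inter> W)
            (?s \<oplus>\<^bsub>sections F (V \<inter> W)\<^esub> ?t \<oplus>\<^bsub>sections F (V \<inter> W)\<^esub> ?u)"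
          by (rule sheafification_add_germ) (use o cl eqs st in auto)
        moreover have "?add \<sigma> (?add \<tau> \<rho>) x = germ X F x (V \<inter> W)
            (?s \<oplus>\<^bsub>sections F (V \<inter> W)\<^esub> (?t \<oplus>\<^bsub>sections F (V \<inter> W)\<^esub> ?u))"
          by (rule sheafification_add_germ) (use o cl eqs tu in auto)
        ultimately show "?add (?add \<sigma> \<tau>) \<rho> x = ?add \<sigma> (?add \<tau> \<rho>) x"
          using cl by (simp only: VW.M.a_assoc)
      qed (use c c' in auto)
      \<comment> \<open>The negative is (\<ominus> 1) \<sigma>; distributivity and 0 \<sigma> = 0
        then give the inverse law without any formula for negation of germs.\<close>
      show "\<exists>\<tau>\<in>carrier (sections F' U). ?add \<tau> \<sigma> = \<zero>\<^bsub>sections F' U\<^esub>"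
      proof (intro bexI)
        have "?add (?smult (\<ominus>\<^bsub>sections S U\<^esub> \<one>\<^bsub>sections S U\<^esub>) \<sigma>) (?smult \<one>\<^bsub>sections S U\<^esub> \<sigma>) = \<zero>\<^bsub>sections F' U\<^esub>"
          using c smult_l[of "\<ominus>\<^bsub>sections S U\<^esub> \<one>\<^bsub>sections S U\<^esub>" "\<one>\<^bsub>sections S U\<^esub>" \<sigma>]
          by (simp add: SU.l_neg smult_zero)
        then show "?add (?smult (\<ominus>\<^bsub>sections S U\<^esub> \<one>\<^bsub>sections S U\<^esub>) \<sigma>) \<sigma> = \<zero>\<^bsub>sections F' U\<^esub>"
          using c by (simp add: smult_one)
      qed (use c in auto)
    qed (use zero in auto)
    show "\<And>\<sigma>. \<sigma> \<in> carrier (sections F' U) \<Longrightarrow> ?smult \<one>\<^bsub>sections S U\<^esub> \<sigma> = \<sigma>"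
      by (rule smult_one)
    fix a \<sigma> assume a: "a \<in> carrier (sections S U)" and \<sigma>: "\<sigma> \<in> carrier (sections F' U)"
    show "?smult a \<sigma> \<in> carrier (sections F' U)"
      using a \<sigma> by simp
    show "?smult a (?add \<sigma> \<tau>) = ?add (?smult a \<sigma>) (?smult a \<tau>)" if \<tau>: "\<tau> \<in> carrier (sections F' U)" for \<tau>
    proof (rule sheafification_eqI)
      fix x assume x: "x \<in> U"
      from sheafification_local2[OF \<sigma> \<tau> x] obtain V s t where V: "openin X V" "x \<in> V" "V \<subseteq> U"
        "s \<in> carrier (sections F V)" "t \<in> carrier (sections F V)"
        "\<forall>y\<in>V. \<sigma> y = germ X F y V s" "\<forall>y\<in>V. \<tau> y = germ X F y V t" by blast
      interpret V: Module.module "sections S V" "sections F V" by (rule module[OF V(1)])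
      have aV: "restr S U V a \<in> carrier (sections S V)"
        using V a by simp
      let ?a = "restr S U V a"
      have "?add \<sigma> \<tau> x = germ X F x V (s \<oplus>\<^bsub>sections F V\<^esub> t)"
        by (rule sheafification_add_germ) (use V in auto)
      then have "?smult a (?add \<sigma> \<tau>) x = germ X F x V (?a \<odot>\<^bsub>sections F V\<^esub> (s \<oplus>\<^bsub>sections F V\<^esub> t))"
        by (intro sheafification_smult_germ) (use U V a in auto)
      moreover have "?smult a \<sigma> x = germ X F x V (?a \<odot>\<^bsub>sections F V\<^esub> s)"
          "?smult a \<tau> x = germ X F x V (?a \<odot>\<^bsub>sections F V\<^esub> t)"
        by (rule sheafification_smult_germ; use U V a in auto)+
      then have "?add (?smult a \<sigma>) (?smult a \<tau>) x = germ X F x V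
          ((?a \<odot>\<^bsub>sections F V\<^esub> s) \<oplus>\<^bsub>sections F V\<^esub> (?a \<odot>\<^bsub>sections F V\<^esub> t))"
        by (intro sheafification_add_germ) (use V aV in auto)
      ultimately show "?smult a (?add \<sigma> \<tau>) x = ?add (?smult a \<sigma>) (?smult a \<tau>) x"
        using V aV by (simp only: V.smult_r_distr)
    qed (use a \<sigma> \<tau> in auto)
    fix b assume b: "b \<in> carrier (sections S U)"
    show "?smult (a \<oplus>\<^bsub>sections S U\<^esub> b) \<sigma> = ?add (?smult a \<sigma>) (?smult b \<sigma>)"
      using a b \<sigma> by (rule smult_l)
    show "?smult (a \<otimes>\<^bsub>sections S U\<^esub> b) \<sigma> = ?smult a (?smult b \<sigma>)"
    proof (rule sheafification_eqI)
      fix x assume x: "x \<in> U"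
      from sheafification_local[OF \<sigma> x] obtain V s where V: "openin X V" "x \<in> V" "V \<subseteq> U"
        "s \<in> carrier (sections F V)" "\<forall>y\<in>V. \<sigma> y = germ X F y V s" by blast
      interpret V: Module.module "sections S V" "sections F V" by (rule module[OF V(1)])
      have bV: "restr S U V a \<in> carrier (sections S V)" "restr S U V b \<in> carrier (sections S V)"
        using V a b by simp_all
      have "?smult b \<sigma> x = germ X F x V (restr S U V b \<odot>\<^bsub>sections F V\<^esub> s)"
        by (rule sheafification_smult_germ) (use U V b in auto)
      then have "?smult a (?smult b \<sigma>) x = germ X F x V
          (restr S U V a \<odot>\<^bsub>sections F V\<^esub> (restr S U V b \<odot>\<^bsub>sections F V\<^esub> s))"
        by (intro sheafification_smult_germ) (use U V a b bV in auto)
      moreover have "?smult (a \<otimes>\<^bsub>sections S U\<^esub> b) \<sigma> x = germ X F x V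
          (restr S U V (a \<otimes>\<^bsub>sections S U\<^esub> b) \<odot>\<^bsub>sections F V\<^esub> s)"
        by (rule sheafification_smult_germ) (use U V a b in auto)
      ultimately show "?smult (a \<otimes>\<^bsub>sections S U\<^esub> b) \<sigma> x = ?smult a (?smult b \<sigma>) x"
        using V a b bV by (simp only: hom V.smult_assoc1)
    qed (use a b \<sigma> in auto)
  qed
qed

lemma sheafification_restrict:
  assumes "openin X V" "V \<subseteq> U" "\<sigma> \<in> carrier (sections F' U)"
  shows "restrict \<sigma> V \<in> carrier (sections F' V)"
proof (rule sheafificationI)
  fix x assume x: "x \<in> V"
  then obtain W s where W: "openin X W" "x \<in> W" "W \<subseteq> U" "s \<in> carrier (sections F W)"
    "\<forall>y\<in>W. \<sigma> y = germ X F y W s"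
    using sheafification_local[OF assms(3)] assms(2) by blast
  have o: "openin X (V \<inter> W)" using W assms by blast
  show "\<exists>V' t. openin X V' \<and> x \<in> V' \<and> V' \<subseteq> V \<and> t \<in> carrier (sections F V') \<and>
      (\<forall>y\<in>V'. restrict \<sigma> V y = germ X F y V' t)"
    by (intro exI[of _ "V \<inter> W"] exI[of _ "restr F W (V \<inter> W) s"])
      (use W o x restr_closed in \<open>auto simp: germ_restr\<close>)
qed auto

text \<open>Sections are functions and restriction maps restrict functions, so separation and gluing
  are those of functions, and being locally given by germs of one section is a local
  condition.\<close>

lemma is_sheaf_sheafification: "is_sheaf X F'"
  unfolding is_sheaf_def
proof (intro conjI allI impI)
  show "is_presheaf X F'"
    unfolding is_presheaf_def
  proof (intro conjI allI impI ballI)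
    fix U V \<sigma> assume "openin X U \<and> openin X V \<and> V \<subseteq> U" "\<sigma> \<in> carrier (sections F' U)"
    then show "restr F' U V \<sigma> \<in> carrier (sections F' V)"
      by (auto intro: sheafification_restrict)
  next
    fix U \<sigma> assume "openin X U" "\<sigma> \<in> carrier (sections F' U)"
    then show "restr F' U U \<sigma> = \<sigma>"
      using sheafification_extensional by (simp add: extensional_restrict)
  next
    fix U V W \<sigma> assume "openin X U \<and> openin X V \<and> openin X W \<and> W \<subseteq> V \<and> V \<subseteq> U"
    then show "restr F' V W (restr F' U V \<sigma>) = restr F' U W \<sigma>"
      by (simp add: Int_absorb1)
  qed
next
  fix \<U> assume \<U>: "\<forall>U\<in>\<U>. openin X U"
  show "\<forall>s\<in>carrier (sections F' (\<Union>\<U>)). \<forall>t\<in>carrier (sections F' (\<Union>\<U>)).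
      (\<forall>U\<in>\<U>. restr F' (\<Union>\<U>) U s = restr F' (\<Union>\<U>) U t) \<longrightarrow> s = t"
  proof (intro ballI impI)
    fix s t assume st: "s \<in> carrier (sections F' (\<Union>\<U>))" "t \<in> carrier (sections F' (\<Union>\<U>))"
      and eq: "\<forall>U\<in>\<U>. restr F' (\<Union>\<U>) U s = restr F' (\<Union>\<U>) U t"
    show "s = t"
    proof (rule sheafification_eqI[OF st])
      fix x assume "x \<in> \<Union>\<U>"
      then obtain U where "U \<in> \<U>" "x \<in> U" by blast
      then show "s x = t x"
        using eq restrict_apply'[of x U s] restrict_apply'[of x U t] by simp
    qed
  qed
  fix \<sigma> assume \<sigma>: "(\<forall>U\<in>\<U>. \<sigma> U \<in> carrier (sections F' U)) \<and>
    (\<forall>U\<in>\<U>. \<forall>V\<in>\<U>. restr F' U (U \<inter> V) (\<sigma> U) = restr F' V (U \<inter> V) (\<sigma> V))"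
  \<comment> \<open>At each point some member of the cover is picked; agreement on overlaps makes
    the choice irrelevant, which is \<open>s_eq\<close>.\<close>
  define s where "s = (\<lambda>x\<in>\<Union>\<U>. \<sigma> (SOME U. U \<in> \<U> \<and> x \<in> U) x)"
  have s_eq: "s x = \<sigma> U x" if "U \<in> \<U>" "x \<in> U" for U x
  proof -
    define V where "V = (SOME U. U \<in> \<U> \<and> x \<in> U)"
    have V: "V \<in> \<U> \<and> x \<in> V"
      unfolding V_def by (rule someI[of _ U]) (use that in blast)
    from bspec[OF bspec[OF conjunct2[OF \<sigma>] that(1)] conjunct1[OF V]]
    have "restrict (\<sigma> U) (U \<inter> V) = restrict (\<sigma> V) (U \<inter> V)"
      by simp
    from fun_cong[OF this, of x] have "\<sigma> U x = \<sigma> V x"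
      using V that by simp
    then show ?thesis
      using that unfolding s_def V_def by auto
  qed
  show "\<exists>s\<in>carrier (sections F' (\<Union>\<U>)). \<forall>U\<in>\<U>. restr F' (\<Union>\<U>) U s = \<sigma> U"
  proof (intro bexI ballI)
    fix U assume U: "U \<in> \<U>"
    have "\<sigma> U \<in> extensional U"
      using \<sigma> U sheafification_extensional by blast
    then show "restr F' (\<Union>\<U>) U s = \<sigma> U"
      using s_eq[OF U] by (auto intro: extensionalityI)
  next
    show "s \<in> carrier (sections F' (\<Union>\<U>))"
    proof (rule sheafificationI)
      fix x assume "x \<in> \<Union>\<U>"
      then obtain U where U: "U \<in> \<U>" "x \<in> U" by blast
      then have "\<sigma> U \<in> carrier (sections F' U)" using \<sigma> by blast
      from sheafification_local[OF this U(2)] obtain V t where V: "openin X V" "x \<in> V" "V \<subseteq> U"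
        "t \<in> carrier (sections F V)" "\<forall>y\<in>V. \<sigma> U y = germ X F y V t" by blast
      then have "\<forall>y\<in>V. s y = germ X F y V t" using s_eq[OF U(1)] by auto
      then show "\<exists>V t. openin X V \<and> x \<in> V \<and> V \<subseteq> \<Union>\<U> \<and> t \<in> carrier (sections F V) \<and>
          (\<forall>y\<in>V. s y = germ X F y V t)"
        using V U by blast
    qed (simp add: s_def)
  qed
qed

lemma module_sheaf_sheafification: "module_sheaf X S F'"
  unfolding module_sheaf_def
proof (intro conjI allI impI ballI)
  show "is_sheaf X F'" by (rule is_sheaf_sheafification)
  show "Module.module (sections S U) (sections F' U)" if "openin X U" for U
    using that by (rule module_sheafification)
  fix U V assume UV: "openin X U \<and> openin X V \<and> V \<subseteq> U"
  fix \<sigma> \<tau> assume c: "\<sigma> \<in> carrier (sections F' U)" "\<tau> \<in> carrier (sections F' U)"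
  show "restr F' U V (\<sigma> \<oplus>\<^bsub>sections F' U\<^esub> \<tau>) = restr F' U V \<sigma> \<oplus>\<^bsub>sections F' V\<^esub> restr F' U V \<tau>"
    using UV by (auto simp: sheafification_def fun_eq_iff)
next
  fix U V assume UV: "openin X U \<and> openin X V \<and> V \<subseteq> U"
  fix r \<sigma> assume r: "r \<in> carrier (sections S U)" and \<sigma>: "\<sigma> \<in> carrier (sections F' U)"
  have rV: "restr S U V r \<in> carrier (sections S V)"
    using UV r S_restr_closed by blast
  have \<sigma>V: "restrict \<sigma> V \<in> carrier (sections F' V)"
    using UV \<sigma> sheafification_restrict by blast
  show "restr F' U V (r \<odot>\<^bsub>sections F' U\<^esub> \<sigma>) = restr S U V r \<odot>\<^bsub>sections F' V\<^esub> restr F' U V \<sigma>"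
  proof (rule sheafification_eqI)
    show "restr F' U V (r \<odot>\<^bsub>sections F' U\<^esub> \<sigma>) \<in> carrier (sections F' V)"
      unfolding sheafification_restr
      by (rule sheafification_restrict[OF _ _ sheafification_smult_closed]) (use UV r \<sigma> in auto)
    show "restr S U V r \<odot>\<^bsub>sections F' V\<^esub> restr F' U V \<sigma> \<in> carrier (sections F' V)"
      using UV rV \<sigma>V by (simp add: sheafification_smult_closed)
    fix x assume x: "x \<in> V"
    from sheafification_local[OF \<sigma>V x] obtain W s where W: "openin X W" "x \<in> W" "W \<subseteq> V"
      "s \<in> carrier (sections F W)" "\<forall>y\<in>W. restrict \<sigma> V y = germ X F y W s" by blast
    then have \<sigma>x: "\<sigma> x = germ X F x W s" using x by (metis restrict_apply')
    have "(r \<odot>\<^bsub>sections F' U\<^esub> \<sigma>) x = germ X F x W (restr S U W r \<odot>\<^bsub>sections F W\<^esub> s)"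
      using UV W r \<sigma>x by (intro sheafification_smult_germ) auto
    moreover have "(restr S U V r \<odot>\<^bsub>sections F' V\<^esub> restrict \<sigma> V) x =
        germ X F x W (restr S V W (restr S U V r) \<odot>\<^bsub>sections F W\<^esub> s)"
      using UV W rV by (intro sheafification_smult_germ) auto
    ultimately show "restr F' U V (r \<odot>\<^bsub>sections F' U\<^esub> \<sigma>) x = (restr S U V r \<odot>\<^bsub>sections F' V\<^esub> restr F' U V \<sigma>) x"
      using x UV W r S_restr_restr by simp
  qed
qed

lemma germ_section_closed:
  assumes "openin X U" "s \<in> carrier (sections F U)"
  shows "(\<lambda>x\<in>U. germ X F x U s) \<in> carrier (sections F' U)"
  by (rule sheafificationI) (use assms in auto)

end

section \<open>Affine neighbourhoods\<close>

text \<open>Fractions are compared through a vanishing multiple of a difference; calculations are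
  easier with an equality of two multiples.\<close>

lemma (in cring) mult_diff_eq_zero_iff:
  assumes "u \<in> carrier R" "x \<in> carrier R" "y \<in> carrier R"
  shows "u \<otimes> (x \<ominus> y) = \<zero> \<longleftrightarrow> u \<otimes> x = u \<otimes> y"
proof -
  have "u \<otimes> (x \<ominus> y) = u \<otimes> x \<ominus> u \<otimes> y"
    using assms by algebra
  then show ?thesis
    using assms by (simp add: r_right_minus_eq)
qed

section \<open>Fractions and localization at a prime ideal\<close>

context primeideal
begin

lemma fraction_iff:
  assumes "a \<in> carrier R" "s \<in> carrier R"
  shows "(b, t) \<in> fraction R I a s \<longleftrightarrow> b \<in> carrier R \<and> t \<in> carrier R \<and> t \<notin> I \<and>
    (\<exists>u\<in>carrier R - I. u \<otimes> (a \<otimes> t) = u \<otimes> (b \<otimes> s))"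
proof -
  have "u \<otimes> (a \<otimes> t \<ominus> b \<otimes> s) = \<zero> \<longleftrightarrow> u \<otimes> (a \<otimes> t) = u \<otimes> (b \<otimes> s)"
    if "u \<in> carrier R" "b \<in> carrier R" "t \<in> carrier R" for u
    using that assms by (simp add: mult_diff_eq_zero_iff)
  then show ?thesis
    unfolding fraction_def by auto
qed

lemma one_notin: "\<one> \<notin> I"
  using I_notcarr one_imp_carrier by blast

lemma mult_notin:
  "s \<in> carrier R \<Longrightarrow> t \<in> carrier R \<Longrightarrow> s \<notin> I \<Longrightarrow> t \<notin> I \<Longrightarrow> s \<otimes> t \<notin> I"
  using I_prime by blast

lemma pow_notin: "s \<in> carrier R \<Longrightarrow> s \<notin> I \<Longrightarrow> s [^] (n::nat) \<notin> I"
  by (induction n) (simp_all add: one_notin mult_notin)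

lemma mult_mem_iff:
  "s \<in> carrier R \<Longrightarrow> t \<in> carrier R \<Longrightarrow> s \<otimes> t \<in> I \<longleftrightarrow> s \<in> I \<or> t \<in> I"
  using I_prime[of s t] I_l_closed[of t s] I_r_closed[of s t] by blast

lemma fraction_self: "a \<in> carrier R \<Longrightarrow> s \<in> carrier R \<Longrightarrow> s \<notin> I \<Longrightarrow> (a, s) \<in> fraction R I a s"
  by (auto simp: fraction_iff intro!: bexI[of _ \<one>] one_notin)

text \<open>Transitivity of equality of fractions: if \<open>u\<close> equates a/s with b/t and
  \<open>v\<close> equates a/s with d/r, then u v s equates b/t with d/r. The factor
  \<open>s\<close> appears when a/s is eliminated and is harmless, being outside the prime.\<close>

lemma fraction_subset:
  assumes c: "a \<in> carrier R" "s \<in> carrier R" "s \<notin> I" "b \<in> carrier R" "t \<in> carrier R" "t \<notin> I"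
    and u: "u \<in> carrier R" "u \<notin> I" "u \<otimes> (a \<otimes> t) = u \<otimes> (b \<otimes> s)"
  shows "fraction R I a s \<subseteq> fraction R I b t"
proof
  fix p assume p: "p \<in> fraction R I a s"
  obtain d r where dr: "p = (d, r)" by fastforce
  with p obtain v where d: "d \<in> carrier R" "r \<in> carrier R" "r \<notin> I"
    and v: "v \<in> carrier R" "v \<notin> I" "v \<otimes> (a \<otimes> r) = v \<otimes> (d \<otimes> s)"
    using c fraction_iff by auto
  have "(u \<otimes> v \<otimes> s) \<otimes> (b \<otimes> r) = v \<otimes> r \<otimes> (u \<otimes> (b \<otimes> s))"
    using c d u v by (simp add: m_ac)
  also have "\<dots> = u \<otimes> t \<otimes> (v \<otimes> (a \<otimes> r))"
    using c d u(1,2) v(1,2) by (simp add: u(3)[symmetric] m_ac)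
  also have "\<dots> = (u \<otimes> v \<otimes> s) \<otimes> (d \<otimes> t)"
    unfolding v(3) using c d u(1,2) v(1,2) by (simp add: m_ac)
  finally have "(u \<otimes> v \<otimes> s) \<otimes> (b \<otimes> r) = (u \<otimes> v \<otimes> s) \<otimes> (d \<otimes> t)" .
  moreover have "u \<otimes> v \<otimes> s \<in> carrier R - I"
    using c u v by (simp add: mult_notin)
  ultimately show "p \<in> fraction R I b t"
    using c d unfolding dr fraction_iff[OF c(4,5)] by blast
qed

lemma fraction_eqI:
  assumes c: "a \<in> carrier R" "s \<in> carrier R" "s \<notin> I" "b \<in> carrier R" "t \<in> carrier R" "t \<notin> I"
    and u: "u \<in> carrier R" "u \<notin> I" "u \<otimes> (a \<otimes> t) = u \<otimes> (b \<otimes> s)"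
  shows "fraction R I a s = fraction R I b t"
  using fraction_subset[OF assms] fraction_subset[OF c(4-6,1-3) u(1,2) u(3)[symmetric]] by blast

lemma fraction_eqI':
  assumes "a \<in> carrier R" "s \<in> carrier R" "s \<notin> I" "b \<in> carrier R" "t \<in> carrier R" "t \<notin> I"
    and "a \<otimes> t = b \<otimes> s"
  shows "fraction R I a s = fraction R I b t"
  by (rule fraction_eqI[OF assms(1-6) one_closed one_notin]) (simp add: assms(7))

lemma in_fractionD:
  assumes "(b, t) \<in> fraction R I a s" "a \<in> carrier R" "s \<in> carrier R" "s \<notin> I"
  shows "b \<in> carrier R" "t \<in> carrier R" "t \<notin> I" "fraction R I b t = fraction R I a s"
proof -
  obtain u where u: "u \<in> carrier R" "u \<notin> I" "u \<otimes> (a \<otimes> t) = u \<otimes> (b \<otimes> s)"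
    and bt: "b \<in> carrier R" "t \<in> carrier R" "t \<notin> I"
    using assms fraction_iff by auto
  then show "b \<in> carrier R" "t \<in> carrier R" "t \<notin> I" by blast+
  show "fraction R I b t = fraction R I a s"
    using fraction_eqI[OF assms(2-4) bt u] by simp
qed

lemma fraction_eqD:
  assumes "fraction R I a s = fraction R I b t"
    and "a \<in> carrier R" "s \<in> carrier R" "s \<notin> I" "b \<in> carrier R" "t \<in> carrier R" "t \<notin> I"
  obtains u where "u \<in> carrier R" "u \<notin> I" "u \<otimes> (a \<otimes> t) = u \<otimes> (b \<otimes> s)"
proof -
  have "(b, t) \<in> fraction R I a s"
    using fraction_self[OF assms(5-7)] assms(1) by simp
  then show thesis
    using that fraction_iff[OF assms(2,3)] by blast
qed

text \<open>The counterpart of \<open>Union_germ_const\<close>: operations on the localization are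
  unions over all representatives of a fraction.\<close>

lemma Union_fraction_const:
  assumes c: "a \<in> carrier R" "s \<in> carrier R" "s \<notin> I"
    and h: "\<And>b t. b \<in> carrier R \<Longrightarrow> t \<in> carrier R \<Longrightarrow> t \<notin> I \<Longrightarrow>
      fraction R I b t = fraction R I a s \<Longrightarrow> h b t = C"
  shows "(\<Union>(b, t)\<in>fraction R I a s. h b t) = C"
proof -
  have "h b t = C" if "(b, t) \<in> fraction R I a s" for b t
    using in_fractionD[OF that c] h by blast
  moreover have "(a, s) \<in> fraction R I a s"
    by (rule fraction_self[OF c])
  ultimately show ?thesis by fastforce
qed

lemma localization_mult:
  assumes a: "a \<in> carrier R" "s \<in> carrier R" "s \<notin> I" and b: "b \<in> carrier R" "t \<in> carrier R" "t \<notin> I"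
  shows "fraction R I a s \<otimes>\<^bsub>localization R I\<^esub> fraction R I b t = fraction R I (a \<otimes> b) (s \<otimes> t)"
proof -
  have "fraction R I (a' \<otimes> b') (s' \<otimes> t') = fraction R I (a \<otimes> b) (s \<otimes> t)"
    if a': "a' \<in> carrier R" "s' \<in> carrier R" "s' \<notin> I" "fraction R I a' s' = fraction R I a s"
      and b': "b' \<in> carrier R" "t' \<in> carrier R" "t' \<notin> I" "fraction R I b' t' = fraction R I b t"
    for a' s' b' t'
  proof -
    obtain u where u: "u \<in> carrier R" "u \<notin> I" "u \<otimes> (a' \<otimes> s) = u \<otimes> (a \<otimes> s')"
      using fraction_eqD[OF a'(4,1-3) a] .
    obtain v where v: "v \<in> carrier R" "v \<notin> I" "v \<otimes> (b' \<otimes> t) = v \<otimes> (b \<otimes> t')"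
      using fraction_eqD[OF b'(4,1-3) b] .
    have "(u \<otimes> v) \<otimes> ((a' \<otimes> b') \<otimes> (s \<otimes> t)) = (u \<otimes> (a' \<otimes> s)) \<otimes> (v \<otimes> (b' \<otimes> t))"
      using a b a' b' u(1) v(1) by (simp add: m_ac)
    also have "\<dots> = (u \<otimes> v) \<otimes> ((a \<otimes> b) \<otimes> (s' \<otimes> t'))"
      unfolding u(3) v(3) using a b a' b' u(1) v(1) by (simp add: m_ac)
    finally show ?thesis
      using a b a' b' u v by (intro fraction_eqI[where u = "u \<otimes> v"]) (auto simp: mult_mem_iff)
  qed
  then show ?thesis
    unfolding localization_def monoid.simps
    by (intro Union_fraction_const[OF a] Union_fraction_const[OF b]) auto
qed

lemma localization_add:
  assumes a: "a \<in> carrier R" "s \<in> carrier R" "s \<notin> I" and b: "b \<in> carrier R" "t \<in> carrier R" "t \<notin> I"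
  shows "fraction R I a s \<oplus>\<^bsub>localization R I\<^esub> fraction R I b t =
    fraction R I (a \<otimes> t \<oplus> b \<otimes> s) (s \<otimes> t)"
proof -
  have "fraction R I (a' \<otimes> t' \<oplus> b' \<otimes> s') (s' \<otimes> t') = fraction R I (a \<otimes> t \<oplus> b \<otimes> s) (s \<otimes> t)"
    if a': "a' \<in> carrier R" "s' \<in> carrier R" "s' \<notin> I" "fraction R I a' s' = fraction R I a s"
      and b': "b' \<in> carrier R" "t' \<in> carrier R" "t' \<notin> I" "fraction R I b' t' = fraction R I b t"
    for a' s' b' t'
  proof -
    obtain u where u: "u \<in> carrier R" "u \<notin> I" "u \<otimes> (a' \<otimes> s) = u \<otimes> (a \<otimes> s')"
      using fraction_eqD[OF a'(4,1-3) a] .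
    obtain v where v: "v \<in> carrier R" "v \<notin> I" "v \<otimes> (b' \<otimes> t) = v \<otimes> (b \<otimes> t')"
      using fraction_eqD[OF b'(4,1-3) b] .
    have "(u \<otimes> v) \<otimes> ((a' \<otimes> t' \<oplus> b' \<otimes> s') \<otimes> (s \<otimes> t))
        = (u \<otimes> (a' \<otimes> s)) \<otimes> (v \<otimes> (t' \<otimes> t)) \<oplus> (v \<otimes> (b' \<otimes> t)) \<otimes> (u \<otimes> (s' \<otimes> s))"
      using a b a' b' u(1) v(1) by (simp add: m_ac l_distr r_distr)
    also have "\<dots> = (u \<otimes> v) \<otimes> ((a \<otimes> t \<oplus> b \<otimes> s) \<otimes> (s' \<otimes> t'))"
      unfolding u(3) v(3) using a b a' b' u(1) v(1) by (simp add: m_ac l_distr r_distr)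
    finally show ?thesis
      using a b a' b' u v by (intro fraction_eqI[where u = "u \<otimes> v"]) (auto simp: mult_mem_iff)
  qed
  then show ?thesis
    unfolding localization_def ring.simps
    by (intro Union_fraction_const[OF a] Union_fraction_const[OF b]) auto
qed

end

text \<open>
  The ring \<open>B\<close> is the localization \<open>A[1/g]\<close>.  The last assumption is the form in which the
  kernel is known below; it says that the kernel consists of \<open>g\<close>-power torsion, without
  mentioning powers.
\<close>

locale basic_localization = A: cring A + B: cring B
  for A :: "('a, 'y) ring_scheme" (structure) and B :: "('b, 'z) ring_scheme" (structure) +
  fixes \<iota> :: "'a \<Rightarrow> 'b" and g :: 'a
  assumes hom: "\<iota> \<in> ring_hom A B"
    and g: "g \<in> carrier A"
    and unit: "\<iota> g \<in> Units B"
    and surj: "b \<in> carrier B \<Longrightarrow> \<exists>a\<in>carrier A. \<exists>n::nat. b \<otimes>\<^bsub>B\<^esub> \<iota> g [^]\<^bsub>B\<^esub> n = \<iota> a"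
    and ker: "a \<in> carrier A \<Longrightarrow> \<iota> a = \<zero>\<^bsub>B\<^esub> \<Longrightarrow> primeideal \<pp> A \<Longrightarrow> g \<notin> \<pp> \<Longrightarrow>
      \<exists>u\<in>carrier A - \<pp>. u \<otimes>\<^bsub>A\<^esub> a = \<zero>\<^bsub>A\<^esub>"
begin

interpretation h: ring_hom_cring A B \<iota>
  by unfold_locales (rule hom)

abbreviation (input) "D \<equiv> spec_open A {g}"

text \<open>The prime of A[1/g] above \<pp>. Numerators are used instead of ideal generators
  because, by \<open>mem_extend_iff\<close>, any single numerator decides membership.\<close>

definition extend :: "'a set \<Rightarrow> 'b set" where
  "extend \<pp> = {b \<in> carrier B. \<exists>a\<in>\<pp>. \<exists>n::nat. b \<otimes>\<^bsub>B\<^esub> \<iota> g [^]\<^bsub>B\<^esub> n = \<iota> a}"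

definition contract :: "'b set \<Rightarrow> 'a set" where
  "contract \<qq> = {a \<in> carrier A. \<iota> a \<in> \<qq>}"

section \<open>Primes of the localization\<close>

lemma in_D: "\<pp> \<in> D \<longleftrightarrow> primeideal \<pp> A \<and> g \<notin> \<pp>"
  by (simp add: spec_open_def)

lemma iota_pow: "\<iota> (g [^]\<^bsub>A\<^esub> (n::nat)) = \<iota> g [^]\<^bsub>B\<^esub> n"
  using g by (induction n) simp_all

lemma iota_eqD:
  assumes "a \<in> carrier A" "a' \<in> carrier A" "\<iota> a = \<iota> a'" "\<pp> \<in> D"
  obtains u where "u \<in> carrier A" "u \<notin> \<pp>" "u \<otimes>\<^bsub>A\<^esub> a = u \<otimes>\<^bsub>A\<^esub> a'"
proof -
  have "\<iota> (a \<ominus>\<^bsub>A\<^esub> a') = \<zero>\<^bsub>B\<^esub>"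
    using assms(1-3) by (simp add: a_minus_def B.r_neg)
  then obtain u where "u \<in> carrier A" "u \<notin> \<pp>" "u \<otimes>\<^bsub>A\<^esub> (a \<ominus>\<^bsub>A\<^esub> a') = \<zero>\<^bsub>A\<^esub>"
    using ker[of "a \<ominus>\<^bsub>A\<^esub> a'" \<pp>] assms in_D by auto
  then show thesis
    using that assms A.mult_diff_eq_zero_iff by simp
qed

text \<open>Two numerators of \<open>b\<close> become equal after multiplication by powers of
  \<open>g\<close> and by some \<open>u\<close> outside \<pp>. As \<pp> is prime and avoids these
  factors, either both numerators lie in \<pp> or neither does.\<close>

lemma mem_extend_iff:
  assumes \<pp>: "\<pp> \<in> D" and b: "b \<in> carrier B" and a: "a \<in> carrier A"
    and ba: "b \<otimes>\<^bsub>B\<^esub> \<iota> g [^]\<^bsub>B\<^esub> (n::nat) = \<iota> a"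
  shows "b \<in> extend \<pp> \<longleftrightarrow> a \<in> \<pp>"
proof
  interpret primeideal \<pp> A using \<pp> in_D by blast
  assume "a \<in> \<pp>"
  then show "b \<in> extend \<pp>"
    using b ba unfolding extend_def by blast
next
  interpret primeideal \<pp> A using \<pp> in_D by blast
  assume "b \<in> extend \<pp>"
  then obtain a' and m :: nat where a': "a' \<in> \<pp>" "b \<otimes>\<^bsub>B\<^esub> \<iota> g [^]\<^bsub>B\<^esub> m = \<iota> a'"
    unfolding extend_def by blast
  have a'c: "a' \<in> carrier A" using a'(1) a_subset by blast
  have "\<iota> (a \<otimes>\<^bsub>A\<^esub> g [^]\<^bsub>A\<^esub> m) = b \<otimes>\<^bsub>B\<^esub> \<iota> g [^]\<^bsub>B\<^esub> n \<otimes>\<^bsub>B\<^esub> \<iota> g [^]\<^bsub>B\<^esub> m"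
    using a g ba by (simp add: iota_pow)
  also have "\<dots> = b \<otimes>\<^bsub>B\<^esub> \<iota> g [^]\<^bsub>B\<^esub> m \<otimes>\<^bsub>B\<^esub> \<iota> g [^]\<^bsub>B\<^esub> n"
    using b g by (simp add: B.m_ac)
  also have "\<dots> = \<iota> (a' \<otimes>\<^bsub>A\<^esub> g [^]\<^bsub>A\<^esub> n)"
    using a'(2) a'c g by (simp add: iota_pow)
  finally obtain u where u: "u \<in> carrier A" "u \<notin> \<pp>"
    "u \<otimes>\<^bsub>A\<^esub> (a \<otimes>\<^bsub>A\<^esub> g [^]\<^bsub>A\<^esub> m) = u \<otimes>\<^bsub>A\<^esub> (a' \<otimes>\<^bsub>A\<^esub> g [^]\<^bsub>A\<^esub> n)"
    using iota_eqD[OF _ _ _ \<pp>, of "a \<otimes>\<^bsub>A\<^esub> g [^]\<^bsub>A\<^esub> m" "a' \<otimes>\<^bsub>A\<^esub> g [^]\<^bsub>A\<^esub> n"] a a'c g by auto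
  have "u \<otimes>\<^bsub>A\<^esub> (a' \<otimes>\<^bsub>A\<^esub> g [^]\<^bsub>A\<^esub> n) \<in> \<pp>"
    using a'(1) a'c u(1) g by (simp add: mult_mem_iff)
  then have "u \<otimes>\<^bsub>A\<^esub> (a \<otimes>\<^bsub>A\<^esub> g [^]\<^bsub>A\<^esub> m) \<in> \<pp>"
    by (simp only: u(3))
  then have "a \<in> \<pp> \<or> g [^]\<^bsub>A\<^esub> m \<in> \<pp>"
    using u(1,2) a g by (simp add: mult_mem_iff)
  moreover have "g [^]\<^bsub>A\<^esub> m \<notin> \<pp>"
    using pow_notin[OF g] \<pp> in_D by blast
  ultimately show "a \<in> \<pp>" by blast
qed

lemma iota_mem_extend_iff: "\<pp> \<in> D \<Longrightarrow> a \<in> carrier A \<Longrightarrow> \<iota> a \<in> extend \<pp> \<longleftrightarrow> a \<in> \<pp>"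
  using mem_extend_iff[of \<pp> "\<iota> a" a 0] by simp

lemma extend_subset: "extend \<pp> \<subseteq> carrier B"
  unfolding extend_def by blast

text \<open>Choose numerators, clear both denominators with the sum of the two exponents, and read
  each closure property off from \<pp> by \<open>mem_extend_iff\<close>.\<close>

lemma primeideal_extend:
  assumes \<pp>: "\<pp> \<in> D" shows "primeideal (extend \<pp>) B"
proof -
  interpret primeideal \<pp> A using \<pp> in_D by blast
  have mem: "b \<in> extend \<pp> \<longleftrightarrow> a \<in> \<pp>"
    if "b \<in> carrier B" "a \<in> carrier A" "b \<otimes>\<^bsub>B\<^esub> \<iota> g [^]\<^bsub>B\<^esub> (n::nat) = \<iota> a" for a b n
    using mem_extend_iff[OF \<pp> that] .
  have add: "b \<oplus>\<^bsub>B\<^esub> b' \<in> extend \<pp>" if bb: "b \<in> extend \<pp>" "b' \<in> extend \<pp>" for b b'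
  proof -
    obtain a and n :: nat where a: "b \<in> carrier B" "a \<in> \<pp>" "b \<otimes>\<^bsub>B\<^esub> \<iota> g [^]\<^bsub>B\<^esub> n = \<iota> a"
      using bb(1) unfolding extend_def by blast
    obtain a' and m :: nat where a': "b' \<in> carrier B" "a' \<in> \<pp>" "b' \<otimes>\<^bsub>B\<^esub> \<iota> g [^]\<^bsub>B\<^esub> m = \<iota> a'"
      using bb(2) unfolding extend_def by blast
    have c: "a \<in> carrier A" "a' \<in> carrier A" using a a' a_subset by blast+
    have "(b \<oplus>\<^bsub>B\<^esub> b') \<otimes>\<^bsub>B\<^esub> \<iota> g [^]\<^bsub>B\<^esub> (n + m) =
        (b \<otimes>\<^bsub>B\<^esub> \<iota> g [^]\<^bsub>B\<^esub> n) \<otimes>\<^bsub>B\<^esub> \<iota> g [^]\<^bsub>B\<^esub> m \<oplus>\<^bsub>B\<^esub> (b' \<otimes>\<^bsub>B\<^esub> \<iota> g [^]\<^bsub>B\<^esub> m) \<otimes>\<^bsub>B\<^esub> \<iota> g [^]\<^bsub>B\<^esub> n"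
      using a(1) a'(1) g by (simp add: B.nat_pow_mult[symmetric] B.l_distr B.m_ac)
    also have "\<dots> = \<iota> (a \<otimes>\<^bsub>A\<^esub> g [^]\<^bsub>A\<^esub> m \<oplus>\<^bsub>A\<^esub> a' \<otimes>\<^bsub>A\<^esub> g [^]\<^bsub>A\<^esub> n)"
      using a(3) a'(3) c g by (simp add: iota_pow)
    finally have eq: "(b \<oplus>\<^bsub>B\<^esub> b') \<otimes>\<^bsub>B\<^esub> \<iota> g [^]\<^bsub>B\<^esub> (n + m) =
        \<iota> (a \<otimes>\<^bsub>A\<^esub> g [^]\<^bsub>A\<^esub> m \<oplus>\<^bsub>A\<^esub> a' \<otimes>\<^bsub>A\<^esub> g [^]\<^bsub>A\<^esub> n)" .
    have "a \<otimes>\<^bsub>A\<^esub> g [^]\<^bsub>A\<^esub> m \<oplus>\<^bsub>A\<^esub> a' \<otimes>\<^bsub>A\<^esub> g [^]\<^bsub>A\<^esub> n \<in> \<pp>"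
      using a(2) a'(2) g by (intro a_closed I_r_closed) auto
    then show ?thesis
      using mem[OF _ _ eq] a(1) a'(1) c g by simp
  qed
  have mult: "x \<otimes>\<^bsub>B\<^esub> b \<in> extend \<pp>" if bb: "b \<in> extend \<pp>" "x \<in> carrier B" for b x
  proof -
    obtain a and n :: nat where a: "b \<in> carrier B" "a \<in> \<pp>" "b \<otimes>\<^bsub>B\<^esub> \<iota> g [^]\<^bsub>B\<^esub> n = \<iota> a"
      using bb(1) unfolding extend_def by blast
    obtain a' and m :: nat where a': "a' \<in> carrier A" "x \<otimes>\<^bsub>B\<^esub> \<iota> g [^]\<^bsub>B\<^esub> m = \<iota> a'"
      using surj[OF bb(2)] by blast
    have c: "a \<in> carrier A" using a a_subset by blast
    have "(x \<otimes>\<^bsub>B\<^esub> b) \<otimes>\<^bsub>B\<^esub> \<iota> g [^]\<^bsub>B\<^esub> (m + n) =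
        (x \<otimes>\<^bsub>B\<^esub> \<iota> g [^]\<^bsub>B\<^esub> m) \<otimes>\<^bsub>B\<^esub> (b \<otimes>\<^bsub>B\<^esub> \<iota> g [^]\<^bsub>B\<^esub> n)"
      using a(1) bb(2) g by (simp add: B.nat_pow_mult[symmetric] B.m_ac)
    also have "\<dots> = \<iota> (a' \<otimes>\<^bsub>A\<^esub> a)"
      using a(3) a' c by simp
    finally have eq: "(x \<otimes>\<^bsub>B\<^esub> b) \<otimes>\<^bsub>B\<^esub> \<iota> g [^]\<^bsub>B\<^esub> (m + n) = \<iota> (a' \<otimes>\<^bsub>A\<^esub> a)" .
    show ?thesis
      using mem[OF _ _ eq] a(1,2) a'(1) c bb(2) I_l_closed by simp
  qed
  have prime: "b \<in> extend \<pp> \<or> b' \<in> extend \<pp>"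
    if bb: "b \<in> carrier B" "b' \<in> carrier B" "b \<otimes>\<^bsub>B\<^esub> b' \<in> extend \<pp>" for b b'
  proof -
    obtain a and n :: nat where a: "a \<in> carrier A" "b \<otimes>\<^bsub>B\<^esub> \<iota> g [^]\<^bsub>B\<^esub> n = \<iota> a"
      using surj[OF bb(1)] by blast
    obtain a' and m :: nat where a': "a' \<in> carrier A" "b' \<otimes>\<^bsub>B\<^esub> \<iota> g [^]\<^bsub>B\<^esub> m = \<iota> a'"
      using surj[OF bb(2)] by blast
    have "(b \<otimes>\<^bsub>B\<^esub> b') \<otimes>\<^bsub>B\<^esub> \<iota> g [^]\<^bsub>B\<^esub> (n + m) =
        (b \<otimes>\<^bsub>B\<^esub> \<iota> g [^]\<^bsub>B\<^esub> n) \<otimes>\<^bsub>B\<^esub> (b' \<otimes>\<^bsub>B\<^esub> \<iota> g [^]\<^bsub>B\<^esub> m)"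
      using bb(1,2) g by (simp add: B.nat_pow_mult[symmetric] B.m_ac)
    also have "\<dots> = \<iota> (a \<otimes>\<^bsub>A\<^esub> a')"
      using a a' by simp
    finally have eq: "(b \<otimes>\<^bsub>B\<^esub> b') \<otimes>\<^bsub>B\<^esub> \<iota> g [^]\<^bsub>B\<^esub> (n + m) = \<iota> (a \<otimes>\<^bsub>A\<^esub> a')" .
    have "a \<otimes>\<^bsub>A\<^esub> a' \<in> \<pp>"
      using mem[OF _ _ eq] bb a(1) a'(1) by simp
    then have "a \<in> \<pp> \<or> a' \<in> \<pp>"
      by (rule I_prime[OF a(1) a'(1)])
    then show ?thesis
      using mem[OF bb(1) a] mem[OF bb(2) a'] by simp
  qed
  \<comment> \<open>Closure under negation is reduced to closure under multiplication by ring
    elements.\<close>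
  have minus_one: "\<ominus>\<^bsub>B\<^esub> b = (\<ominus>\<^bsub>B\<^esub> \<one>\<^bsub>B\<^esub>) \<otimes>\<^bsub>B\<^esub> b" if "b \<in> carrier B" for b
    using that by (simp add: B.l_minus)
  have "subgroup (extend \<pp>) (add_monoid B)"
  proof (rule B.add.subgroupI)
    show "extend \<pp> \<subseteq> carrier B" by (rule extend_subset)
    show "extend \<pp> \<noteq> {}"
      using iota_mem_extend_iff[OF \<pp> A.zero_closed] by auto
    show "\<ominus>\<^bsub>B\<^esub> b \<in> extend \<pp>" if "b \<in> extend \<pp>" for b
    proof -
      have "b \<in> carrier B" using that extend_subset by blast
      then show ?thesis
        unfolding minus_one[OF \<open>b \<in> carrier B\<close>] by (intro mult[OF that]) simp
    qed
  qed (simp_all add: add)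
  then have sub: "additive_subgroup (extend \<pp>) B"
    by (rule additive_subgroup.intro)
  have "\<one>\<^bsub>B\<^esub> \<notin> extend \<pp>"
    using iota_mem_extend_iff[OF \<pp> A.one_closed] one_notin by simp
  then have proper: "carrier B \<noteq> extend \<pp>"
    using B.one_closed by blast
  have mult': "b \<otimes>\<^bsub>B\<^esub> x \<in> extend \<pp>" if "b \<in> extend \<pp>" "x \<in> carrier B" for b x
  proof -
    have "b \<in> carrier B" using that(1) extend_subset by blast
    then show ?thesis using mult[OF that] that(2) by (simp add: B.m_comm)
  qed
  show ?thesis
    by (rule primeidealI2[OF sub B.is_cring mult mult' proper prime])
qed

lemma primeideal_contract:
  assumes "primeideal \<qq> B" shows "contract \<qq> \<in> D"
proof -
  interpret primeideal \<qq> B by fact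
  have "\<iota> g \<notin> \<qq>"
  proof
    assume "\<iota> g \<in> \<qq>"
    then have "inv\<^bsub>B\<^esub> \<iota> g \<otimes>\<^bsub>B\<^esub> \<iota> g \<in> \<qq>"
      using unit by (intro I_l_closed) auto
    then show False
      using unit one_notin by (simp add: B.Units_l_inv)
  qed
  then show ?thesis
    using ring_hom_ring.primeideal_vimage[OF ring_hom_ringI2[OF A.ring_axioms B.ring_axioms hom] A.is_cring assms] unfolding in_D contract_def by simp
qed

lemma contract_extend: "\<pp> \<in> D \<Longrightarrow> contract (extend \<pp>) = \<pp>"
  unfolding contract_def using iota_mem_extend_iff
  by (auto simp: in_D dest: primeideal.axioms(1) ideal.Icarr)

lemma extend_contract:
  assumes "primeideal \<qq> B" shows "extend (contract \<qq>) = \<qq>"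
proof -
  interpret primeideal \<qq> B by fact
  have "b \<in> extend (contract \<qq>) \<longleftrightarrow> b \<in> \<qq>" if b: "b \<in> carrier B" for b
  proof -
    obtain a and n :: nat where a: "a \<in> carrier A" "b \<otimes>\<^bsub>B\<^esub> \<iota> g [^]\<^bsub>B\<^esub> n = \<iota> a"
      using surj[OF b] by blast
    have "b \<in> extend (contract \<qq>) \<longleftrightarrow> \<iota> a \<in> \<qq>"
      using mem_extend_iff[OF primeideal_contract[OF assms] b a] a(1) by (simp add: contract_def)
    also have "\<dots> \<longleftrightarrow> b \<in> \<qq>"
    proof -
      have "g \<notin> contract \<qq>" using primeideal_contract[OF assms] in_D by blast
      then have "\<iota> g [^]\<^bsub>B\<^esub> n \<notin> \<qq>" using pow_notin g by (simp add: contract_def)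
      then show ?thesis
        unfolding a(2)[symmetric] using b g by (simp add: mult_mem_iff)
    qed
    finally show ?thesis .
  qed
  then show ?thesis
    using extend_subset a_subset by blast
qed

text \<open>Fractions are sets of pairs, so the inverse of the isomorphism from the local ring of
  \<open>A\<close> at \<pp> to that of \<open>B\<close> at its extension is simply the preimage
  under \<iota> on both components.\<close>

definition contract_fraction :: "('b \<times> 'b) set \<Rightarrow> ('a \<times> 'a) set" where
  "contract_fraction y = {(a, s). a \<in> carrier A \<and> s \<in> carrier A \<and> (\<iota> a, \<iota> s) \<in> y}"

text \<open>A witness \<open>v\<close> over \<open>B\<close> is multiplied by a power of
  \<open>g\<close> until it comes from some \<open>w\<close> in \<open>A\<close>. The remaining
  equation holds in \<open>A\<close> up to the kernel of \<iota>, which some \<open>u\<close>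
  outside \<pp> kills, so u w is a witness over \<open>A\<close>.\<close>

lemma contract_fraction:
  assumes \<pp>: "\<pp> \<in> D" and c: "a \<in> carrier A" "s \<in> carrier A" "s \<notin> \<pp>"
  shows "contract_fraction (fraction B (extend \<pp>) (\<iota> a) (\<iota> s)) = fraction A \<pp> a s"
proof -
  interpret P: primeideal \<pp> A using \<pp> in_D by blast
  interpret Q: primeideal "extend \<pp>" B by (rule primeideal_extend[OF \<pp>])
  have "(\<iota> b, \<iota> t) \<in> fraction B (extend \<pp>) (\<iota> a) (\<iota> s) \<longleftrightarrow> (b, t) \<in> fraction A \<pp> a s"
    if bt: "b \<in> carrier A" "t \<in> carrier A" for b t
  proof
    assume "(b, t) \<in> fraction A \<pp> a s"
    then obtain u where u: "u \<in> carrier A" "u \<notin> \<pp>" "u \<otimes>\<^bsub>A\<^esub> (a \<otimes>\<^bsub>A\<^esub> t) = u \<otimes>\<^bsub>A\<^esub> (b \<otimes>\<^bsub>A\<^esub> s)" "t \<notin> \<pp>"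
      using P.fraction_iff[OF c(1,2)] by auto
    from u(3) have "\<iota> u \<otimes>\<^bsub>B\<^esub> (\<iota> a \<otimes>\<^bsub>B\<^esub> \<iota> t) = \<iota> u \<otimes>\<^bsub>B\<^esub> (\<iota> b \<otimes>\<^bsub>B\<^esub> \<iota> s)"
      using u(1) c bt by (metis h.hom_mult A.m_closed)
    moreover have "\<iota> u \<in> carrier B - extend \<pp>" "\<iota> t \<notin> extend \<pp>"
      using u bt by (simp_all add: iota_mem_extend_iff[OF \<pp>])
    ultimately show "(\<iota> b, \<iota> t) \<in> fraction B (extend \<pp>) (\<iota> a) (\<iota> s)"
      using c bt by (subst Q.fraction_iff) auto
  next
    assume "(\<iota> b, \<iota> t) \<in> fraction B (extend \<pp>) (\<iota> a) (\<iota> s)"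
    then obtain v where v: "v \<in> carrier B" "v \<notin> extend \<pp>"
        "v \<otimes>\<^bsub>B\<^esub> (\<iota> a \<otimes>\<^bsub>B\<^esub> \<iota> t) = v \<otimes>\<^bsub>B\<^esub> (\<iota> b \<otimes>\<^bsub>B\<^esub> \<iota> s)" and t: "\<iota> t \<notin> extend \<pp>"
      using Q.fraction_iff[of "\<iota> a" "\<iota> s"] c by auto
    obtain w and n :: nat where w: "w \<in> carrier A" "v \<otimes>\<^bsub>B\<^esub> \<iota> g [^]\<^bsub>B\<^esub> n = \<iota> w"
      using surj[OF v(1)] by blast
    have w': "w \<notin> \<pp>"
      using mem_extend_iff[OF \<pp> v(1) w] v(2) by simp
    have "\<iota> (w \<otimes>\<^bsub>A\<^esub> (a \<otimes>\<^bsub>A\<^esub> t)) = \<iota> g [^]\<^bsub>B\<^esub> n \<otimes>\<^bsub>B\<^esub> (v \<otimes>\<^bsub>B\<^esub> (\<iota> a \<otimes>\<^bsub>B\<^esub> \<iota> t))"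
      using w(1) c bt v(1) g by (simp add: w(2)[symmetric] B.m_ac)
    also have "\<dots> = \<iota> (w \<otimes>\<^bsub>A\<^esub> (b \<otimes>\<^bsub>A\<^esub> s))"
      unfolding v(3) using w(1) c bt v(1) g by (simp add: w(2)[symmetric] B.m_ac)
    finally obtain u where u: "u \<in> carrier A" "u \<notin> \<pp>"
      "u \<otimes>\<^bsub>A\<^esub> (w \<otimes>\<^bsub>A\<^esub> (a \<otimes>\<^bsub>A\<^esub> t)) = u \<otimes>\<^bsub>A\<^esub> (w \<otimes>\<^bsub>A\<^esub> (b \<otimes>\<^bsub>A\<^esub> s))"
      using iota_eqD[OF _ _ _ \<pp>, of "w \<otimes>\<^bsub>A\<^esub> (a \<otimes>\<^bsub>A\<^esub> t)" "w \<otimes>\<^bsub>A\<^esub> (b \<otimes>\<^bsub>A\<^esub> s)"] w c bt by auto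
    then have "(u \<otimes>\<^bsub>A\<^esub> w) \<otimes>\<^bsub>A\<^esub> (a \<otimes>\<^bsub>A\<^esub> t) = (u \<otimes>\<^bsub>A\<^esub> w) \<otimes>\<^bsub>A\<^esub> (b \<otimes>\<^bsub>A\<^esub> s)"
      using w(1) c bt by (simp add: A.m_assoc)
    moreover have "u \<otimes>\<^bsub>A\<^esub> w \<in> carrier A - \<pp>"
      using u w w' by (simp add: P.mult_notin)
    moreover have "t \<notin> \<pp>" using t iota_mem_extend_iff[OF \<pp>] bt by blast
    ultimately show "(b, t) \<in> fraction A \<pp> a s"
      using P.fraction_iff[OF c(1,2)] bt by blast
  qed
  moreover have "b \<in> carrier A \<and> t \<in> carrier A" if "(b, t) \<in> fraction A \<pp> a s" for b t
    using P.in_fractionD[OF that c] by blast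
  ultimately show ?thesis
    unfolding contract_fraction_def by auto
qed

text \<open>The pair (a, s) is chosen before \<pp>, so a section given by one fraction over
  \<open>B\<close> on an open set is given by one fraction over \<open>A\<close> on the
  corresponding open set.\<close>

lemma fraction_iota:
  assumes b: "b \<in> carrier B" and t: "t \<in> carrier B"
  obtains a s where "a \<in> carrier A" "s \<in> carrier A"
    "\<forall>\<pp>\<in>D. t \<notin> extend \<pp> \<longrightarrow> s \<notin> \<pp> \<and>
      fraction B (extend \<pp>) b t = fraction B (extend \<pp>) (\<iota> a) (\<iota> s)"
proof -
  obtain a and n :: nat where a: "a \<in> carrier A" "b \<otimes>\<^bsub>B\<^esub> \<iota> g [^]\<^bsub>B\<^esub> n = \<iota> a"
    using surj[OF b] by blast
  obtain s and m :: nat where s: "s \<in> carrier A" "t \<otimes>\<^bsub>B\<^esub> \<iota> g [^]\<^bsub>B\<^esub> m = \<iota> s"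
    using surj[OF t] by blast
  \<comment> \<open>Identifying elements of \<open>A\<close> with their images, b g^n = a and t g^m
    = s give b s g^n = a g^m t. So b/t is the fraction with numerator a g^m and denominator s
    g^n.\<close>
  have eq: "b \<otimes>\<^bsub>B\<^esub> \<iota> (s \<otimes>\<^bsub>A\<^esub> g [^]\<^bsub>A\<^esub> n) = \<iota> (a \<otimes>\<^bsub>A\<^esub> g [^]\<^bsub>A\<^esub> m) \<otimes>\<^bsub>B\<^esub> t"
    using a(1) s(1) b t g by (simp add: iota_pow a(2)[symmetric] s(2)[symmetric] B.m_ac)
  show thesis
  proof (rule that[of "a \<otimes>\<^bsub>A\<^esub> g [^]\<^bsub>A\<^esub> m" "s \<otimes>\<^bsub>A\<^esub> g [^]\<^bsub>A\<^esub> n"], goal_cases)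
    case 3
    show ?case
    proof (intro ballI impI)
    fix \<pp> assume \<pp>: "\<pp> \<in> D" and t': "t \<notin> extend \<pp>"
    interpret P: primeideal \<pp> A using \<pp> in_D by blast
    interpret Q: primeideal "extend \<pp>" B by (rule primeideal_extend[OF \<pp>])
    have "s \<notin> \<pp>"
      using mem_extend_iff[OF \<pp> t s] t' by simp
    moreover have "g [^]\<^bsub>A\<^esub> n \<notin> \<pp>"
      using P.pow_notin[OF g] \<pp> in_D by blast
    ultimately have *: "s \<otimes>\<^bsub>A\<^esub> g [^]\<^bsub>A\<^esub> n \<notin> \<pp>"
      using s g by (simp add: P.mult_notin)
    then have "\<iota> (s \<otimes>\<^bsub>A\<^esub> g [^]\<^bsub>A\<^esub> n) \<notin> extend \<pp>"
      using s g by (simp add: iota_mem_extend_iff[OF \<pp>] del: h.hom_mult)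
    then have "fraction B (extend \<pp>) b t =
        fraction B (extend \<pp>) (\<iota> (a \<otimes>\<^bsub>A\<^esub> g [^]\<^bsub>A\<^esub> m)) (\<iota> (s \<otimes>\<^bsub>A\<^esub> g [^]\<^bsub>A\<^esub> n))"
      using a s g b t t' eq by (intro Q.fraction_eqI') (simp_all del: h.hom_mult)
    then show "s \<otimes>\<^bsub>A\<^esub> g [^]\<^bsub>A\<^esub> n \<notin> \<pp> \<and> fraction B (extend \<pp>) b t =
        fraction B (extend \<pp>) (\<iota> (a \<otimes>\<^bsub>A\<^esub> g [^]\<^bsub>A\<^esub> m)) (\<iota> (s \<otimes>\<^bsub>A\<^esub> g [^]\<^bsub>A\<^esub> n))"
      using * by blast
    qed
  qed (use a s g in auto)
qed

section \<open>The basic open set as a ringed space\<close>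

lemma extend_in_spec_open_iff:
  assumes \<pp>: "\<pp> \<in> D" and E: "E \<subseteq> carrier A"
  shows "extend \<pp> \<in> spec_open B (\<iota> ` E) \<longleftrightarrow> \<pp> \<in> spec_open A E"
  using primeideal_extend[OF \<pp>] iota_mem_extend_iff[OF \<pp>] \<pp> E
  by (auto simp: spec_open_def)

lemma topspace_spec: "cring C \<Longrightarrow> topspace (spec_topology C) = {\<pp>. primeideal \<pp> C}"
proof -
  assume C: "cring C"
  interpret C: cring C by fact
  have "openin (spec_topology C) {\<pp>. primeideal \<pp> C}"
    \<comment> \<open>The whole ring serves as \<open>E\<close>: no prime ideal contains it.\<close>
    unfolding openin_spec_topology[OF C]
    by (intro exI[of _ "carrier C"])
      (auto simp: spec_open_def dest: primeideal.one_notin[THEN contrapos_nn] subsetD)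
  moreover have "U \<subseteq> {\<pp>. primeideal \<pp> C}" if "openin (spec_topology C) U" for U
    using that unfolding openin_spec_topology[OF C] by (auto simp: spec_open_def)
  ultimately show ?thesis
    by (metis openin_subset openin_topspace subset_antisym)
qed

lemma openin_D: "openin (spec_topology A) D"
  unfolding openin_spec_topology[OF A.is_cring] using g by blast

lemma topspace_D: "topspace (subtopology (spec_topology A) D) = D"
  using openin_subset[OF openin_D] by auto

text \<open>The inverse is \<open>contract\<close>. Open sets of \<open>D\<close> are cut out by
  subsets of \<open>A\<close>, and the images of these under \<iota> cut out the image sets; for
  continuity a subset of \<open>B\<close> is replaced by the set of its numerators.\<close>

lemma homeomorphic_extend:
  "homeomorphic_map (subtopology (spec_topology A) D) (spec_topology B) extend"
proof (rule bijective_open_imp_homeomorphic_map)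
  have inj: "inj_on extend D"
    by (rule inj_on_inverseI[of _ contract]) (rule contract_extend)
  then show "inj_on extend (topspace (subtopology (spec_topology A) D))"
    by (simp only: topspace_D)
  have image: "extend ` D = {\<qq>. primeideal \<qq> B}"
  proof
    show "extend ` D \<subseteq> {\<qq>. primeideal \<qq> B}"
      using primeideal_extend by blast
    show "{\<qq>. primeideal \<qq> B} \<subseteq> extend ` D"
      using extend_contract primeideal_contract by (metis (no_types, lifting) image_eqI mem_Collect_eq subsetI)
  qed
  then show "extend ` topspace (subtopology (spec_topology A) D) = topspace (spec_topology B)"
    by (simp only: topspace_D topspace_spec[OF B.is_cring])
  show "open_map (subtopology (spec_topology A) D) (spec_topology B) extend"
    unfolding open_map_def
  proof (intro allI impI)
    fix U assume U: "openin (subtopology (spec_topology A) D) U"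
    then have "openin (spec_topology A) U" "U \<subseteq> D"
      using openin_open_subtopology[OF openin_D] by blast+
    then obtain E where E: "E \<subseteq> carrier A" "U = spec_open A E"
      using openin_spec_topology[OF A.is_cring] by blast
    have "extend ` U = spec_open B (\<iota> ` E)"
    proof
      show "extend ` U \<subseteq> spec_open B (\<iota> ` E)"
        using extend_in_spec_open_iff[OF _ E(1)] \<open>U \<subseteq> D\<close> E(2) by blast
      show "spec_open B (\<iota> ` E) \<subseteq> extend ` U"
      proof
        fix \<qq> assume \<qq>: "\<qq> \<in> spec_open B (\<iota> ` E)"
        then have p: "primeideal \<qq> B" by (simp add: spec_open_def)
        have "contract \<qq> \<in> U"
          using extend_in_spec_open_iff[OF primeideal_contract[OF p] E(1)] \<qq> E(2)
          by (simp add: extend_contract[OF p])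
        then show "\<qq> \<in> extend ` U"
          using extend_contract[OF p] by (metis image_eqI)
      qed
    qed
    moreover have "\<iota> ` E \<subseteq> carrier B" using E by auto
    ultimately show "openin (spec_topology B) (extend ` U)"
      unfolding openin_spec_topology[OF B.is_cring] by (intro exI conjI)
  qed
  show "continuous_map (subtopology (spec_topology A) D) (spec_topology B) extend"
    unfolding continuous_map_def topspace_D
  proof (intro conjI allI impI)
    show "extend \<in> D \<rightarrow> topspace (spec_topology B)"
      using primeideal_extend by (auto simp: topspace_spec[OF B.is_cring])
    fix U assume "openin (spec_topology B) U"
    then obtain E where E: "E \<subseteq> carrier B" "U = spec_open B E"
      using openin_spec_topology[OF B.is_cring] by blast
    define E' where "E' = {a \<in> carrier A. \<exists>b\<in>E. \<exists>n::nat. b \<otimes>\<^bsub>B\<^esub> \<iota> g [^]\<^bsub>B\<^esub> n = \<iota> a}"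
    have "{\<pp> \<in> D. extend \<pp> \<in> U} = spec_open A E' \<inter> D"
    proof -
      have "E \<subseteq> extend \<pp> \<longleftrightarrow> E' \<subseteq> \<pp>" if \<pp>: "\<pp> \<in> D" for \<pp>
      proof
        assume sub: "E \<subseteq> extend \<pp>"
        show "E' \<subseteq> \<pp>"
        proof
          fix a assume "a \<in> E'"
          then obtain b and n :: nat where "a \<in> carrier A" "b \<in> E" "b \<otimes>\<^bsub>B\<^esub> \<iota> g [^]\<^bsub>B\<^esub> n = \<iota> a"
            unfolding E'_def by blast
          then show "a \<in> \<pp>"
            using mem_extend_iff[OF \<pp>] E(1) sub by blast
        qed
      next
        assume sub: "E' \<subseteq> \<pp>"
        show "E \<subseteq> extend \<pp>"
        proof
          fix b assume b: "b \<in> E"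
          then have bc: "b \<in> carrier B" using E(1) by blast
          obtain a and n :: nat where a: "a \<in> carrier A" "b \<otimes>\<^bsub>B\<^esub> \<iota> g [^]\<^bsub>B\<^esub> n = \<iota> a"
            using surj[OF bc] by blast
          then have "a \<in> E'" using b unfolding E'_def by blast
          then show "b \<in> extend \<pp>"
            using mem_extend_iff[OF \<pp> bc a] sub by blast
        qed
      qed
      then show ?thesis
        using primeideal_extend unfolding E(2) spec_open_def by blast
    qed
    moreover have "openin (spec_topology A) (spec_open A E')"
      unfolding openin_spec_topology[OF A.is_cring]
      by (rule exI[of _ E']) (auto simp: E'_def)
    ultimately show "openin (subtopology (spec_topology A) D) {\<pp> \<in> D. extend \<pp> \<in> U}"
      by (auto simp: openin_subtopology)
  qed
qed

text \<open>It goes from sections over the spectrum of \<open>B\<close> to sections over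
  \<open>D\<close>, the direction that \<open>ringed_space_iso\<close> asks for along
  \<open>extend\<close>.\<close>

definition pull_section :: "'b set set \<Rightarrow> ('b set \<Rightarrow> ('b \<times> 'b) set) \<Rightarrow> 'a set \<Rightarrow> ('a \<times> 'a) set" where
  "pull_section V \<tau> = (\<lambda>\<pp>\<in>{\<pp> \<in> D. extend \<pp> \<in> V}. contract_fraction (\<tau> (extend \<pp>)))"

lemma spec_section_iff:
  "\<sigma> \<in> carrier (sections (spec_sheaf C) U) \<longleftrightarrow> \<sigma> \<in> extensional U \<and> (\<forall>\<pp>\<in>U. \<exists>V a f.
     openin (spec_topology C) V \<and> \<pp> \<in> V \<and> V \<subseteq> U \<and> a \<in> carrier C \<and> f \<in> carrier C \<and>
     (\<forall>\<qq>\<in>V. f \<notin> \<qq> \<and> \<sigma> \<qq> = fraction C \<qq> a f))"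
  by (simp add: spec_sheaf_def)

lemma spec_section_at:
  assumes \<tau>: "\<tau> \<in> carrier (sections (spec_sheaf B) V)" and \<pp>: "\<pp> \<in> D" "extend \<pp> \<in> V"
  obtains a s where "a \<in> carrier A" "s \<in> carrier A" "s \<notin> \<pp>"
    "\<tau> (extend \<pp>) = fraction B (extend \<pp>) (\<iota> a) (\<iota> s)"
proof -
  obtain b t where bt: "b \<in> carrier B" "t \<in> carrier B" "t \<notin> extend \<pp>"
    "\<tau> (extend \<pp>) = fraction B (extend \<pp>) b t"
    using bspec[OF conjunct2[OF iffD1[OF spec_section_iff \<tau>]] \<pp>(2)] by auto
  obtain a s where as: "a \<in> carrier A" "s \<in> carrier A" "\<forall>\<pp>\<in>D. t \<notin> extend \<pp> \<longrightarrow> s \<notin> \<pp> \<and>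
      fraction B (extend \<pp>) b t = fraction B (extend \<pp>) (\<iota> a) (\<iota> s)"
    using fraction_iota[OF bt(1,2)] by blast
  from mp[OF bspec[OF as(3) \<pp>(1)] bt(3)] show thesis
    using that[OF as(1,2)] bt(4) by simp
qed

text \<open>At each prime the map is \<open>contract_fraction\<close>, which matches fractions over
  \<open>B\<close> with fractions over \<open>A\<close> and respects sums and products. The content
  is that being locally one fraction is preserved in both directions: by
  \<open>fraction_iota\<close>, and by applying \<iota> to numerator and denominator.\<close>

lemma pull_section_iso:
  assumes V: "openin (spec_topology B) V"
  shows "pull_section V \<in> ring_iso (sections (spec_sheaf B) V)
    (sections (spec_sheaf A) {\<pp> \<in> D. extend \<pp> \<in> V})"
proof -
  let ?V = "{\<pp> \<in> D. extend \<pp> \<in> V}"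
  let ?SB = "sections (spec_sheaf B) V" and ?SA = "sections (spec_sheaf A) ?V"
  have open_preimage: "openin (spec_topology A) {\<pp> \<in> D. extend \<pp> \<in> W}"
    if "openin (spec_topology B) W" for W
  proof -
    have "openin (subtopology (spec_topology A) D) {\<pp> \<in> topspace (subtopology (spec_topology A) D). extend \<pp> \<in> W}"
      using homeomorphic_imp_continuous_map[OF homeomorphic_extend] that
      by (rule openin_continuous_map_preimage)
    then show ?thesis
      unfolding topspace_D using openin_open_subtopology[OF openin_D] by blast
  qed
  have prime_V: "primeideal \<qq> B" if "\<qq> \<in> V" for \<qq>
    using openin_subset[OF V] that by (auto simp: topspace_spec[OF B.is_cring])
  have closed: "pull_section V \<tau> \<in> carrier ?SA" if \<tau>: "\<tau> \<in> carrier ?SB" for \<tau>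
    unfolding spec_section_iff
  proof (intro conjI ballI)
    show "pull_section V \<tau> \<in> extensional ?V" by (simp add: pull_section_def)
    fix \<pp> assume \<pp>: "\<pp> \<in> ?V"
    then have "extend \<pp> \<in> V" by simp
    from bspec[OF conjunct2[OF iffD1[OF spec_section_iff \<tau>]] this]
    obtain W b t where W: "openin (spec_topology B) W" "extend \<pp> \<in> W" "W \<subseteq> V"
      and bt: "b \<in> carrier B" "t \<in> carrier B"
      and eq: "\<forall>\<qq>\<in>W. t \<notin> \<qq> \<and> \<tau> \<qq> = fraction B \<qq> b t"
      by (elim exE conjE)
    obtain a s where as: "a \<in> carrier A" "s \<in> carrier A" "\<forall>\<pp>\<in>D. t \<notin> extend \<pp> \<longrightarrow> s \<notin> \<pp> \<and>
        fraction B (extend \<pp>) b t = fraction B (extend \<pp>) (\<iota> a) (\<iota> s)"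
      using fraction_iota[OF bt] by blast
    have *: "s \<notin> \<pp>' \<and> pull_section V \<tau> \<pp>' = fraction A \<pp>' a s" if "\<pp>' \<in> {\<pp> \<in> D. extend \<pp> \<in> W}" for \<pp>'
    proof -
      have \<pp>': "\<pp>' \<in> D" "extend \<pp>' \<in> W" "extend \<pp>' \<in> V" using that W(3) by auto
      have s: "s \<notin> \<pp>'" and f: "\<tau> (extend \<pp>') = fraction B (extend \<pp>') (\<iota> a) (\<iota> s)"
        using bspec[OF as(3) \<pp>'(1)] eq \<pp>'(2) by auto
      then show ?thesis
        using \<pp>' contract_fraction[OF \<pp>'(1) as(1,2) s] by (simp add: pull_section_def)
    qed
    show "\<exists>W' a f. openin (spec_topology A) W' \<and> \<pp> \<in> W' \<and> W' \<subseteq> ?V \<and> a \<in> carrier A \<and> f \<in> carrier A \<and>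
        (\<forall>\<qq>\<in>W'. f \<notin> \<qq> \<and> pull_section V \<tau> \<qq> = fraction A \<qq> a f)"
    proof (intro exI conjI)
      show "openin (spec_topology A) {\<pp> \<in> D. extend \<pp> \<in> W}"
        by (rule open_preimage[OF W(1)])
      show "\<forall>\<qq>\<in>{\<pp> \<in> D. extend \<pp> \<in> W}. s \<notin> \<qq> \<and> pull_section V \<tau> \<qq> = fraction A \<qq> a s"
        using * by (rule ballI)
    qed (use \<pp> W(2,3) as(1,2) in auto)
  qed
  \<comment> \<open>Every prime in \<open>V\<close> is the extension of its contraction, so the
    pulled back section determines all values of \<tau>: equal fractions over \<open>A\<close> stay
    equal under \<iota>.\<close>
  have inj: "inj_on (pull_section V) (carrier ?SB)"
  proof (rule inj_onI)
    fix \<tau> \<tau>' assume \<tau>: "\<tau> \<in> carrier ?SB" and \<tau>': "\<tau>' \<in> carrier ?SB"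
      and eq: "pull_section V \<tau> = pull_section V \<tau>'"
    show "\<tau> = \<tau>'"
    proof (rule extensionalityI)
      show "\<tau> \<in> extensional V" "\<tau>' \<in> extensional V"
        using \<tau> \<tau>' unfolding spec_section_iff by blast+
      fix \<qq> assume \<qq>: "\<qq> \<in> V"
      define \<pp> where "\<pp> = contract \<qq>"
      have \<pp>: "\<pp> \<in> D" "extend \<pp> = \<qq>"
        using extend_contract primeideal_contract prime_V[OF \<qq>] by (auto simp: \<pp>_def)
      interpret P: primeideal \<pp> A using \<pp>(1) in_D by blast
      interpret Q: primeideal \<qq> B using prime_V[OF \<qq>] .
      obtain a s where as: "a \<in> carrier A" "s \<in> carrier A" "s \<notin> \<pp>" "\<tau> \<qq> = fraction B \<qq> (\<iota> a) (\<iota> s)"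
        using spec_section_at[OF \<tau> \<pp>(1)] \<pp>(2) \<qq> by metis
      obtain b t where bt: "b \<in> carrier A" "t \<in> carrier A" "t \<notin> \<pp>" "\<tau>' \<qq> = fraction B \<qq> (\<iota> b) (\<iota> t)"
        using spec_section_at[OF \<tau>' \<pp>(1)] \<pp>(2) \<qq> by metis
      have st: "\<iota> s \<notin> \<qq>" "\<iota> t \<notin> \<qq>"
        using iota_mem_extend_iff[OF \<pp>(1)] as bt unfolding \<pp>(2) by auto
      have "contract_fraction (\<tau> \<qq>) = contract_fraction (\<tau>' \<qq>)"
        using fun_cong[OF eq, of \<pp>] \<pp> \<qq> by (simp add: pull_section_def)
      then have "fraction A \<pp> a s = fraction A \<pp> b t"
        using contract_fraction[OF \<pp>(1) as(1-3)] contract_fraction[OF \<pp>(1) bt(1-3)]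
        unfolding \<pp>(2) as(4) bt(4) by simp
      then obtain u where u: "u \<in> carrier A" "u \<notin> \<pp>" "u \<otimes>\<^bsub>A\<^esub> (a \<otimes>\<^bsub>A\<^esub> t) = u \<otimes>\<^bsub>A\<^esub> (b \<otimes>\<^bsub>A\<^esub> s)"
        using P.fraction_eqD[OF _ as(1-3) bt(1-3)] by blast
      have "\<iota> u \<otimes>\<^bsub>B\<^esub> (\<iota> a \<otimes>\<^bsub>B\<^esub> \<iota> t) = \<iota> u \<otimes>\<^bsub>B\<^esub> (\<iota> b \<otimes>\<^bsub>B\<^esub> \<iota> s)"
        using arg_cong[OF u(3), of \<iota>] u(1) as(1-3) bt(1-3) by simp
      moreover have "\<iota> u \<notin> \<qq>"
        using iota_mem_extend_iff[OF \<pp>(1)] u unfolding \<pp>(2) by auto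
      ultimately show "\<tau> \<qq> = \<tau>' \<qq>"
        unfolding as(4) bt(4) using as bt u st by (intro Q.fraction_eqI[where u = "\<iota> u"]) auto
    qed
  qed
  have surj': "\<sigma> \<in> pull_section V ` carrier ?SB" if \<sigma>: "\<sigma> \<in> carrier ?SA" for \<sigma>
  proof -
    \<comment> \<open>The candidate preimage applies \<iota> to some fraction representing \<sigma>
      at the contracted prime; the next fact shows that the representative does not matter.\<close>
    define \<tau> where "\<tau> = (\<lambda>\<qq>\<in>V. SOME y. \<exists>a\<in>carrier A. \<exists>s\<in>carrier A - contract \<qq>.
      y = fraction B \<qq> (\<iota> a) (\<iota> s) \<and> \<sigma> (contract \<qq>) = fraction A (contract \<qq>) a s)"
    have \<tau>: "\<tau> \<qq> = fraction B \<qq> (\<iota> a) (\<iota> s)"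
      if \<qq>: "\<qq> \<in> V" and as: "a \<in> carrier A" "s \<in> carrier A" "s \<notin> contract \<qq>"
        and f: "\<sigma> (contract \<qq>) = fraction A (contract \<qq>) a s" for \<qq> a s
    proof -
      have \<pp>: "contract \<qq> \<in> D" "extend (contract \<qq>) = \<qq>"
        using extend_contract primeideal_contract prime_V[OF \<qq>] by auto
      interpret P: primeideal "contract \<qq>" A using \<pp>(1) in_D by blast
      interpret Q: primeideal \<qq> B using prime_V[OF \<qq>] .
      have "\<exists>a\<in>carrier A. \<exists>s\<in>carrier A - contract \<qq>.
          \<tau> \<qq> = fraction B \<qq> (\<iota> a) (\<iota> s) \<and> \<sigma> (contract \<qq>) = fraction A (contract \<qq>) a s"
        unfolding \<tau>_def restrict_apply'[OF \<qq>]
        by (rule someI[of _ "fraction B \<qq> (\<iota> a) (\<iota> s)"]) (use as f in blast)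
      then obtain b t where bt: "b \<in> carrier A" "t \<in> carrier A" "t \<notin> contract \<qq>"
          "\<tau> \<qq> = fraction B \<qq> (\<iota> b) (\<iota> t)" "\<sigma> (contract \<qq>) = fraction A (contract \<qq>) b t"
        by blast
      then have "fraction A (contract \<qq>) b t = fraction A (contract \<qq>) a s"
        using f by simp
      then obtain u where u: "u \<in> carrier A" "u \<notin> contract \<qq>"
          "u \<otimes>\<^bsub>A\<^esub> (b \<otimes>\<^bsub>A\<^esub> s) = u \<otimes>\<^bsub>A\<^esub> (a \<otimes>\<^bsub>A\<^esub> t)"
        using P.fraction_eqD[OF _ bt(1-3) as] by blast
      have "\<iota> u \<otimes>\<^bsub>B\<^esub> (\<iota> b \<otimes>\<^bsub>B\<^esub> \<iota> s) = \<iota> u \<otimes>\<^bsub>B\<^esub> (\<iota> a \<otimes>\<^bsub>B\<^esub> \<iota> t)"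
        using arg_cong[OF u(3), of \<iota>] u(1) as(1-3) bt(1-3) by simp
      moreover have notin: "\<iota> x \<notin> \<qq>" if "x \<in> carrier A" "x \<notin> contract \<qq>" for x
        using that unfolding contract_def by blast
      ultimately show ?thesis
        unfolding bt(4) using as(1,2) bt(1,2) u(1)
        by (intro Q.fraction_eqI[where u = "\<iota> u"] notin[OF u(1,2)] notin[OF as(2,3)] notin[OF bt(2,3)]) auto
    qed
    have local: "\<exists>W a f. openin (spec_topology A) W \<and> \<pp> \<in> W \<and> W \<subseteq> ?V \<and> a \<in> carrier A \<and> f \<in> carrier A \<and>
        (\<forall>\<qq>\<in>W. f \<notin> \<qq> \<and> \<sigma> \<qq> = fraction A \<qq> a f)" if "\<pp> \<in> ?V" for \<pp>
      by (rule bspec[OF conjunct2[OF iffD1[OF spec_section_iff \<sigma>]] that])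
    have "\<tau> \<in> carrier ?SB"
      unfolding spec_section_iff
    proof (intro conjI ballI)
      show "\<tau> \<in> extensional V" by (simp add: \<tau>_def)
      fix \<qq> assume \<qq>: "\<qq> \<in> V"
      have \<pp>: "contract \<qq> \<in> ?V"
        using extend_contract primeideal_contract prime_V[OF \<qq>] \<qq> by auto
      obtain W a f where W: "openin (spec_topology A) W" "contract \<qq> \<in> W" "W \<subseteq> ?V"
        and af: "a \<in> carrier A" "f \<in> carrier A" and eq: "\<forall>\<qq>\<in>W. f \<notin> \<qq> \<and> \<sigma> \<qq> = fraction A \<qq> a f"
        using local[OF \<pp>] by blast
      have WD: "openin (subtopology (spec_topology A) D) W"
        using openin_open_subtopology[OF openin_D] W by blast
      have "openin (spec_topology B) (extend ` W)"
        using homeomorphic_imp_open_map[OF homeomorphic_extend] WD unfolding open_map_def by blast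
      moreover have "\<qq> \<in> extend ` W"
        using W(2) extend_contract[OF prime_V[OF \<qq>]] by (metis image_eqI)
      moreover have "extend ` W \<subseteq> V" using W(3) by blast
      moreover have "\<iota> f \<notin> \<qq>' \<and> \<tau> \<qq>' = fraction B \<qq>' (\<iota> a) (\<iota> f)" if \<qq>': "\<qq>' \<in> extend ` W" for \<qq>'
      proof -
        obtain \<pp> where \<pp>: "\<pp> \<in> W" "\<qq>' = extend \<pp>" using \<qq>' by blast
        then have "\<pp> \<in> D" "contract \<qq>' = \<pp>" "\<qq>' \<in> V"
          using W(3) contract_extend by auto
        then show ?thesis
          using \<tau>[of \<qq>' a f] eq \<pp> af iota_mem_extend_iff by simp
      qed
      ultimately show "\<exists>W b t. openin (spec_topology B) W \<and> \<qq> \<in> W \<and> W \<subseteq> V \<and> b \<in> carrier B \<and> t \<in> carrier B \<and>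
          (\<forall>\<qq>\<in>W. t \<notin> \<qq> \<and> \<tau> \<qq> = fraction B \<qq> b t)"
        using af by (intro exI[of _ "extend ` W"] exI[of _ "\<iota> a"] exI[of _ "\<iota> f"]) auto
    qed
    moreover have "pull_section V \<tau> = \<sigma>"
    proof (rule extensionalityI)
      show "pull_section V \<tau> \<in> extensional ?V" by (simp add: pull_section_def)
      show "\<sigma> \<in> extensional ?V" using \<sigma> unfolding spec_section_iff by blast
      fix \<pp> assume \<pp>: "\<pp> \<in> ?V"
      then obtain a f where af: "a \<in> carrier A" "f \<in> carrier A" "f \<notin> \<pp>" "\<sigma> \<pp> = fraction A \<pp> a f"
        using local[OF \<pp>] by blast
      have "contract (extend \<pp>) = \<pp>" using \<pp> contract_extend by blast
      then have "\<tau> (extend \<pp>) = fraction B (extend \<pp>) (\<iota> a) (\<iota> f)"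
        using \<tau>[of "extend \<pp>" a f] \<pp> af by simp
      then show "pull_section V \<tau> \<pp> = \<sigma> \<pp>"
        using \<pp> af contract_fraction[of \<pp> a f] by (simp add: pull_section_def)
    qed
    ultimately show ?thesis by (metis image_eqI)
  qed
  have at: "\<exists>a s b t. a \<in> carrier A \<and> s \<in> carrier A \<and> s \<notin> \<pp> \<and> b \<in> carrier A \<and> t \<in> carrier A \<and> t \<notin> \<pp> \<and>
      \<tau> (extend \<pp>) = fraction B (extend \<pp>) (\<iota> a) (\<iota> s) \<and> \<tau>' (extend \<pp>) = fraction B (extend \<pp>) (\<iota> b) (\<iota> t) \<and>
      \<iota> s \<notin> extend \<pp> \<and> \<iota> t \<notin> extend \<pp>"
    if c: "\<tau> \<in> carrier ?SB" "\<tau>' \<in> carrier ?SB" and \<pp>: "\<pp> \<in> ?V" for \<tau> \<tau>' \<pp>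
  proof -
    have \<pp>': "\<pp> \<in> D" "extend \<pp> \<in> V" using \<pp> by auto
    obtain a s where as: "a \<in> carrier A" "s \<in> carrier A" "s \<notin> \<pp>" "\<tau> (extend \<pp>) = fraction B (extend \<pp>) (\<iota> a) (\<iota> s)"
      using spec_section_at[OF c(1) \<pp>'] .
    obtain b t where bt: "b \<in> carrier A" "t \<in> carrier A" "t \<notin> \<pp>" "\<tau>' (extend \<pp>) = fraction B (extend \<pp>) (\<iota> b) (\<iota> t)"
      using spec_section_at[OF c(2) \<pp>'] .
    have "\<iota> s \<notin> extend \<pp>" "\<iota> t \<notin> extend \<pp>"
      using as bt iota_mem_extend_iff[OF \<pp>'(1)] by auto
    then show ?thesis using as bt by blast
  qed
  have "pull_section V \<in> ring_hom ?SB ?SA"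
  proof (rule ring_hom_memI)
    show "pull_section V \<tau> \<in> carrier ?SA" if "\<tau> \<in> carrier ?SB" for \<tau>
      using that by (rule closed)
    fix \<tau> \<tau>' assume c: "\<tau> \<in> carrier ?SB" "\<tau>' \<in> carrier ?SB"
    show "pull_section V (\<tau> \<otimes>\<^bsub>?SB\<^esub> \<tau>') = pull_section V \<tau> \<otimes>\<^bsub>?SA\<^esub> pull_section V \<tau>'"
    proof (rule extensionalityI[where A = ?V])
      fix \<pp> assume \<pp>: "\<pp> \<in> ?V"
      then have \<pp>': "\<pp> \<in> D" "extend \<pp> \<in> V" by auto
      interpret P: primeideal \<pp> A using \<pp>'(1) in_D by blast
      interpret Q: primeideal "extend \<pp>" B by (rule primeideal_extend[OF \<pp>'(1)])
      obtain a s b t where *: "a \<in> carrier A" "s \<in> carrier A" "s \<notin> \<pp>" "b \<in> carrier A" "t \<in> carrier A" "t \<notin> \<pp>"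
        "\<tau> (extend \<pp>) = fraction B (extend \<pp>) (\<iota> a) (\<iota> s)" "\<tau>' (extend \<pp>) = fraction B (extend \<pp>) (\<iota> b) (\<iota> t)"
        "\<iota> s \<notin> extend \<pp>" "\<iota> t \<notin> extend \<pp>"
        using at[OF c \<pp>] by blast
      have "(\<tau> \<otimes>\<^bsub>?SB\<^esub> \<tau>') (extend \<pp>) = fraction B (extend \<pp>) (\<iota> (a \<otimes>\<^bsub>A\<^esub> b)) (\<iota> (s \<otimes>\<^bsub>A\<^esub> t))"
        using \<pp>' * by (simp add: spec_sheaf_def Q.localization_mult)
      then have "pull_section V (\<tau> \<otimes>\<^bsub>?SB\<^esub> \<tau>') \<pp> = fraction A \<pp> (a \<otimes>\<^bsub>A\<^esub> b) (s \<otimes>\<^bsub>A\<^esub> t)"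
        using \<pp>' * contract_fraction[OF \<pp>'(1), of "a \<otimes>\<^bsub>A\<^esub> b" "s \<otimes>\<^bsub>A\<^esub> t"]
        by (simp add: pull_section_def P.mult_notin del: h.hom_mult)
      moreover have "(pull_section V \<tau> \<otimes>\<^bsub>?SA\<^esub> pull_section V \<tau>') \<pp> = fraction A \<pp> (a \<otimes>\<^bsub>A\<^esub> b) (s \<otimes>\<^bsub>A\<^esub> t)"
        using \<pp> \<pp>' * by (simp add: spec_sheaf_def pull_section_def contract_fraction P.localization_mult)
      ultimately show "pull_section V (\<tau> \<otimes>\<^bsub>?SB\<^esub> \<tau>') \<pp> = (pull_section V \<tau> \<otimes>\<^bsub>?SA\<^esub> pull_section V \<tau>') \<pp>"
        by simp
    qed (simp_all add: pull_section_def spec_sheaf_def)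
    show "pull_section V (\<tau> \<oplus>\<^bsub>?SB\<^esub> \<tau>') = pull_section V \<tau> \<oplus>\<^bsub>?SA\<^esub> pull_section V \<tau>'"
    proof (rule extensionalityI[where A = ?V])
      fix \<pp> assume \<pp>: "\<pp> \<in> ?V"
      then have \<pp>': "\<pp> \<in> D" "extend \<pp> \<in> V" by auto
      interpret P: primeideal \<pp> A using \<pp>'(1) in_D by blast
      interpret Q: primeideal "extend \<pp>" B by (rule primeideal_extend[OF \<pp>'(1)])
      obtain a s b t where *: "a \<in> carrier A" "s \<in> carrier A" "s \<notin> \<pp>" "b \<in> carrier A" "t \<in> carrier A" "t \<notin> \<pp>"
        "\<tau> (extend \<pp>) = fraction B (extend \<pp>) (\<iota> a) (\<iota> s)" "\<tau>' (extend \<pp>) = fraction B (extend \<pp>) (\<iota> b) (\<iota> t)"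
        "\<iota> s \<notin> extend \<pp>" "\<iota> t \<notin> extend \<pp>"
        using at[OF c \<pp>] by blast
      let ?n = "a \<otimes>\<^bsub>A\<^esub> t \<oplus>\<^bsub>A\<^esub> b \<otimes>\<^bsub>A\<^esub> s"
      have "(\<tau> \<oplus>\<^bsub>?SB\<^esub> \<tau>') (extend \<pp>) = fraction B (extend \<pp>) (\<iota> ?n) (\<iota> (s \<otimes>\<^bsub>A\<^esub> t))"
        using \<pp>' * by (simp add: spec_sheaf_def Q.localization_add)
      then have "pull_section V (\<tau> \<oplus>\<^bsub>?SB\<^esub> \<tau>') \<pp> = fraction A \<pp> ?n (s \<otimes>\<^bsub>A\<^esub> t)"
        using \<pp>' * contract_fraction[OF \<pp>'(1), of ?n "s \<otimes>\<^bsub>A\<^esub> t"]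
        by (simp add: pull_section_def P.mult_notin del: h.hom_mult h.hom_add)
      moreover have "(pull_section V \<tau> \<oplus>\<^bsub>?SA\<^esub> pull_section V \<tau>') \<pp> = fraction A \<pp> ?n (s \<otimes>\<^bsub>A\<^esub> t)"
        using \<pp> \<pp>' * by (simp add: spec_sheaf_def pull_section_def contract_fraction P.localization_add)
      ultimately show "pull_section V (\<tau> \<oplus>\<^bsub>?SB\<^esub> \<tau>') \<pp> = (pull_section V \<tau> \<oplus>\<^bsub>?SA\<^esub> pull_section V \<tau>') \<pp>"
        by simp
    qed (simp_all add: pull_section_def spec_sheaf_def)
  next
    show "pull_section V \<one>\<^bsub>?SB\<^esub> = \<one>\<^bsub>?SA\<^esub>"
    proof (rule extensionalityI[where A = ?V])
      fix \<pp> assume \<pp>: "\<pp> \<in> ?V"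
      then have \<pp>': "\<pp> \<in> D" "extend \<pp> \<in> V" by auto
      interpret P: primeideal \<pp> A using \<pp>'(1) in_D by blast
      show "pull_section V \<one>\<^bsub>?SB\<^esub> \<pp> = \<one>\<^bsub>?SA\<^esub> \<pp>"
        using \<pp> \<pp>' contract_fraction[OF \<pp>'(1), of "\<one>\<^bsub>A\<^esub>" "\<one>\<^bsub>A\<^esub>"] P.one_notin
        by (simp add: pull_section_def spec_sheaf_def localization_def)
    qed (simp_all add: pull_section_def spec_sheaf_def)
  qed
  moreover have "bij_betw (pull_section V) (carrier ?SB) (carrier ?SA)"
    using inj closed surj' by (auto simp: bij_betw_def)
  ultimately show ?thesis
    by (simp add: ring_iso_def)
qed

lemma ringed_space_iso_basic_open:
  "ringed_space_iso (subtopology (spec_topology A) D) (spec_sheaf A) (spec_topology B) (spec_sheaf B)"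
  unfolding ringed_space_iso_def topspace_D
proof (intro exI[of _ extend] exI[of _ pull_section] conjI allI impI ballI)
  show "homeomorphic_map (subtopology (spec_topology A) D) (spec_topology B) extend"
    by (rule homeomorphic_extend)
  show "pull_section V \<in> ring_iso (sections (spec_sheaf B) V) (sections (spec_sheaf A) {\<pp> \<in> D. extend \<pp> \<in> V})"
    if "openin (spec_topology B) V" for V
    using that by (rule pull_section_iso)
  fix V W \<tau> assume "openin (spec_topology B) V \<and> openin (spec_topology B) W \<and> W \<subseteq> V"
  then show "restr (spec_sheaf A) {\<pp> \<in> D. extend \<pp> \<in> V} {\<pp> \<in> D. extend \<pp> \<in> W} (pull_section V \<tau>) =
      pull_section W (restr (spec_sheaf B) V W \<tau>)"
    by (auto simp: spec_sheaf_def pull_section_def fun_eq_iff)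
qed

end

text \<open>A basic open set of the affine \<open>U\<close> inside \<open>W\<close> is the spectrum
  of A[1/g]. The difficulty is one of types: \<open>affine_open\<close> wants a ring with elements
  of type \<open>'r\<close>, whereas fractions over \<open>A\<close> are sets of pairs. So the
  localization is realized inside the sections over \<open>V\<close>, as the subring
  \<open>B\<close> of the images \<open>b a n\<close> of all a / g^n. This sidesteps the computation
  of all sections over a basic open set.\<close>

lemma affine_open_basis:
  fixes \<O> :: "('x, 'r ring, 'r) presheaf"
  assumes \<O>: "ring_sheaf X \<O>" and aff: "affine_open X \<O> U"
    and W: "openin X W" "x \<in> W" "x \<in> U"
  obtains V where "affine_open X \<O> V" "x \<in> V" "V \<subseteq> U" "V \<subseteq> W"
proof -
  have U: "openin X U"
    using aff unfolding affine_open_def by blast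
  have topU: "topspace (subtopology X U) = U"
    using openin_subset[OF U] by auto
  obtain A :: "'r ring" and f \<phi> where A: "cring A"
    and f: "homeomorphic_map (subtopology X U) (spec_topology A) f"
    and \<phi>_all: "\<forall>V. openin (spec_topology A) V \<longrightarrow>
      \<phi> V \<in> ring_iso (sections (spec_sheaf A) V) (sections \<O> {x\<in>U. f x \<in> V})"
    and \<phi>_restr: "\<forall>V W. openin (spec_topology A) V \<and> openin (spec_topology A) W \<and> W \<subseteq> V \<longrightarrow>
      (\<forall>s\<in>carrier (sections (spec_sheaf A) V).
        restr \<O> {x\<in>U. f x \<in> V} {x\<in>U. f x \<in> W} (\<phi> V s) = \<phi> W (restr (spec_sheaf A) V W s))"
    using aff unfolding affine_open_def ringed_space_iso_def topU by (elim conjE exE) (rule that, assumption+)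
  note \<phi> = mp[OF spec[OF \<phi>_all]]
  interpret A: cring A by fact
  have UW: "openin (subtopology X U) (U \<inter> W)"
    using U W(1) by (simp add: openin_open_subtopology openin_Int)
  have "openin (spec_topology A) (f ` (U \<inter> W))"
    using homeomorphic_imp_open_map[OF f] UW unfolding open_map_def by blast
  then obtain E where E: "E \<subseteq> carrier A" "f ` (U \<inter> W) = spec_open A E"
    unfolding openin_spec_topology[OF A] by (elim exE conjE) (rule that)
  have "f x \<in> spec_open A E"
    using W E(2) by blast
  then obtain g where g: "g \<in> E" "g \<notin> f x" "primeideal (f x) A"
    unfolding spec_open_def by blast
  have gA: "g \<in> carrier A" using g E by blast
  \<comment> \<open>The point \<open>f x\<close> lies in the open set cut out by \<open>E\<close>,
    so some \<open>g\<close> in \<open>E\<close> avoids it; the basic open set of this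
    \<open>g\<close> is the neighbourhood sought.\<close>
  define D where "D = spec_open A {g}"
  have D_iff: "\<pp> \<in> D \<longleftrightarrow> primeideal \<pp> A \<and> g \<notin> \<pp>" for \<pp>
    by (simp add: D_def spec_open_def)
  have D_sub: "D \<subseteq> spec_open A E"
    using g(1) unfolding D_def spec_open_def by blast
  have D_open: "openin (spec_topology A) D"
    unfolding openin_spec_topology[OF A] D_def using gA by blast
  define V where "V = {y\<in>U. f y \<in> D}"
  have V_open: "openin X V"
  proof -
    have "openin (subtopology X U) {y \<in> topspace (subtopology X U). f y \<in> D}"
      by (rule openin_continuous_map_preimage[OF homeomorphic_imp_continuous_map[OF f] D_open])
    then show ?thesis
      unfolding topU V_def[symmetric] using openin_open_subtopology[OF U] by blast
  qed
  have V_W: "V \<subseteq> W"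
  proof
    fix y assume "y \<in> V"
    then have "y \<in> U" "f y \<in> f ` (U \<inter> W)"
      using D_sub E(2) unfolding V_def by auto
    moreover have "inj_on f U"
      using homeomorphic_imp_injective_map[OF f] topU by simp
    ultimately show "y \<in> W"
      by (auto dest: inj_onD)
  qed
  interpret OV: cring "sections \<O> V"
    using \<O> V_open unfolding ring_sheaf_def by blast
  have \<phi>D: "\<phi> D \<in> ring_iso (sections (spec_sheaf A) D) (sections \<O> V)"
    using \<phi>[OF D_open] unfolding V_def .
  \<comment> \<open>The section a / g^n over \<open>D\<close>; its image \<open>b a n\<close> under
    the structure isomorphism is a section over \<open>V\<close>.\<close>
  define \<sigma> where "\<sigma> = (\<lambda>a (n::nat). \<lambda>\<pp>\<in>D. fraction A \<pp> a (g [^]\<^bsub>A\<^esub> n))"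
  have g_pow: "g [^]\<^bsub>A\<^esub> (n::nat) \<notin> \<pp>" if "\<pp> \<in> D" for \<pp> n
    using primeideal.pow_notin[OF _ gA] that D_iff by blast
  have \<sigma>_closed: "\<sigma> a n \<in> carrier (sections (spec_sheaf A) D)" if "a \<in> carrier A" for a n
  proof -
    have "\<exists>V a' f. openin (spec_topology A) V \<and> \<pp> \<in> V \<and> V \<subseteq> D \<and> a' \<in> carrier A \<and> f \<in> carrier A \<and>
        (\<forall>\<qq>\<in>V. f \<notin> \<qq> \<and> \<sigma> a n \<qq> = fraction A \<qq> a' f)" if \<pp>: "\<pp> \<in> D" for \<pp>
      by (rule exI[of _ D], rule exI[of _ a], rule exI[of _ "g [^]\<^bsub>A\<^esub> n"])
        (use \<open>a \<in> carrier A\<close> \<pp> D_open g_pow gA in \<open>simp add: \<sigma>_def\<close>)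
    moreover have "\<sigma> a n \<in> extensional D" by (simp add: \<sigma>_def)
    ultimately show ?thesis by (simp add: spec_sheaf_def)
  qed
  have \<sigma>_eq: "\<sigma> a n = \<sigma> b m"
    if "a \<in> carrier A" "b \<in> carrier A" "a \<otimes>\<^bsub>A\<^esub> g [^]\<^bsub>A\<^esub> m = b \<otimes>\<^bsub>A\<^esub> g [^]\<^bsub>A\<^esub> n" for a b n m
    unfolding \<sigma>_def
  proof (rule restrict_ext)
    fix \<pp> assume \<pp>: "\<pp> \<in> D"
    then interpret primeideal \<pp> A using D_iff by blast
    show "fraction A \<pp> a (g [^]\<^bsub>A\<^esub> n) = fraction A \<pp> b (g [^]\<^bsub>A\<^esub> m)"
      by (rule fraction_eqI') (use that gA g_pow[OF \<pp>] in simp_all)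
  qed
  define b where "b a n = \<phi> D (\<sigma> a n)" for a n
  have b_closed: "b a n \<in> carrier (sections \<O> V)" if "a \<in> carrier A" for a n
    unfolding b_def by (rule ring_iso_memE(1)[OF \<phi>D \<sigma>_closed[OF that]])
  have b_mult: "b a n \<otimes>\<^bsub>sections \<O> V\<^esub> b a' m = b (a \<otimes>\<^bsub>A\<^esub> a') (n + m)"
    if "a \<in> carrier A" "a' \<in> carrier A" for a a' n m
  proof -
    have "\<sigma> a n \<otimes>\<^bsub>sections (spec_sheaf A) D\<^esub> \<sigma> a' m = \<sigma> (a \<otimes>\<^bsub>A\<^esub> a') (n + m)"
      using that gA g_pow
      by (auto simp: spec_sheaf_def \<sigma>_def fun_eq_iff primeideal.localization_mult D_iff
          A.nat_pow_mult intro!: restrict_ext)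
    then show ?thesis
      unfolding b_def using ring_iso_memE(2)[OF \<phi>D \<sigma>_closed \<sigma>_closed] that by metis
  qed
  have b_add: "b a n \<oplus>\<^bsub>sections \<O> V\<^esub> b a' m = b (a \<otimes>\<^bsub>A\<^esub> g [^]\<^bsub>A\<^esub> m \<oplus>\<^bsub>A\<^esub> a' \<otimes>\<^bsub>A\<^esub> g [^]\<^bsub>A\<^esub> n) (n + m)"
    if "a \<in> carrier A" "a' \<in> carrier A" for a a' n m
  proof -
    have "\<sigma> a n \<oplus>\<^bsub>sections (spec_sheaf A) D\<^esub> \<sigma> a' m =
        \<sigma> (a \<otimes>\<^bsub>A\<^esub> g [^]\<^bsub>A\<^esub> m \<oplus>\<^bsub>A\<^esub> a' \<otimes>\<^bsub>A\<^esub> g [^]\<^bsub>A\<^esub> n) (n + m)"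
      using that gA g_pow
      by (auto simp: spec_sheaf_def \<sigma>_def fun_eq_iff primeideal.localization_add D_iff
          A.nat_pow_mult intro!: restrict_ext)
    then show ?thesis
      unfolding b_def using ring_iso_memE(3)[OF \<phi>D \<sigma>_closed \<sigma>_closed] that by metis
  qed
  have b_one: "\<one>\<^bsub>sections \<O> V\<^esub> = b \<one>\<^bsub>A\<^esub> 0"
  proof -
    have "\<one>\<^bsub>sections (spec_sheaf A) D\<^esub> = \<sigma> \<one>\<^bsub>A\<^esub> 0"
      by (simp add: spec_sheaf_def \<sigma>_def localization_def)
    then show ?thesis
      unfolding b_def using ring_iso_memE(4)[OF \<phi>D] by simp
  qed
  have b_eq: "b a n = b a' m"
    if "a \<in> carrier A" "a' \<in> carrier A" "a \<otimes>\<^bsub>A\<^esub> g [^]\<^bsub>A\<^esub> m = a' \<otimes>\<^bsub>A\<^esub> g [^]\<^bsub>A\<^esub> n" for a a' n m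
    unfolding b_def using \<sigma>_eq[OF that] by simp
  have b_zero: "b \<zero>\<^bsub>A\<^esub> n = \<zero>\<^bsub>sections \<O> V\<^esub>" for n
  proof -
    have "b \<zero>\<^bsub>A\<^esub> 0 \<oplus>\<^bsub>sections \<O> V\<^esub> b \<zero>\<^bsub>A\<^esub> 0 = b \<zero>\<^bsub>A\<^esub> 0"
      using b_add[of "\<zero>\<^bsub>A\<^esub>" "\<zero>\<^bsub>A\<^esub>" 0 0] by simp
    then have "b \<zero>\<^bsub>A\<^esub> 0 = \<zero>\<^bsub>sections \<O> V\<^esub>"
      using b_closed[of "\<zero>\<^bsub>A\<^esub>" 0] by simp
    moreover have "b \<zero>\<^bsub>A\<^esub> n = b \<zero>\<^bsub>A\<^esub> 0"
      by (rule b_eq) (use gA in simp_all)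
    ultimately show ?thesis by simp
  qed
  define H where "H = {b a n | a n. a \<in> carrier A}"
  define B where "B = (sections \<O> V)\<lparr>carrier := H\<rparr>"
  have H_sub: "H \<subseteq> carrier (sections \<O> V)"
    using b_closed unfolding H_def by blast
  have HI: "b a n \<in> H" if "a \<in> carrier A" for a n
    using that unfolding H_def by blast
  have "subcring H (sections \<O> V)"
  proof (rule OV.subcringI', rule OV.subringI[OF H_sub])
    show "\<one>\<^bsub>sections \<O> V\<^esub> \<in> H"
      unfolding b_one by (rule HI) simp
    show "\<ominus>\<^bsub>sections \<O> V\<^esub> h \<in> H" if h: "h \<in> H" for h
    proof -
      obtain a n where a: "a \<in> carrier A" "h = b a n" using h unfolding H_def by blast
      have "b (\<ominus>\<^bsub>A\<^esub> a) n \<oplus>\<^bsub>sections \<O> V\<^esub> b a n = \<zero>\<^bsub>sections \<O> V\<^esub>"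
        using a(1) gA by (simp add: b_add b_zero A.l_minus A.l_neg)
      then have "\<ominus>\<^bsub>sections \<O> V\<^esub> h = b (\<ominus>\<^bsub>A\<^esub> a) n"
        using a b_closed by (intro OV.minus_equality) auto
      then show ?thesis using a HI by simp
    qed
    show "h \<otimes>\<^bsub>sections \<O> V\<^esub> h' \<in> H" if "h \<in> H" "h' \<in> H" for h h'
      using that unfolding H_def by clarsimp (metis b_mult A.m_closed)
    show "h \<oplus>\<^bsub>sections \<O> V\<^esub> h' \<in> H" if "h \<in> H" "h' \<in> H" for h h'
      using that unfolding H_def by clarsimp (metis b_add A.m_closed A.a_closed A.nat_pow_closed gA)
  qed
  then have "cring B"
    unfolding B_def using OV.subcring_iff[OF H_sub] by simp
  then interpret B: cring B .
  have B_simps: "carrier B = H" "x \<otimes>\<^bsub>B\<^esub> y = x \<otimes>\<^bsub>sections \<O> V\<^esub> y" "x \<oplus>\<^bsub>B\<^esub> y = x \<oplus>\<^bsub>sections \<O> V\<^esub> y"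
      "\<one>\<^bsub>B\<^esub> = b \<one>\<^bsub>A\<^esub> 0" "\<zero>\<^bsub>B\<^esub> = \<zero>\<^bsub>sections \<O> V\<^esub>" for x y
    by (simp_all add: B_def b_one)
  have hom: "(\<lambda>a. b a 0) \<in> ring_hom A B"
    by (rule ring_hom_memI) (simp_all add: B_simps HI b_mult b_add)
  have h_pow: "b g 0 [^]\<^bsub>B\<^esub> n = b (g [^]\<^bsub>A\<^esub> n) 0" for n :: nat
    using gA by (induction n) (simp_all add: B_simps b_mult)
  interpret L: basic_localization A B "\<lambda>a. b a 0" g
  proof unfold_locales
    show "(\<lambda>a. b a 0) \<in> ring_hom A B" by (rule hom)
    show "g \<in> carrier A" by (rule gA)
    have "b \<one>\<^bsub>A\<^esub> 1 \<otimes>\<^bsub>B\<^esub> b g 0 = \<one>\<^bsub>B\<^esub>" "b g 0 \<otimes>\<^bsub>B\<^esub> b \<one>\<^bsub>A\<^esub> 1 = \<one>\<^bsub>B\<^esub>"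
      using gA by (simp_all add: B_simps b_mult) (rule b_eq; simp)+
    moreover have "b g 0 \<in> carrier B" "b \<one>\<^bsub>A\<^esub> 1 \<in> carrier B"
      using gA by (simp_all add: B_simps HI)
    ultimately show "b g 0 \<in> Units B"
      unfolding Units_def by blast
    show "\<exists>a\<in>carrier A. \<exists>n::nat. h \<otimes>\<^bsub>B\<^esub> b g 0 [^]\<^bsub>B\<^esub> n = b a 0" if h: "h \<in> carrier B" for h
    proof -
      obtain a n where a: "a \<in> carrier A" "h = b a n"
        using h unfolding B_simps H_def by blast
      have "h \<otimes>\<^bsub>B\<^esub> b g 0 [^]\<^bsub>B\<^esub> n = b a 0"
        unfolding h_pow using a gA by (simp add: B_simps b_mult) (rule b_eq; simp)
      then show ?thesis using a by blast
    qed
    fix a \<pp> assume a: "a \<in> carrier A" "b a 0 = \<zero>\<^bsub>B\<^esub>" and \<pp>: "primeideal \<pp> A" "g \<notin> \<pp>"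
    interpret primeideal \<pp> A by fact
    \<comment> \<open>An element of the kernel has the zero section as its image. Since
      \<open>\<phi> D\<close> is injective, a/1 = 0/1 at every prime of \<open>D\<close>, and this
      yields the annihilating \<open>u\<close>.\<close>
    have "b a 0 = b \<zero>\<^bsub>A\<^esub> 0"
      using a(2) by (simp add: B_simps b_zero)
    then have "\<sigma> a 0 = \<sigma> \<zero>\<^bsub>A\<^esub> 0"
      using ring_iso_memE(5)[OF \<phi>D] \<sigma>_closed a(1) unfolding b_def
      by (metis A.zero_closed bij_betw_inv_into_left)
    then have "fraction A \<pp> a \<one>\<^bsub>A\<^esub> = fraction A \<pp> \<zero>\<^bsub>A\<^esub> \<one>\<^bsub>A\<^esub>"
      using \<pp> unfolding \<sigma>_def by (metis A.nat_pow_0 D_iff restrict_apply')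
    then obtain u where "u \<in> carrier A" "u \<notin> \<pp>" "u \<otimes>\<^bsub>A\<^esub> (a \<otimes>\<^bsub>A\<^esub> \<one>\<^bsub>A\<^esub>) = u \<otimes>\<^bsub>A\<^esub> (\<zero>\<^bsub>A\<^esub> \<otimes>\<^bsub>A\<^esub> \<one>\<^bsub>A\<^esub>)"
      using fraction_eqD[OF _ a(1) A.one_closed one_notin A.zero_closed A.one_closed one_notin] by blast
    then show "\<exists>u\<in>carrier A - \<pp>. u \<otimes>\<^bsub>A\<^esub> a = \<zero>\<^bsub>A\<^esub>"
      using a(1) by auto
  qed
  have topD: "topspace (subtopology (spec_topology A) D) = D"
    using openin_subset[OF D_open] by auto
  obtain e \<psi> where e: "homeomorphic_map (subtopology (spec_topology A) D) (spec_topology B) e"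
    and \<psi>: "\<forall>W. openin (spec_topology B) W \<longrightarrow>
      \<psi> W \<in> ring_iso (sections (spec_sheaf B) W) (sections (spec_sheaf A) {\<pp>\<in>D. e \<pp> \<in> W})"
    and \<psi>_restr: "\<forall>W W'. openin (spec_topology B) W \<and> openin (spec_topology B) W' \<and> W' \<subseteq> W \<longrightarrow>
      (\<forall>s\<in>carrier (sections (spec_sheaf B) W).
        restr (spec_sheaf A) {\<pp>\<in>D. e \<pp> \<in> W} {\<pp>\<in>D. e \<pp> \<in> W'} (\<psi> W s) = \<psi> W' (restr (spec_sheaf B) W W' s))"
    using L.ringed_space_iso_basic_open unfolding ringed_space_iso_def D_def[symmetric] topD by blast
  have topV: "topspace (subtopology X V) = V"
    using openin_subset[OF V_open] by auto
  have VU: "V \<subseteq> U" unfolding V_def by blast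
  have "f ` (topspace (subtopology X U) \<inter> V) = topspace (spec_topology A) \<inter> D"
    unfolding homeomorphic_imp_surjective_map[OF f, symmetric] topU V_def by auto
  then have "homeomorphic_map (subtopology (subtopology X U) V) (subtopology (spec_topology A) D) f"
    by (rule homeomorphic_map_subtopologies[OF f])
  moreover have "subtopology (subtopology X U) V = subtopology X V"
    using VU by (simp add: subtopology_subtopology Int_absorb1)
  ultimately have ef: "homeomorphic_map (subtopology X V) (spec_topology B) (e \<circ> f)"
    using homeomorphic_map_compose e by metis
  have preimage: "{y\<in>V. (e \<circ> f) y \<in> W} = {y\<in>U. f y \<in> {\<pp>\<in>D. e \<pp> \<in> W}}" for W
    unfolding V_def by auto
  have open_preimage: "openin (spec_topology A) {\<pp>\<in>D. e \<pp> \<in> W}" if "openin (spec_topology B) W" for W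
    using openin_continuous_map_preimage[OF homeomorphic_imp_continuous_map[OF e] that]
      openin_open_subtopology[OF D_open] unfolding topD by blast
  \<comment> \<open>The restricted chart \<open>f\<close> is followed by the identification
    \<open>e\<close> of \<open>D\<close> with the spectrum of \<open>B\<close>; on sections the maps
    compose in the opposite order.\<close>
  have "ringed_space_iso (subtopology X V) \<O> (spec_topology B) (spec_sheaf B)"
    unfolding ringed_space_iso_def topV preimage
  proof (intro exI[of _ "e \<circ> f"] exI[of _ "\<lambda>W. \<phi> {\<pp>\<in>D. e \<pp> \<in> W} \<circ> \<psi> W"] conjI allI impI ballI)
    show "homeomorphic_map (subtopology X V) (spec_topology B) (e \<circ> f)" by (rule ef)
    show "\<phi> {\<pp>\<in>D. e \<pp> \<in> W} \<circ> \<psi> W \<in> ring_iso (sections (spec_sheaf B) W)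
        (sections \<O> {y\<in>V. (e \<circ> f) y \<in> W})"
      if W: "openin (spec_topology B) W" for W
      unfolding preimage
      by (rule ring_iso_set_trans[OF mp[OF spec[OF \<psi>] W] \<phi>[OF open_preimage[OF W]]])
    fix W W' s assume W: "openin (spec_topology B) W \<and> openin (spec_topology B) W' \<and> W' \<subseteq> W"
      and s: "s \<in> carrier (sections (spec_sheaf B) W)"
    let ?P = "{\<pp>\<in>D. e \<pp> \<in> W}" and ?P' = "{\<pp>\<in>D. e \<pp> \<in> W'}"
    have c: "\<psi> W s \<in> carrier (sections (spec_sheaf A) ?P)"
      by (rule ring_iso_memE(1)[OF mp[OF spec[OF \<psi>]] s]) (use W in blast)
    have \<phi>_eq: "restr \<O> {y\<in>U. f y \<in> ?P} {y\<in>U. f y \<in> ?P'} (\<phi> ?P (\<psi> W s)) =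
        \<phi> ?P' (restr (spec_sheaf A) ?P ?P' (\<psi> W s))"
      by (rule bspec[OF mp[OF spec[OF spec[OF \<phi>_restr]]] c]) (use W open_preimage in auto)
    have \<psi>_eq: "restr (spec_sheaf A) ?P ?P' (\<psi> W s) = \<psi> W' (restr (spec_sheaf B) W W' s)"
      by (rule bspec[OF mp[OF spec[OF spec[OF \<psi>_restr]] W] s])
    show "restr \<O> {y\<in>V. (e \<circ> f) y \<in> W} {y\<in>V. (e \<circ> f) y \<in> W'} ((\<phi> ?P \<circ> \<psi> W) s) =
        (\<phi> ?P' \<circ> \<psi> W') (restr (spec_sheaf B) W W' s)"
      unfolding preimage using \<phi>_eq \<psi>_eq by (simp only: o_apply)
  qed
  then have "affine_open X \<O> V"
    unfolding affine_open_def using V_open \<open>cring B\<close> by blast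
  moreover have "x \<in> V"
    using W(3) g by (simp add: V_def D_iff)
  ultimately show thesis
    using that VU V_W by blast
qed

section \<open>Units in stalks\<close>

text \<open>Zorn's lemma for the ideals that contain \<open>a\<close> but not 1. The principal ideal
  of \<open>a\<close> is one of them, and a larger proper ideal still contains \<open>a\<close>, so
  a maximal member of the family is a maximal ideal.\<close>

lemma (in cring) nonunit_in_maximalideal:
  assumes a: "a \<in> carrier R" "a \<notin> Units R"
  obtains \<mm> where "maximalideal \<mm> R" "a \<in> \<mm>"
proof -
  let ?\<A> = "{I. ideal I R \<and> a \<in> I \<and> \<one> \<notin> I}"
  have "\<one> \<notin> PIdl a"
  proof
    assume "\<one> \<in> PIdl a"
    then obtain x where "x \<in> carrier R" "\<one> = x \<otimes> a" unfolding cgenideal_def by blast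
    then have "a \<in> Units R"
      using a(1) m_comm unfolding Units_def by auto
    then show False using a(2) by blast
  qed
  then have "PIdl a \<in> ?\<A>"
    using cgenideal_ideal[OF a(1)] cgenideal_self[OF a(1)] by blast
  then have ne: "?\<A> \<noteq> {}" by blast
  have "\<exists>M\<in>?\<A>. \<forall>X\<in>?\<A>. M \<subseteq> X \<longrightarrow> X = M"
  proof (rule subset_Zorn_nonempty[OF ne])
    fix C assume C: "C \<noteq> {}" "subset.chain ?\<A> C"
    then have "subset.chain {I. ideal I R} C"
      unfolding pred_on.chain_def by blast
    then have "ideal (\<Union>C) R"
      using chain_Union_is_ideal[of C] C(1) by simp
    moreover have "C \<subseteq> ?\<A>" using C(2) unfolding pred_on.chain_def by blast
    ultimately show "\<Union>C \<in> ?\<A>" using C(1) by blast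
  qed
  then obtain \<mm> where \<mm>: "\<mm> \<in> ?\<A>" "\<forall>X\<in>?\<A>. \<mm> \<subseteq> X \<longrightarrow> X = \<mm>" by blast
  interpret ideal \<mm> R using \<mm>(1) by blast
  have "maximalideal \<mm> R"
  proof (rule maximalidealI)
    show "ideal \<mm> R" by (rule is_ideal)
    show "carrier R \<noteq> \<mm>" using \<mm>(1) one_closed by blast
    fix J assume J: "ideal J R" "\<mm> \<subseteq> J" "J \<subseteq> carrier R"
    show "J = \<mm> \<or> J = carrier R"
    proof (cases "\<one> \<in> J")
      case True
      then show ?thesis using ideal.one_imp_carrier[OF J(1)] by blast
    next
      case False
      then have "J \<in> ?\<A>" using J(1,2) \<mm>(1) by blast
      then show ?thesis using \<mm>(2) J(2) by blast
    qed
  qed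
  then show thesis using that \<mm>(1) by blast
qed

lemma ring_hom_Units:
  assumes f: "f \<in> ring_hom R S" and u: "u \<in> Units R"
  shows "f u \<in> Units S"
proof -
  obtain v where v: "u \<in> carrier R" "v \<in> carrier R" "v \<otimes>\<^bsub>R\<^esub> u = \<one>\<^bsub>R\<^esub>" "u \<otimes>\<^bsub>R\<^esub> v = \<one>\<^bsub>R\<^esub>"
    using u unfolding Units_def by blast
  have "f v \<otimes>\<^bsub>S\<^esub> f u = \<one>\<^bsub>S\<^esub>" "f u \<otimes>\<^bsub>S\<^esub> f v = \<one>\<^bsub>S\<^esub>"
    using ring_hom_mult[OF f v(1,2)] ring_hom_mult[OF f v(2,1)] ring_hom_one[OF f] v(3,4) by simp_all
  then show ?thesis
    using ring_hom_closed[OF f v(1)] ring_hom_closed[OF f v(2)] unfolding Units_def by blast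
qed

locale ring_sheaf_on = presheaf_on X \<O> for X :: "'x topology" and
    \<O> :: "('x, ('r, 'z) ring_scheme, 'r) presheaf" +
  assumes ring_sheaf: "ring_sheaf X \<O>"
begin

lemma cring_sections: "openin X U \<Longrightarrow> cring (sections \<O> U)"
  using ring_sheaf unfolding ring_sheaf_def by blast

lemma restr_hom: "openin X U \<Longrightarrow> openin X V \<Longrightarrow> V \<subseteq> U \<Longrightarrow>
    restr \<O> U V \<in> ring_hom (sections \<O> U) (sections \<O> V)"
  using ring_sheaf unfolding ring_sheaf_def by blast

lemma restr_Units:
  "openin X U \<Longrightarrow> openin X V \<Longrightarrow> V \<subseteq> U \<Longrightarrow> u \<in> Units (sections \<O> U) \<Longrightarrow>
    restr \<O> U V u \<in> Units (sections \<O> V)"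
  by (rule ring_hom_Units[OF restr_hom])

lemma germ_hom:
  assumes U: "openin X U" "x \<in> U"
  shows "germ X \<O> x U \<in> ring_hom (sections \<O> U) (stalk X \<O> x)"
proof -
  interpret U: cring "sections \<O> U" by (rule cring_sections[OF U(1)])
  have UX: "U \<subseteq> topspace X" using U(1) by (rule openin_subset)
  have top: "openin X (topspace X)" by simp
  interpret T: cring "sections \<O> (topspace X)" by (rule cring_sections[OF top])
  show ?thesis
  proof (rule ring_hom_memI)
    show "germ X \<O> x U s \<in> carrier (stalk X \<O> x)" if "s \<in> carrier (sections \<O> U)" for s
      using that U by (auto simp: stalk_def stalk_carrier_def)
    fix s t assume st: "s \<in> carrier (sections \<O> U)" "t \<in> carrier (sections \<O> U)"
    have "stalk_op X \<O> x (\<lambda>W. monoid.mult (sections \<O> W)) (germ X \<O> x U s) (germ X \<O> x U t) =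
        germ X \<O> x U (s \<otimes>\<^bsub>sections \<O> U\<^esub> t)"
      by (rule stalk_op_germ[OF _ _ U st])
        (simp_all add: cring.cring_simprules(5)[OF cring_sections] ring_hom_mult[OF restr_hom])
    then show "germ X \<O> x U (s \<otimes>\<^bsub>sections \<O> U\<^esub> t) = germ X \<O> x U s \<otimes>\<^bsub>stalk X \<O> x\<^esub> germ X \<O> x U t"
      by (simp add: stalk_def)
    have "stalk_op X \<O> x (\<lambda>W. ring.add (sections \<O> W)) (germ X \<O> x U s) (germ X \<O> x U t) =
        germ X \<O> x U (s \<oplus>\<^bsub>sections \<O> U\<^esub> t)"
      by (rule stalk_op_germ[OF _ _ U st])
        (simp_all add: cring.cring_simprules(1)[OF cring_sections] ring_hom_add[OF restr_hom])
    then show "germ X \<O> x U (s \<oplus>\<^bsub>sections \<O> U\<^esub> t) = germ X \<O> x U s \<oplus>\<^bsub>stalk X \<O> x\<^esub> germ X \<O> x U t"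
      by (simp add: stalk_def)
  next
    have "germ X \<O> x U (restr \<O> (topspace X) U \<one>\<^bsub>sections \<O> (topspace X)\<^esub>) = germ X \<O> x (topspace X) \<one>\<^bsub>sections \<O> (topspace X)\<^esub>"
      by (rule germ_restr[OF top U(1) UX U(2) T.one_closed])
    then show "germ X \<O> x U \<one>\<^bsub>sections \<O> U\<^esub> = \<one>\<^bsub>stalk X \<O> x\<^esub>"
      using ring_hom_one[OF restr_hom[OF top U(1) UX]] by (simp add: stalk_def)
  qed
qed

text \<open>The inverse in the stalk is the germ of some section \<open>v\<close>, and the equation
  u v = 1 between germs already holds on a small neighbourhood.\<close>

lemma germ_unit:
  assumes U: "openin X U" "x \<in> U" and u: "u \<in> carrier (sections \<O> U)"
    and unit: "germ X \<O> x U u \<in> Units (stalk X \<O> x)"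
  obtains W where "openin X W" "x \<in> W" "W \<subseteq> U" "restr \<O> U W u \<in> Units (sections \<O> W)"
proof -
  obtain y where y: "y \<in> carrier (stalk X \<O> x)" "germ X \<O> x U u \<otimes>\<^bsub>stalk X \<O> x\<^esub> y = \<one>\<^bsub>stalk X \<O> x\<^esub>"
    using unit unfolding Units_def by blast
  then obtain V v where V: "openin X V" "x \<in> V" "v \<in> carrier (sections \<O> V)" "y = germ X \<O> x V v"
    by (auto simp: stalk_def stalk_carrier_def)
  let ?W = "U \<inter> V"
  have W: "openin X ?W" "x \<in> ?W" "?W \<subseteq> U" "?W \<subseteq> V"
    using U V by auto
  interpret W: cring "sections \<O> ?W" by (rule cring_sections[OF W(1)])
  let ?u = "restr \<O> U ?W u" and ?v = "restr \<O> V ?W v"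
  have uv: "?u \<in> carrier (sections \<O> ?W)" "?v \<in> carrier (sections \<O> ?W)"
    using restr_closed[OF U(1) W(1,3) u] restr_closed[OF V(1) W(1,4) V(3)] by auto
  have "germ X \<O> x ?W (?u \<otimes>\<^bsub>sections \<O> ?W\<^esub> ?v) = germ X \<O> x ?W \<one>\<^bsub>sections \<O> ?W\<^esub>"
    using ring_hom_mult[OF germ_hom[OF W(1,2)] uv] ring_hom_one[OF germ_hom[OF W(1,2)]] y(2)
      germ_restr[OF U(1) W(1,3,2) u] germ_restr[OF V(1) W(1,4,2) V(3)] V(4) by simp
  then obtain Z where Z: "openin X Z" "x \<in> Z" "Z \<subseteq> ?W \<inter> ?W"
    and eq: "restr \<O> ?W Z (?u \<otimes>\<^bsub>sections \<O> ?W\<^esub> ?v) = restr \<O> ?W Z \<one>\<^bsub>sections \<O> ?W\<^esub>"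
    using germ_eqD[OF _ W(1,2) W.one_closed] by metis
  have ZW: "Z \<subseteq> ?W" using Z(3) by blast
  interpret Z: cring "sections \<O> Z" by (rule cring_sections[OF Z(1)])
  have "restr \<O> ?W Z ?u \<otimes>\<^bsub>sections \<O> Z\<^esub> restr \<O> ?W Z ?v = \<one>\<^bsub>sections \<O> Z\<^esub>"
    using eq ring_hom_mult[OF restr_hom[OF W(1) Z(1) ZW] uv] ring_hom_one[OF restr_hom[OF W(1) Z(1) ZW]]
    by simp
  moreover have "restr \<O> ?W Z ?u \<in> carrier (sections \<O> Z)" "restr \<O> ?W Z ?v \<in> carrier (sections \<O> Z)"
    using restr_closed[OF W(1) Z(1) ZW] uv by auto
  ultimately have "restr \<O> ?W Z ?u \<in> Units (sections \<O> Z)"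
    using Z.m_comm[of "restr \<O> ?W Z ?u" "restr \<O> ?W Z ?v"] unfolding Units_def by auto
  then have "restr \<O> U Z u \<in> Units (sections \<O> Z)"
    using restr_restr[OF U(1) W(1) Z(1) ZW W(3) u] by simp
  then show thesis using that[OF Z(1,2)] ZW by blast
qed

text \<open>If no element of \<open>E\<close> had an invertible germ, all germs would lie in the
  unique maximal ideal of the stalk; its preimage would be an ideal containing \<open>E\<close>,
  hence 1. This is how a condition on ideals becomes an invertible coefficient near a point.\<close>

lemma local_unit:
  assumes local: "local_ring (stalk X \<O> x)" and U: "openin X U" "x \<in> U"
    and E: "E \<subseteq> carrier (sections \<O> U)" "Idl\<^bsub>sections \<O> U\<^esub> E = carrier (sections \<O> U)"
  obtains u W where "u \<in> E" "openin X W" "x \<in> W" "W \<subseteq> U" "restr \<O> U W u \<in> Units (sections \<O> W)"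
proof (cases "\<exists>u\<in>E. germ X \<O> x U u \<in> Units (stalk X \<O> x)")
  case True
  then obtain u where u: "u \<in> E" "germ X \<O> x U u \<in> Units (stalk X \<O> x)" by blast
  have uc: "u \<in> carrier (sections \<O> U)" using u(1) E(1) by blast
  show thesis
    by (rule germ_unit[OF U uc u(2)]) (rule that[OF u(1)])
next
  case False
  interpret K: cring "stalk X \<O> x" using local unfolding local_ring_def by blast
  interpret U: cring "sections \<O> U" by (rule cring_sections[OF U(1)])
  obtain \<mm> where \<mm>: "maximalideal \<mm> (stalk X \<O> x)"
      "\<And>\<nn>. maximalideal \<nn> (stalk X \<O> x) \<Longrightarrow> \<nn> = \<mm>"
    using local unfolding local_ring_def by blast
  interpret \<mm>: maximalideal \<mm> "stalk X \<O> x" by (rule \<mm>(1))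
  have "germ X \<O> x U u \<in> \<mm>" if "u \<in> E" for u
  proof -
    have "germ X \<O> x U u \<in> carrier (stalk X \<O> x)"
      using ring_hom_closed[OF germ_hom[OF U]] E(1) that by blast
    then obtain \<nn> where "maximalideal \<nn> (stalk X \<O> x)" "germ X \<O> x U u \<in> \<nn>"
      using K.nonunit_in_maximalideal False \<open>u \<in> E\<close> by metis
    then show ?thesis using \<mm>(2) by blast
  qed
  then have "E \<subseteq> {s \<in> carrier (sections \<O> U). germ X \<O> x U s \<in> \<mm>}"
    using E(1) by blast
  moreover have "ideal {s \<in> carrier (sections \<O> U). germ X \<O> x U s \<in> \<mm>} (sections \<O> U)"
    by (rule ring_hom_ring.ideal_vimage[OF ring_hom_ringI2[OF U.ring_axioms K.ring_axioms germ_hom[OF U]] \<mm>.is_ideal])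
  ultimately have "Idl\<^bsub>sections \<O> U\<^esub> E \<subseteq> {s \<in> carrier (sections \<O> U). germ X \<O> x U s \<in> \<mm>}"
    by (intro U.genideal_minimal)
  then have "germ X \<O> x U \<one>\<^bsub>sections \<O> U\<^esub> \<in> \<mm>"
    using E(2) U.one_closed by blast
  then have "\<one>\<^bsub>stalk X \<O> x\<^esub> \<in> \<mm>"
    using ring_hom_one[OF germ_hom[OF U]] by simp
  then show thesis
    using \<mm>.one_imp_carrier \<mm>.I_notcarr by blast
qed

end

section \<open>Restriction of scalars\<close>

lemma scalar_restriction_simps [simp]:
  "carrier (scalar_restriction S M) = carrier M"
  "x \<oplus>\<^bsub>scalar_restriction S M\<^esub> y = x \<oplus>\<^bsub>M\<^esub> y"
  "\<zero>\<^bsub>scalar_restriction S M\<^esub> = \<zero>\<^bsub>M\<^esub>"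
  "r \<odot>\<^bsub>scalar_restriction S M\<^esub> x = (r \<odot>\<^bsub>S\<^esub> \<one>\<^bsub>S\<^esub>) \<odot>\<^bsub>M\<^esub> x"
  by (simp_all add: scalar_restriction_def)

context Module.algebra
begin

lemma scalar_one_closed [simp]: "r \<in> carrier R \<Longrightarrow> r \<odot>\<^bsub>M\<^esub> \<one>\<^bsub>M\<^esub> \<in> carrier M"
  by simp

lemma scalar_one_mult:
  "r \<in> carrier R \<Longrightarrow> r' \<in> carrier R \<Longrightarrow>
    (r \<otimes>\<^bsub>R\<^esub> r') \<odot>\<^bsub>M\<^esub> \<one>\<^bsub>M\<^esub> = (r \<odot>\<^bsub>M\<^esub> \<one>\<^bsub>M\<^esub>) \<otimes>\<^bsub>M\<^esub> (r' \<odot>\<^bsub>M\<^esub> \<one>\<^bsub>M\<^esub>)"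
  by (simp add: smult_assoc1 smult_assoc2)

lemma scalar_one_smult:
  "r \<in> carrier R \<Longrightarrow> x \<in> carrier M \<Longrightarrow> (r \<odot>\<^bsub>M\<^esub> \<one>\<^bsub>M\<^esub>) \<otimes>\<^bsub>M\<^esub> x = r \<odot>\<^bsub>M\<^esub> x"
  by (simp add: smult_assoc2)

end

lemma module_scalar_restriction:
  assumes alg: "Module.algebra R S" and M: "Module.module S M"
  shows "Module.module R (scalar_restriction S M)"
proof -
  interpret A: Module.algebra R S by fact
  interpret M: Module.module S M by fact
  show ?thesis
  proof (rule Module.moduleI)
    show "cring R" by (rule A.R.is_cring)
    show "abelian_group (scalar_restriction S M)"
      by (rule abelian_groupI) (auto simp: M.M.a_ac intro: M.M.l_neg)
  qed (auto simp: A.smult_l_distr M.smult_l_distr M.smult_r_distr A.scalar_one_mult M.smult_assoc1)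
qed

lemma scalar_restriction_sheaf_simps [simp]:
  "sections (scalar_restriction_sheaf S M) U = scalar_restriction (sections S U) (sections M U)"
  "restr (scalar_restriction_sheaf S M) = restr M"
  by (simp_all add: scalar_restriction_sheaf_def)

lemma module_sheaf_module_presheaf:
  assumes "ring_sheaf X S" "module_sheaf X S M"
  shows "module_presheaf X M S"
proof -
  interpret presheaf_on X M by (rule module_sheaf_presheaf[OF assms(2)])
  show ?thesis
    by (intro module_presheaf.intro presheaf_on_axioms module_presheaf_axioms.intro)
      (use assms in \<open>simp_all add: module_sheaf_def\<close>)
qed

lemma algebra_sheaf_restr_scalar:
  assumes S: "algebra_sheaf X R S" and U: "openin X U" "openin X V" "V \<subseteq> U" and r: "r \<in> carrier (sections R U)"
  shows "restr S U V (r \<odot>\<^bsub>sections S U\<^esub> \<one>\<^bsub>sections S U\<^esub>) = restr R U V r \<odot>\<^bsub>sections S V\<^esub> \<one>\<^bsub>sections S V\<^esub>"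
proof -
  have "cring (sections S U)" "restr S U V \<in> ring_hom (sections S U) (sections S V)"
    using S U unfolding algebra_sheaf_def ring_sheaf_def by blast+
  moreover have "restr S U V (r \<odot>\<^bsub>sections S U\<^esub> x) = restr R U V r \<odot>\<^bsub>sections S V\<^esub> restr S U V x"
    if "x \<in> carrier (sections S U)" for x
    using S U r that unfolding algebra_sheaf_def module_sheaf_def by simp
  ultimately show ?thesis
    using ring_hom_one cring.cring_simprules(6) by metis
qed

lemma module_presheaf_scalar_restriction:
  assumes R: "ring_sheaf X R" and S: "algebra_sheaf X R S" and M: "module_presheaf X M S"
  shows "module_presheaf X (scalar_restriction_sheaf S M) R"
proof -
  interpret M: module_presheaf X M S by fact
  have alg: "Module.algebra (sections R U) (sections S U)" if "openin X U" for U
    using S that unfolding algebra_sheaf_def by blast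
  have scalar: "r \<odot>\<^bsub>sections S U\<^esub> \<one>\<^bsub>sections S U\<^esub> \<in> carrier (sections S U)"
    if "openin X U" "r \<in> carrier (sections R U)" for r U
    using algebra.scalar_one_closed[OF alg] that .
  show ?thesis
  proof (intro module_presheaf.intro presheaf_on.intro module_presheaf_axioms.intro)
    show "is_presheaf X (scalar_restriction_sheaf S M)"
      using M.is_presheaf by (simp add: is_presheaf_def)
    show "Module.module (sections R U) (sections (scalar_restriction_sheaf S M) U)" if "openin X U" for U
      using module_scalar_restriction[OF alg M.module] that by simp
  qed (use R S in \<open>simp_all add: M.restr_add M.restr_smult scalar algebra_sheaf_restr_scalar\<close>)
qed

lemma module_sheaf_scalar_restriction:
  assumes R: "ring_sheaf X R" and S: "algebra_sheaf X R S" and M: "module_sheaf X S M"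
  shows "module_sheaf X R (scalar_restriction_sheaf S M)"
proof -
  have "ring_sheaf X S" using S unfolding algebra_sheaf_def by blast
  then interpret P: module_presheaf X "scalar_restriction_sheaf S M" R
    by (intro module_presheaf_scalar_restriction[OF R S] module_sheaf_module_presheaf M)
  have "is_sheaf X M"
    using M unfolding module_sheaf_def by blast
  \<comment> \<open>The sheaf axioms mention only carriers and restriction maps, which restriction
    of scalars leaves alone.\<close>
  then have "is_sheaf X (scalar_restriction_sheaf S M)"
    unfolding is_sheaf_def is_presheaf_def scalar_restriction_sheaf_simps scalar_restriction_simps .
  then show ?thesis
    unfolding module_sheaf_def by (simp add: P.module P.restr_add P.restr_smult
      del: scalar_restriction_sheaf_simps scalar_restriction_simps)
qed

section \<open>Bases\<close>

lemma basis2I: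
  assumes "e\<^sub>1 \<in> carrier M" "e\<^sub>2 \<in> carrier M"
    and "\<And>x y. x \<in> carrier R \<Longrightarrow> y \<in> carrier R \<Longrightarrow> x \<odot>\<^bsub>M\<^esub> e\<^sub>1 \<oplus>\<^bsub>M\<^esub> y \<odot>\<^bsub>M\<^esub> e\<^sub>2 \<in> carrier M"
    and "\<And>x y x' y'. \<lbrakk>x \<in> carrier R; y \<in> carrier R; x' \<in> carrier R; y' \<in> carrier R;
      x \<odot>\<^bsub>M\<^esub> e\<^sub>1 \<oplus>\<^bsub>M\<^esub> y \<odot>\<^bsub>M\<^esub> e\<^sub>2 = x' \<odot>\<^bsub>M\<^esub> e\<^sub>1 \<oplus>\<^bsub>M\<^esub> y' \<odot>\<^bsub>M\<^esub> e\<^sub>2\<rbrakk> \<Longrightarrow> x = x' \<and> y = y'"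
    and "\<And>m. m \<in> carrier M \<Longrightarrow> \<exists>x\<in>carrier R. \<exists>y\<in>carrier R. m = x \<odot>\<^bsub>M\<^esub> e\<^sub>1 \<oplus>\<^bsub>M\<^esub> y \<odot>\<^bsub>M\<^esub> e\<^sub>2"
  shows "basis2 R M e\<^sub>1 e\<^sub>2"
  unfolding basis2_def
proof (intro conjI bij_betw_imageI inj_onI)
  fix p q assume "p \<in> carrier R \<times> carrier R" "q \<in> carrier R \<times> carrier R"
    "(\<lambda>(x, y). x \<odot>\<^bsub>M\<^esub> e\<^sub>1 \<oplus>\<^bsub>M\<^esub> y \<odot>\<^bsub>M\<^esub> e\<^sub>2) p = (\<lambda>(x, y). x \<odot>\<^bsub>M\<^esub> e\<^sub>1 \<oplus>\<^bsub>M\<^esub> y \<odot>\<^bsub>M\<^esub> e\<^sub>2) q"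
  then show "p = q" using assms(4) by (cases p, cases q) auto
next
  show "(\<lambda>(x, y). x \<odot>\<^bsub>M\<^esub> e\<^sub>1 \<oplus>\<^bsub>M\<^esub> y \<odot>\<^bsub>M\<^esub> e\<^sub>2) ` (carrier R \<times> carrier R) = carrier M"
  proof
    show "(\<lambda>(x, y). x \<odot>\<^bsub>M\<^esub> e\<^sub>1 \<oplus>\<^bsub>M\<^esub> y \<odot>\<^bsub>M\<^esub> e\<^sub>2) ` (carrier R \<times> carrier R) \<subseteq> carrier M"
      using assms(3) by auto
    show "carrier M \<subseteq> (\<lambda>(x, y). x \<odot>\<^bsub>M\<^esub> e\<^sub>1 \<oplus>\<^bsub>M\<^esub> y \<odot>\<^bsub>M\<^esub> e\<^sub>2) ` (carrier R \<times> carrier R)"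
    proof
      fix m assume "m \<in> carrier M"
      then obtain x y where "x \<in> carrier R" "y \<in> carrier R" "m = x \<odot>\<^bsub>M\<^esub> e\<^sub>1 \<oplus>\<^bsub>M\<^esub> y \<odot>\<^bsub>M\<^esub> e\<^sub>2"
        using assms(5) by blast
      then show "m \<in> (\<lambda>(x, y). x \<odot>\<^bsub>M\<^esub> e\<^sub>1 \<oplus>\<^bsub>M\<^esub> y \<odot>\<^bsub>M\<^esub> e\<^sub>2) ` (carrier R \<times> carrier R)"
        by (intro image_eqI[of _ _ "(x, y)"]) auto
    qed
  qed
qed (use assms in auto)

lemma basis2_closed:
  assumes "basis2 R M e\<^sub>1 e\<^sub>2" shows "e\<^sub>1 \<in> carrier M" "e\<^sub>2 \<in> carrier M"
  using assms unfolding basis2_def by blast+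

lemma basis2_rep:
  assumes "basis2 R M e\<^sub>1 e\<^sub>2" "m \<in> carrier M"
  obtains x y where "x \<in> carrier R" "y \<in> carrier R" "m = x \<odot>\<^bsub>M\<^esub> e\<^sub>1 \<oplus>\<^bsub>M\<^esub> y \<odot>\<^bsub>M\<^esub> e\<^sub>2"
proof -
  have "m \<in> (\<lambda>(x, y). x \<odot>\<^bsub>M\<^esub> e\<^sub>1 \<oplus>\<^bsub>M\<^esub> y \<odot>\<^bsub>M\<^esub> e\<^sub>2) ` (carrier R \<times> carrier R)"
    using assms unfolding basis2_def bij_betw_def by simp
  then show thesis using that by auto
qed

lemma basis2_unique:
  assumes "basis2 R M e\<^sub>1 e\<^sub>2"
    and "x \<in> carrier R" "y \<in> carrier R" "x' \<in> carrier R" "y' \<in> carrier R"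
    and "x \<odot>\<^bsub>M\<^esub> e\<^sub>1 \<oplus>\<^bsub>M\<^esub> y \<odot>\<^bsub>M\<^esub> e\<^sub>2 = x' \<odot>\<^bsub>M\<^esub> e\<^sub>1 \<oplus>\<^bsub>M\<^esub> y' \<odot>\<^bsub>M\<^esub> e\<^sub>2"
  shows "x = x'" "y = y'"
proof -
  have "inj_on (\<lambda>(x, y). x \<odot>\<^bsub>M\<^esub> e\<^sub>1 \<oplus>\<^bsub>M\<^esub> y \<odot>\<^bsub>M\<^esub> e\<^sub>2) (carrier R \<times> carrier R)"
    using assms(1) unfolding basis2_def bij_betw_def by simp
  from inj_onD[OF this, of "(x, y)" "(x', y')"] show "x = x'" "y = y'"
    using assms(2-) by auto
qed

context Module.module
begin

lemma combine:
  assumes "e\<^sub>1 \<in> carrier M" "e\<^sub>2 \<in> carrier M"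
    and "{x, y, a, b, c, d} \<subseteq> carrier R"
  shows "x \<odot>\<^bsub>M\<^esub> (a \<odot>\<^bsub>M\<^esub> e\<^sub>1 \<oplus>\<^bsub>M\<^esub> b \<odot>\<^bsub>M\<^esub> e\<^sub>2) \<oplus>\<^bsub>M\<^esub> y \<odot>\<^bsub>M\<^esub> (c \<odot>\<^bsub>M\<^esub> e\<^sub>1 \<oplus>\<^bsub>M\<^esub> d \<odot>\<^bsub>M\<^esub> e\<^sub>2) =
    (x \<otimes> a \<oplus> y \<otimes> c) \<odot>\<^bsub>M\<^esub> e\<^sub>1 \<oplus>\<^bsub>M\<^esub> (x \<otimes> b \<oplus> y \<otimes> d) \<odot>\<^bsub>M\<^esub> e\<^sub>2"
  using assms by (simp add: smult_l_distr smult_r_distr smult_assoc1 M.a_ac)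

text \<open>Here \<open>fe\<close> gives generation, and \<open>inv\<close> recovers the coordinates
  along \<open>e\<close> from those along \<open>f\<close>, which gives independence. Apart from
  \<open>f\<close> being a basis, the hypotheses are memberships and equations, which survive
  restriction to smaller open sets.\<close>

lemma basis2_change:
  assumes f: "basis2 R M f\<^sub>1 f\<^sub>2"
    and c: "{a, b, c, d, a', b', c', d'} \<subseteq> carrier R"
    and e: "e\<^sub>1 = a \<odot>\<^bsub>M\<^esub> f\<^sub>1 \<oplus>\<^bsub>M\<^esub> b \<odot>\<^bsub>M\<^esub> f\<^sub>2" "e\<^sub>2 = c \<odot>\<^bsub>M\<^esub> f\<^sub>1 \<oplus>\<^bsub>M\<^esub> d \<odot>\<^bsub>M\<^esub> f\<^sub>2"
    and fe: "f\<^sub>1 = a' \<odot>\<^bsub>M\<^esub> e\<^sub>1 \<oplus>\<^bsub>M\<^esub> b' \<odot>\<^bsub>M\<^esub> e\<^sub>2" "f\<^sub>2 = c' \<odot>\<^bsub>M\<^esub> e\<^sub>1 \<oplus>\<^bsub>M\<^esub> d' \<odot>\<^bsub>M\<^esub> e\<^sub>2"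
    and inv: "a \<otimes> a' \<oplus> b \<otimes> c' = \<one>" "a \<otimes> b' \<oplus> b \<otimes> d' = \<zero>" "c \<otimes> a' \<oplus> d \<otimes> c' = \<zero>" "c \<otimes> b' \<oplus> d \<otimes> d' = \<one>"
  shows "basis2 R M e\<^sub>1 e\<^sub>2"
proof -
  have fc: "f\<^sub>1 \<in> carrier M" "f\<^sub>2 \<in> carrier M" using basis2_closed[OF f] by auto
  have ec: "e\<^sub>1 \<in> carrier M" "e\<^sub>2 \<in> carrier M" using e fc c by auto
  have recover: "x = (x \<otimes> a \<oplus> y \<otimes> c) \<otimes> a' \<oplus> (x \<otimes> b \<oplus> y \<otimes> d) \<otimes> c'"
      "y = (x \<otimes> a \<oplus> y \<otimes> c) \<otimes> b' \<oplus> (x \<otimes> b \<oplus> y \<otimes> d) \<otimes> d'"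
    if "x \<in> carrier R" "y \<in> carrier R" for x y
  proof -
    have "(x \<otimes> a \<oplus> y \<otimes> c) \<otimes> a' \<oplus> (x \<otimes> b \<oplus> y \<otimes> d) \<otimes> c' = x \<otimes> (a \<otimes> a' \<oplus> b \<otimes> c') \<oplus> y \<otimes> (c \<otimes> a' \<oplus> d \<otimes> c')"
      using that c by (simp add: l_distr r_distr m_assoc R.add.m_ac)
    then show "x = (x \<otimes> a \<oplus> y \<otimes> c) \<otimes> a' \<oplus> (x \<otimes> b \<oplus> y \<otimes> d) \<otimes> c'"
      using that by (simp add: inv)
    have "(x \<otimes> a \<oplus> y \<otimes> c) \<otimes> b' \<oplus> (x \<otimes> b \<oplus> y \<otimes> d) \<otimes> d' = x \<otimes> (a \<otimes> b' \<oplus> b \<otimes> d') \<oplus> y \<otimes> (c \<otimes> b' \<oplus> d \<otimes> d')"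
      using that c by (simp add: l_distr r_distr m_assoc R.add.m_ac)
    then show "y = (x \<otimes> a \<oplus> y \<otimes> c) \<otimes> b' \<oplus> (x \<otimes> b \<oplus> y \<otimes> d) \<otimes> d'"
      using that by (simp add: inv)
  qed
  have expand: "x \<odot>\<^bsub>M\<^esub> e\<^sub>1 \<oplus>\<^bsub>M\<^esub> y \<odot>\<^bsub>M\<^esub> e\<^sub>2 = (x \<otimes> a \<oplus> y \<otimes> c) \<odot>\<^bsub>M\<^esub> f\<^sub>1 \<oplus>\<^bsub>M\<^esub> (x \<otimes> b \<oplus> y \<otimes> d) \<odot>\<^bsub>M\<^esub> f\<^sub>2"
    if "x \<in> carrier R" "y \<in> carrier R" for x y
    unfolding e by (rule combine[OF fc]) (use that c in auto)
  show ?thesis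
  proof (rule basis2I)
    fix x y x' y' assume xy: "x \<in> carrier R" "y \<in> carrier R" "x' \<in> carrier R" "y' \<in> carrier R"
      and eq: "x \<odot>\<^bsub>M\<^esub> e\<^sub>1 \<oplus>\<^bsub>M\<^esub> y \<odot>\<^bsub>M\<^esub> e\<^sub>2 = x' \<odot>\<^bsub>M\<^esub> e\<^sub>1 \<oplus>\<^bsub>M\<^esub> y' \<odot>\<^bsub>M\<^esub> e\<^sub>2"
    have "x \<otimes> a \<oplus> y \<otimes> c = x' \<otimes> a \<oplus> y' \<otimes> c" "x \<otimes> b \<oplus> y \<otimes> d = x' \<otimes> b \<oplus> y' \<otimes> d"
      using basis2_unique[OF f, of "x \<otimes> a \<oplus> y \<otimes> c" "x \<otimes> b \<oplus> y \<otimes> d" "x' \<otimes> a \<oplus> y' \<otimes> c" "x' \<otimes> b \<oplus> y' \<otimes> d"]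
        eq xy c by (auto simp: expand)
    then show "x = x' \<and> y = y'"
      using recover[OF xy(1,2)] recover[OF xy(3,4)] by simp
  next
    fix m assume "m \<in> carrier M"
    then obtain x y where xy: "x \<in> carrier R" "y \<in> carrier R" "m = x \<odot>\<^bsub>M\<^esub> f\<^sub>1 \<oplus>\<^bsub>M\<^esub> y \<odot>\<^bsub>M\<^esub> f\<^sub>2"
      using basis2_rep[OF f] by blast
    have "x \<odot>\<^bsub>M\<^esub> f\<^sub>1 \<oplus>\<^bsub>M\<^esub> y \<odot>\<^bsub>M\<^esub> f\<^sub>2 = (x \<otimes> a' \<oplus> y \<otimes> c') \<odot>\<^bsub>M\<^esub> e\<^sub>1 \<oplus>\<^bsub>M\<^esub> (x \<otimes> b' \<oplus> y \<otimes> d') \<odot>\<^bsub>M\<^esub> e\<^sub>2"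
      using combine[OF ec, of x y a' b' c' d'] xy c fe by simp
    then show "\<exists>x\<in>carrier R. \<exists>y\<in>carrier R. m = x \<odot>\<^bsub>M\<^esub> e\<^sub>1 \<oplus>\<^bsub>M\<^esub> y \<odot>\<^bsub>M\<^esub> e\<^sub>2"
      using xy c by (intro bexI[of _ "x \<otimes> a' \<oplus> y \<otimes> c'"] bexI[of _ "x \<otimes> b' \<oplus> y \<otimes> d'"]) auto
  qed (use ec in auto)
qed

text \<open>Substituting one expansion into the other and comparing coordinates shows that the two
  transition matrices are inverse to each other. Both products are recorded, because the comparison
  of characteristic polynomials uses both.\<close>

lemma basis2_transition:
  assumes f: "basis2 R M f\<^sub>1 f\<^sub>2" and e: "basis2 R M e\<^sub>1 e\<^sub>2"
  obtains a b c d a' b' c' d' where "{a, b, c, d, a', b', c', d'} \<subseteq> carrier R"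
    "e\<^sub>1 = a \<odot>\<^bsub>M\<^esub> f\<^sub>1 \<oplus>\<^bsub>M\<^esub> b \<odot>\<^bsub>M\<^esub> f\<^sub>2" "e\<^sub>2 = c \<odot>\<^bsub>M\<^esub> f\<^sub>1 \<oplus>\<^bsub>M\<^esub> d \<odot>\<^bsub>M\<^esub> f\<^sub>2"
    "f\<^sub>1 = a' \<odot>\<^bsub>M\<^esub> e\<^sub>1 \<oplus>\<^bsub>M\<^esub> b' \<odot>\<^bsub>M\<^esub> e\<^sub>2" "f\<^sub>2 = c' \<odot>\<^bsub>M\<^esub> e\<^sub>1 \<oplus>\<^bsub>M\<^esub> d' \<odot>\<^bsub>M\<^esub> e\<^sub>2"
    "a \<otimes> a' \<oplus> b \<otimes> c' = \<one>" "a \<otimes> b' \<oplus> b \<otimes> d' = \<zero>" "c \<otimes> a' \<oplus> d \<otimes> c' = \<zero>" "c \<otimes> b' \<oplus> d \<otimes> d' = \<one>"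
    "a' \<otimes> a \<oplus> b' \<otimes> c = \<one>" "a' \<otimes> b \<oplus> b' \<otimes> d = \<zero>" "c' \<otimes> a \<oplus> d' \<otimes> c = \<zero>" "c' \<otimes> b \<oplus> d' \<otimes> d = \<one>"
proof -
  have fc: "f\<^sub>1 \<in> carrier M" "f\<^sub>2 \<in> carrier M" using basis2_closed[OF f] by auto
  have ec: "e\<^sub>1 \<in> carrier M" "e\<^sub>2 \<in> carrier M" using basis2_closed[OF e] by auto
  obtain a b where ab: "a \<in> carrier R" "b \<in> carrier R" "e\<^sub>1 = a \<odot>\<^bsub>M\<^esub> f\<^sub>1 \<oplus>\<^bsub>M\<^esub> b \<odot>\<^bsub>M\<^esub> f\<^sub>2"
    using basis2_rep[OF f ec(1)] .
  obtain c d where cd: "c \<in> carrier R" "d \<in> carrier R" "e\<^sub>2 = c \<odot>\<^bsub>M\<^esub> f\<^sub>1 \<oplus>\<^bsub>M\<^esub> d \<odot>\<^bsub>M\<^esub> f\<^sub>2"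
    using basis2_rep[OF f ec(2)] .
  obtain a' b' where ab': "a' \<in> carrier R" "b' \<in> carrier R" "f\<^sub>1 = a' \<odot>\<^bsub>M\<^esub> e\<^sub>1 \<oplus>\<^bsub>M\<^esub> b' \<odot>\<^bsub>M\<^esub> e\<^sub>2"
    using basis2_rep[OF e fc(1)] .
  obtain c' d' where cd': "c' \<in> carrier R" "d' \<in> carrier R" "f\<^sub>2 = c' \<odot>\<^bsub>M\<^esub> e\<^sub>1 \<oplus>\<^bsub>M\<^esub> d' \<odot>\<^bsub>M\<^esub> e\<^sub>2"
    using basis2_rep[OF e fc(2)] .
  have "(a \<otimes> a' \<oplus> b \<otimes> c') \<odot>\<^bsub>M\<^esub> e\<^sub>1 \<oplus>\<^bsub>M\<^esub> (a \<otimes> b' \<oplus> b \<otimes> d') \<odot>\<^bsub>M\<^esub> e\<^sub>2 = \<one> \<odot>\<^bsub>M\<^esub> e\<^sub>1 \<oplus>\<^bsub>M\<^esub> \<zero> \<odot>\<^bsub>M\<^esub> e\<^sub>2"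
    using combine[OF ec, of a b a' b' c' d', folded ab'(3) cd'(3) ab(3), symmetric]
      ab(1,2) ab'(1,2) cd'(1,2) ec by simp
  from basis2_unique[OF e _ _ _ _ this] have 1: "a \<otimes> a' \<oplus> b \<otimes> c' = \<one>" "a \<otimes> b' \<oplus> b \<otimes> d' = \<zero>"
    using ab(1,2) ab'(1,2) cd'(1,2) by simp_all
  have "(c \<otimes> a' \<oplus> d \<otimes> c') \<odot>\<^bsub>M\<^esub> e\<^sub>1 \<oplus>\<^bsub>M\<^esub> (c \<otimes> b' \<oplus> d \<otimes> d') \<odot>\<^bsub>M\<^esub> e\<^sub>2 = \<zero> \<odot>\<^bsub>M\<^esub> e\<^sub>1 \<oplus>\<^bsub>M\<^esub> \<one> \<odot>\<^bsub>M\<^esub> e\<^sub>2"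
    using combine[OF ec, of c d a' b' c' d', folded ab'(3) cd'(3) cd(3), symmetric]
      cd(1,2) ab'(1,2) cd'(1,2) ec by simp
  from basis2_unique[OF e _ _ _ _ this] have 2: "c \<otimes> a' \<oplus> d \<otimes> c' = \<zero>" "c \<otimes> b' \<oplus> d \<otimes> d' = \<one>"
    using cd(1,2) ab'(1,2) cd'(1,2) by simp_all
  have "(a' \<otimes> a \<oplus> b' \<otimes> c) \<odot>\<^bsub>M\<^esub> f\<^sub>1 \<oplus>\<^bsub>M\<^esub> (a' \<otimes> b \<oplus> b' \<otimes> d) \<odot>\<^bsub>M\<^esub> f\<^sub>2 = \<one> \<odot>\<^bsub>M\<^esub> f\<^sub>1 \<oplus>\<^bsub>M\<^esub> \<zero> \<odot>\<^bsub>M\<^esub> f\<^sub>2"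
    using combine[OF fc, of a' b' a b c d, folded ab(3) cd(3) ab'(3), symmetric]
      ab(1,2) cd(1,2) ab'(1,2) fc by simp
  from basis2_unique[OF f _ _ _ _ this] have 3: "a' \<otimes> a \<oplus> b' \<otimes> c = \<one>" "a' \<otimes> b \<oplus> b' \<otimes> d = \<zero>"
    using ab(1,2) cd(1,2) ab'(1,2) by simp_all
  have "(c' \<otimes> a \<oplus> d' \<otimes> c) \<odot>\<^bsub>M\<^esub> f\<^sub>1 \<oplus>\<^bsub>M\<^esub> (c' \<otimes> b \<oplus> d' \<otimes> d) \<odot>\<^bsub>M\<^esub> f\<^sub>2 = \<zero> \<odot>\<^bsub>M\<^esub> f\<^sub>1 \<oplus>\<^bsub>M\<^esub> \<one> \<odot>\<^bsub>M\<^esub> f\<^sub>2"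
    using combine[OF fc, of c' d' a b c d, folded ab(3) cd(3) cd'(3), symmetric]
      ab(1,2) cd(1,2) cd'(1,2) fc by simp
  from basis2_unique[OF f _ _ _ _ this] have 4: "c' \<otimes> a \<oplus> d' \<otimes> c = \<zero>" "c' \<otimes> b \<oplus> d' \<otimes> d = \<one>"
    using ab(1,2) cd(1,2) cd'(1,2) by simp_all
  show thesis
    by (rule that[OF _ ab(3) cd(3) ab'(3) cd'(3) 1 2 3 4])
      (use ab(1,2) cd(1,2) ab'(1,2) cd'(1,2) in simp)
qed

end

section \<open>Bases of presheaves of modules\<close>

lemma sheaf_basis2_mono:
  assumes "presheaf_on X M" "sheaf_basis2 X R M U e\<^sub>1 e\<^sub>2" "openin X U" "openin X V" "V \<subseteq> U"
  shows "sheaf_basis2 X R M V (restr M U V e\<^sub>1) (restr M U V e\<^sub>2)"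
proof -
  interpret presheaf_on X M by fact
  have e: "e\<^sub>1 \<in> carrier (sections M U)" "e\<^sub>2 \<in> carrier (sections M U)"
    using assms(2) unfolding sheaf_basis2_def by auto
  then show ?thesis
    using assms restr_closed[OF assms(3-5)] restr_restr[OF assms(3,4) _ _ assms(5)]
    unfolding sheaf_basis2_def by auto
qed

lemma sheaf_basis2_basis2:
  assumes "presheaf_on X M" "sheaf_basis2 X R M U e\<^sub>1 e\<^sub>2" "openin X U"
  shows "basis2 (sections R U) (sections M U) e\<^sub>1 e\<^sub>2"
  using assms presheaf_on.restr_id[OF assms(1,3)] unfolding sheaf_basis2_def by force

lemma free2_on_mono:
  assumes "free2_on X R M U" "openin X U" "openin X V" "V \<subseteq> U"
  shows "free2_on X R M V"
proof -
  have "openin (subtopology X U) W" if "openin (subtopology X V) W" for W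
    using that assms by (meson openin_open_subtopology order_trans)
  then show ?thesis
    using assms(1) unfolding free2_on_def module_sheaf_iso_def
    by (elim exE, rule_tac x = \<phi> in exI) simp
qed

context module_presheaf
begin

lemma restr_comb:
  assumes "openin X U" "openin X V" "V \<subseteq> U"
    and "e\<^sub>1 \<in> carrier (sections F U)" "e\<^sub>2 \<in> carrier (sections F U)"
    and "x \<in> carrier (sections S U)" "y \<in> carrier (sections S U)"
  shows "restr F U V (x \<odot>\<^bsub>sections F U\<^esub> e\<^sub>1 \<oplus>\<^bsub>sections F U\<^esub> y \<odot>\<^bsub>sections F U\<^esub> e\<^sub>2) =
    restr S U V x \<odot>\<^bsub>sections F V\<^esub> restr F U V e\<^sub>1 \<oplus>\<^bsub>sections F V\<^esub> restr S U V y \<odot>\<^bsub>sections F V\<^esub> restr F U V e\<^sub>2"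
  using assms by (simp add: restr_add restr_smult smult_closed)

text \<open>The basis consists of the images of (1, 0) and (0, 1) over \<open>U\<close>. As the
  isomorphism commutes with restriction, these restrict to the images of the standard basis over
  every smaller open set.\<close>

lemma free2_on_sheaf_basis2:
  assumes U: "openin X U" and free: "free2_on X S F U"
  obtains e\<^sub>1 e\<^sub>2 where "sheaf_basis2 X S F U e\<^sub>1 e\<^sub>2"
proof -
  have open_sub: "openin (subtopology X U) V \<longleftrightarrow> openin X V \<and> V \<subseteq> U" for V
    using U by (auto simp: openin_open_subtopology)
  obtain \<phi> where \<phi>: "\<And>V. openin X V \<Longrightarrow> V \<subseteq> U \<Longrightarrow>
      bij_betw (\<phi> V) (carrier (free2_module (sections S V))) (carrier (sections F V)) \<and>
      (\<forall>x\<in>carrier (free2_module (sections S V)). \<forall>y\<in>carrier (free2_module (sections S V)).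
         \<phi> V (x \<oplus>\<^bsub>free2_module (sections S V)\<^esub> y) = \<phi> V x \<oplus>\<^bsub>sections F V\<^esub> \<phi> V y) \<and>
      (\<forall>r\<in>carrier (sections S V). \<forall>x\<in>carrier (free2_module (sections S V)).
         \<phi> V (r \<odot>\<^bsub>free2_module (sections S V)\<^esub> x) = r \<odot>\<^bsub>sections F V\<^esub> \<phi> V x)"
    and \<phi>_restr: "\<And>V. openin X V \<Longrightarrow> V \<subseteq> U \<Longrightarrow> \<forall>x\<in>carrier (free2_module (sections S U)).
      restr F U V (\<phi> U x) = \<phi> V (restr (free2_sheaf S) U V x)"
  proof -
    obtain \<phi> where 1: "\<forall>V. openin X V \<and> V \<subseteq> U \<longrightarrow>
        bij_betw (\<phi> V) (carrier (sections (free2_sheaf S) V)) (carrier (sections F V)) \<and>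
        (\<forall>x\<in>carrier (sections (free2_sheaf S) V). \<forall>y\<in>carrier (sections (free2_sheaf S) V).
           \<phi> V (x \<oplus>\<^bsub>sections (free2_sheaf S) V\<^esub> y) = \<phi> V x \<oplus>\<^bsub>sections F V\<^esub> \<phi> V y) \<and>
        (\<forall>r\<in>carrier (sections S V). \<forall>x\<in>carrier (sections (free2_sheaf S) V).
           \<phi> V (r \<odot>\<^bsub>sections (free2_sheaf S) V\<^esub> x) = r \<odot>\<^bsub>sections F V\<^esub> \<phi> V x)"
      and 2: "\<forall>V W. (openin X V \<and> V \<subseteq> U) \<and> (openin X W \<and> W \<subseteq> U) \<and> W \<subseteq> V \<longrightarrow>
        (\<forall>x\<in>carrier (sections (free2_sheaf S) V). restr F V W (\<phi> V x) = \<phi> W (restr (free2_sheaf S) V W x))"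
      using free unfolding free2_on_def module_sheaf_iso_def open_sub
      by (elim exE conjE) (rule that, assumption+)
    show thesis
      by (rule that[of \<phi>]) (use 1 2 U in \<open>simp_all add: free2_sheaf_def\<close>)
  qed
  have bij: "bij_betw (\<phi> V) (carrier (sections S V) \<times> carrier (sections S V)) (carrier (sections F V))"
    if "openin X V" "V \<subseteq> U" for V
    using \<phi>[OF that] by (simp add: free2_module_def)
  have add: "\<phi> V (p \<oplus>\<^bsub>sections S V\<^esub> p', q \<oplus>\<^bsub>sections S V\<^esub> q') = \<phi> V (p, q) \<oplus>\<^bsub>sections F V\<^esub> \<phi> V (p', q')"
    if "openin X V" "V \<subseteq> U" "p \<in> carrier (sections S V)" "q \<in> carrier (sections S V)"
      "p' \<in> carrier (sections S V)" "q' \<in> carrier (sections S V)" for V p q p' q'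
    using \<phi>[OF that(1,2)] that(3-) by (simp add: free2_module_def)
  have smult: "\<phi> V (r \<otimes>\<^bsub>sections S V\<^esub> p, r \<otimes>\<^bsub>sections S V\<^esub> q) = r \<odot>\<^bsub>sections F V\<^esub> \<phi> V (p, q)"
    if "openin X V" "V \<subseteq> U" "r \<in> carrier (sections S V)" "p \<in> carrier (sections S V)"
      "q \<in> carrier (sections S V)" for V r p q
    using \<phi>[OF that(1,2)] that(3-) by (simp add: free2_module_def)
  have restr: "restr F U V (\<phi> U (p, q)) = \<phi> V (restr S U V p, restr S U V q)"
    if "openin X V" "V \<subseteq> U" "p \<in> carrier (sections S U)" "q \<in> carrier (sections S U)" for V p q
    using \<phi>_restr[OF that(1,2)] that(3-) by (simp add: free2_module_def free2_sheaf_def)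
  interpret SU: cring "sections S U"
    using ring_sheaf U unfolding ring_sheaf_def by blast
  let ?e1 = "\<phi> U (\<one>\<^bsub>sections S U\<^esub>, \<zero>\<^bsub>sections S U\<^esub>)" and ?e2 = "\<phi> U (\<zero>\<^bsub>sections S U\<^esub>, \<one>\<^bsub>sections S U\<^esub>)"
  have "sheaf_basis2 X S F U ?e1 ?e2"
    unfolding sheaf_basis2_def
  proof (intro conjI allI impI)
    show e: "?e1 \<in> carrier (sections F U)" "?e2 \<in> carrier (sections F U)"
      using bij_betw_apply[OF bij[OF U]] by auto
    fix V assume V: "openin X V \<and> V \<subseteq> U"
    interpret SV: cring "sections S V"
      using ring_sheaf V unfolding ring_sheaf_def by blast
    have hom: "restr S U V \<one>\<^bsub>sections S U\<^esub> = \<one>\<^bsub>sections S V\<^esub>" "restr S U V \<zero>\<^bsub>sections S U\<^esub> = \<zero>\<^bsub>sections S V\<^esub>"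
      using ring_hom_one[OF S_restr_hom] ring_hom_zero[OF S_restr_hom] U V SU.ring_axioms SV.ring_axioms by auto
    have eV: "restr F U V ?e1 = \<phi> V (\<one>\<^bsub>sections S V\<^esub>, \<zero>\<^bsub>sections S V\<^esub>)"
        "restr F U V ?e2 = \<phi> V (\<zero>\<^bsub>sections S V\<^esub>, \<one>\<^bsub>sections S V\<^esub>)"
      using restr V hom by simp_all
    have comb: "\<phi> V (x, y) = x \<odot>\<^bsub>sections F V\<^esub> restr F U V ?e1 \<oplus>\<^bsub>sections F V\<^esub> y \<odot>\<^bsub>sections F V\<^esub> restr F U V ?e2"
      if xy: "x \<in> carrier (sections S V)" "y \<in> carrier (sections S V)" for x y
    proof -
      have "x \<odot>\<^bsub>sections F V\<^esub> restr F U V ?e1 = \<phi> V (x, \<zero>\<^bsub>sections S V\<^esub>)"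
        "y \<odot>\<^bsub>sections F V\<^esub> restr F U V ?e2 = \<phi> V (\<zero>\<^bsub>sections S V\<^esub>, y)"
        using smult[of V x "\<one>\<^bsub>sections S V\<^esub>" "\<zero>\<^bsub>sections S V\<^esub>"] smult[of V y "\<zero>\<^bsub>sections S V\<^esub>" "\<one>\<^bsub>sections S V\<^esub>"]
          V xy unfolding eV by simp_all
      then show ?thesis
        using add[of V x "\<zero>\<^bsub>sections S V\<^esub>" "\<zero>\<^bsub>sections S V\<^esub>" y] V xy by simp
    qed
    have "bij_betw (\<lambda>(x, y). x \<odot>\<^bsub>sections F V\<^esub> restr F U V ?e1 \<oplus>\<^bsub>sections F V\<^esub> y \<odot>\<^bsub>sections F V\<^esub> restr F U V ?e2)
        (carrier (sections S V) \<times> carrier (sections S V)) (carrier (sections F V))"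
      using bij[of V] V by (subst bij_betw_cong[where g = "\<phi> V"]) (auto simp: comb)
    moreover have "restr F U V ?e1 \<in> carrier (sections F V)" "restr F U V ?e2 \<in> carrier (sections F V)"
      using restr_closed U V e by blast+
    ultimately show "basis2 (sections S V) (sections F V) (restr F U V ?e1) (restr F U V ?e2)"
      unfolding basis2_def by blast
  qed
  then show thesis by (rule that)
qed

text \<open>Over \<open>U\<close> the two bases differ by an invertible matrix, and the equations
  saying so restrict to every smaller open set. Thus freeness of the sheaf, witnessed by
  \<open>f\<close>, upgrades a basis over \<open>U\<close> alone to a basis of the sheaf.\<close>

lemma basis2_sheaf_basis2:
  assumes U: "openin X U" and f: "sheaf_basis2 X S F U f\<^sub>1 f\<^sub>2"
    and e: "basis2 (sections S U) (sections F U) e\<^sub>1 e\<^sub>2"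
  shows "sheaf_basis2 X S F U e\<^sub>1 e\<^sub>2"
proof -
  interpret M: Module.module "sections S U" "sections F U" by (rule module[OF U])
  have fU: "basis2 (sections S U) (sections F U) f\<^sub>1 f\<^sub>2"
    by (rule sheaf_basis2_basis2[OF presheaf_on_axioms f U])
  have fc: "f\<^sub>1 \<in> carrier (sections F U)" "f\<^sub>2 \<in> carrier (sections F U)"
    using basis2_closed[OF fU] by auto
  have ec: "e\<^sub>1 \<in> carrier (sections F U)" "e\<^sub>2 \<in> carrier (sections F U)"
    using basis2_closed[OF e] by auto
  from M.basis2_transition[OF fU e] obtain a b c d a' b' c' d' where
    cl: "{a, b, c, d, a', b', c', d'} \<subseteq> carrier (sections S U)"
    and eqs: "e\<^sub>1 = a \<odot>\<^bsub>sections F U\<^esub> f\<^sub>1 \<oplus>\<^bsub>sections F U\<^esub> b \<odot>\<^bsub>sections F U\<^esub> f\<^sub>2"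
    "e\<^sub>2 = c \<odot>\<^bsub>sections F U\<^esub> f\<^sub>1 \<oplus>\<^bsub>sections F U\<^esub> d \<odot>\<^bsub>sections F U\<^esub> f\<^sub>2"
    "f\<^sub>1 = a' \<odot>\<^bsub>sections F U\<^esub> e\<^sub>1 \<oplus>\<^bsub>sections F U\<^esub> b' \<odot>\<^bsub>sections F U\<^esub> e\<^sub>2"
    "f\<^sub>2 = c' \<odot>\<^bsub>sections F U\<^esub> e\<^sub>1 \<oplus>\<^bsub>sections F U\<^esub> d' \<odot>\<^bsub>sections F U\<^esub> e\<^sub>2"
    and inv: "a \<otimes>\<^bsub>sections S U\<^esub> a' \<oplus>\<^bsub>sections S U\<^esub> b \<otimes>\<^bsub>sections S U\<^esub> c' = \<one>\<^bsub>sections S U\<^esub>"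
    "a \<otimes>\<^bsub>sections S U\<^esub> b' \<oplus>\<^bsub>sections S U\<^esub> b \<otimes>\<^bsub>sections S U\<^esub> d' = \<zero>\<^bsub>sections S U\<^esub>"
    "c \<otimes>\<^bsub>sections S U\<^esub> a' \<oplus>\<^bsub>sections S U\<^esub> d \<otimes>\<^bsub>sections S U\<^esub> c' = \<zero>\<^bsub>sections S U\<^esub>"
    "c \<otimes>\<^bsub>sections S U\<^esub> b' \<oplus>\<^bsub>sections S U\<^esub> d \<otimes>\<^bsub>sections S U\<^esub> d' = \<one>\<^bsub>sections S U\<^esub>"
    by metis
  have "basis2 (sections S V) (sections F V) (restr F U V e\<^sub>1) (restr F U V e\<^sub>2)"
    if V: "openin X V" "V \<subseteq> U" for V
  proof -
    interpret V: Module.module "sections S V" "sections F V" by (rule module[OF V(1)])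
    have hom: "restr S U V \<in> ring_hom (sections S U) (sections S V)"
      by (rule S_restr_hom[OF U V])
    have hom_inv: "restr S U V (x \<otimes>\<^bsub>sections S U\<^esub> y \<oplus>\<^bsub>sections S U\<^esub> z \<otimes>\<^bsub>sections S U\<^esub> w) =
        restr S U V x \<otimes>\<^bsub>sections S V\<^esub> restr S U V y \<oplus>\<^bsub>sections S V\<^esub> restr S U V z \<otimes>\<^bsub>sections S V\<^esub> restr S U V w"
      if "x \<in> carrier (sections S U)" "y \<in> carrier (sections S U)" "z \<in> carrier (sections S U)" "w \<in> carrier (sections S U)" for x y z w
      using that by (simp add: ring_hom_add[OF hom] ring_hom_mult[OF hom])
    show ?thesis
    proof (rule V.basis2_change[where a = "restr S U V a" and b = "restr S U V b" and c = "restr S U V c"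
          and d = "restr S U V d" and a' = "restr S U V a'" and b' = "restr S U V b'" and c' = "restr S U V c'"
          and d' = "restr S U V d'" and f\<^sub>1 = "restr F U V f\<^sub>1" and f\<^sub>2 = "restr F U V f\<^sub>2"])
      show "basis2 (sections S V) (sections F V) (restr F U V f\<^sub>1) (restr F U V f\<^sub>2)"
        using f V unfolding sheaf_basis2_def by blast
      show "{restr S U V a, restr S U V b, restr S U V c, restr S U V d, restr S U V a', restr S U V b',
          restr S U V c', restr S U V d'} \<subseteq> carrier (sections S V)"
        using cl S_restr_closed[OF U V] by auto
      show "restr F U V e\<^sub>1 = restr S U V a \<odot>\<^bsub>sections F V\<^esub> restr F U V f\<^sub>1 \<oplus>\<^bsub>sections F V\<^esub> restr S U V b \<odot>\<^bsub>sections F V\<^esub> restr F U V f\<^sub>2"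
        unfolding eqs(1) by (rule restr_comb[OF U V fc]) (use cl in auto)
      show "restr F U V e\<^sub>2 = restr S U V c \<odot>\<^bsub>sections F V\<^esub> restr F U V f\<^sub>1 \<oplus>\<^bsub>sections F V\<^esub> restr S U V d \<odot>\<^bsub>sections F V\<^esub> restr F U V f\<^sub>2"
        unfolding eqs(2) by (rule restr_comb[OF U V fc]) (use cl in auto)
      show "restr F U V f\<^sub>1 = restr S U V a' \<odot>\<^bsub>sections F V\<^esub> restr F U V e\<^sub>1 \<oplus>\<^bsub>sections F V\<^esub> restr S U V b' \<odot>\<^bsub>sections F V\<^esub> restr F U V e\<^sub>2"
        by (subst eqs(3), rule restr_comb[OF U V ec]) (use cl in auto)
      show "restr F U V f\<^sub>2 = restr S U V c' \<odot>\<^bsub>sections F V\<^esub> restr F U V e\<^sub>1 \<oplus>\<^bsub>sections F V\<^esub> restr S U V d' \<odot>\<^bsub>sections F V\<^esub> restr F U V e\<^sub>2"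
        by (subst eqs(4), rule restr_comb[OF U V ec]) (use cl in auto)
    qed (use inv[THEN arg_cong[where f = "restr S U V"]] cl ring_hom_one[OF hom]
        ring_hom_zero[OF hom M.R.ring_axioms V.R.ring_axioms] in \<open>simp_all add: hom_inv\<close>)
  qed
  then show ?thesis
    using ec unfolding sheaf_basis2_def by blast
qed

end

section \<open>Characteristic polynomials\<close>

text \<open>
  Rewriting with associativity and commutativity does not cancel opposite summands that are not
  adjacent; these rules do.
\<close>

lemma (in abelian_group) cancel_opposite:
  assumes "x \<in> carrier G" "y \<in> carrier G" "z \<in> carrier G" "u \<in> carrier G" "v \<in> carrier G"
  shows "x \<oplus> (y \<oplus> \<ominus> x) = y" "x \<oplus> (y \<oplus> (\<ominus> x \<oplus> v)) = y \<oplus> v"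
    "x \<oplus> (y \<oplus> (z \<oplus> \<ominus> x)) = y \<oplus> z" "x \<oplus> (y \<oplus> (z \<oplus> (\<ominus> x \<oplus> v))) = y \<oplus> (z \<oplus> v)"
    "x \<oplus> (y \<oplus> (z \<oplus> (u \<oplus> \<ominus> x))) = y \<oplus> (z \<oplus> u)"
    "x \<oplus> (y \<oplus> (z \<oplus> (u \<oplus> (\<ominus> x \<oplus> v)))) = y \<oplus> (z \<oplus> (u \<oplus> v))"
    "\<ominus> x \<oplus> (y \<oplus> x) = y" "\<ominus> x \<oplus> (y \<oplus> (x \<oplus> v)) = y \<oplus> v"
    "\<ominus> x \<oplus> (y \<oplus> (z \<oplus> x)) = y \<oplus> z" "\<ominus> x \<oplus> (y \<oplus> (z \<oplus> (x \<oplus> v))) = y \<oplus> (z \<oplus> v)"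
    "\<ominus> x \<oplus> (y \<oplus> (z \<oplus> (u \<oplus> x))) = y \<oplus> (z \<oplus> u)"
    "\<ominus> x \<oplus> (y \<oplus> (z \<oplus> (u \<oplus> (x \<oplus> v)))) = y \<oplus> (z \<oplus> (u \<oplus> v))"
proof -
  have "a \<oplus> (b \<oplus> (\<ominus> a \<oplus> c)) = b \<oplus> c" "\<ominus> a \<oplus> (b \<oplus> (a \<oplus> c)) = b \<oplus> c"
    if "a \<in> carrier G" "b \<in> carrier G" "c \<in> carrier G" for a b c
  proof -
    have "a \<oplus> (b \<oplus> (\<ominus> a \<oplus> c)) = (a \<oplus> \<ominus> a) \<oplus> (b \<oplus> c)"
      using that by (simp only: a_ac a_closed a_inv_closed)
    then show "a \<oplus> (b \<oplus> (\<ominus> a \<oplus> c)) = b \<oplus> c"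
      using that by (simp add: r_neg)
    have "\<ominus> a \<oplus> (b \<oplus> (a \<oplus> c)) = (a \<oplus> \<ominus> a) \<oplus> (b \<oplus> c)"
      using that by (simp only: a_ac a_closed a_inv_closed)
    then show "\<ominus> a \<oplus> (b \<oplus> (a \<oplus> c)) = b \<oplus> c"
      using that by (simp add: r_neg)
  qed
  note cancel = this
  have shift: "y \<oplus> (z \<oplus> w) = (y \<oplus> z) \<oplus> w" "y \<oplus> (z \<oplus> (u \<oplus> w)) = (y \<oplus> (z \<oplus> u)) \<oplus> w"
    if "w \<in> carrier G" for w
    using assms that by (simp_all add: a_assoc)
  show "x \<oplus> (y \<oplus> \<ominus> x) = y" "\<ominus> x \<oplus> (y \<oplus> x) = y"
    using cancel[of x y "\<zero>"] assms by simp_all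
  show "x \<oplus> (y \<oplus> (\<ominus> x \<oplus> v)) = y \<oplus> v" "\<ominus> x \<oplus> (y \<oplus> (x \<oplus> v)) = y \<oplus> v"
    using cancel assms by simp_all
  show "x \<oplus> (y \<oplus> (z \<oplus> \<ominus> x)) = y \<oplus> z" "\<ominus> x \<oplus> (y \<oplus> (z \<oplus> x)) = y \<oplus> z"
    using cancel[of x "y \<oplus> z" "\<zero>"] assms by (simp_all add: a_assoc)
  show "x \<oplus> (y \<oplus> (z \<oplus> (\<ominus> x \<oplus> v))) = y \<oplus> (z \<oplus> v)" "\<ominus> x \<oplus> (y \<oplus> (z \<oplus> (x \<oplus> v))) = y \<oplus> (z \<oplus> v)"
    using cancel[of x "y \<oplus> z" v] assms by (simp_all add: a_assoc)
  show "x \<oplus> (y \<oplus> (z \<oplus> (u \<oplus> \<ominus> x))) = y \<oplus> (z \<oplus> u)" "\<ominus> x \<oplus> (y \<oplus> (z \<oplus> (u \<oplus> x))) = y \<oplus> (z \<oplus> u)"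
    using cancel[of x "y \<oplus> (z \<oplus> u)" "\<zero>"] assms by (simp_all add: a_assoc)
  show "x \<oplus> (y \<oplus> (z \<oplus> (u \<oplus> (\<ominus> x \<oplus> v)))) = y \<oplus> (z \<oplus> (u \<oplus> v))"
      "\<ominus> x \<oplus> (y \<oplus> (z \<oplus> (u \<oplus> (x \<oplus> v)))) = y \<oplus> (z \<oplus> (u \<oplus> v))"
    using cancel[of x "y \<oplus> (z \<oplus> u)" v] assms by (simp_all add: a_assoc)
qed

context cring
begin

lemmas expand_simps = l_distr r_distr l_minus r_minus m_ac a_minus_def minus_add add.m_ac
  r_neg1 r_neg2 l_neg r_neg cancel_opposite

text \<open>Multiplicativity of the determinant, for the matrix with rows (a, b), (c, d) times the
  matrix with columns (p, q), (r, s).\<close>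

lemma det_mult:
  assumes "a \<in> carrier R" "b \<in> carrier R" "c \<in> carrier R" "d \<in> carrier R"
    and "p \<in> carrier R" "q \<in> carrier R" "r \<in> carrier R" "s \<in> carrier R"
  shows "(a \<otimes> p \<oplus> b \<otimes> q) \<otimes> (c \<otimes> r \<oplus> d \<otimes> s) \<ominus> (a \<otimes> r \<oplus> b \<otimes> s) \<otimes> (c \<otimes> p \<oplus> d \<otimes> q) =
    (a \<otimes> d \<ominus> b \<otimes> c) \<otimes> (p \<otimes> s \<ominus> q \<otimes> r)"
  using assms by (simp add: expand_simps)

text \<open>
  With \<open>G = (a, b; c, d)\<close>, \<open>H = (a', b'; c', d')\<close>, \<open>A = (p, r; q, s)\<close> and \<open>A' = (p', r'; q', s')\<close>
  the assumptions say that \<open>G H = H G = 1\<close> and \<open>G A = A' G\<close>.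
\<close>

lemma similar_matrices_trace_det:
  assumes c: "{a, b, c, d, a', b', c', d', p, q, r, s, p', q', r', s'} \<subseteq> carrier R"
    and GH: "a \<otimes> a' \<oplus> b \<otimes> c' = \<one>" "a \<otimes> b' \<oplus> b \<otimes> d' = \<zero>" "c \<otimes> a' \<oplus> d \<otimes> c' = \<zero>" "c \<otimes> b' \<oplus> d \<otimes> d' = \<one>"
    and HG: "a' \<otimes> a \<oplus> b' \<otimes> c = \<one>" "a' \<otimes> b \<oplus> b' \<otimes> d = \<zero>" "c' \<otimes> a \<oplus> d' \<otimes> c = \<zero>" "c' \<otimes> b \<oplus> d' \<otimes> d = \<one>"
    and eqs: "a \<otimes> p \<oplus> b \<otimes> q = p' \<otimes> a \<oplus> r' \<otimes> c" "a \<otimes> r \<oplus> b \<otimes> s = p' \<otimes> b \<oplus> r' \<otimes> d"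
      "c \<otimes> p \<oplus> d \<otimes> q = q' \<otimes> a \<oplus> s' \<otimes> c" "c \<otimes> r \<oplus> d \<otimes> s = q' \<otimes> b \<oplus> s' \<otimes> d"
  shows "p \<oplus> s = p' \<oplus> s'" "p \<otimes> s \<ominus> q \<otimes> r = p' \<otimes> s' \<ominus> q' \<otimes> r'"
proof -
  have cl: "a \<in> carrier R" "b \<in> carrier R" "c \<in> carrier R" "d \<in> carrier R"
      "a' \<in> carrier R" "b' \<in> carrier R" "c' \<in> carrier R" "d' \<in> carrier R"
      "p \<in> carrier R" "q \<in> carrier R" "r \<in> carrier R" "s \<in> carrier R"
      "p' \<in> carrier R" "q' \<in> carrier R" "r' \<in> carrier R" "s' \<in> carrier R"
    using c by auto
  \<comment> \<open>Since A' = G A H, the diagonal entries of A' are obtained by multiplying the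
    rows of G A with the columns of H.\<close>
  have "(a \<otimes> p \<oplus> b \<otimes> q) \<otimes> a' \<oplus> (a \<otimes> r \<oplus> b \<otimes> s) \<otimes> c' = p' \<otimes> (a \<otimes> a' \<oplus> b \<otimes> c') \<oplus> r' \<otimes> (c \<otimes> a' \<oplus> d \<otimes> c')"
    unfolding eqs using cl by (simp add: l_distr r_distr m_ac add.m_ac)
  then have p': "p' = (a \<otimes> p \<oplus> b \<otimes> q) \<otimes> a' \<oplus> (a \<otimes> r \<oplus> b \<otimes> s) \<otimes> c'"
    unfolding GH using cl by simp
  have "(c \<otimes> p \<oplus> d \<otimes> q) \<otimes> b' \<oplus> (c \<otimes> r \<oplus> d \<otimes> s) \<otimes> d' = q' \<otimes> (a \<otimes> b' \<oplus> b \<otimes> d') \<oplus> s' \<otimes> (c \<otimes> b' \<oplus> d \<otimes> d')"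
    unfolding eqs using cl by (simp add: l_distr r_distr m_ac add.m_ac)
  then have s': "s' = (c \<otimes> p \<oplus> d \<otimes> q) \<otimes> b' \<oplus> (c \<otimes> r \<oplus> d \<otimes> s) \<otimes> d'"
    unfolding GH using cl by simp
  \<comment> \<open>Cyclicity of the trace: the trace of G A H is that of A H G, and H G =
    1.\<close>
  have "p' \<oplus> s' = p \<otimes> (a' \<otimes> a \<oplus> b' \<otimes> c) \<oplus> q \<otimes> (a' \<otimes> b \<oplus> b' \<otimes> d) \<oplus>
      (r \<otimes> (c' \<otimes> a \<oplus> d' \<otimes> c) \<oplus> s \<otimes> (c' \<otimes> b \<oplus> d' \<otimes> d))"
    unfolding p' s' using cl by (simp add: l_distr r_distr m_ac add.m_ac)
  then show "p \<oplus> s = p' \<oplus> s'"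
    unfolding HG using cl by simp
  \<comment> \<open>The determinants of G and H. Taking determinants in G A = A' G leaves the factor
    det G on both sides, which det H cancels.\<close>
  let ?\<Delta> = "a \<otimes> d \<ominus> b \<otimes> c" and ?\<Delta>' = "a' \<otimes> d' \<ominus> c' \<otimes> b'"
  have unit: "?\<Delta>' \<otimes> ?\<Delta> = \<one>"
    using det_mult[of a b c d a' c' b' d'] cl unfolding GH by (simp add: m_comm a_minus_def)
  have "?\<Delta> \<otimes> (p \<otimes> s \<ominus> q \<otimes> r) = (p' \<otimes> s' \<ominus> r' \<otimes> q') \<otimes> ?\<Delta>"
    using det_mult[of a b c d p q r s] det_mult[of p' r' q' s' a c b d] cl
    unfolding eqs by (simp add: m_ac)
  also have "\<dots> = ?\<Delta> \<otimes> (p' \<otimes> s' \<ominus> q' \<otimes> r')"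
    using cl by (simp add: m_comm)
  finally have "?\<Delta>' \<otimes> (?\<Delta> \<otimes> (p \<otimes> s \<ominus> q \<otimes> r)) = ?\<Delta>' \<otimes> (?\<Delta> \<otimes> (p' \<otimes> s' \<ominus> q' \<otimes> r'))"
    by simp
  then have "(?\<Delta>' \<otimes> ?\<Delta>) \<otimes> (p \<otimes> s \<ominus> q \<otimes> r) = (?\<Delta>' \<otimes> ?\<Delta>) \<otimes> (p' \<otimes> s' \<ominus> q' \<otimes> r')"
    using cl by (simp add: m_assoc)
  then show "p \<otimes> s \<ominus> q \<otimes> r = p' \<otimes> s' \<ominus> q' \<otimes> r'"
    unfolding unit using cl by simp
qed

end

text \<open>Expressing the images of the new basis through the old one in two ways gives G A = A' G
  for the transition matrix G, so the two matrices of \<open>f\<close> have the same trace and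
  determinant.\<close>

lemma (in Module.module) char_poly_basis_independent:
  assumes e: "basis2 R M e\<^sub>1 e\<^sub>2" and e': "basis2 R M e\<^sub>1' e\<^sub>2'"
    and lin: "\<And>x y m n. x \<in> carrier R \<Longrightarrow> y \<in> carrier R \<Longrightarrow> m \<in> carrier M \<Longrightarrow> n \<in> carrier M \<Longrightarrow>
      f (x \<odot>\<^bsub>M\<^esub> m \<oplus>\<^bsub>M\<^esub> y \<odot>\<^bsub>M\<^esub> n) = x \<odot>\<^bsub>M\<^esub> f m \<oplus>\<^bsub>M\<^esub> y \<odot>\<^bsub>M\<^esub> f n"
    and c: "{p, q, r, s} \<subseteq> carrier R" and c': "{p', q', r', s'} \<subseteq> carrier R"
    and fe: "f e\<^sub>1 = p \<odot>\<^bsub>M\<^esub> e\<^sub>1 \<oplus>\<^bsub>M\<^esub> r \<odot>\<^bsub>M\<^esub> e\<^sub>2" "f e\<^sub>2 = q \<odot>\<^bsub>M\<^esub> e\<^sub>1 \<oplus>\<^bsub>M\<^esub> s \<odot>\<^bsub>M\<^esub> e\<^sub>2"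
    and fe': "f e\<^sub>1' = p' \<odot>\<^bsub>M\<^esub> e\<^sub>1' \<oplus>\<^bsub>M\<^esub> r' \<odot>\<^bsub>M\<^esub> e\<^sub>2'" "f e\<^sub>2' = q' \<odot>\<^bsub>M\<^esub> e\<^sub>1' \<oplus>\<^bsub>M\<^esub> s' \<odot>\<^bsub>M\<^esub> e\<^sub>2'"
  shows "char_poly_matrix2 R p q r s = char_poly_matrix2 R p' q' r' s'"
proof -
  have ec: "e\<^sub>1 \<in> carrier M" "e\<^sub>2 \<in> carrier M" using basis2_closed[OF e] by auto
  from basis2_transition[OF e e'] obtain a b c d a' b' c' d' where
    cl: "{a, b, c, d, a', b', c', d'} \<subseteq> carrier R"
    and ee: "e\<^sub>1' = a \<odot>\<^bsub>M\<^esub> e\<^sub>1 \<oplus>\<^bsub>M\<^esub> b \<odot>\<^bsub>M\<^esub> e\<^sub>2" "e\<^sub>2' = c \<odot>\<^bsub>M\<^esub> e\<^sub>1 \<oplus>\<^bsub>M\<^esub> d \<odot>\<^bsub>M\<^esub> e\<^sub>2"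
    and GH: "a \<otimes> a' \<oplus> b \<otimes> c' = \<one>" "a \<otimes> b' \<oplus> b \<otimes> d' = \<zero>" "c \<otimes> a' \<oplus> d \<otimes> c' = \<zero>" "c \<otimes> b' \<oplus> d \<otimes> d' = \<one>"
    and HG: "a' \<otimes> a \<oplus> b' \<otimes> c = \<one>" "a' \<otimes> b \<oplus> b' \<otimes> d = \<zero>" "c' \<otimes> a \<oplus> d' \<otimes> c = \<zero>" "c' \<otimes> b \<oplus> d' \<otimes> d = \<one>"
    by metis
  have 1: "(a \<otimes> p \<oplus> b \<otimes> q) \<odot>\<^bsub>M\<^esub> e\<^sub>1 \<oplus>\<^bsub>M\<^esub> (a \<otimes> r \<oplus> b \<otimes> s) \<odot>\<^bsub>M\<^esub> e\<^sub>2 =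
      (p' \<otimes> a \<oplus> r' \<otimes> c) \<odot>\<^bsub>M\<^esub> e\<^sub>1 \<oplus>\<^bsub>M\<^esub> (p' \<otimes> b \<oplus> r' \<otimes> d) \<odot>\<^bsub>M\<^esub> e\<^sub>2"
  proof -
    have "(a \<otimes> p \<oplus> b \<otimes> q) \<odot>\<^bsub>M\<^esub> e\<^sub>1 \<oplus>\<^bsub>M\<^esub> (a \<otimes> r \<oplus> b \<otimes> s) \<odot>\<^bsub>M\<^esub> e\<^sub>2 = a \<odot>\<^bsub>M\<^esub> f e\<^sub>1 \<oplus>\<^bsub>M\<^esub> b \<odot>\<^bsub>M\<^esub> f e\<^sub>2"
      unfolding fe by (rule combine[OF ec, symmetric]) (use c cl in auto)
    also have "\<dots> = f e\<^sub>1'" unfolding ee by (rule lin[symmetric]) (use cl ec in auto)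
    also have "\<dots> = (p' \<otimes> a \<oplus> r' \<otimes> c) \<odot>\<^bsub>M\<^esub> e\<^sub>1 \<oplus>\<^bsub>M\<^esub> (p' \<otimes> b \<oplus> r' \<otimes> d) \<odot>\<^bsub>M\<^esub> e\<^sub>2"
      unfolding fe' unfolding ee by (rule combine[OF ec]) (use c' cl in auto)
    finally show ?thesis .
  qed
  have 2: "(c \<otimes> p \<oplus> d \<otimes> q) \<odot>\<^bsub>M\<^esub> e\<^sub>1 \<oplus>\<^bsub>M\<^esub> (c \<otimes> r \<oplus> d \<otimes> s) \<odot>\<^bsub>M\<^esub> e\<^sub>2 =
      (q' \<otimes> a \<oplus> s' \<otimes> c) \<odot>\<^bsub>M\<^esub> e\<^sub>1 \<oplus>\<^bsub>M\<^esub> (q' \<otimes> b \<oplus> s' \<otimes> d) \<odot>\<^bsub>M\<^esub> e\<^sub>2"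
  proof -
    have "(c \<otimes> p \<oplus> d \<otimes> q) \<odot>\<^bsub>M\<^esub> e\<^sub>1 \<oplus>\<^bsub>M\<^esub> (c \<otimes> r \<oplus> d \<otimes> s) \<odot>\<^bsub>M\<^esub> e\<^sub>2 = c \<odot>\<^bsub>M\<^esub> f e\<^sub>1 \<oplus>\<^bsub>M\<^esub> d \<odot>\<^bsub>M\<^esub> f e\<^sub>2"
      unfolding fe by (rule combine[OF ec, symmetric]) (use c cl in auto)
    also have "\<dots> = f e\<^sub>2'" unfolding ee by (rule lin[symmetric]) (use cl ec in auto)
    also have "\<dots> = (q' \<otimes> a \<oplus> s' \<otimes> c) \<odot>\<^bsub>M\<^esub> e\<^sub>1 \<oplus>\<^bsub>M\<^esub> (q' \<otimes> b \<oplus> s' \<otimes> d) \<odot>\<^bsub>M\<^esub> e\<^sub>2"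
      unfolding fe' unfolding ee by (rule combine[OF ec]) (use c' cl in auto)
    finally show ?thesis .
  qed
  have eqs: "a \<otimes> p \<oplus> b \<otimes> q = p' \<otimes> a \<oplus> r' \<otimes> c" "a \<otimes> r \<oplus> b \<otimes> s = p' \<otimes> b \<oplus> r' \<otimes> d"
      "c \<otimes> p \<oplus> d \<otimes> q = q' \<otimes> a \<oplus> s' \<otimes> c" "c \<otimes> r \<oplus> d \<otimes> s = q' \<otimes> b \<oplus> s' \<otimes> d"
    using basis2_unique[OF e _ _ _ _ 1] basis2_unique[OF e _ _ _ _ 2] c c' cl by simp_all
  show ?thesis
    unfolding char_poly_matrix2_def
    using R.similar_matrices_trace_det[OF _ GH HG eqs] c c' cl by simp
qed

lemma ring_hom_minus:
  assumes "f \<in> ring_hom R S" "ring R" "ring S" "x \<in> carrier R"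
  shows "f (\<ominus>\<^bsub>R\<^esub> x) = \<ominus>\<^bsub>S\<^esub> f x"
proof -
  interpret R: ring R by fact
  interpret S: ring S by fact
  have "f (\<ominus>\<^bsub>R\<^esub> x) \<oplus>\<^bsub>S\<^esub> f x = \<zero>\<^bsub>S\<^esub>"
    using ring_hom_add[OF assms(1), of "\<ominus>\<^bsub>R\<^esub> x" x] ring_hom_zero[OF assms(1-3)] assms(4) by (simp add: R.l_neg)
  then show ?thesis
    using ring_hom_closed[OF assms(1)] assms(4) S.minus_equality by (metis R.a_inv_closed)
qed

lemma map_char_poly_matrix2:
  assumes f: "f \<in> ring_hom R S" "cring R" "cring S" and c: "{p, q, r, s} \<subseteq> carrier R"
  shows "map f (char_poly_matrix2 R p q r s) = char_poly_matrix2 S (f p) (f q) (f r) (f s)"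
proof -
  interpret R: cring R by fact
  interpret S: cring S by fact
  note [simp] = ring_hom_add[OF f(1)] ring_hom_mult[OF f(1)] ring_hom_one[OF f(1)]
    ring_hom_minus[OF f(1) R.ring_axioms S.ring_axioms]
  show ?thesis
    using c by (simp add: char_poly_matrix2_def a_minus_def)
qed

text \<open>Resolves the definite description when \<open>U\<close> itself has a basis: the
  polynomial of that basis satisfies the condition on every \<open>V\<close> by basis independence,
  and the instance V = U of the condition leaves no other choice.\<close>

lemma (in module_presheaf) sheaf_char_poly_eq:
  assumes U: "openin X U" and e: "sheaf_basis2 X S F U e\<^sub>1 e\<^sub>2"
    and c: "{p, q, r, s} \<subseteq> carrier (sections S U)"
    and fe: "f U e\<^sub>1 = p \<odot>\<^bsub>sections F U\<^esub> e\<^sub>1 \<oplus>\<^bsub>sections F U\<^esub> r \<odot>\<^bsub>sections F U\<^esub> e\<^sub>2"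
      "f U e\<^sub>2 = q \<odot>\<^bsub>sections F U\<^esub> e\<^sub>1 \<oplus>\<^bsub>sections F U\<^esub> s \<odot>\<^bsub>sections F U\<^esub> e\<^sub>2"
    and lin: "\<And>V x y m n. openin X V \<Longrightarrow> V \<subseteq> U \<Longrightarrow> x \<in> carrier (sections S V) \<Longrightarrow> y \<in> carrier (sections S V) \<Longrightarrow>
      m \<in> carrier (sections F V) \<Longrightarrow> n \<in> carrier (sections F V) \<Longrightarrow>
      f V (x \<odot>\<^bsub>sections F V\<^esub> m \<oplus>\<^bsub>sections F V\<^esub> y \<odot>\<^bsub>sections F V\<^esub> n) = x \<odot>\<^bsub>sections F V\<^esub> f V m \<oplus>\<^bsub>sections F V\<^esub> y \<odot>\<^bsub>sections F V\<^esub> f V n"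
    and nat: "\<And>V m. openin X V \<Longrightarrow> V \<subseteq> U \<Longrightarrow> m \<in> carrier (sections F U) \<Longrightarrow>
      f V (restr F U V m) = restr F U V (f U m)"
  shows "sheaf_char_poly X S F U f = char_poly_matrix2 (sections S U) p q r s"
  unfolding sheaf_char_poly_def
proof (rule the_equality)
  have SU: "cring (sections S U)" if "openin X U" for U
    using ring_sheaf that unfolding ring_sheaf_def by blast
  interpret SU: cring "sections S U" by (rule SU[OF U])
  let ?P = "char_poly_matrix2 (sections S U) p q r s"
  have ec: "e\<^sub>1 \<in> carrier (sections F U)" "e\<^sub>2 \<in> carrier (sections F U)"
    using e unfolding sheaf_basis2_def by auto
  have P: "set ?P \<subseteq> carrier (sections S U)"
    using c by (auto simp: char_poly_matrix2_def)
  show "set ?P \<subseteq> carrier (sections S U) \<and>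
     (\<forall>V e\<^sub>1 e\<^sub>2 p' q' r' s'.
        openin X V \<and> V \<subseteq> U \<and> sheaf_basis2 X S F V e\<^sub>1 e\<^sub>2 \<and> {p', q', r', s'} \<subseteq> carrier (sections S V) \<and>
        f V e\<^sub>1 = p' \<odot>\<^bsub>sections F V\<^esub> e\<^sub>1 \<oplus>\<^bsub>sections F V\<^esub> r' \<odot>\<^bsub>sections F V\<^esub> e\<^sub>2 \<and>
        f V e\<^sub>2 = q' \<odot>\<^bsub>sections F V\<^esub> e\<^sub>1 \<oplus>\<^bsub>sections F V\<^esub> s' \<odot>\<^bsub>sections F V\<^esub> e\<^sub>2 \<longrightarrow>
        map (restr S U V) ?P = char_poly_matrix2 (sections S V) p' q' r' s')"
  proof (intro conjI[OF P] allI impI, elim conjE)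
    fix V e\<^sub>1' e\<^sub>2' p' q' r' s'
    assume V: "openin X V" "V \<subseteq> U" and e': "sheaf_basis2 X S F V e\<^sub>1' e\<^sub>2'"
      and c': "{p', q', r', s'} \<subseteq> carrier (sections S V)"
      and fe': "f V e\<^sub>1' = p' \<odot>\<^bsub>sections F V\<^esub> e\<^sub>1' \<oplus>\<^bsub>sections F V\<^esub> r' \<odot>\<^bsub>sections F V\<^esub> e\<^sub>2'"
        "f V e\<^sub>2' = q' \<odot>\<^bsub>sections F V\<^esub> e\<^sub>1' \<oplus>\<^bsub>sections F V\<^esub> s' \<odot>\<^bsub>sections F V\<^esub> e\<^sub>2'"
    interpret V: Module.module "sections S V" "sections F V" by (rule module[OF V(1)])
    have cV: "{restr S U V p, restr S U V q, restr S U V r, restr S U V s} \<subseteq> carrier (sections S V)"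
      using c S_restr_closed[OF U V] by auto
    have "char_poly_matrix2 (sections S V) (restr S U V p) (restr S U V q) (restr S U V r) (restr S U V s) =
        char_poly_matrix2 (sections S V) p' q' r' s'"
    proof (rule V.char_poly_basis_independent[OF _ _ _ cV c' _ _ fe'])
      show "basis2 (sections S V) (sections F V) (restr F U V e\<^sub>1) (restr F U V e\<^sub>2)"
        using e V unfolding sheaf_basis2_def by blast
      show "basis2 (sections S V) (sections F V) e\<^sub>1' e\<^sub>2'"
        by (rule sheaf_basis2_basis2[OF presheaf_on_axioms e' V(1)])
      show "f V (restr F U V e\<^sub>1) = restr S U V p \<odot>\<^bsub>sections F V\<^esub> restr F U V e\<^sub>1 \<oplus>\<^bsub>sections F V\<^esub> restr S U V r \<odot>\<^bsub>sections F V\<^esub> restr F U V e\<^sub>2"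
        unfolding nat[OF V ec(1)] fe by (rule restr_comb[OF U V ec]) (use c in auto)
      show "f V (restr F U V e\<^sub>2) = restr S U V q \<odot>\<^bsub>sections F V\<^esub> restr F U V e\<^sub>1 \<oplus>\<^bsub>sections F V\<^esub> restr S U V s \<odot>\<^bsub>sections F V\<^esub> restr F U V e\<^sub>2"
        unfolding nat[OF V ec(2)] fe by (rule restr_comb[OF U V ec]) (use c in auto)
    qed (rule lin[OF V])
    then show "map (restr S U V) ?P = char_poly_matrix2 (sections S V) p' q' r' s'"
      unfolding map_char_poly_matrix2[OF S_restr_hom[OF U V] SU.is_cring V.R.is_cring c] .
  qed
next
  let ?P = "char_poly_matrix2 (sections S U) p q r s"
  fix P' assume P': "set P' \<subseteq> carrier (sections S U) \<and>
     (\<forall>V e\<^sub>1 e\<^sub>2 p' q' r' s'.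
        openin X V \<and> V \<subseteq> U \<and> sheaf_basis2 X S F V e\<^sub>1 e\<^sub>2 \<and> {p', q', r', s'} \<subseteq> carrier (sections S V) \<and>
        f V e\<^sub>1 = p' \<odot>\<^bsub>sections F V\<^esub> e\<^sub>1 \<oplus>\<^bsub>sections F V\<^esub> r' \<odot>\<^bsub>sections F V\<^esub> e\<^sub>2 \<and>
        f V e\<^sub>2 = q' \<odot>\<^bsub>sections F V\<^esub> e\<^sub>1 \<oplus>\<^bsub>sections F V\<^esub> s' \<odot>\<^bsub>sections F V\<^esub> e\<^sub>2 \<longrightarrow>
        map (restr S U V) P' = char_poly_matrix2 (sections S V) p' q' r' s')"
  have "map (restr S U U) P' = ?P"
    using mp[OF spec[OF spec[OF spec[OF spec[OF spec[OF spec[OF spec[OF conjunct2[OF P']]]]]]]]] U e c fe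
    by simp
  moreover have "map (restr S U U) P' = P'"
    using presheaf_on.restr_id[OF ring_sheaf_presheaf[OF ring_sheaf] U] P' by (intro map_idI) blast
  ultimately show "P' = ?P" by simp
qed

section \<open>Sheafification of free presheaves\<close>

context module_presheaf
begin

lemma open_subtopology_iff: "openin X U \<Longrightarrow> openin (subtopology X U) V \<longleftrightarrow> openin X V \<and> V \<subseteq> U"
  by (auto simp: openin_open_subtopology)

end

text \<open>The cover fed to the sheaf axiom consists of all open subsets on which \<open>s\<close>
  and \<open>t\<close> agree; by hypothesis they exhaust \<open>W\<close>.\<close>

lemma sheaf_separated:
  assumes F: "is_sheaf X F" and W: "openin X W" and st: "s \<in> carrier (sections F W)" "t \<in> carrier (sections F W)"
    and loc: "\<And>x. x \<in> W \<Longrightarrow> \<exists>Z. openin X Z \<and> x \<in> Z \<and> Z \<subseteq> W \<and> restr F W Z s = restr F W Z t"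
  shows "s = t"
proof -
  define \<U> where "\<U> = {Z. openin X Z \<and> Z \<subseteq> W \<and> restr F W Z s = restr F W Z t}"
  have "\<Union>\<U> = W"
    unfolding \<U>_def using loc by blast
  moreover have "\<forall>U\<in>\<U>. openin X U" "\<forall>U\<in>\<U>. restr F W U s = restr F W U t"
    unfolding \<U>_def by blast+
  ultimately show ?thesis
    using F st unfolding is_sheaf_def by metis
qed

lemma sheaf_glue:
  assumes F: "is_sheaf X F" and open_cover: "\<And>U. U \<in> \<U> \<Longrightarrow> openin X U"
    and closed: "\<And>U. U \<in> \<U> \<Longrightarrow> \<sigma> U \<in> carrier (sections F U)"
    and agree: "\<And>U V. U \<in> \<U> \<Longrightarrow> V \<in> \<U> \<Longrightarrow> restr F U (U \<inter> V) (\<sigma> U) = restr F V (U \<inter> V) (\<sigma> V)"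
  obtains s where "s \<in> carrier (sections F (\<Union>\<U>))" "\<And>U. U \<in> \<U> \<Longrightarrow> restr F (\<Union>\<U>) U s = \<sigma> U"
proof -
  have "\<forall>\<sigma>. (\<forall>U\<in>\<U>. \<sigma> U \<in> carrier (sections F U)) \<and>
      (\<forall>U\<in>\<U>. \<forall>V\<in>\<U>. restr F U (U \<inter> V) (\<sigma> U) = restr F V (U \<inter> V) (\<sigma> V)) \<longrightarrow>
      (\<exists>s\<in>carrier (sections F (\<Union>\<U>)). \<forall>U\<in>\<U>. restr F (\<Union>\<U>) U s = \<sigma> U)"
    using conjunct2[OF mp[OF spec[OF conjunct2[OF F[unfolded is_sheaf_def]], of \<U>]]] open_cover by simp
  then show thesis
    using that closed agree by blast
qed

text \<open>Over \<open>U\<close> the presheaf is isomorphic to two copies of \<open>R\<close>,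
  which is already a sheaf, so sheafifying does not change it there. Concretely, a pair of
  coefficients goes to the section of germs of the combination \<open>\<kappa>\<close>; separation
  of \<open>R\<close> gives injectivity, and gluing in \<open>R\<close> gives surjectivity.\<close>

lemma free2_on_sheafification:
  fixes R :: "('x, ('r, 'z) ring_scheme, 'r) presheaf"
    and S :: "('x, ('r, 's, 'y) module_scheme, 's) presheaf"
    and F :: "('x, ('s, 't, 'w) module_scheme, 't) presheaf"
  assumes R: "ring_sheaf X R" and S: "algebra_sheaf X R S" and F: "module_presheaf X F S"
    and U: "openin X U" and t: "sheaf_basis2 X R (scalar_restriction_sheaf S F) U t\<^sub>1 t\<^sub>2"
  shows "free2_on X R (scalar_restriction_sheaf S (sheafification X S F)) U"
proof -
  interpret F: module_presheaf X F S by fact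
  let ?FR = "scalar_restriction_sheaf S F"
  interpret FR: module_presheaf X ?FR R
    by (rule module_presheaf_scalar_restriction[OF R S F])
  interpret R: ring_sheaf_on X R
    using R by (intro ring_sheaf_on.intro ring_sheaf_on_axioms.intro ring_sheaf_presheaf)
  have R_sheaf: "is_sheaf X R" using R unfolding ring_sheaf_def by blast
  have tc: "t\<^sub>1 \<in> carrier (sections F U)" "t\<^sub>2 \<in> carrier (sections F U)"
    using t unfolding sheaf_basis2_def by auto
  define \<kappa> where "\<kappa> W p q = (p \<odot>\<^bsub>sections ?FR W\<^esub> restr F U W t\<^sub>1) \<oplus>\<^bsub>sections ?FR W\<^esub> (q \<odot>\<^bsub>sections ?FR W\<^esub> restr F U W t\<^sub>2)"
    for W p q
  have basis: "basis2 (sections R W) (sections ?FR W) (restr F U W t\<^sub>1) (restr F U W t\<^sub>2)" if "openin X W" "W \<subseteq> U" for W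
    using t that unfolding sheaf_basis2_def by simp
  have tW: "restr F U W t\<^sub>1 \<in> carrier (sections ?FR W)" "restr F U W t\<^sub>2 \<in> carrier (sections ?FR W)" if "openin X W" "W \<subseteq> U" for W
    using basis2_closed[OF basis[OF that]] by auto
  have mod: "Module.module (sections R W) (sections ?FR W)" if "openin X W" for W
    by (rule FR.module[OF that])
  have \<kappa>_closed: "\<kappa> W p q \<in> carrier (sections F W)"
    if "openin X W" "W \<subseteq> U" "p \<in> carrier (sections R W)" "q \<in> carrier (sections R W)" for W p q
    using FR.add_closed[OF that(1) FR.smult_closed[OF that(1,3) tW(1)[OF that(1,2)]] FR.smult_closed[OF that(1,4) tW(2)[OF that(1,2)]]]
    unfolding \<kappa>_def by simp
  have \<kappa>_restr: "restr F W Z (\<kappa> W p q) = \<kappa> Z (restr R W Z p) (restr R W Z q)"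
    if "openin X W" "W \<subseteq> U" "p \<in> carrier (sections R W)" "q \<in> carrier (sections R W)" "openin X Z" "Z \<subseteq> W" for W p q Z
    using FR.restr_comb[OF that(1,5,6) tW[OF that(1,2)] that(3,4)]
      F.restr_restr[OF U that(1,5,6,2) tc(1)] F.restr_restr[OF U that(1,5,6,2) tc(2)]
    unfolding \<kappa>_def by simp
  define \<phi> where "\<phi> W = (\<lambda>(p, q). \<lambda>y\<in>W. germ X F y W (\<kappa> W p q))" for W
  have \<phi>_closed: "\<phi> W (p, q) \<in> carrier (sections F.F' W)"
    if "openin X W" "W \<subseteq> U" "p \<in> carrier (sections R W)" "q \<in> carrier (sections R W)" for W p q
    unfolding \<phi>_def using F.germ_section_closed[OF that(1) \<kappa>_closed[OF that]] by simp
  \<comment> \<open>Equal germs mean that the combinations agree locally, so the coefficients do, by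
    uniqueness of coordinates; then \<open>R\<close> is separated. The same fact later makes local
    coefficients agree on overlaps.\<close>
  have \<phi>_inj: "p = p' \<and> q = q'"
    if W: "openin X W" "W \<subseteq> U" and c: "p \<in> carrier (sections R W)" "q \<in> carrier (sections R W)"
      and c': "p' \<in> carrier (sections R W)" "q' \<in> carrier (sections R W)"
      and eq: "\<And>y. y \<in> W \<Longrightarrow> germ X F y W (\<kappa> W p q) = germ X F y W (\<kappa> W p' q')" for W p q p' q'
  proof -
    have "\<exists>Z. openin X Z \<and> y \<in> Z \<and> Z \<subseteq> W \<and> restr R W Z p = restr R W Z p' \<and> restr R W Z q = restr R W Z q'"
      if y: "y \<in> W" for y
    proof -
      obtain Z where Z: "openin X Z" "y \<in> Z" "Z \<subseteq> W \<inter> W" "restr F W Z (\<kappa> W p q) = restr F W Z (\<kappa> W p' q')"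
        using F.germ_eqD[OF eq[OF y] W(1) y \<kappa>_closed[OF W c']] .
      have ZW: "Z \<subseteq> W" "Z \<subseteq> U" using Z(3) W(2) by auto
      have "\<kappa> Z (restr R W Z p) (restr R W Z q) = \<kappa> Z (restr R W Z p') (restr R W Z q')"
        using Z(4) \<kappa>_restr[OF W c Z(1) ZW(1)] \<kappa>_restr[OF W c' Z(1) ZW(1)] by simp
      then have "restr R W Z p = restr R W Z p'" "restr R W Z q = restr R W Z q'"
        using basis2_unique[OF basis[OF Z(1) ZW(2)]] R.restr_closed[OF W(1) Z(1) ZW(1)] c c'
        unfolding \<kappa>_def by metis+
      then show ?thesis using Z ZW by blast
    qed
    then show ?thesis
      using sheaf_separated[OF R_sheaf W(1) c(1) c'(1)] sheaf_separated[OF R_sheaf W(1) c(2) c'(2)] by metis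
  qed
  have \<phi>_surj: "\<exists>p\<in>carrier (sections R W). \<exists>q\<in>carrier (sections R W). \<sigma> = \<phi> W (p, q)"
    if W: "openin X W" "W \<subseteq> U" and \<sigma>: "\<sigma> \<in> carrier (sections F.F' W)" for W \<sigma>
  proof -
    define good where "good Z p q \<longleftrightarrow> p \<in> carrier (sections R Z) \<and> q \<in> carrier (sections R Z) \<and>
      (\<forall>y\<in>Z. \<sigma> y = germ X F y Z (\<kappa> Z p q))" for Z p q
    define \<U> where "\<U> = {Z. openin X Z \<and> Z \<subseteq> W \<and> (\<exists>p q. good Z p q)}"
    have "y \<in> \<Union>\<U>" if y: "y \<in> W" for y
    proof -
      obtain Z u where Z: "openin X Z" "y \<in> Z" "Z \<subseteq> W" "u \<in> carrier (sections F Z)"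
        "\<forall>y\<in>Z. \<sigma> y = germ X F y Z u"
        using F.sheafification_local[OF \<sigma> y] by blast
      have "u \<in> carrier (sections ?FR Z)" using Z(4) by simp
      moreover have "Z \<subseteq> U" using Z(3) W(2) by blast
      ultimately obtain p q where "p \<in> carrier (sections R Z)" "q \<in> carrier (sections R Z)" "u = \<kappa> Z p q"
        using basis2_rep[OF basis[OF Z(1)]] unfolding \<kappa>_def by metis
      then have "good Z p q" using Z(5) unfolding good_def by simp
      then show ?thesis using Z unfolding \<U>_def by blast
    qed
    then have cover: "\<Union>\<U> = W" unfolding \<U>_def by blast
    have "\<forall>Z\<in>\<U>. \<exists>p q. good Z p q" unfolding \<U>_def by simp
    \<comment> \<open>Coefficients are chosen on each member of the cover; \<open>\<phi>_inj\<close>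
      on the intersections shows that they are compatible, so they glue in \<open>R\<close>.\<close>
    from bchoice[OF this] obtain P where "\<forall>Z\<in>\<U>. \<exists>q. good Z (P Z) q" ..
    from bchoice[OF this] obtain Q where "\<forall>Z\<in>\<U>. good Z (P Z) (Q Z)" ..
    then have PQ: "good Z (P Z) (Q Z)" if "Z \<in> \<U>" for Z
      using that by simp
    have \<U>: "openin X Z" "Z \<subseteq> W" "Z \<subseteq> U" "P Z \<in> carrier (sections R Z)" "Q Z \<in> carrier (sections R Z)"
        "\<And>y. y \<in> Z \<Longrightarrow> \<sigma> y = germ X F y Z (\<kappa> Z (P Z) (Q Z))" if "Z \<in> \<U>" for Z
      using that PQ[OF that] W(2) unfolding \<U>_def good_def by auto
    have agree: "restr R Z (Z \<inter> Z') (P Z) = restr R Z' (Z \<inter> Z') (P Z') \<and>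
        restr R Z (Z \<inter> Z') (Q Z) = restr R Z' (Z \<inter> Z') (Q Z')" if ZZ': "Z \<in> \<U>" "Z' \<in> \<U>" for Z Z'
    proof (rule \<phi>_inj)
      have o: "openin X (Z \<inter> Z')" using \<U>(1) ZZ' by blast
      then show "openin X (Z \<inter> Z')" .
      show "Z \<inter> Z' \<subseteq> U" using \<U>(3)[OF ZZ'(1)] by blast
      show "restr R Z (Z \<inter> Z') (P Z) \<in> carrier (sections R (Z \<inter> Z'))"
          "restr R Z (Z \<inter> Z') (Q Z) \<in> carrier (sections R (Z \<inter> Z'))"
          "restr R Z' (Z \<inter> Z') (P Z') \<in> carrier (sections R (Z \<inter> Z'))"
          "restr R Z' (Z \<inter> Z') (Q Z') \<in> carrier (sections R (Z \<inter> Z'))"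
        using R.restr_closed[OF \<U>(1)[OF ZZ'(1)] o] R.restr_closed[OF \<U>(1)[OF ZZ'(2)] o] \<U>(4,5) ZZ' by auto
      fix y assume y: "y \<in> Z \<inter> Z'"
      have "germ X F y (Z \<inter> Z') (\<kappa> (Z \<inter> Z') (restr R Z (Z \<inter> Z') (P Z)) (restr R Z (Z \<inter> Z') (Q Z))) = \<sigma> y"
        using F.germ_restr[OF \<U>(1)[OF ZZ'(1)] o _ y \<kappa>_closed[OF \<U>(1,3,4,5)[OF ZZ'(1)]]]
          \<kappa>_restr[OF \<U>(1,3,4,5)[OF ZZ'(1)] o] \<U>(6)[OF ZZ'(1)] y by simp
      moreover have "germ X F y (Z \<inter> Z') (\<kappa> (Z \<inter> Z') (restr R Z' (Z \<inter> Z') (P Z')) (restr R Z' (Z \<inter> Z') (Q Z'))) = \<sigma> y"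
        using F.germ_restr[OF \<U>(1)[OF ZZ'(2)] o _ y \<kappa>_closed[OF \<U>(1,3,4,5)[OF ZZ'(2)]]]
          \<kappa>_restr[OF \<U>(1,3,4,5)[OF ZZ'(2)] o] \<U>(6)[OF ZZ'(2)] y by simp
      ultimately show "germ X F y (Z \<inter> Z') (\<kappa> (Z \<inter> Z') (restr R Z (Z \<inter> Z') (P Z)) (restr R Z (Z \<inter> Z') (Q Z))) =
          germ X F y (Z \<inter> Z') (\<kappa> (Z \<inter> Z') (restr R Z' (Z \<inter> Z') (P Z')) (restr R Z' (Z \<inter> Z') (Q Z')))"
        by simp
    qed
    obtain p where p: "p \<in> carrier (sections R W)" "\<And>Z. Z \<in> \<U> \<Longrightarrow> restr R W Z p = P Z"
      using sheaf_glue[OF R_sheaf, of \<U> P] \<U>(1,4) agree unfolding cover by blast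
    obtain q where q: "q \<in> carrier (sections R W)" "\<And>Z. Z \<in> \<U> \<Longrightarrow> restr R W Z q = Q Z"
      using sheaf_glue[OF R_sheaf, of \<U> Q] \<U>(1,5) agree unfolding cover by blast
    have "\<sigma> = \<phi> W (p, q)"
    proof (rule F.sheafification_eqI[OF \<sigma> \<phi>_closed[OF W p(1) q(1)]])
      fix y assume y: "y \<in> W"
      then obtain Z where Z: "Z \<in> \<U>" "y \<in> Z" using cover by blast
      have "germ X F y W (\<kappa> W p q) = germ X F y Z (\<kappa> Z (P Z) (Q Z))"
        using F.germ_restr[OF W(1) \<U>(1,2)[OF Z(1)] Z(2) \<kappa>_closed[OF W p(1) q(1)]]
          \<kappa>_restr[OF W p(1) q(1) \<U>(1,2)[OF Z(1)]] p(2)[OF Z(1)] q(2)[OF Z(1)] by simp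
      then show "\<sigma> y = \<phi> W (p, q) y"
        using \<U>(6)[OF Z] y by (simp add: \<phi>_def)
    qed
    then show ?thesis using p(1) q(1) by blast
  qed
  show ?thesis
    unfolding free2_on_def module_sheaf_iso_def F.open_subtopology_iff[OF U]
  proof (intro exI[of _ \<phi>] conjI allI impI ballI)
    fix W assume "openin X W \<and> W \<subseteq> U"
    then have W: "openin X W" "W \<subseteq> U" by auto
    interpret M: Module.module "sections R W" "sections ?FR W" by (rule mod[OF W(1)])
    show "bij_betw (\<phi> W) (carrier (sections (free2_sheaf R) W))
        (carrier (sections (scalar_restriction_sheaf S (sheafification X S F)) W))"
    proof (rule bij_betw_imageI)
      show "inj_on (\<phi> W) (carrier (sections (free2_sheaf R) W))"
      proof (rule inj_onI)
        fix x y assume xy: "x \<in> carrier (sections (free2_sheaf R) W)" "y \<in> carrier (sections (free2_sheaf R) W)"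
          and eq: "\<phi> W x = \<phi> W y"
        obtain p q p' q' where pq: "x = (p, q)" "y = (p', q')" by fastforce
        have "germ X F z W (\<kappa> W p q) = germ X F z W (\<kappa> W p' q')" if "z \<in> W" for z
          using fun_cong[OF eq, of z] that unfolding pq \<phi>_def by simp
        then have "p = p' \<and> q = q'"
          using xy unfolding pq by (intro \<phi>_inj[OF W]) (auto simp: free2_sheaf_def free2_module_def)
        then show "x = y" unfolding pq by simp
      qed
      show "\<phi> W ` carrier (sections (free2_sheaf R) W) =
          carrier (sections (scalar_restriction_sheaf S (sheafification X S F)) W)"
      proof
        show "\<phi> W ` carrier (sections (free2_sheaf R) W) \<subseteq> carrier (sections (scalar_restriction_sheaf S (sheafification X S F)) W)"
          using \<phi>_closed[OF W] by (auto simp: free2_sheaf_def free2_module_def)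
        show "carrier (sections (scalar_restriction_sheaf S (sheafification X S F)) W) \<subseteq> \<phi> W ` carrier (sections (free2_sheaf R) W)"
        proof
          fix \<sigma> assume "\<sigma> \<in> carrier (sections (scalar_restriction_sheaf S (sheafification X S F)) W)"
          then obtain p q where "p \<in> carrier (sections R W)" "q \<in> carrier (sections R W)" "\<sigma> = \<phi> W (p, q)"
            using \<phi>_surj[OF W, of \<sigma>] by auto
          then show "\<sigma> \<in> \<phi> W ` carrier (sections (free2_sheaf R) W)"
            by (intro image_eqI[of _ _ "(p, q)"]) (auto simp: free2_sheaf_def free2_module_def)
        qed
      qed
    qed
    fix x assume x: "x \<in> carrier (sections (free2_sheaf R) W)"
    obtain p q where pq: "x = (p, q)" by fastforce
    have c: "p \<in> carrier (sections R W)" "q \<in> carrier (sections R W)"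
      using x unfolding pq by (auto simp: free2_sheaf_def free2_module_def)
    show "\<phi> W (x \<oplus>\<^bsub>sections (free2_sheaf R) W\<^esub> y) =
        \<phi> W x \<oplus>\<^bsub>sections (scalar_restriction_sheaf S (sheafification X S F)) W\<^esub> \<phi> W y"
      if y: "y \<in> carrier (sections (free2_sheaf R) W)" for y
    proof -
      obtain p' q' where pq': "y = (p', q')" by fastforce
      have c': "p' \<in> carrier (sections R W)" "q' \<in> carrier (sections R W)"
        using y unfolding pq' by (auto simp: free2_sheaf_def free2_module_def)
      have \<kappa>_add: "\<kappa> W (p \<oplus>\<^bsub>sections R W\<^esub> p') (q \<oplus>\<^bsub>sections R W\<^esub> q') = \<kappa> W p q \<oplus>\<^bsub>sections F W\<^esub> \<kappa> W p' q'"
      proof -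
        have "\<kappa> W (p \<oplus>\<^bsub>sections R W\<^esub> p') (q \<oplus>\<^bsub>sections R W\<^esub> q') = \<kappa> W p q \<oplus>\<^bsub>sections ?FR W\<^esub> \<kappa> W p' q'"
          using M.smult_l_distr[OF c(1) c'(1) tW(1)[OF W]] M.smult_l_distr[OF c(2) c'(2) tW(2)[OF W]]
            M.smult_closed[OF c(1) tW(1)[OF W]] M.smult_closed[OF c'(1) tW(1)[OF W]]
            M.smult_closed[OF c(2) tW(2)[OF W]] M.smult_closed[OF c'(2) tW(2)[OF W]]
          unfolding \<kappa>_def by (simp only: M.M.a_ac M.M.a_closed)
        then show ?thesis by simp
      qed
      have "\<phi> W (p \<oplus>\<^bsub>sections R W\<^esub> p', q \<oplus>\<^bsub>sections R W\<^esub> q') = \<phi> W (p, q) \<oplus>\<^bsub>sections F.F' W\<^esub> \<phi> W (p', q')"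
      proof (rule F.sheafification_eqI)
        show "\<phi> W (p \<oplus>\<^bsub>sections R W\<^esub> p', q \<oplus>\<^bsub>sections R W\<^esub> q') \<in> carrier (sections F.F' W)"
          using c c' by (intro \<phi>_closed[OF W]) auto
        show "\<phi> W (p, q) \<oplus>\<^bsub>sections F.F' W\<^esub> \<phi> W (p', q') \<in> carrier (sections F.F' W)"
          by (intro F.sheafification_add_closed \<phi>_closed[OF W] c c')
        fix z assume z: "z \<in> W"
        have "(\<phi> W (p, q) \<oplus>\<^bsub>sections F.F' W\<^esub> \<phi> W (p', q')) z = germ X F z W (\<kappa> W p q \<oplus>\<^bsub>sections F W\<^esub> \<kappa> W p' q')"
          by (rule F.sheafification_add_germ[OF W(1) subset_refl z \<kappa>_closed[OF W c] \<kappa>_closed[OF W c']])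
            (use z in \<open>simp_all add: \<phi>_def\<close>)
        then show "\<phi> W (p \<oplus>\<^bsub>sections R W\<^esub> p', q \<oplus>\<^bsub>sections R W\<^esub> q') z = (\<phi> W (p, q) \<oplus>\<^bsub>sections F.F' W\<^esub> \<phi> W (p', q')) z"
          using z by (simp add: \<phi>_def \<kappa>_add)
      qed
      then show ?thesis
        unfolding pq pq' by (simp add: free2_sheaf_def free2_module_def)
    qed
    show "\<phi> W (r \<odot>\<^bsub>sections (free2_sheaf R) W\<^esub> x) =
        r \<odot>\<^bsub>sections (scalar_restriction_sheaf S (sheafification X S F)) W\<^esub> \<phi> W x"
      if r: "r \<in> carrier (sections R W)" for r
    proof -
      have alg: "Module.algebra (sections R W) (sections S W)"
        using S W unfolding algebra_sheaf_def by blast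
      let ?r = "r \<odot>\<^bsub>sections S W\<^esub> \<one>\<^bsub>sections S W\<^esub>"
      have rS: "?r \<in> carrier (sections S W)" by (rule algebra.scalar_one_closed[OF alg r])
      have \<kappa>_smult: "\<kappa> W (r \<otimes>\<^bsub>sections R W\<^esub> p) (r \<otimes>\<^bsub>sections R W\<^esub> q) = ?r \<odot>\<^bsub>sections F W\<^esub> \<kappa> W p q"
      proof -
        have "\<kappa> W (r \<otimes>\<^bsub>sections R W\<^esub> p) (r \<otimes>\<^bsub>sections R W\<^esub> q) = r \<odot>\<^bsub>sections ?FR W\<^esub> \<kappa> W p q"
          unfolding \<kappa>_def
          using M.smult_assoc1[OF r c(1) tW(1)[OF W]] M.smult_assoc1[OF r c(2) tW(2)[OF W]]
            M.smult_r_distr[OF r M.smult_closed[OF c(1) tW(1)[OF W]] M.smult_closed[OF c(2) tW(2)[OF W]]] by simp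
        then show ?thesis by simp
      qed
      have "\<phi> W (r \<otimes>\<^bsub>sections R W\<^esub> p, r \<otimes>\<^bsub>sections R W\<^esub> q) = ?r \<odot>\<^bsub>sections F.F' W\<^esub> \<phi> W (p, q)"
      proof (rule F.sheafification_eqI)
        show "\<phi> W (r \<otimes>\<^bsub>sections R W\<^esub> p, r \<otimes>\<^bsub>sections R W\<^esub> q) \<in> carrier (sections F.F' W)"
          using c r by (intro \<phi>_closed[OF W]) auto
        show "?r \<odot>\<^bsub>sections F.F' W\<^esub> \<phi> W (p, q) \<in> carrier (sections F.F' W)"
          by (intro F.sheafification_smult_closed W(1) rS \<phi>_closed[OF W] c)
        fix z assume z: "z \<in> W"
        have "(?r \<odot>\<^bsub>sections F.F' W\<^esub> \<phi> W (p, q)) z = germ X F z W (restr S W W ?r \<odot>\<^bsub>sections F W\<^esub> \<kappa> W p q)"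
          by (rule F.sheafification_smult_germ[OF W(1) W(1) subset_refl z \<kappa>_closed[OF W c] rS])
            (use z in \<open>simp add: \<phi>_def\<close>)
        moreover have "restr S W W ?r = ?r"
          by (rule presheaf_on.restr_id[OF ring_sheaf_presheaf[OF F.ring_sheaf] W(1) rS])
        ultimately show "\<phi> W (r \<otimes>\<^bsub>sections R W\<^esub> p, r \<otimes>\<^bsub>sections R W\<^esub> q) z = (?r \<odot>\<^bsub>sections F.F' W\<^esub> \<phi> W (p, q)) z"
          using z by (simp add: \<phi>_def \<kappa>_smult)
      qed
      then show ?thesis
        unfolding pq by (simp add: free2_sheaf_def free2_module_def)
    qed
  next
    fix W Z x assume "(openin X W \<and> W \<subseteq> U) \<and> (openin X Z \<and> Z \<subseteq> U) \<and> Z \<subseteq> W"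
      and x: "x \<in> carrier (sections (free2_sheaf R) W)"
    then have W: "openin X W" "W \<subseteq> U" and Z: "openin X Z" "Z \<subseteq> W" by auto
    obtain p q where pq: "x = (p, q)" by fastforce
    have c: "p \<in> carrier (sections R W)" "q \<in> carrier (sections R W)"
      using x unfolding pq by (auto simp: free2_sheaf_def free2_module_def)
    have "germ X F y Z (\<kappa> Z (restr R W Z p) (restr R W Z q)) = germ X F y W (\<kappa> W p q)" if "y \<in> Z" for y
      using F.germ_restr[OF W(1) Z that \<kappa>_closed[OF W c]] \<kappa>_restr[OF W c Z] by simp
    then show "restr (scalar_restriction_sheaf S (sheafification X S F)) W Z (\<phi> W x) = \<phi> Z (restr (free2_sheaf R) W Z x)"
      using Z(2) unfolding pq by (auto simp: \<phi>_def free2_sheaf_def fun_eq_iff)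
  qed
qed

section \<open>The presheaf of tensor products\<close>

lemma tensor_presheaf_simps [simp]:
  "sections (tensor_presheaf S M N) U = tensor_module (sections S U) (sections M U) (sections N U)"
  by (simp add: tensor_presheaf_def)

lemma tensor_presheaf_restr:
  assumes M: "module_presheaf X M S" and N: "module_presheaf X N S"
    and U: "openin X U" "openin X V" "V \<subseteq> U"
  shows "\<And>x. x \<in> carrier (sections (tensor_presheaf S M N) U) \<Longrightarrow>
      restr (tensor_presheaf S M N) U V x \<in> carrier (sections (tensor_presheaf S M N) V)"
    and "\<And>x y. x \<in> carrier (sections (tensor_presheaf S M N) U) \<Longrightarrow> y \<in> carrier (sections (tensor_presheaf S M N) U) \<Longrightarrow>
      restr (tensor_presheaf S M N) U V (x \<oplus>\<^bsub>sections (tensor_presheaf S M N) U\<^esub> y) =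
      restr (tensor_presheaf S M N) U V x \<oplus>\<^bsub>sections (tensor_presheaf S M N) V\<^esub> restr (tensor_presheaf S M N) U V y"
    and "\<And>m n. m \<in> carrier (sections M U) \<Longrightarrow> n \<in> carrier (sections N U) \<Longrightarrow>
      restr (tensor_presheaf S M N) U V (pure_tensor (sections S U) (sections M U) (sections N U) m n) =
      pure_tensor (sections S V) (sections M V) (sections N V) (restr M U V m) (restr N U V n)"
proof -
  interpret M: module_presheaf X M S by fact
  interpret N: module_presheaf X N S by fact
  interpret A: tensor_pair "sections S U" "sections M U" "sections N U"
    by (intro tensor_pair.intro M.module N.module U)
  interpret B: tensor_pair "sections S V" "sections M V" "sections N V"
    by (intro tensor_pair.intro M.module N.module U)
  have "balanced_map (sections S U) (sections M U) (sections N U)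
      (tensor_module (sections S V) (sections M V) (sections N V))
      (\<lambda>m n. pure_tensor (sections S V) (sections M V) (sections N V) (restr M U V m) (restr N U V n))"
    by (rule balanced_mapI)
      (simp_all add: M.restr_add[OF U] N.restr_add[OF U] M.restr_smult[OF U] N.restr_smult[OF U]
        M.restr_closed[OF U] N.restr_closed[OF U] M.S_restr_closed[OF U]
        B.pure_tensor_add_left B.pure_tensor_add_right B.pure_tensor_balanced)
  note * = tensor_map_exists[OF A.tensor_pair_axioms B.tensor_pair_axioms this M.restr_closed[OF U] N.restr_closed[OF U],
      where h = "restr (tensor_presheaf S M N) U V"]
  show "\<And>x. x \<in> carrier (sections (tensor_presheaf S M N) U) \<Longrightarrow>
      restr (tensor_presheaf S M N) U V x \<in> carrier (sections (tensor_presheaf S M N) V)"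
    and "\<And>x y. x \<in> carrier (sections (tensor_presheaf S M N) U) \<Longrightarrow> y \<in> carrier (sections (tensor_presheaf S M N) U) \<Longrightarrow>
      restr (tensor_presheaf S M N) U V (x \<oplus>\<^bsub>sections (tensor_presheaf S M N) U\<^esub> y) =
      restr (tensor_presheaf S M N) U V x \<oplus>\<^bsub>sections (tensor_presheaf S M N) V\<^esub> restr (tensor_presheaf S M N) U V y"
    and "\<And>m n. m \<in> carrier (sections M U) \<Longrightarrow> n \<in> carrier (sections N U) \<Longrightarrow>
      restr (tensor_presheaf S M N) U V (pure_tensor (sections S U) (sections M U) (sections N U) m n) =
      pure_tensor (sections S V) (sections M V) (sections N V) (restr M U V m) (restr N U V n)"
    unfolding tensor_presheaf_simps
    by (rule *; simp add: tensor_presheaf_def)+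
qed

text \<open>Both sides of each compatibility law are additive in the tensor, so
  \<open>tensor_induct\<close> reduces it to pure tensors, where it holds in \<open>M\<close> and
  \<open>N\<close>.\<close>

lemma module_presheaf_tensor:
  assumes M: "module_presheaf X M S" and N: "module_presheaf X N S"
  shows "module_presheaf X (tensor_presheaf S M N) S"
proof -
  interpret M: module_presheaf X M S by fact
  interpret N: module_presheaf X N S by fact
  let ?T = "tensor_presheaf S M N"
  have pair: "tensor_pair (sections S U) (sections M U) (sections N U)" if "openin X U" for U
    using that by (intro tensor_pair.intro M.module N.module)
  note r = tensor_presheaf_restr[OF M N, unfolded tensor_presheaf_simps]
  show ?thesis
  proof (intro module_presheaf.intro presheaf_on.intro module_presheaf_axioms.intro)
    show "is_presheaf X ?T"
      unfolding is_presheaf_def tensor_presheaf_simps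
    proof (intro conjI allI impI ballI)
      fix U V x assume "openin X U \<and> openin X V \<and> V \<subseteq> U"
        "x \<in> carrier (tensor_module (sections S U) (sections M U) (sections N U))"
      then show "restr ?T U V x \<in> carrier (tensor_module (sections S V) (sections M V) (sections N V))"
        by (auto intro: r(1))
    next
      fix U x assume U: "openin X U" and x: "x \<in> carrier (tensor_module (sections S U) (sections M U) (sections N U))"
      interpret A: tensor_pair "sections S U" "sections M U" "sections N U" by (rule pair[OF U])
      show "restr ?T U U x = x"
        using x
      proof (induction rule: A.tensor_induct)
        case (pure m n)
        then show ?case
          using r(3)[OF U U subset_refl pure] M.restr_id[OF U] N.restr_id[OF U] by simp
      next
        case (add x y)
        then show ?case using r(2)[OF U U subset_refl add(1,2)] by simp
      qed
    next
      fix U V W x assume "openin X U \<and> openin X V \<and> openin X W \<and> W \<subseteq> V \<and> V \<subseteq> U"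
        and x: "x \<in> carrier (tensor_module (sections S U) (sections M U) (sections N U))"
      then have U: "openin X U" and V: "openin X V" and W: "openin X W" and WV: "W \<subseteq> V" and VU: "V \<subseteq> U"
        by auto
      have WU: "W \<subseteq> U" using WV VU by blast
      interpret A: tensor_pair "sections S U" "sections M U" "sections N U" by (rule pair[OF U])
      show "restr ?T V W (restr ?T U V x) = restr ?T U W x"
        using x
      proof (induction rule: A.tensor_induct)
        case (pure m n)
        have "restr M U V m \<in> carrier (sections M V)" "restr N U V n \<in> carrier (sections N V)"
          using M.restr_closed[OF U V VU pure(1)] N.restr_closed[OF U V VU pure(2)] by auto
        then show ?case
          using r(3)[OF U V VU pure] r(3)[OF V W WV] r(3)[OF U W WU pure]
            M.restr_restr[OF U V W WV VU pure(1)] N.restr_restr[OF U V W WV VU pure(2)] by simp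
      next
        case (add x y)
        then show ?case
          using r(2)[OF U V VU add(1,2)] r(2)[OF U W WU add(1,2)]
            r(2)[OF V W WV r(1)[OF U V VU add(1)] r(1)[OF U V VU add(2)]] by simp
      qed
    qed
    show "ring_sheaf X S" by (rule M.ring_sheaf)
    show "Module.module (sections S U) (sections ?T U)" if "openin X U" for U
      using tensor_pair.module_tensor[OF pair[OF that]] by simp
    show "restr ?T U V (x \<oplus>\<^bsub>sections ?T U\<^esub> y) = restr ?T U V x \<oplus>\<^bsub>sections ?T V\<^esub> restr ?T U V y"
      if "openin X U" "openin X V" "V \<subseteq> U" "x \<in> carrier (sections ?T U)" "y \<in> carrier (sections ?T U)" for U V x y
      using r(2)[OF that(1-3)] that(4,5) by simp
    fix U V s x assume U: "openin X U" "openin X V" "V \<subseteq> U" and s: "s \<in> carrier (sections S U)"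
      and x: "x \<in> carrier (sections ?T U)"
    interpret A: tensor_pair "sections S U" "sections M U" "sections N U" by (rule pair[OF U(1)])
    interpret B: tensor_pair "sections S V" "sections M V" "sections N V" by (rule pair[OF U(2)])
    have sV: "restr S U V s \<in> carrier (sections S V)" by (rule M.S_restr_closed[OF U s])
    have "x \<in> carrier (tensor_module (sections S U) (sections M U) (sections N U))" using x by simp
    then show "restr ?T U V (s \<odot>\<^bsub>sections ?T U\<^esub> x) = restr S U V s \<odot>\<^bsub>sections ?T V\<^esub> restr ?T U V x"
      unfolding tensor_presheaf_simps
    proof (induction rule: A.tensor_induct)
      case (pure m n)
      have "s \<odot>\<^bsub>sections M U\<^esub> m \<in> carrier (sections M U)" by (rule M.smult_closed[OF U(1) s pure(1)])
      then show ?case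
        using A.tensor_smult(3)[OF s pure] r(3)[OF U pure] r(3)[OF U _ pure(2)]
          B.tensor_smult(3)[OF sV M.restr_closed[OF U pure(1)] N.restr_closed[OF U pure(2)]]
          M.restr_smult[OF U s pure(1)] by simp
    next
      case (add x y)
      then show ?case
        using A.tensor_smult(2)[OF s add(1,2)] r(2)[OF U A.tensor_smult(1)[OF s add(1)] A.tensor_smult(1)[OF s add(2)]]
          r(2)[OF U add(1,2)] B.tensor_smult(2)[OF sV r(1)[OF U add(1)] r(1)[OF U add(2)]] by simp
    qed
  qed
qed

section \<open>Tensor products of framed modules\<close>

text \<open>A \<open>3 \<times> 2\<close> matrix times a \<open>2 \<times> 3\<close> matrix is the identity only over the zero ring.\<close>

lemma (in cring) no_rank2_factorization_of_identity:
  assumes c: "{p1, p2, p3, q1, q2, q3, u1, u2, u3, v1, v2, v3} \<subseteq> carrier R"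
    and 11: "p1 \<otimes> u1 \<oplus> q1 \<otimes> v1 = \<one>" and 12: "p1 \<otimes> u2 \<oplus> q1 \<otimes> v2 = \<zero>" and 13: "p1 \<otimes> u3 \<oplus> q1 \<otimes> v3 = \<zero>"
    and 21: "p2 \<otimes> u1 \<oplus> q2 \<otimes> v1 = \<zero>" and 22: "p2 \<otimes> u2 \<oplus> q2 \<otimes> v2 = \<one>" and 23: "p2 \<otimes> u3 \<oplus> q2 \<otimes> v3 = \<zero>"
    and 33: "p3 \<otimes> u3 \<oplus> q3 \<otimes> v3 = \<one>"
  shows "\<one> = \<zero>"
proof -
  have cl: "p1 \<in> carrier R" "p2 \<in> carrier R" "p3 \<in> carrier R" "q1 \<in> carrier R" "q2 \<in> carrier R" "q3 \<in> carrier R"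
    "u1 \<in> carrier R" "u2 \<in> carrier R" "u3 \<in> carrier R" "v1 \<in> carrier R" "v2 \<in> carrier R" "v3 \<in> carrier R"
    using c by auto
  \<comment> \<open>The minor of the first two rows of the left factor. By Cramer's rule it
    annihilates the third column of the right factor, so the third diagonal entry forces it to
    vanish; but it also divides the upper left 2 x 2 minor of the identity.\<close>
  let ?\<Delta> = "p1 \<otimes> q2 \<ominus> q1 \<otimes> p2"
  have "p2 \<otimes> (p1 \<otimes> u3 \<oplus> q1 \<otimes> v3) \<oplus> ?\<Delta> \<otimes> v3 = p1 \<otimes> (p2 \<otimes> u3 \<oplus> q2 \<otimes> v3)"
    using cl by (simp add: expand_simps)
  then have v: "?\<Delta> \<otimes> v3 = \<zero>"
    unfolding 13 23 using cl by simp
  have "q1 \<otimes> (p2 \<otimes> u3 \<oplus> q2 \<otimes> v3) \<oplus> ?\<Delta> \<otimes> u3 = q2 \<otimes> (p1 \<otimes> u3 \<oplus> q1 \<otimes> v3)"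
    using cl by (simp add: expand_simps)
  then have u: "?\<Delta> \<otimes> u3 = \<zero>"
    unfolding 13 23 using cl by simp
  have "?\<Delta> = ?\<Delta> \<otimes> (p3 \<otimes> u3 \<oplus> q3 \<otimes> v3)"
    unfolding 33 using cl by simp
  also have "\<dots> = p3 \<otimes> (?\<Delta> \<otimes> u3) \<oplus> q3 \<otimes> (?\<Delta> \<otimes> v3)"
  proof -
    have "\<And>\<delta>. \<delta> \<in> carrier R \<Longrightarrow> \<delta> \<otimes> (p3 \<otimes> u3 \<oplus> q3 \<otimes> v3) = p3 \<otimes> (\<delta> \<otimes> u3) \<oplus> q3 \<otimes> (\<delta> \<otimes> v3)"
      using cl by (simp add: r_distr m_ac)
    then show ?thesis using cl by simp
  qed
  finally have \<Delta>: "?\<Delta> = \<zero>"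
    unfolding u v using cl by simp
  have "(p1 \<otimes> u1 \<oplus> q1 \<otimes> v1) \<otimes> (p2 \<otimes> u2 \<oplus> q2 \<otimes> v2) \<ominus> (p1 \<otimes> u2 \<oplus> q1 \<otimes> v2) \<otimes> (p2 \<otimes> u1 \<oplus> q2 \<otimes> v1) =
      ?\<Delta> \<otimes> (u1 \<otimes> v2 \<ominus> v1 \<otimes> u2)"
    using cl det_mult[of p1 q1 p2 q2 u1 v1 u2 v2] by simp
  then show ?thesis
    unfolding 11 12 21 22 \<Delta> using cl by simp
qed

section \<open>Coordinates and linear relations in modules\<close>

lemma (in Module.module) basis2_coordinates:
  assumes e: "basis2 R M e\<^sub>1 e\<^sub>2"
  obtains x\<^sub>1 x\<^sub>2 where "\<forall>m\<in>carrier M. x\<^sub>1 m \<in> carrier R" "\<forall>m\<in>carrier M. x\<^sub>2 m \<in> carrier R"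
    "\<forall>m\<in>carrier M. m = x\<^sub>1 m \<odot>\<^bsub>M\<^esub> e\<^sub>1 \<oplus>\<^bsub>M\<^esub> x\<^sub>2 m \<odot>\<^bsub>M\<^esub> e\<^sub>2"
    "\<forall>a\<in>carrier R. \<forall>b\<in>carrier R. x\<^sub>1 (a \<odot>\<^bsub>M\<^esub> e\<^sub>1 \<oplus>\<^bsub>M\<^esub> b \<odot>\<^bsub>M\<^esub> e\<^sub>2) = a"
    "\<forall>a\<in>carrier R. \<forall>b\<in>carrier R. x\<^sub>2 (a \<odot>\<^bsub>M\<^esub> e\<^sub>1 \<oplus>\<^bsub>M\<^esub> b \<odot>\<^bsub>M\<^esub> e\<^sub>2) = b"
proof -
  have ec: "e\<^sub>1 \<in> carrier M" "e\<^sub>2 \<in> carrier M" using basis2_closed[OF e] by auto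
  have "\<forall>m\<in>carrier M. \<exists>z. fst z \<in> carrier R \<and> snd z \<in> carrier R \<and> m = fst z \<odot>\<^bsub>M\<^esub> e\<^sub>1 \<oplus>\<^bsub>M\<^esub> snd z \<odot>\<^bsub>M\<^esub> e\<^sub>2"
  proof
    fix m assume "m \<in> carrier M"
    then obtain x y where "x \<in> carrier R" "y \<in> carrier R" "m = x \<odot>\<^bsub>M\<^esub> e\<^sub>1 \<oplus>\<^bsub>M\<^esub> y \<odot>\<^bsub>M\<^esub> e\<^sub>2"
      using basis2_rep[OF e] by blast
    then show "\<exists>z. fst z \<in> carrier R \<and> snd z \<in> carrier R \<and> m = fst z \<odot>\<^bsub>M\<^esub> e\<^sub>1 \<oplus>\<^bsub>M\<^esub> snd z \<odot>\<^bsub>M\<^esub> e\<^sub>2"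
      by (intro exI[of _ "(x, y)"]) simp
  qed
  from bchoice[OF this] obtain z where z: "\<forall>m\<in>carrier M. fst (z m) \<in> carrier R \<and> snd (z m) \<in> carrier R \<and>
      m = fst (z m) \<odot>\<^bsub>M\<^esub> e\<^sub>1 \<oplus>\<^bsub>M\<^esub> snd (z m) \<odot>\<^bsub>M\<^esub> e\<^sub>2" ..
  have inv: "fst (z (a \<odot>\<^bsub>M\<^esub> e\<^sub>1 \<oplus>\<^bsub>M\<^esub> b \<odot>\<^bsub>M\<^esub> e\<^sub>2)) = a \<and> snd (z (a \<odot>\<^bsub>M\<^esub> e\<^sub>1 \<oplus>\<^bsub>M\<^esub> b \<odot>\<^bsub>M\<^esub> e\<^sub>2)) = b"
    if ab: "a \<in> carrier R" "b \<in> carrier R" for a b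
  proof -
    let ?m = "a \<odot>\<^bsub>M\<^esub> e\<^sub>1 \<oplus>\<^bsub>M\<^esub> b \<odot>\<^bsub>M\<^esub> e\<^sub>2"
    have m: "?m \<in> carrier M" using ab ec by simp
    then have zc: "fst (z ?m) \<in> carrier R" "snd (z ?m) \<in> carrier R"
      and eq: "?m = fst (z ?m) \<odot>\<^bsub>M\<^esub> e\<^sub>1 \<oplus>\<^bsub>M\<^esub> snd (z ?m) \<odot>\<^bsub>M\<^esub> e\<^sub>2" using z by blast+
    show ?thesis
      using basis2_unique[OF e ab zc eq] by simp
  qed
  show thesis
    by (rule that[of "\<lambda>m. fst (z m)" "\<lambda>m. snd (z m)"]) (use z inv in blast)+
qed

text \<open>Up to the unit \<open>u\<close>, \<open>F\<close> is the coordinate along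
  \<open>w\<close> and \<open>G\<close> is minus the coordinate along \<open>z\<close>, so applying
  them to a relation isolates its coefficients. The sign is that of a pair of rows of an alternating
  matrix.\<close>

lemma (in Module.module) basis2_functionals:
  assumes span: "\<And>m. m \<in> carrier M \<Longrightarrow> \<exists>x\<in>carrier R. \<exists>y\<in>carrier R. m = x \<odot>\<^bsub>M\<^esub> z \<oplus>\<^bsub>M\<^esub> y \<odot>\<^bsub>M\<^esub> w"
    and c: "z \<in> carrier M" "w \<in> carrier M"
    and F: "\<And>m n. m \<in> carrier M \<Longrightarrow> n \<in> carrier M \<Longrightarrow> F (m \<oplus>\<^bsub>M\<^esub> n) = F m \<oplus> F n"
      "\<And>x m. x \<in> carrier R \<Longrightarrow> m \<in> carrier M \<Longrightarrow> F (x \<odot>\<^bsub>M\<^esub> m) = x \<otimes> F m"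
    and G: "\<And>m n. m \<in> carrier M \<Longrightarrow> n \<in> carrier M \<Longrightarrow> G (m \<oplus>\<^bsub>M\<^esub> n) = G m \<oplus> G n"
      "\<And>x m. x \<in> carrier R \<Longrightarrow> m \<in> carrier M \<Longrightarrow> G (x \<odot>\<^bsub>M\<^esub> m) = x \<otimes> G m"
    and u: "u \<in> Units R" and vals: "F z = \<zero>" "F w = u" "G z = \<ominus> u" "G w = \<zero>"
  shows "basis2 R M z w"
proof (rule basis2I[OF c])
  have uc: "u \<in> carrier R" using u by blast
  show "x \<odot>\<^bsub>M\<^esub> z \<oplus>\<^bsub>M\<^esub> y \<odot>\<^bsub>M\<^esub> w \<in> carrier M" if "x \<in> carrier R" "y \<in> carrier R" for x y
    using that c by simp
  fix x y x' y' assume xy: "x \<in> carrier R" "y \<in> carrier R" "x' \<in> carrier R" "y' \<in> carrier R"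
    and eq: "x \<odot>\<^bsub>M\<^esub> z \<oplus>\<^bsub>M\<^esub> y \<odot>\<^bsub>M\<^esub> w = x' \<odot>\<^bsub>M\<^esub> z \<oplus>\<^bsub>M\<^esub> y' \<odot>\<^bsub>M\<^esub> w"
  have cancel: "s = t" if "s \<in> carrier R" "t \<in> carrier R" "s \<otimes> u = t \<otimes> u" for s t
  proof -
    have "s = (s \<otimes> u) \<otimes> inv u" using that(1) u uc by (simp add: m_assoc)
    also have "\<dots> = t" unfolding that(3) using that(2) u uc by (simp add: m_assoc)
    finally show ?thesis .
  qed
  have "y \<otimes> u = y' \<otimes> u"
    using arg_cong[OF eq, of F] xy c uc by (simp add: F vals)
  moreover have "\<ominus> (x \<otimes> u) = \<ominus> (x' \<otimes> u)"
    using arg_cong[OF eq, of G] xy c uc by (simp add: G vals r_minus)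
  then have "x \<otimes> u = x' \<otimes> u"
    using xy uc by (metis R.minus_minus R.m_closed)
  ultimately show "x = x' \<and> y = y'" using cancel xy by blast
qed (use span in blast)

lemma (in abelian_group) add_minus_cancel:
  assumes "x \<in> carrier G" "y \<in> carrier G"
  shows "x \<oplus> (y \<oplus> \<ominus> x) = y"
proof -
  have "x \<oplus> (y \<oplus> \<ominus> x) = y \<oplus> (x \<oplus> \<ominus> x)" using assms by (intro a_lcomm) simp_all
  then show ?thesis using assms by (simp add: r_neg)
qed

lemma (in abelian_group) add_minus_cancel2:
  assumes "x \<in> carrier G" "y \<in> carrier G" "z \<in> carrier G"
  shows "x \<oplus> (y \<oplus> (z \<oplus> \<ominus> x)) = y \<oplus> z"
proof -
  have "x \<oplus> (y \<oplus> (z \<oplus> \<ominus> x)) = y \<oplus> (x \<oplus> (z \<oplus> \<ominus> x))" using assms by (intro a_lcomm) simp_all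
  then show ?thesis using assms by (simp add: add_minus_cancel)
qed

text \<open>The relations coming from the frames carry negated coefficients on both sides; this
  moves them across.\<close>

lemma (in Module.module) smult_minus_swap:
  assumes c: "{a, b, c, d} \<subseteq> carrier R" "{x, y, z, w} \<subseteq> carrier M"
    and eq: "a \<odot>\<^bsub>M\<^esub> x \<oplus>\<^bsub>M\<^esub> (\<ominus> b) \<odot>\<^bsub>M\<^esub> y = c \<odot>\<^bsub>M\<^esub> z \<oplus>\<^bsub>M\<^esub> (\<ominus> d) \<odot>\<^bsub>M\<^esub> w"
  shows "a \<odot>\<^bsub>M\<^esub> x \<oplus>\<^bsub>M\<^esub> d \<odot>\<^bsub>M\<^esub> w = c \<odot>\<^bsub>M\<^esub> z \<oplus>\<^bsub>M\<^esub> b \<odot>\<^bsub>M\<^esub> y"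
proof -
  have cl: "a \<in> carrier R" "b \<in> carrier R" "c \<in> carrier R" "d \<in> carrier R"
    "x \<in> carrier M" "y \<in> carrier M" "z \<in> carrier M" "w \<in> carrier M" using c by auto
  have "a \<odot>\<^bsub>M\<^esub> x \<oplus>\<^bsub>M\<^esub> d \<odot>\<^bsub>M\<^esub> w = (a \<odot>\<^bsub>M\<^esub> x \<oplus>\<^bsub>M\<^esub> (\<ominus> b) \<odot>\<^bsub>M\<^esub> y) \<oplus>\<^bsub>M\<^esub> (b \<odot>\<^bsub>M\<^esub> y \<oplus>\<^bsub>M\<^esub> d \<odot>\<^bsub>M\<^esub> w)"
    using cl by (simp add: smult_l_minus M.add.m_ac M.r_neg1 M.r_neg2 M.r_neg M.add_minus_cancel)
  also have "\<dots> = c \<odot>\<^bsub>M\<^esub> z \<oplus>\<^bsub>M\<^esub> b \<odot>\<^bsub>M\<^esub> y"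
    unfolding eq using cl by (simp add: smult_l_minus M.add.m_ac M.r_neg1 M.r_neg2 M.r_neg M.add_minus_cancel)
  finally show ?thesis .
qed

text \<open>A three-term relation is solved for either term of its left side, so that a coefficient
  which is a unit can be isolated.\<close>

lemma (in Module.module) smult_relation_solve:
  assumes c: "{a, b, c} \<subseteq> carrier R" "{x, y, z} \<subseteq> carrier M"
    and eq: "a \<odot>\<^bsub>M\<^esub> x \<oplus>\<^bsub>M\<^esub> b \<odot>\<^bsub>M\<^esub> y = c \<odot>\<^bsub>M\<^esub> z"
  shows "a \<odot>\<^bsub>M\<^esub> x = c \<odot>\<^bsub>M\<^esub> z \<oplus>\<^bsub>M\<^esub> (\<ominus> b) \<odot>\<^bsub>M\<^esub> y" "b \<odot>\<^bsub>M\<^esub> y = (\<ominus> a) \<odot>\<^bsub>M\<^esub> x \<oplus>\<^bsub>M\<^esub> c \<odot>\<^bsub>M\<^esub> z"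
proof -
  have cl: "a \<in> carrier R" "b \<in> carrier R" "x \<in> carrier M" "y \<in> carrier M" using c by auto
  show "a \<odot>\<^bsub>M\<^esub> x = c \<odot>\<^bsub>M\<^esub> z \<oplus>\<^bsub>M\<^esub> (\<ominus> b) \<odot>\<^bsub>M\<^esub> y" "b \<odot>\<^bsub>M\<^esub> y = (\<ominus> a) \<odot>\<^bsub>M\<^esub> x \<oplus>\<^bsub>M\<^esub> c \<odot>\<^bsub>M\<^esub> z"
    unfolding eq[symmetric] using cl by (simp_all add: smult_l_minus M.add.m_ac M.r_neg1 M.r_neg2 M.r_neg M.add_minus_cancel)
qed

text \<open>Commutativity of \<open>S\<close> makes each of its elements act
  \<open>R\<close>-linearly on the module.\<close>

lemma smult_scalar_restriction_linear:
  assumes "Module.algebra R S" "Module.module S M"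
    and "s \<in> carrier S" "m \<in> carrier M" "n \<in> carrier M" "x \<in> carrier R" "y \<in> carrier R"
  shows "s \<odot>\<^bsub>M\<^esub> (x \<odot>\<^bsub>scalar_restriction S M\<^esub> m \<oplus>\<^bsub>M\<^esub> y \<odot>\<^bsub>scalar_restriction S M\<^esub> n) =
    x \<odot>\<^bsub>scalar_restriction S M\<^esub> (s \<odot>\<^bsub>M\<^esub> m) \<oplus>\<^bsub>M\<^esub> y \<odot>\<^bsub>scalar_restriction S M\<^esub> (s \<odot>\<^bsub>M\<^esub> n)"
proof -
  interpret A: Module.algebra R S by (rule assms(1))
  interpret M: Module.module S M by (rule assms(2))
  have comm: "s \<otimes>\<^bsub>S\<^esub> t = t \<otimes>\<^bsub>S\<^esub> s" if "t \<in> carrier S" for t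
    using A.m_comm[OF assms(3) that] .
  have "s \<odot>\<^bsub>M\<^esub> (t \<odot>\<^bsub>M\<^esub> m) = t \<odot>\<^bsub>M\<^esub> (s \<odot>\<^bsub>M\<^esub> m)" if "t \<in> carrier S" "m \<in> carrier M" for t m
    using that assms(3) comm[OF that(1)] by (simp flip: M.smult_assoc1)
  then show ?thesis
    using assms(3-7) by (simp add: M.smult_r_distr)
qed

text \<open>With \<alpha> acting on coordinates by an explicit matrix, bilinear forms on two modules
  can be written down and checked by coefficients; this is what the functionals on the tensor
  product need.\<close>

lemma frame_coordinates:
  fixes R :: "('r, 'y) ring_scheme" (structure)
  assumes algebra: "Module.algebra R S" and M: "Module.module S M"
    and e: "basis2 R (scalar_restriction S M) e\<^sub>1 e\<^sub>2" and \<alpha>: "\<alpha> \<in> carrier S" and c: "{p, q, s, t} \<subseteq> carrier R"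
    and \<alpha>e: "\<alpha> \<odot>\<^bsub>M\<^esub> e\<^sub>1 = p \<odot>\<^bsub>scalar_restriction S M\<^esub> e\<^sub>1 \<oplus>\<^bsub>M\<^esub> q \<odot>\<^bsub>scalar_restriction S M\<^esub> e\<^sub>2"
      "\<alpha> \<odot>\<^bsub>M\<^esub> e\<^sub>2 = s \<odot>\<^bsub>scalar_restriction S M\<^esub> e\<^sub>1 \<oplus>\<^bsub>M\<^esub> t \<odot>\<^bsub>scalar_restriction S M\<^esub> e\<^sub>2"
  obtains x y where "\<forall>m\<in>carrier M. x m \<in> carrier R \<and> y m \<in> carrier R"
    "\<forall>m\<in>carrier M. \<forall>n\<in>carrier M. x (m \<oplus>\<^bsub>M\<^esub> n) = x m \<oplus> x n \<and> y (m \<oplus>\<^bsub>M\<^esub> n) = y m \<oplus> y n"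
    "\<forall>a\<in>carrier R. \<forall>m\<in>carrier M. x (a \<odot>\<^bsub>scalar_restriction S M\<^esub> m) = a \<otimes> x m \<and>
      y (a \<odot>\<^bsub>scalar_restriction S M\<^esub> m) = a \<otimes> y m"
    "\<forall>m\<in>carrier M. x (\<alpha> \<odot>\<^bsub>M\<^esub> m) = p \<otimes> x m \<oplus> s \<otimes> y m \<and> y (\<alpha> \<odot>\<^bsub>M\<^esub> m) = q \<otimes> x m \<oplus> t \<otimes> y m"
    "x e\<^sub>1 = \<one> \<and> y e\<^sub>1 = \<zero> \<and> x e\<^sub>2 = \<zero> \<and> y e\<^sub>2 = \<one>"
proof -
  interpret A: Module.algebra R S by (rule algebra)
  interpret M: Module.module S M by (rule M)
  let ?MR = "scalar_restriction S M"
  interpret MR: Module.module R ?MR by (rule module_scalar_restriction[OF algebra M])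
  have [simp]: "p \<in> carrier R" "q \<in> carrier R" "s \<in> carrier R" "t \<in> carrier R" using c by auto
  obtain x y where c0: "\<forall>m\<in>carrier ?MR. x m \<in> carrier R" "\<forall>m\<in>carrier ?MR. y m \<in> carrier R"
    and m0: "\<forall>m\<in>carrier ?MR. m = x m \<odot>\<^bsub>?MR\<^esub> e\<^sub>1 \<oplus>\<^bsub>?MR\<^esub> y m \<odot>\<^bsub>?MR\<^esub> e\<^sub>2"
    and x0: "\<forall>a\<in>carrier R. \<forall>b\<in>carrier R. x (a \<odot>\<^bsub>?MR\<^esub> e\<^sub>1 \<oplus>\<^bsub>?MR\<^esub> b \<odot>\<^bsub>?MR\<^esub> e\<^sub>2) = a"
    and y0: "\<forall>a\<in>carrier R. \<forall>b\<in>carrier R. y (a \<odot>\<^bsub>?MR\<^esub> e\<^sub>1 \<oplus>\<^bsub>?MR\<^esub> b \<odot>\<^bsub>?MR\<^esub> e\<^sub>2) = b"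
    by (rule MR.basis2_coordinates[OF e], rule that)
  note x = x0[rule_format] and y = y0[rule_format]
  have xc [simp]: "x m \<in> carrier R" "y m \<in> carrier R"
    and xm: "m = x m \<odot>\<^bsub>?MR\<^esub> e\<^sub>1 \<oplus>\<^bsub>?MR\<^esub> y m \<odot>\<^bsub>?MR\<^esub> e\<^sub>2" if "m \<in> carrier M" for m
    using bspec[OF c0(1), of m] bspec[OF c0(2), of m] bspec[OF m0, of m] that by (simp_all only: scalar_restriction_simps)
  have eMR: "e\<^sub>1 \<in> carrier ?MR" "e\<^sub>2 \<in> carrier ?MR" using basis2_closed[OF e] .
  then have eM: "e\<^sub>1 \<in> carrier M" "e\<^sub>2 \<in> carrier M" by simp_all
  have comb: "x (a \<odot>\<^bsub>?MR\<^esub> m \<oplus>\<^bsub>?MR\<^esub> b \<odot>\<^bsub>?MR\<^esub> m') = a \<otimes> x m \<oplus> b \<otimes> x m' \<and>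
      y (a \<odot>\<^bsub>?MR\<^esub> m \<oplus>\<^bsub>?MR\<^esub> b \<odot>\<^bsub>?MR\<^esub> m') = a \<otimes> y m \<oplus> b \<otimes> y m'"
    if "a \<in> carrier R" "b \<in> carrier R" "m \<in> carrier M" "m' \<in> carrier M" for a b m m'
  proof -
    have "a \<odot>\<^bsub>?MR\<^esub> m \<oplus>\<^bsub>?MR\<^esub> b \<odot>\<^bsub>?MR\<^esub> m' =
        a \<odot>\<^bsub>?MR\<^esub> (x m \<odot>\<^bsub>?MR\<^esub> e\<^sub>1 \<oplus>\<^bsub>?MR\<^esub> y m \<odot>\<^bsub>?MR\<^esub> e\<^sub>2) \<oplus>\<^bsub>?MR\<^esub> b \<odot>\<^bsub>?MR\<^esub> (x m' \<odot>\<^bsub>?MR\<^esub> e\<^sub>1 \<oplus>\<^bsub>?MR\<^esub> y m' \<odot>\<^bsub>?MR\<^esub> e\<^sub>2)"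
      using xm[OF that(3)] xm[OF that(4)] by simp
    also have "\<dots> = (a \<otimes> x m \<oplus> b \<otimes> x m') \<odot>\<^bsub>?MR\<^esub> e\<^sub>1 \<oplus>\<^bsub>?MR\<^esub> (a \<otimes> y m \<oplus> b \<otimes> y m') \<odot>\<^bsub>?MR\<^esub> e\<^sub>2"
      by (rule MR.combine[OF eMR]) (use that in simp)
    finally show ?thesis
      using x[of "a \<otimes> x m \<oplus> b \<otimes> x m'" "a \<otimes> y m \<oplus> b \<otimes> y m'"]
        y[of "a \<otimes> x m \<oplus> b \<otimes> x m'" "a \<otimes> y m \<oplus> b \<otimes> y m'"] that by simp
  qed
  have add: "x (m \<oplus>\<^bsub>M\<^esub> n) = x m \<oplus> x n \<and> y (m \<oplus>\<^bsub>M\<^esub> n) = y m \<oplus> y n" if "m \<in> carrier M" "n \<in> carrier M" for m n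
    using comb[of \<one> \<one> m n] MR.smult_one that by (simp_all del: scalar_restriction_simps(4))
  have smult: "x (a \<odot>\<^bsub>?MR\<^esub> m) = a \<otimes> x m \<and> y (a \<odot>\<^bsub>?MR\<^esub> m) = a \<otimes> y m" if "a \<in> carrier R" "m \<in> carrier M" for a m
    using comb[of a \<zero> m m] MR.smult_l_null that by (simp_all del: scalar_restriction_simps(4) MR.smult_l_null)
      (simp_all add: A.smult_l_null)
  have e_vals: "x (\<alpha> \<odot>\<^bsub>M\<^esub> e\<^sub>1) = p" "y (\<alpha> \<odot>\<^bsub>M\<^esub> e\<^sub>1) = q" "x (\<alpha> \<odot>\<^bsub>M\<^esub> e\<^sub>2) = s" "y (\<alpha> \<odot>\<^bsub>M\<^esub> e\<^sub>2) = t"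
    unfolding \<alpha>e using x[of p q] y[of p q] x[of s t] y[of s t]
    by (simp_all only: scalar_restriction_simps \<open>p \<in> carrier R\<close> \<open>q \<in> carrier R\<close> \<open>s \<in> carrier R\<close> \<open>t \<in> carrier R\<close>)
  have alpha: "x (\<alpha> \<odot>\<^bsub>M\<^esub> m) = p \<otimes> x m \<oplus> s \<otimes> y m \<and> y (\<alpha> \<odot>\<^bsub>M\<^esub> m) = q \<otimes> x m \<oplus> t \<otimes> y m" if m: "m \<in> carrier M" for m
  proof -
    have "\<alpha> \<odot>\<^bsub>M\<^esub> m = \<alpha> \<odot>\<^bsub>M\<^esub> (x m \<odot>\<^bsub>?MR\<^esub> e\<^sub>1 \<oplus>\<^bsub>M\<^esub> y m \<odot>\<^bsub>?MR\<^esub> e\<^sub>2)"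
      using xm[OF m] by simp
    also have "\<dots> = x m \<odot>\<^bsub>?MR\<^esub> (\<alpha> \<odot>\<^bsub>M\<^esub> e\<^sub>1) \<oplus>\<^bsub>?MR\<^esub> y m \<odot>\<^bsub>?MR\<^esub> (\<alpha> \<odot>\<^bsub>M\<^esub> e\<^sub>2)"
      using smult_scalar_restriction_linear[OF algebra M \<alpha> eM xc(1)[OF m] xc(2)[OF m]] by simp
    finally have "\<alpha> \<odot>\<^bsub>M\<^esub> m = x m \<odot>\<^bsub>?MR\<^esub> (\<alpha> \<odot>\<^bsub>M\<^esub> e\<^sub>1) \<oplus>\<^bsub>?MR\<^esub> y m \<odot>\<^bsub>?MR\<^esub> (\<alpha> \<odot>\<^bsub>M\<^esub> e\<^sub>2)" .
    then show ?thesis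
      using comb[OF xc(1)[OF m] xc(2)[OF m], of "\<alpha> \<odot>\<^bsub>M\<^esub> e\<^sub>1" "\<alpha> \<odot>\<^bsub>M\<^esub> e\<^sub>2"] m \<alpha> eM
      by (simp only: e_vals M.smult_closed) (simp add: A.R.m_comm)
  qed
  have basis_vals: "x e\<^sub>1 = \<one> \<and> y e\<^sub>1 = \<zero> \<and> x e\<^sub>2 = \<zero> \<and> y e\<^sub>2 = \<one>"
    using x[of \<one> \<zero>] y[of \<one> \<zero>] x[of \<zero> \<one>] y[of \<zero> \<one>] MR.smult_one MR.smult_l_null eMR
    by (simp_all del: scalar_restriction_simps(4))
  show thesis
    by (rule that[of x y]) (use add smult alpha basis_vals in simp_all)
qed

text \<open>The zero term and the negated coefficients are spelled out so that each equation is a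
  full row of a 2 x 2 matrix, the form that \<open>frame_coordinates\<close> and
  \<open>pseudoregular_trace_det\<close> take.\<close>

locale frame_pair =
  fixes R :: "('r, 'y) ring_scheme" (structure) and S :: "('r, 's, 'z) module_scheme"
    and M :: "('s, 'm, 'w) module_scheme" and N :: "('s, 'n, 'v) module_scheme"
    and \<alpha> e\<^sub>1 e\<^sub>2 f\<^sub>1 f\<^sub>2 a b c a' c' d r
  assumes algebra: "Module.algebra R S" and module_M: "Module.module S M" and module_N: "Module.module S N"
    and basis_S: "basis2 R S \<one>\<^bsub>S\<^esub> \<alpha>"
    and basis_M: "basis2 R (scalar_restriction S M) e\<^sub>1 e\<^sub>2"
    and basis_N: "basis2 R (scalar_restriction S N) f\<^sub>1 f\<^sub>2"
    and closed: "a \<in> carrier R" "b \<in> carrier R" "c \<in> carrier R" "a' \<in> carrier R" "c' \<in> carrier R"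
      "d \<in> carrier R" "r \<in> carrier R"
    and alpha_e1: "\<alpha> \<odot>\<^bsub>M\<^esub> e\<^sub>1 = b \<odot>\<^bsub>scalar_restriction S M\<^esub> e\<^sub>1 \<oplus>\<^bsub>M\<^esub> (\<ominus> a) \<odot>\<^bsub>scalar_restriction S M\<^esub> e\<^sub>2"
    and alpha_e2: "\<alpha> \<odot>\<^bsub>M\<^esub> e\<^sub>2 = c \<odot>\<^bsub>scalar_restriction S M\<^esub> e\<^sub>1 \<oplus>\<^bsub>M\<^esub> \<zero> \<odot>\<^bsub>scalar_restriction S M\<^esub> e\<^sub>2"
    and alpha_f1: "\<alpha> \<odot>\<^bsub>N\<^esub> f\<^sub>1 = d \<odot>\<^bsub>scalar_restriction S N\<^esub> f\<^sub>1 \<oplus>\<^bsub>N\<^esub> (\<ominus> a') \<odot>\<^bsub>scalar_restriction S N\<^esub> f\<^sub>2"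
    and alpha_f2: "\<alpha> \<odot>\<^bsub>N\<^esub> f\<^sub>2 = c' \<odot>\<^bsub>scalar_restriction S N\<^esub> f\<^sub>1 \<oplus>\<^bsub>N\<^esub> (\<ominus> r) \<odot>\<^bsub>scalar_restriction S N\<^esub> f\<^sub>2"

text \<open>Kept apart from \<open>frame_pair\<close> because frames can be made from arbitrary
  bases, whereas these two equations come from pseudoregularity over affine open sets. Once known,
  they hold over every smaller open set.\<close>

locale tensor_frame = frame_pair +
  assumes trace: "d = b \<oplus> r" and pfaffian: "a \<otimes> c = a' \<otimes> c' \<ominus> r \<otimes> d"
begin

abbreviation (input) "MR \<equiv> scalar_restriction S M"
abbreviation (input) "NR \<equiv> scalar_restriction S N"
abbreviation (input) "T \<equiv> tensor_module S M N"
abbreviation (input) "TR \<equiv> scalar_restriction S (tensor_module S M N)"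
abbreviation (input) "pt \<equiv> pure_tensor S M N"

sublocale P: tensor_pair S M N
  by (rule tensor_pair.intro[OF module_M module_N])

interpretation A: Module.algebra R S by (rule algebra)
interpretation M: Module.module S M by (rule module_M)
interpretation N: Module.module S N by (rule module_N)
interpretation T: Module.module S T by (rule P.module_tensor)
interpretation MR: Module.module R MR by (rule module_scalar_restriction[OF algebra module_M])
interpretation NR: Module.module R NR by (rule module_scalar_restriction[OF algebra module_N])
interpretation TR: Module.module R TR by (rule module_scalar_restriction[OF algebra P.module_tensor])

lemma e_closed: "e\<^sub>1 \<in> carrier M" "e\<^sub>2 \<in> carrier M"
  using basis2_closed[OF basis_M] by simp_all

lemma f_closed: "f\<^sub>1 \<in> carrier N" "f\<^sub>2 \<in> carrier N"
  using basis2_closed[OF basis_N] by simp_all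

lemma alpha_closed: "\<alpha> \<in> carrier S"
  using basis2_closed[OF basis_S] by simp

lemma TR_pure_left: "x \<in> carrier R \<Longrightarrow> m \<in> carrier M \<Longrightarrow> n \<in> carrier N \<Longrightarrow>
    x \<odot>\<^bsub>TR\<^esub> pt m n = pt (x \<odot>\<^bsub>MR\<^esub> m) n"
  by (simp add: P.tensor_smult(3))

lemma TR_pure_right: "x \<in> carrier R \<Longrightarrow> m \<in> carrier M \<Longrightarrow> n \<in> carrier N \<Longrightarrow>
    x \<odot>\<^bsub>TR\<^esub> pt m n = pt m (x \<odot>\<^bsub>NR\<^esub> n)"
  by (simp add: P.tensor_smult(3) P.pure_tensor_balanced)

lemma pure_comb_left:
  assumes "x \<in> carrier R" "y \<in> carrier R" "m \<in> carrier M" "m' \<in> carrier M" "n \<in> carrier N"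
  shows "pt (x \<odot>\<^bsub>MR\<^esub> m \<oplus>\<^bsub>M\<^esub> y \<odot>\<^bsub>MR\<^esub> m') n = x \<odot>\<^bsub>TR\<^esub> pt m n \<oplus>\<^bsub>TR\<^esub> y \<odot>\<^bsub>TR\<^esub> pt m' n"
  using assms P.pure_tensor_add_left[of "x \<odot>\<^bsub>MR\<^esub> m" "y \<odot>\<^bsub>MR\<^esub> m'" n]
    TR_pure_left[of x m n] TR_pure_left[of y m' n] by simp

lemma pure_comb_right:
  assumes "x \<in> carrier R" "y \<in> carrier R" "m \<in> carrier M" "n \<in> carrier N" "n' \<in> carrier N"
  shows "pt m (x \<odot>\<^bsub>NR\<^esub> n \<oplus>\<^bsub>N\<^esub> y \<odot>\<^bsub>NR\<^esub> n') = x \<odot>\<^bsub>TR\<^esub> pt m n \<oplus>\<^bsub>TR\<^esub> y \<odot>\<^bsub>TR\<^esub> pt m n'"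
  using assms P.pure_tensor_add_right[of m "x \<odot>\<^bsub>NR\<^esub> n" "y \<odot>\<^bsub>NR\<^esub> n'"]
    TR_pure_right[of x m n] TR_pure_right[of y m n'] by simp

text \<open>The last four hypotheses are the relations \<open>\<alpha> e\<^sub>i \<otimes> f\<^sub>j = e\<^sub>i \<otimes> \<alpha> f\<^sub>j\<close>.\<close>

lemma tensor_functional:
  assumes B: "cring B" and \<pi>: "\<pi> \<in> ring_hom R B"
    and l: "l11 \<in> carrier B" "l12 \<in> carrier B" "l21 \<in> carrier B" "l22 \<in> carrier B"
    and rel11: "\<pi> b \<otimes>\<^bsub>B\<^esub> l11 \<ominus>\<^bsub>B\<^esub> \<pi> a \<otimes>\<^bsub>B\<^esub> l21 = \<pi> d \<otimes>\<^bsub>B\<^esub> l11 \<ominus>\<^bsub>B\<^esub> \<pi> a' \<otimes>\<^bsub>B\<^esub> l12"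
    and rel12: "\<pi> b \<otimes>\<^bsub>B\<^esub> l12 \<ominus>\<^bsub>B\<^esub> \<pi> a \<otimes>\<^bsub>B\<^esub> l22 = \<pi> c' \<otimes>\<^bsub>B\<^esub> l11 \<ominus>\<^bsub>B\<^esub> \<pi> r \<otimes>\<^bsub>B\<^esub> l12"
    and rel21: "\<pi> c \<otimes>\<^bsub>B\<^esub> l11 = \<pi> d \<otimes>\<^bsub>B\<^esub> l21 \<ominus>\<^bsub>B\<^esub> \<pi> a' \<otimes>\<^bsub>B\<^esub> l22"
    and rel22: "\<pi> c \<otimes>\<^bsub>B\<^esub> l12 = \<pi> c' \<otimes>\<^bsub>B\<^esub> l21 \<ominus>\<^bsub>B\<^esub> \<pi> r \<otimes>\<^bsub>B\<^esub> l22"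
  shows "\<exists>h. (\<forall>t\<in>carrier T. h t \<in> carrier B) \<and>
    (\<forall>t\<in>carrier T. \<forall>t'\<in>carrier T. h (t \<oplus>\<^bsub>TR\<^esub> t') = h t \<oplus>\<^bsub>B\<^esub> h t') \<and>
    (\<forall>x\<in>carrier R. \<forall>t\<in>carrier T. h (x \<odot>\<^bsub>TR\<^esub> t) = \<pi> x \<otimes>\<^bsub>B\<^esub> h t) \<and>
    h (pt e\<^sub>1 f\<^sub>1) = l11 \<and> h (pt e\<^sub>1 f\<^sub>2) = l12 \<and> h (pt e\<^sub>2 f\<^sub>1) = l21 \<and> h (pt e\<^sub>2 f\<^sub>2) = l22"
proof -
  interpret B: cring B by (rule B)
  have \<pi>c [simp]: "\<pi> x \<in> carrier B" if "x \<in> carrier R" for x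
    using ring_hom_closed[OF \<pi> that] .
  have \<pi>_add: "\<pi> (x \<oplus> y) = \<pi> x \<oplus>\<^bsub>B\<^esub> \<pi> y" "\<pi> (x \<otimes> y) = \<pi> x \<otimes>\<^bsub>B\<^esub> \<pi> y" if "x \<in> carrier R" "y \<in> carrier R" for x y
    using ring_hom_add[OF \<pi> that] ring_hom_mult[OF \<pi> that] by auto
  have \<pi>_minus: "\<pi> (\<ominus> x) = \<ominus>\<^bsub>B\<^esub> \<pi> x" if "x \<in> carrier R" for x
    using ring_hom_minus[OF \<pi> A.R.ring_axioms B.ring_axioms that] .
  have \<pi>_one: "\<pi> \<one> = \<one>\<^bsub>B\<^esub>" "\<pi> \<zero> = \<zero>\<^bsub>B\<^esub>"
    using ring_hom_one[OF \<pi>] ring_hom_zero[OF \<pi> A.R.ring_axioms B.ring_axioms] by auto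
  obtain x1 x2 where x: "\<forall>m\<in>carrier M. x1 m \<in> carrier R \<and> x2 m \<in> carrier R"
    "\<forall>m\<in>carrier M. \<forall>n\<in>carrier M. x1 (m \<oplus>\<^bsub>M\<^esub> n) = x1 m \<oplus> x1 n \<and> x2 (m \<oplus>\<^bsub>M\<^esub> n) = x2 m \<oplus> x2 n"
    "\<forall>s\<in>carrier R. \<forall>m\<in>carrier M. x1 (s \<odot>\<^bsub>MR\<^esub> m) = s \<otimes> x1 m \<and> x2 (s \<odot>\<^bsub>MR\<^esub> m) = s \<otimes> x2 m"
    "\<forall>m\<in>carrier M. x1 (\<alpha> \<odot>\<^bsub>M\<^esub> m) = b \<otimes> x1 m \<oplus> c \<otimes> x2 m \<and> x2 (\<alpha> \<odot>\<^bsub>M\<^esub> m) = \<ominus> a \<otimes> x1 m \<oplus> \<zero> \<otimes> x2 m"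
    "x1 e\<^sub>1 = \<one> \<and> x2 e\<^sub>1 = \<zero> \<and> x1 e\<^sub>2 = \<zero> \<and> x2 e\<^sub>2 = \<one>"
    by (rule frame_coordinates[OF algebra module_M basis_M alpha_closed _ alpha_e1 alpha_e2]) (use closed in simp, rule that)
  obtain y1 y2 where y: "\<forall>n\<in>carrier N. y1 n \<in> carrier R \<and> y2 n \<in> carrier R"
    "\<forall>m\<in>carrier N. \<forall>n\<in>carrier N. y1 (m \<oplus>\<^bsub>N\<^esub> n) = y1 m \<oplus> y1 n \<and> y2 (m \<oplus>\<^bsub>N\<^esub> n) = y2 m \<oplus> y2 n"
    "\<forall>s\<in>carrier R. \<forall>n\<in>carrier N. y1 (s \<odot>\<^bsub>NR\<^esub> n) = s \<otimes> y1 n \<and> y2 (s \<odot>\<^bsub>NR\<^esub> n) = s \<otimes> y2 n"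
    "\<forall>n\<in>carrier N. y1 (\<alpha> \<odot>\<^bsub>N\<^esub> n) = d \<otimes> y1 n \<oplus> c' \<otimes> y2 n \<and> y2 (\<alpha> \<odot>\<^bsub>N\<^esub> n) = \<ominus> a' \<otimes> y1 n \<oplus> \<ominus> r \<otimes> y2 n"
    "y1 f\<^sub>1 = \<one> \<and> y2 f\<^sub>1 = \<zero> \<and> y1 f\<^sub>2 = \<zero> \<and> y2 f\<^sub>2 = \<one>"
    by (rule frame_coordinates[OF algebra module_N basis_N alpha_closed _ alpha_f1 alpha_f2]) (use closed in simp, rule that)
  have xc [simp]: "x1 m \<in> carrier R" "x2 m \<in> carrier R" if "m \<in> carrier M" for m
    using x(1) that by blast+
  have yc [simp]: "y1 n \<in> carrier R" "y2 n \<in> carrier R" if "n \<in> carrier N" for n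
    using y(1) that by blast+
  have x_add: "x1 (m \<oplus>\<^bsub>M\<^esub> m') = x1 m \<oplus> x1 m'" "x2 (m \<oplus>\<^bsub>M\<^esub> m') = x2 m \<oplus> x2 m'"
    if "m \<in> carrier M" "m' \<in> carrier M" for m m'
    using x(2) that by blast+
  have y_add: "y1 (m \<oplus>\<^bsub>N\<^esub> m') = y1 m \<oplus> y1 m'" "y2 (m \<oplus>\<^bsub>N\<^esub> m') = y2 m \<oplus> y2 m'"
    if "m \<in> carrier N" "m' \<in> carrier N" for m m'
    using y(2) that by blast+
  have x_smult: "x1 (s \<odot>\<^bsub>MR\<^esub> m) = s \<otimes> x1 m" "x2 (s \<odot>\<^bsub>MR\<^esub> m) = s \<otimes> x2 m"
    if "s \<in> carrier R" "m \<in> carrier M" for s m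
    using bspec[OF bspec[OF x(3) that(1)] that(2)] by blast+
  have y_smult: "y1 (s \<odot>\<^bsub>NR\<^esub> m) = s \<otimes> y1 m" "y2 (s \<odot>\<^bsub>NR\<^esub> m) = s \<otimes> y2 m"
    if "s \<in> carrier R" "m \<in> carrier N" for s m
    using bspec[OF bspec[OF y(3) that(1)] that(2)] by blast+
  have x_alpha: "x1 (\<alpha> \<odot>\<^bsub>M\<^esub> m) = b \<otimes> x1 m \<oplus> c \<otimes> x2 m \<and> x2 (\<alpha> \<odot>\<^bsub>M\<^esub> m) = \<ominus> a \<otimes> x1 m" if "m \<in> carrier M" for m
    using bspec[OF x(4) that] that closed by simp
  have y_alpha: "y1 (\<alpha> \<odot>\<^bsub>N\<^esub> n) = d \<otimes> y1 n \<oplus> c' \<otimes> y2 n \<and> y2 (\<alpha> \<odot>\<^bsub>N\<^esub> n) = \<ominus> a' \<otimes> y1 n \<oplus> \<ominus> r \<otimes> y2 n"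
    if "n \<in> carrier N" for n
    using bspec[OF y(4) that] .
  \<comment> \<open>The bilinear form on coordinate pairs whose Gram matrix has the entries
    \<open>l11\<close>, \<open>l12\<close>, \<open>l21\<close>, \<open>l22\<close>.\<close>
  define Q where "Q p1 p2 q1 q2 = p1 \<otimes>\<^bsub>B\<^esub> (q1 \<otimes>\<^bsub>B\<^esub> l11) \<oplus>\<^bsub>B\<^esub> p1 \<otimes>\<^bsub>B\<^esub> (q2 \<otimes>\<^bsub>B\<^esub> l12) \<oplus>\<^bsub>B\<^esub>
      (p2 \<otimes>\<^bsub>B\<^esub> (q1 \<otimes>\<^bsub>B\<^esub> l21) \<oplus>\<^bsub>B\<^esub> p2 \<otimes>\<^bsub>B\<^esub> (q2 \<otimes>\<^bsub>B\<^esub> l22))" for p1 p2 q1 q2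
  have Q_closed [simp]: "Q p1 p2 q1 q2 \<in> carrier B"
    if "p1 \<in> carrier B" "p2 \<in> carrier B" "q1 \<in> carrier B" "q2 \<in> carrier B" for p1 p2 q1 q2
    using that l by (simp add: Q_def)
  have Q_add: "Q (p1 \<oplus>\<^bsub>B\<^esub> p1') (p2 \<oplus>\<^bsub>B\<^esub> p2') q1 q2 = Q p1 p2 q1 q2 \<oplus>\<^bsub>B\<^esub> Q p1' p2' q1 q2"
      "Q q1 q2 (p1 \<oplus>\<^bsub>B\<^esub> p1') (p2 \<oplus>\<^bsub>B\<^esub> p2') = Q q1 q2 p1 p2 \<oplus>\<^bsub>B\<^esub> Q q1 q2 p1' p2'"
    if "p1 \<in> carrier B" "p2 \<in> carrier B" "p1' \<in> carrier B" "p2' \<in> carrier B" "q1 \<in> carrier B" "q2 \<in> carrier B"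
    for p1 p2 p1' p2' q1 q2
    using that l by (simp_all add: Q_def B.l_distr B.r_distr B.add.m_ac)
  have Q_smult: "Q (s \<otimes>\<^bsub>B\<^esub> p1) (s \<otimes>\<^bsub>B\<^esub> p2) q1 q2 = s \<otimes>\<^bsub>B\<^esub> Q p1 p2 q1 q2"
      "Q p1 p2 (s \<otimes>\<^bsub>B\<^esub> q1) (s \<otimes>\<^bsub>B\<^esub> q2) = s \<otimes>\<^bsub>B\<^esub> Q p1 p2 q1 q2"
    if "s \<in> carrier B" "p1 \<in> carrier B" "p2 \<in> carrier B" "q1 \<in> carrier B" "q2 \<in> carrier B" for s p1 p2 q1 q2
    using that l by (simp_all add: Q_def B.r_distr B.m_ac)
  note \<pi>cl = closed[THEN \<pi>c]
  \<comment> \<open>Compatibility with \<alpha>: after expansion in the products of a left and a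
    right coordinate, the four coefficients on the two sides are equal by the four
    relations.\<close>
  have Q_alpha: "Q (\<pi> b \<otimes>\<^bsub>B\<^esub> p1 \<oplus>\<^bsub>B\<^esub> \<pi> c \<otimes>\<^bsub>B\<^esub> p2) (\<ominus>\<^bsub>B\<^esub> \<pi> a \<otimes>\<^bsub>B\<^esub> p1) q1 q2 =
      Q p1 p2 (\<pi> d \<otimes>\<^bsub>B\<^esub> q1 \<oplus>\<^bsub>B\<^esub> \<pi> c' \<otimes>\<^bsub>B\<^esub> q2) (\<ominus>\<^bsub>B\<^esub> \<pi> a' \<otimes>\<^bsub>B\<^esub> q1 \<oplus>\<^bsub>B\<^esub> \<ominus>\<^bsub>B\<^esub> \<pi> r \<otimes>\<^bsub>B\<^esub> q2)"
    if p: "p1 \<in> carrier B" "p2 \<in> carrier B" "q1 \<in> carrier B" "q2 \<in> carrier B" for p1 p2 q1 q2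
  proof -
    have "Q (\<pi> b \<otimes>\<^bsub>B\<^esub> p1 \<oplus>\<^bsub>B\<^esub> \<pi> c \<otimes>\<^bsub>B\<^esub> p2) (\<ominus>\<^bsub>B\<^esub> \<pi> a \<otimes>\<^bsub>B\<^esub> p1) q1 q2 =
        p1 \<otimes>\<^bsub>B\<^esub> (q1 \<otimes>\<^bsub>B\<^esub> (\<pi> b \<otimes>\<^bsub>B\<^esub> l11 \<ominus>\<^bsub>B\<^esub> \<pi> a \<otimes>\<^bsub>B\<^esub> l21)) \<oplus>\<^bsub>B\<^esub> p1 \<otimes>\<^bsub>B\<^esub> (q2 \<otimes>\<^bsub>B\<^esub> (\<pi> b \<otimes>\<^bsub>B\<^esub> l12 \<ominus>\<^bsub>B\<^esub> \<pi> a \<otimes>\<^bsub>B\<^esub> l22)) \<oplus>\<^bsub>B\<^esub>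
        (p2 \<otimes>\<^bsub>B\<^esub> (q1 \<otimes>\<^bsub>B\<^esub> (\<pi> c \<otimes>\<^bsub>B\<^esub> l11)) \<oplus>\<^bsub>B\<^esub> p2 \<otimes>\<^bsub>B\<^esub> (q2 \<otimes>\<^bsub>B\<^esub> (\<pi> c \<otimes>\<^bsub>B\<^esub> l12)))"
      unfolding Q_def using p l \<pi>cl
      by (simp add: a_minus_def B.l_distr B.r_distr B.l_minus B.r_minus B.m_ac B.add.m_ac)
    also have "\<dots> = Q p1 p2 (\<pi> d \<otimes>\<^bsub>B\<^esub> q1 \<oplus>\<^bsub>B\<^esub> \<pi> c' \<otimes>\<^bsub>B\<^esub> q2) (\<ominus>\<^bsub>B\<^esub> \<pi> a' \<otimes>\<^bsub>B\<^esub> q1 \<oplus>\<^bsub>B\<^esub> \<ominus>\<^bsub>B\<^esub> \<pi> r \<otimes>\<^bsub>B\<^esub> q2)"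
      unfolding Q_def rel11 rel12 rel21 rel22 using p l \<pi>cl
      by (simp add: a_minus_def B.l_distr B.r_distr B.l_minus B.r_minus B.m_ac B.add.m_ac)
    finally show ?thesis .
  qed
  define \<beta> where "\<beta> m n = Q (\<pi> (x1 m)) (\<pi> (x2 m)) (\<pi> (y1 n)) (\<pi> (y2 n))" for m n
  have \<beta>_closed [simp]: "\<beta> m n \<in> carrier B" if "m \<in> carrier M" "n \<in> carrier N" for m n
    using that by (simp add: \<beta>_def)
  have \<beta>_add: "\<beta> (m \<oplus>\<^bsub>M\<^esub> m') n = \<beta> m n \<oplus>\<^bsub>B\<^esub> \<beta> m' n"
    if "m \<in> carrier M" "m' \<in> carrier M" "n \<in> carrier N" for m m' n
    using that by (simp add: \<beta>_def x_add \<pi>_add Q_add)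
  have \<beta>_add': "\<beta> m (n \<oplus>\<^bsub>N\<^esub> n') = \<beta> m n \<oplus>\<^bsub>B\<^esub> \<beta> m n'"
    if "m \<in> carrier M" "n \<in> carrier N" "n' \<in> carrier N" for m n n'
    using that by (simp add: \<beta>_def y_add \<pi>_add Q_add)
  have \<beta>_smult: "\<beta> (s \<odot>\<^bsub>MR\<^esub> m) n = \<pi> s \<otimes>\<^bsub>B\<^esub> \<beta> m n" "\<beta> m (s \<odot>\<^bsub>NR\<^esub> n) = \<pi> s \<otimes>\<^bsub>B\<^esub> \<beta> m n"
    if "s \<in> carrier R" "m \<in> carrier M" "n \<in> carrier N" for s m n
    using that unfolding \<beta>_def x_smult[OF that(1,2)] y_smult[OF that(1,3)]
    by (simp_all add: \<pi>_add Q_smult)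
  have \<beta>_alpha: "\<beta> (\<alpha> \<odot>\<^bsub>M\<^esub> m) n = \<beta> m (\<alpha> \<odot>\<^bsub>N\<^esub> n)" if "m \<in> carrier M" "n \<in> carrier N" for m n
    using Q_alpha[of "\<pi> (x1 m)" "\<pi> (x2 m)" "\<pi> (y1 n)" "\<pi> (y2 n)"] that closed
    by (simp add: \<beta>_def x_alpha y_alpha \<pi>_add \<pi>_minus)
  have "balanced_map S M N B \<beta>"
  proof (rule balanced_mapI)
    fix \<sigma> m n assume \<sigma>: "\<sigma> \<in> carrier S" and m: "m \<in> carrier M" and n: "n \<in> carrier N"
    \<comment> \<open>Every scalar is s + t \<alpha>, so compatibility with \<open>R\<close> and
      with \<alpha> yields balancedness over all of \<open>S\<close>.\<close>
    obtain s t where st: "s \<in> carrier R" "t \<in> carrier R" "\<sigma> = s \<odot>\<^bsub>S\<^esub> \<one>\<^bsub>S\<^esub> \<oplus>\<^bsub>S\<^esub> t \<odot>\<^bsub>S\<^esub> \<alpha>"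
      using basis2_rep[OF basis_S \<sigma>] .
    have \<sigma>': "\<sigma> = s \<odot>\<^bsub>S\<^esub> \<one>\<^bsub>S\<^esub> \<oplus>\<^bsub>S\<^esub> (t \<odot>\<^bsub>S\<^esub> \<one>\<^bsub>S\<^esub>) \<otimes>\<^bsub>S\<^esub> \<alpha>"
      using st alpha_closed A.scalar_one_smult by simp
    have \<sigma>m: "\<sigma> \<odot>\<^bsub>M\<^esub> m = s \<odot>\<^bsub>MR\<^esub> m \<oplus>\<^bsub>M\<^esub> t \<odot>\<^bsub>MR\<^esub> (\<alpha> \<odot>\<^bsub>M\<^esub> m)"
      unfolding \<sigma>' using st(1,2) m alpha_closed by (simp add: M.smult_l_distr M.smult_assoc1)
    have \<sigma>n: "\<sigma> \<odot>\<^bsub>N\<^esub> n = s \<odot>\<^bsub>NR\<^esub> n \<oplus>\<^bsub>N\<^esub> t \<odot>\<^bsub>NR\<^esub> (\<alpha> \<odot>\<^bsub>N\<^esub> n)"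
      unfolding \<sigma>' using st(1,2) n alpha_closed by (simp add: N.smult_l_distr N.smult_assoc1)
    have cl: "\<alpha> \<odot>\<^bsub>M\<^esub> m \<in> carrier M" "\<alpha> \<odot>\<^bsub>N\<^esub> n \<in> carrier N"
      using m n alpha_closed by simp_all
    have cl': "s \<odot>\<^bsub>MR\<^esub> m \<in> carrier M" "t \<odot>\<^bsub>MR\<^esub> (\<alpha> \<odot>\<^bsub>M\<^esub> m) \<in> carrier M"
        "s \<odot>\<^bsub>NR\<^esub> n \<in> carrier N" "t \<odot>\<^bsub>NR\<^esub> (\<alpha> \<odot>\<^bsub>N\<^esub> n) \<in> carrier N"
      using m n cl st by simp_all
    show "\<beta> (\<sigma> \<odot>\<^bsub>M\<^esub> m) n = \<beta> m (\<sigma> \<odot>\<^bsub>N\<^esub> n)"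
      unfolding \<sigma>m \<sigma>n \<beta>_add[OF cl'(1,2) n] \<beta>_add'[OF m cl'(3,4)] \<beta>_smult(1)[OF st(1) m n]
        \<beta>_smult(2)[OF st(1) m n] \<beta>_smult(1)[OF st(2) cl(1) n] \<beta>_smult(2)[OF st(2) m cl(2)] \<beta>_alpha[OF m n] ..
  qed (simp_all add: \<beta>_add \<beta>_add')
  then obtain h where h: "\<And>t. t \<in> carrier T \<Longrightarrow> h t \<in> carrier B"
      "\<And>t t'. t \<in> carrier T \<Longrightarrow> t' \<in> carrier T \<Longrightarrow> h (t \<oplus>\<^bsub>T\<^esub> t') = h t \<oplus>\<^bsub>B\<^esub> h t'"
      "\<And>m n. m \<in> carrier M \<Longrightarrow> n \<in> carrier N \<Longrightarrow> h (pt m n) = \<beta> m n"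
    using P.tensor_universal[OF B.abelian_group_axioms] by blast
  have h_smult: "h (x \<odot>\<^bsub>TR\<^esub> t) = \<pi> x \<otimes>\<^bsub>B\<^esub> h t" if x: "x \<in> carrier R" and t: "t \<in> carrier T" for x t
    using t
  proof (induction rule: P.tensor_induct)
    case (pure m n)
    have "x \<odot>\<^bsub>MR\<^esub> m \<in> carrier M" using x pure by simp
    then show ?case
      unfolding TR_pure_left[OF x pure] using h(3) pure \<beta>_smult(1)[OF x pure] by simp
  next
    case (add t t')
    have "t \<in> carrier TR" "t' \<in> carrier TR" using add by simp_all
    then have "x \<odot>\<^bsub>TR\<^esub> (t \<oplus>\<^bsub>TR\<^esub> t') = x \<odot>\<^bsub>TR\<^esub> t \<oplus>\<^bsub>TR\<^esub> x \<odot>\<^bsub>TR\<^esub> t'" "x \<odot>\<^bsub>TR\<^esub> t \<in> carrier T" "x \<odot>\<^bsub>TR\<^esub> t' \<in> carrier T"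
      using TR.smult_r_distr[OF x, of t t'] TR.smult_closed[OF x, of t] TR.smult_closed[OF x, of t'] by simp_all
    then show ?case
      using add h x by (simp add: B.r_distr)
  qed
  note basis_vals = x(5) y(5)
  show ?thesis
    by (rule exI[of _ h]) (use h h_smult e_closed f_closed l in \<open>simp_all add: \<beta>_def basis_vals Q_def \<pi>_one\<close>)
qed

lemma tensor_form:
  assumes "l11 \<in> carrier R" "l12 \<in> carrier R" "l21 \<in> carrier R" "l22 \<in> carrier R"
    and "b \<otimes> l11 \<ominus> a \<otimes> l21 = d \<otimes> l11 \<ominus> a' \<otimes> l12"
    and "b \<otimes> l12 \<ominus> a \<otimes> l22 = c' \<otimes> l11 \<ominus> r \<otimes> l12"
    and "c \<otimes> l11 = d \<otimes> l21 \<ominus> a' \<otimes> l22"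
    and "c \<otimes> l12 = c' \<otimes> l21 \<ominus> r \<otimes> l22"
  shows "\<exists>h. (\<forall>t\<in>carrier T. \<forall>t'\<in>carrier T. h (t \<oplus>\<^bsub>TR\<^esub> t') = h t \<oplus> h t') \<and>
    (\<forall>x\<in>carrier R. \<forall>t\<in>carrier T. h (x \<odot>\<^bsub>TR\<^esub> t) = x \<otimes> h t) \<and>
    h (pt e\<^sub>1 f\<^sub>1) = l11 \<and> h (pt e\<^sub>1 f\<^sub>2) = l12 \<and> h (pt e\<^sub>2 f\<^sub>1) = l21 \<and> h (pt e\<^sub>2 f\<^sub>2) = l22"
proof -
  have "(\<lambda>x. x) \<in> ring_hom R R" by (rule ring_hom_memI) simp_all
  then obtain h where h: "\<forall>t\<in>carrier T. \<forall>t'\<in>carrier T. h (t \<oplus>\<^bsub>TR\<^esub> t') = h t \<oplus> h t'"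
    "\<forall>x\<in>carrier R. \<forall>t\<in>carrier T. h (x \<odot>\<^bsub>TR\<^esub> t) = x \<otimes> h t"
    "h (pt e\<^sub>1 f\<^sub>1) = l11" "h (pt e\<^sub>1 f\<^sub>2) = l12" "h (pt e\<^sub>2 f\<^sub>1) = l21" "h (pt e\<^sub>2 f\<^sub>2) = l22"
    using tensor_functional[OF A.R.cring_axioms _ assms(1-8)] by (elim exE conjE meta_impE) (assumption, rule that)
  show ?thesis
    by (intro exI[of _ h] conjI h)
qed

text \<open>Generation of the tensor product by the four elements, phrased as induction so that the
  property of being a combination of two chosen elements can be inserted for
  \<open>P\<close>.\<close>

lemma tensor_span:
  assumes t: "t \<in> carrier T"
    and z: "P (pt e\<^sub>1 f\<^sub>1)" "P (pt e\<^sub>1 f\<^sub>2)" "P (pt e\<^sub>2 f\<^sub>1)" "P (pt e\<^sub>2 f\<^sub>2)"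
    and P_add: "\<And>t t'. t \<in> carrier T \<Longrightarrow> t' \<in> carrier T \<Longrightarrow> P t \<Longrightarrow> P t' \<Longrightarrow> P (t \<oplus>\<^bsub>TR\<^esub> t')"
    and P_smult: "\<And>x t. x \<in> carrier R \<Longrightarrow> t \<in> carrier T \<Longrightarrow> P t \<Longrightarrow> P (x \<odot>\<^bsub>TR\<^esub> t)"
  shows "P t"
proof -
  have smult_T: "x \<odot>\<^bsub>TR\<^esub> t \<in> carrier T" if "x \<in> carrier R" "t \<in> carrier T" for x t
    using TR.smult_closed[of x t] that by (simp only: scalar_restriction_simps)
  have P_comb: "P (x \<odot>\<^bsub>TR\<^esub> t \<oplus>\<^bsub>TR\<^esub> y \<odot>\<^bsub>TR\<^esub> t')"
    if "x \<in> carrier R" "y \<in> carrier R" "t \<in> carrier T" "t' \<in> carrier T" "P t" "P t'" for x y t t'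
    by (rule P_add[OF smult_T[OF that(1,3)] smult_T[OF that(2,4)] P_smult[OF that(1,3,5)] P_smult[OF that(2,4,6)]])
  show ?thesis
    using t
  proof (induction rule: P.tensor_induct)
    case (pure m n)
    have "m \<in> carrier MR" "n \<in> carrier NR" using pure by simp_all
    then obtain x y x' y' where xy: "x \<in> carrier R" "y \<in> carrier R" "m = x \<odot>\<^bsub>MR\<^esub> e\<^sub>1 \<oplus>\<^bsub>MR\<^esub> y \<odot>\<^bsub>MR\<^esub> e\<^sub>2"
      and xy': "x' \<in> carrier R" "y' \<in> carrier R" "n = x' \<odot>\<^bsub>NR\<^esub> f\<^sub>1 \<oplus>\<^bsub>NR\<^esub> y' \<odot>\<^bsub>NR\<^esub> f\<^sub>2"
      using basis2_rep[OF basis_M] basis2_rep[OF basis_N] by metis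
    have m: "m = x \<odot>\<^bsub>MR\<^esub> e\<^sub>1 \<oplus>\<^bsub>M\<^esub> y \<odot>\<^bsub>MR\<^esub> e\<^sub>2" and n: "n = x' \<odot>\<^bsub>NR\<^esub> f\<^sub>1 \<oplus>\<^bsub>N\<^esub> y' \<odot>\<^bsub>NR\<^esub> f\<^sub>2"
      using xy(3) xy'(3) by (simp_all only: scalar_restriction_simps)
    have "P (pt e\<^sub>1 n)" "P (pt e\<^sub>2 n)"
      unfolding n using pure_comb_right[OF xy'(1,2) e_closed(1) f_closed] pure_comb_right[OF xy'(1,2) e_closed(2) f_closed]
        P_comb[OF xy'(1,2)] z e_closed f_closed P.pure_tensor_closed by metis+
    then show ?case
      unfolding m pure_comb_left[OF xy(1,2) e_closed pure(2)]
      by (intro P_comb xy(1,2) P.pure_tensor_closed e_closed pure(2))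
  next
    case (add t t')
    then show ?case using P_add[of t t'] by simp
  qed
qed

section \<open>The relations and their alternating matrix\<close>

lemma pt_closed: "pt e\<^sub>1 f\<^sub>1 \<in> carrier T" "pt e\<^sub>1 f\<^sub>2 \<in> carrier T" "pt e\<^sub>2 f\<^sub>1 \<in> carrier T" "pt e\<^sub>2 f\<^sub>2 \<in> carrier T"
  by (intro P.pure_tensor_closed e_closed f_closed)+

text \<open>Moving \<alpha> across the tensor sign in e_i \<otimes> f_j gives one relation for each
  pair of indices. In the first two, \<open>trace\<close> makes \<open>b\<close> disappear: it
  cancels in one and is absorbed into \<open>d\<close> in the other.\<close>

lemma rel11: "r \<odot>\<^bsub>TR\<^esub> pt e\<^sub>1 f\<^sub>1 \<oplus>\<^bsub>TR\<^esub> a \<odot>\<^bsub>TR\<^esub> pt e\<^sub>2 f\<^sub>1 = a' \<odot>\<^bsub>TR\<^esub> pt e\<^sub>1 f\<^sub>2"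
  and rel12: "c' \<odot>\<^bsub>TR\<^esub> pt e\<^sub>1 f\<^sub>1 \<oplus>\<^bsub>TR\<^esub> a \<odot>\<^bsub>TR\<^esub> pt e\<^sub>2 f\<^sub>2 = d \<odot>\<^bsub>TR\<^esub> pt e\<^sub>1 f\<^sub>2"
  and rel21: "c \<odot>\<^bsub>TR\<^esub> pt e\<^sub>1 f\<^sub>1 \<oplus>\<^bsub>TR\<^esub> a' \<odot>\<^bsub>TR\<^esub> pt e\<^sub>2 f\<^sub>2 = d \<odot>\<^bsub>TR\<^esub> pt e\<^sub>2 f\<^sub>1"
  and rel22: "c \<odot>\<^bsub>TR\<^esub> pt e\<^sub>1 f\<^sub>2 \<oplus>\<^bsub>TR\<^esub> r \<odot>\<^bsub>TR\<^esub> pt e\<^sub>2 f\<^sub>2 = c' \<odot>\<^bsub>TR\<^esub> pt e\<^sub>2 f\<^sub>1"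
proof -
  have pt: "pt e\<^sub>1 f\<^sub>1 \<in> carrier TR" "pt e\<^sub>1 f\<^sub>2 \<in> carrier TR" "pt e\<^sub>2 f\<^sub>1 \<in> carrier TR" "pt e\<^sub>2 f\<^sub>2 \<in> carrier TR"
    using pt_closed by (simp_all only: scalar_restriction_simps)
  have bal: "pt (\<alpha> \<odot>\<^bsub>M\<^esub> m) n = pt m (\<alpha> \<odot>\<^bsub>N\<^esub> n)" if "m \<in> carrier M" "n \<in> carrier N" for m n
    using P.pure_tensor_balanced[OF alpha_closed that] by simp
  have minus_closed: "\<ominus> a \<in> carrier R" "\<ominus> a' \<in> carrier R" "\<ominus> r \<in> carrier R" "\<zero> \<in> carrier R"
    using closed by simp_all
  note cl = closed minus_closed e_closed f_closed
  note left = pure_comb_left[OF _ _ e_closed] and right = pure_comb_right[OF _ _ _ f_closed]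
  have "b \<odot>\<^bsub>TR\<^esub> pt e\<^sub>1 f\<^sub>1 \<oplus>\<^bsub>TR\<^esub> (\<ominus> a) \<odot>\<^bsub>TR\<^esub> pt e\<^sub>2 f\<^sub>1 = d \<odot>\<^bsub>TR\<^esub> pt e\<^sub>1 f\<^sub>1 \<oplus>\<^bsub>TR\<^esub> (\<ominus> a') \<odot>\<^bsub>TR\<^esub> pt e\<^sub>1 f\<^sub>2"
    using bal[OF e_closed(1) f_closed(1)] unfolding alpha_e1 alpha_f1 left[OF cl(2) cl(8) f_closed(1)]
      right[OF cl(6) cl(9) e_closed(1)] .
  then have "b \<odot>\<^bsub>TR\<^esub> pt e\<^sub>1 f\<^sub>1 \<oplus>\<^bsub>TR\<^esub> a' \<odot>\<^bsub>TR\<^esub> pt e\<^sub>1 f\<^sub>2 = d \<odot>\<^bsub>TR\<^esub> pt e\<^sub>1 f\<^sub>1 \<oplus>\<^bsub>TR\<^esub> a \<odot>\<^bsub>TR\<^esub> pt e\<^sub>2 f\<^sub>1"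
    by (rule TR.smult_minus_swap[rotated 2]) (use cl pt in simp_all)
  also have "\<dots> = b \<odot>\<^bsub>TR\<^esub> pt e\<^sub>1 f\<^sub>1 \<oplus>\<^bsub>TR\<^esub> (r \<odot>\<^bsub>TR\<^esub> pt e\<^sub>1 f\<^sub>1 \<oplus>\<^bsub>TR\<^esub> a \<odot>\<^bsub>TR\<^esub> pt e\<^sub>2 f\<^sub>1)"
    unfolding trace TR.smult_l_distr[OF cl(2) cl(7) pt(1)]
    by (intro TR.a_assoc TR.smult_closed cl pt)
  finally show "r \<odot>\<^bsub>TR\<^esub> pt e\<^sub>1 f\<^sub>1 \<oplus>\<^bsub>TR\<^esub> a \<odot>\<^bsub>TR\<^esub> pt e\<^sub>2 f\<^sub>1 = a' \<odot>\<^bsub>TR\<^esub> pt e\<^sub>1 f\<^sub>2"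
    using TR.add.l_cancel[OF _ _ _ TR.smult_closed[OF cl(2) pt(1)]] TR.smult_closed cl pt by (metis TR.add.m_closed)
  have "b \<odot>\<^bsub>TR\<^esub> pt e\<^sub>1 f\<^sub>2 \<oplus>\<^bsub>TR\<^esub> (\<ominus> a) \<odot>\<^bsub>TR\<^esub> pt e\<^sub>2 f\<^sub>2 = c' \<odot>\<^bsub>TR\<^esub> pt e\<^sub>1 f\<^sub>1 \<oplus>\<^bsub>TR\<^esub> (\<ominus> r) \<odot>\<^bsub>TR\<^esub> pt e\<^sub>1 f\<^sub>2"
    using bal[OF e_closed(1) f_closed(2)] unfolding alpha_e1 alpha_f2 left[OF cl(2) cl(8) f_closed(2)]
      right[OF cl(5) cl(10) e_closed(1)] .
  then have "b \<odot>\<^bsub>TR\<^esub> pt e\<^sub>1 f\<^sub>2 \<oplus>\<^bsub>TR\<^esub> r \<odot>\<^bsub>TR\<^esub> pt e\<^sub>1 f\<^sub>2 = c' \<odot>\<^bsub>TR\<^esub> pt e\<^sub>1 f\<^sub>1 \<oplus>\<^bsub>TR\<^esub> a \<odot>\<^bsub>TR\<^esub> pt e\<^sub>2 f\<^sub>2"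
    by (rule TR.smult_minus_swap[rotated 2]) (use cl pt in simp_all)
  then show "c' \<odot>\<^bsub>TR\<^esub> pt e\<^sub>1 f\<^sub>1 \<oplus>\<^bsub>TR\<^esub> a \<odot>\<^bsub>TR\<^esub> pt e\<^sub>2 f\<^sub>2 = d \<odot>\<^bsub>TR\<^esub> pt e\<^sub>1 f\<^sub>2"
    unfolding trace TR.smult_l_distr[OF cl(2) cl(7) pt(2)] by (rule sym)
  have zero: "x \<oplus>\<^bsub>TR\<^esub> \<zero> \<odot>\<^bsub>TR\<^esub> t = x" if "x \<in> carrier TR" "t \<in> carrier TR" for x t
    unfolding TR.smult_l_null[OF that(2)] by (rule TR.r_zero[OF that(1)])
  have "c \<odot>\<^bsub>TR\<^esub> pt e\<^sub>1 f\<^sub>1 \<oplus>\<^bsub>TR\<^esub> \<zero> \<odot>\<^bsub>TR\<^esub> pt e\<^sub>2 f\<^sub>1 = d \<odot>\<^bsub>TR\<^esub> pt e\<^sub>2 f\<^sub>1 \<oplus>\<^bsub>TR\<^esub> (\<ominus> a') \<odot>\<^bsub>TR\<^esub> pt e\<^sub>2 f\<^sub>2"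
    using bal[OF e_closed(2) f_closed(1)] unfolding alpha_e2 alpha_f1 left[OF cl(3) cl(11) f_closed(1)]
      right[OF cl(6) cl(9) e_closed(2)] .
  \<comment> \<open>The vanishing coefficient is written as \<ominus> 0 to fit the shape of
    \<open>smult_minus_swap\<close>.\<close>
  then have "c \<odot>\<^bsub>TR\<^esub> pt e\<^sub>1 f\<^sub>1 \<oplus>\<^bsub>TR\<^esub> (\<ominus> \<zero>) \<odot>\<^bsub>TR\<^esub> pt e\<^sub>2 f\<^sub>1 = d \<odot>\<^bsub>TR\<^esub> pt e\<^sub>2 f\<^sub>1 \<oplus>\<^bsub>TR\<^esub> (\<ominus> a') \<odot>\<^bsub>TR\<^esub> pt e\<^sub>2 f\<^sub>2"
    unfolding A.R.minus_zero .
  then have "c \<odot>\<^bsub>TR\<^esub> pt e\<^sub>1 f\<^sub>1 \<oplus>\<^bsub>TR\<^esub> a' \<odot>\<^bsub>TR\<^esub> pt e\<^sub>2 f\<^sub>2 = d \<odot>\<^bsub>TR\<^esub> pt e\<^sub>2 f\<^sub>1 \<oplus>\<^bsub>TR\<^esub> \<zero> \<odot>\<^bsub>TR\<^esub> pt e\<^sub>2 f\<^sub>1"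
    by (rule TR.smult_minus_swap[rotated 2]) (use cl pt in simp_all)
  then show "c \<odot>\<^bsub>TR\<^esub> pt e\<^sub>1 f\<^sub>1 \<oplus>\<^bsub>TR\<^esub> a' \<odot>\<^bsub>TR\<^esub> pt e\<^sub>2 f\<^sub>2 = d \<odot>\<^bsub>TR\<^esub> pt e\<^sub>2 f\<^sub>1"
    unfolding zero[OF TR.smult_closed[OF cl(6) pt(3)] pt(3)] .
  have "c \<odot>\<^bsub>TR\<^esub> pt e\<^sub>1 f\<^sub>2 \<oplus>\<^bsub>TR\<^esub> \<zero> \<odot>\<^bsub>TR\<^esub> pt e\<^sub>2 f\<^sub>2 = c' \<odot>\<^bsub>TR\<^esub> pt e\<^sub>2 f\<^sub>1 \<oplus>\<^bsub>TR\<^esub> (\<ominus> r) \<odot>\<^bsub>TR\<^esub> pt e\<^sub>2 f\<^sub>2"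
    using bal[OF e_closed(2) f_closed(2)] unfolding alpha_e2 alpha_f2 left[OF cl(3) cl(11) f_closed(2)]
      right[OF cl(5) cl(10) e_closed(2)] .
  then have "c \<odot>\<^bsub>TR\<^esub> pt e\<^sub>1 f\<^sub>2 \<oplus>\<^bsub>TR\<^esub> (\<ominus> \<zero>) \<odot>\<^bsub>TR\<^esub> pt e\<^sub>2 f\<^sub>2 = c' \<odot>\<^bsub>TR\<^esub> pt e\<^sub>2 f\<^sub>1 \<oplus>\<^bsub>TR\<^esub> (\<ominus> r) \<odot>\<^bsub>TR\<^esub> pt e\<^sub>2 f\<^sub>2"
    unfolding A.R.minus_zero .
  then have "c \<odot>\<^bsub>TR\<^esub> pt e\<^sub>1 f\<^sub>2 \<oplus>\<^bsub>TR\<^esub> r \<odot>\<^bsub>TR\<^esub> pt e\<^sub>2 f\<^sub>2 = c' \<odot>\<^bsub>TR\<^esub> pt e\<^sub>2 f\<^sub>1 \<oplus>\<^bsub>TR\<^esub> \<zero> \<odot>\<^bsub>TR\<^esub> pt e\<^sub>2 f\<^sub>2"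
    by (rule TR.smult_minus_swap[rotated 2]) (use cl pt in simp_all)
  then show "c \<odot>\<^bsub>TR\<^esub> pt e\<^sub>1 f\<^sub>2 \<oplus>\<^bsub>TR\<^esub> r \<odot>\<^bsub>TR\<^esub> pt e\<^sub>2 f\<^sub>2 = c' \<odot>\<^bsub>TR\<^esub> pt e\<^sub>2 f\<^sub>1"
    unfolding zero[OF TR.smult_closed[OF cl(5) pt(3)] pt(4)] .
qed

abbreviation (input) "linear_form h z w x y \<equiv>
    (\<forall>t\<in>carrier T. \<forall>t'\<in>carrier T. h (t \<oplus>\<^bsub>TR\<^esub> t') = h t \<oplus> h t') \<and>
    (\<forall>x\<in>carrier R. \<forall>t\<in>carrier T. h (x \<odot>\<^bsub>TR\<^esub> t) = x \<otimes> h t) \<and> h z = x \<and> h w = y"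

text \<open>After division by \<open>u\<close>, the equations \<open>v1\<close> and
  \<open>v2\<close> put the remaining two generators into the span of \<open>z\<close> and
  \<open>w\<close>; the two forms give independence. The generators are only asked to lie in the set
  of the four named elements, so any two of them can play the role of \<open>z\<close> and
  \<open>w\<close>.\<close>

lemma basis2_if_unit:
  assumes u: "u \<in> Units R" and zw: "z \<in> carrier T" "w \<in> carrier T" and v: "v\<^sub>1 \<in> carrier T" "v\<^sub>2 \<in> carrier T"
    and gens: "{pt e\<^sub>1 f\<^sub>1, pt e\<^sub>1 f\<^sub>2, pt e\<^sub>2 f\<^sub>1, pt e\<^sub>2 f\<^sub>2} \<subseteq> {z, w, v\<^sub>1, v\<^sub>2}"
    and xy: "{x\<^sub>1, y\<^sub>1, x\<^sub>2, y\<^sub>2} \<subseteq> carrier R"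
    and v1: "u \<odot>\<^bsub>TR\<^esub> v\<^sub>1 = x\<^sub>1 \<odot>\<^bsub>TR\<^esub> z \<oplus>\<^bsub>TR\<^esub> y\<^sub>1 \<odot>\<^bsub>TR\<^esub> w"
    and v2: "u \<odot>\<^bsub>TR\<^esub> v\<^sub>2 = x\<^sub>2 \<odot>\<^bsub>TR\<^esub> z \<oplus>\<^bsub>TR\<^esub> y\<^sub>2 \<odot>\<^bsub>TR\<^esub> w"
    and F: "\<exists>h. linear_form h z w \<zero> u" and G: "\<exists>h. linear_form h z w (\<ominus> u) \<zero>"
  shows "basis2 R TR z w"
proof -
  have T: "carrier TR = carrier T" by simp
  have uc: "u \<in> carrier R" "inv u \<in> carrier R"
    using u A.R.Units_closed A.R.Units_inv_closed by blast+
  define P where "P t \<longleftrightarrow> (\<exists>x\<in>carrier R. \<exists>y\<in>carrier R. t = x \<odot>\<^bsub>TR\<^esub> z \<oplus>\<^bsub>TR\<^esub> y \<odot>\<^bsub>TR\<^esub> w)" for t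
  note zwR = zw[folded T]
  have PI: "P (x \<odot>\<^bsub>TR\<^esub> z \<oplus>\<^bsub>TR\<^esub> y \<odot>\<^bsub>TR\<^esub> w)" if "x \<in> carrier R" "y \<in> carrier R" for x y
    unfolding P_def using that by blast
  have P_add: "P (t \<oplus>\<^bsub>TR\<^esub> t')" if t: "P t" "P t'" for t t'
  proof -
    obtain x y x' y' where *: "x \<in> carrier R" "y \<in> carrier R" "x' \<in> carrier R" "y' \<in> carrier R"
      and eq: "t = x \<odot>\<^bsub>TR\<^esub> z \<oplus>\<^bsub>TR\<^esub> y \<odot>\<^bsub>TR\<^esub> w" "t' = x' \<odot>\<^bsub>TR\<^esub> z \<oplus>\<^bsub>TR\<^esub> y' \<odot>\<^bsub>TR\<^esub> w"
      using t unfolding P_def by (elim bexE) (rule that)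
    have "t \<oplus>\<^bsub>TR\<^esub> t' = (x \<oplus> x') \<odot>\<^bsub>TR\<^esub> z \<oplus>\<^bsub>TR\<^esub> (y \<oplus> y') \<odot>\<^bsub>TR\<^esub> w"
      unfolding eq TR.smult_l_distr[OF *(1,3) zwR(1)] TR.smult_l_distr[OF *(2,4) zwR(2)]
      using TR.smult_closed[OF *(1) zwR(1)] TR.smult_closed[OF *(3) zwR(1)]
        TR.smult_closed[OF *(2) zwR(2)] TR.smult_closed[OF *(4) zwR(2)]
      by (simp only: TR.M.add.m_ac TR.M.add.m_closed)
    then show ?thesis using PI * by (metis A.R.a_closed)
  qed
  have P_smult: "P (s \<odot>\<^bsub>TR\<^esub> t)" if t: "P t" and s: "s \<in> carrier R" for s t
  proof -
    obtain x y where *: "x \<in> carrier R" "y \<in> carrier R"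
      and eq: "t = x \<odot>\<^bsub>TR\<^esub> z \<oplus>\<^bsub>TR\<^esub> y \<odot>\<^bsub>TR\<^esub> w"
      using t unfolding P_def by (elim bexE) (rule that)
    have "s \<odot>\<^bsub>TR\<^esub> t = (s \<otimes> x) \<odot>\<^bsub>TR\<^esub> z \<oplus>\<^bsub>TR\<^esub> (s \<otimes> y) \<odot>\<^bsub>TR\<^esub> w"
      unfolding eq TR.smult_assoc1[OF s *(1) zwR(1)] TR.smult_assoc1[OF s *(2) zwR(2)]
      by (rule TR.smult_r_distr[OF s TR.smult_closed[OF *(1) zwR(1)] TR.smult_closed[OF *(2) zwR(2)]])
    then show ?thesis using PI * s by (metis A.R.m_closed)
  qed
  have inverse: "inv u \<odot>\<^bsub>TR\<^esub> (u \<odot>\<^bsub>TR\<^esub> t) = t" if "t \<in> carrier T" for t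
    unfolding TR.smult_assoc1[OF uc(2,1) that[folded T], symmetric] A.R.Units_l_inv[OF u]
    by (rule TR.smult_one[OF that[folded T]])
  have "P z"
    using PI[of \<one> \<zero>] TR.smult_one[OF zwR(1)] TR.smult_l_null[OF zwR(2)] TR.M.r_zero[OF zwR(1)] by simp
  moreover have "P w"
    using PI[of \<zero> \<one>] TR.smult_one[OF zwR(2)] TR.smult_l_null[OF zwR(1)] TR.M.l_zero[OF zwR(2)] by simp
  moreover have "P v\<^sub>1"
    using P_smult[OF PI[of x\<^sub>1 y\<^sub>1, folded v1] uc(2)] inverse[OF v(1)] xy by simp
  moreover have "P v\<^sub>2"
    using P_smult[OF PI[of x\<^sub>2 y\<^sub>2, folded v2] uc(2)] inverse[OF v(2)] xy by simp
  ultimately have P_gens: "P (pt e\<^sub>1 f\<^sub>1)" "P (pt e\<^sub>1 f\<^sub>2)" "P (pt e\<^sub>2 f\<^sub>1)" "P (pt e\<^sub>2 f\<^sub>2)"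
    using gens by auto
  have span: "P t" if "t \<in> carrier TR" for t
    by (rule tensor_span[OF that[unfolded T] P_gens]) (use P_add P_smult in blast)+
  obtain F where F0: "\<forall>t\<in>carrier T. \<forall>t'\<in>carrier T. F (t \<oplus>\<^bsub>TR\<^esub> t') = F t \<oplus> F t'"
    "\<forall>x\<in>carrier R. \<forall>t\<in>carrier T. F (x \<odot>\<^bsub>TR\<^esub> t) = x \<otimes> F t" "F z = \<zero>" "F w = u"
    using F by (elim exE conjE) (rule that)
  note F = F0[folded T]
  obtain G where G0: "\<forall>t\<in>carrier T. \<forall>t'\<in>carrier T. G (t \<oplus>\<^bsub>TR\<^esub> t') = G t \<oplus> G t'"
    "\<forall>x\<in>carrier R. \<forall>t\<in>carrier T. G (x \<odot>\<^bsub>TR\<^esub> t) = x \<otimes> G t" "G z = \<ominus> u" "G w = \<zero>"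
    using G by (elim exE conjE) (rule that)
  note G = G0[folded T]
  show ?thesis
    by (rule TR.basis2_functionals[OF span[unfolded P_def] zwR F(1,2)[rule_format] G(1,2)[rule_format] u F(3,4) G(3,4)])
qed

text \<open>On the generators in the order 11, 12, 21, 22 the forms take the values (0, a, a', d),
  (-a, 0, r, c'), (-a', -r, 0, c) and (-d, -c', -c, 0). This alternating matrix has Pfaffian a c -
  a' c' + r d; its vanishing together with d = b + r gives the hypotheses of
  \<open>tensor_form\<close> for each row.\<close>

lemma tensor_forms:
  "\<exists>h. linear_form h (pt e\<^sub>1 f\<^sub>1) (pt e\<^sub>1 f\<^sub>2) \<zero> a \<and> h (pt e\<^sub>2 f\<^sub>1) = a' \<and> h (pt e\<^sub>2 f\<^sub>2) = d"
  "\<exists>h. linear_form h (pt e\<^sub>1 f\<^sub>1) (pt e\<^sub>1 f\<^sub>2) (\<ominus> a) \<zero> \<and> h (pt e\<^sub>2 f\<^sub>1) = r \<and> h (pt e\<^sub>2 f\<^sub>2) = c'"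
  "\<exists>h. linear_form h (pt e\<^sub>1 f\<^sub>1) (pt e\<^sub>1 f\<^sub>2) (\<ominus> a') (\<ominus> r) \<and> h (pt e\<^sub>2 f\<^sub>1) = \<zero> \<and> h (pt e\<^sub>2 f\<^sub>2) = c"
  "\<exists>h. linear_form h (pt e\<^sub>1 f\<^sub>1) (pt e\<^sub>1 f\<^sub>2) (\<ominus> d) (\<ominus> c') \<and> h (pt e\<^sub>2 f\<^sub>1) = \<ominus> c \<and> h (pt e\<^sub>2 f\<^sub>2) = \<zero>"
proof -
  have pf: "c \<otimes> a = a' \<otimes> c' \<ominus> r \<otimes> d" "a \<otimes> c = a' \<otimes> c' \<ominus> r \<otimes> d"
    using pfaffian closed A.R.m_comm by simp_all
  note d = trace
  have bc: "b \<in> carrier R" "r \<in> carrier R" using closed by simp_all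
  note simps = A.R.l_distr A.R.r_distr A.R.l_minus A.R.r_minus A.R.m_comm A.R.m_assoc A.R.m_lcomm A.R.minus_add
    A.R.a_comm A.R.a_assoc A.R.a_lcomm A.R.minus_eq A.R.r_neg1 A.R.r_neg2 A.R.r_neg A.R.l_neg
    A.R.add_minus_cancel A.R.add_minus_cancel2
  show "\<exists>h. linear_form h (pt e\<^sub>1 f\<^sub>1) (pt e\<^sub>1 f\<^sub>2) \<zero> a \<and> h (pt e\<^sub>2 f\<^sub>1) = a' \<and> h (pt e\<^sub>2 f\<^sub>2) = d"
    using tensor_form[of \<zero> a a' d] closed pf by (simp add: d simps)
  show "\<exists>h. linear_form h (pt e\<^sub>1 f\<^sub>1) (pt e\<^sub>1 f\<^sub>2) (\<ominus> a) \<zero> \<and> h (pt e\<^sub>2 f\<^sub>1) = r \<and> h (pt e\<^sub>2 f\<^sub>2) = c'"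
    using tensor_form[of "\<ominus> a" \<zero> r c'] closed pf by (simp add: d simps)
  show "\<exists>h. linear_form h (pt e\<^sub>1 f\<^sub>1) (pt e\<^sub>1 f\<^sub>2) (\<ominus> a') (\<ominus> r) \<and> h (pt e\<^sub>2 f\<^sub>1) = \<zero> \<and> h (pt e\<^sub>2 f\<^sub>2) = c"
    using tensor_form[of "\<ominus> a'" "\<ominus> r" \<zero> c] closed pf by (simp add: d simps)
  show "\<exists>h. linear_form h (pt e\<^sub>1 f\<^sub>1) (pt e\<^sub>1 f\<^sub>2) (\<ominus> d) (\<ominus> c') \<and> h (pt e\<^sub>2 f\<^sub>1) = \<ominus> c \<and> h (pt e\<^sub>2 f\<^sub>2) = \<zero>"
    using tensor_form[of "\<ominus> d" "\<ominus> c'" "\<ominus> c" \<zero>] closed pf by (simp add: d simps)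
qed

text \<open>A unit \<open>u\<close> at place (i, j), i < j, of the matrix in
  \<open>tensor_forms\<close> makes generators i and j a basis. Rows i and j vanish on their own
  generator and take the values u and -u on the other one; and each of the remaining two generators
  has coefficient \<open>u\<close> in one of the four relations.\<close>

lemma basis2_pure_tensors:
  shows "a \<in> Units R \<Longrightarrow> basis2 R TR (pt e\<^sub>1 f\<^sub>1) (pt e\<^sub>1 f\<^sub>2)"
    and "a' \<in> Units R \<Longrightarrow> basis2 R TR (pt e\<^sub>1 f\<^sub>1) (pt e\<^sub>2 f\<^sub>1)"
    and "d \<in> Units R \<Longrightarrow> basis2 R TR (pt e\<^sub>1 f\<^sub>1) (pt e\<^sub>2 f\<^sub>2)"
    and "r \<in> Units R \<Longrightarrow> basis2 R TR (pt e\<^sub>1 f\<^sub>2) (pt e\<^sub>2 f\<^sub>1)"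
    and "c' \<in> Units R \<Longrightarrow> basis2 R TR (pt e\<^sub>1 f\<^sub>2) (pt e\<^sub>2 f\<^sub>2)"
    and "c \<in> Units R \<Longrightarrow> basis2 R TR (pt e\<^sub>2 f\<^sub>1) (pt e\<^sub>2 f\<^sub>2)"
proof -
  have T: "carrier TR = carrier T" by simp
  have cl: "{r, a, a'} \<subseteq> carrier R" "{c', a, d} \<subseteq> carrier R" "{c, a', d} \<subseteq> carrier R" "{c, r, c'} \<subseteq> carrier R"
    using closed by simp_all
  have minus: "\<ominus> a \<in> carrier R" "\<ominus> a' \<in> carrier R" "\<ominus> c \<in> carrier R" "\<ominus> c' \<in> carrier R" "\<ominus> d \<in> carrier R" "\<ominus> r \<in> carrier R"
    using closed by simp_all
  note pt = pt_closed[folded T]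
  have pts: "{pt e\<^sub>1 f\<^sub>1, pt e\<^sub>2 f\<^sub>1, pt e\<^sub>1 f\<^sub>2} \<subseteq> carrier TR" "{pt e\<^sub>1 f\<^sub>1, pt e\<^sub>2 f\<^sub>2, pt e\<^sub>1 f\<^sub>2} \<subseteq> carrier TR"
    "{pt e\<^sub>1 f\<^sub>1, pt e\<^sub>2 f\<^sub>2, pt e\<^sub>2 f\<^sub>1} \<subseteq> carrier TR" "{pt e\<^sub>1 f\<^sub>2, pt e\<^sub>2 f\<^sub>2, pt e\<^sub>2 f\<^sub>1} \<subseteq> carrier TR"
    using pt by simp_all
  note solve11 = TR.smult_relation_solve[OF cl(1) pts(1) rel11]
    and solve12 = TR.smult_relation_solve[OF cl(2) pts(2) rel12]
    and solve21 = TR.smult_relation_solve[OF cl(3) pts(3) rel21]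
    and solve22 = TR.smult_relation_solve[OF cl(4) pts(4) rel22]
  show "basis2 R TR (pt e\<^sub>1 f\<^sub>1) (pt e\<^sub>1 f\<^sub>2)" if u: "a \<in> Units R"
    by (rule basis2_if_unit[OF u pt_closed(1,2) pt_closed(3,4) _ _ solve11(2) solve12(2)])
      (use closed minus tensor_forms in blast)+
  show "basis2 R TR (pt e\<^sub>1 f\<^sub>1) (pt e\<^sub>2 f\<^sub>1)" if u: "a' \<in> Units R"
    by (rule basis2_if_unit[OF u pt_closed(1,3) pt_closed(2,4) _ _ rel11[symmetric] solve21(2)])
      (use closed minus tensor_forms in blast)+
  show "basis2 R TR (pt e\<^sub>1 f\<^sub>1) (pt e\<^sub>2 f\<^sub>2)" if u: "d \<in> Units R"
    by (rule basis2_if_unit[OF u pt_closed(1,4) pt_closed(2,3) _ _ rel12[symmetric] rel21[symmetric]])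
      (use closed minus tensor_forms in blast)+
  show "basis2 R TR (pt e\<^sub>1 f\<^sub>2) (pt e\<^sub>2 f\<^sub>1)" if u: "r \<in> Units R"
    by (rule basis2_if_unit[OF u pt_closed(2,3) pt_closed(1,4) _ _ solve11(1) solve22(2)])
      (use closed minus tensor_forms in blast)+
  show "basis2 R TR (pt e\<^sub>1 f\<^sub>2) (pt e\<^sub>2 f\<^sub>2)" if u: "c' \<in> Units R"
    by (rule basis2_if_unit[OF u pt_closed(2,4) pt_closed(1,3) _ _ solve12(1) rel22[symmetric]])
      (use closed minus tensor_forms in blast)+
  show "basis2 R TR (pt e\<^sub>2 f\<^sub>1) (pt e\<^sub>2 f\<^sub>2)" if u: "c \<in> Units R"
    by (rule basis2_if_unit[OF u pt_closed(3,4) pt_closed(1,2) _ _ solve21(1) solve22(1)])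
      (use closed minus tensor_forms in blast)+
qed

text \<open>Functionals into R / J dual to three of the generators, evaluated at \<open>t1\<close>
  and \<open>t2\<close>, factor the 3 x 3 identity matrix through rank 2. Hence R / J is the zero
  ring.\<close>

lemma one_in_ideal_if_rank2:
  assumes J: "ideal J R" and coeffs: "{a, b, c, a', c', d, r} \<subseteq> J"
    and t: "t1 \<in> carrier T" "t2 \<in> carrier T"
    and pq: "{p1, p2, p3, q1, q2, q3} \<subseteq> carrier R"
    and z: "pt e\<^sub>1 f\<^sub>1 = p1 \<odot>\<^bsub>TR\<^esub> t1 \<oplus>\<^bsub>TR\<^esub> q1 \<odot>\<^bsub>TR\<^esub> t2" "pt e\<^sub>1 f\<^sub>2 = p2 \<odot>\<^bsub>TR\<^esub> t1 \<oplus>\<^bsub>TR\<^esub> q2 \<odot>\<^bsub>TR\<^esub> t2"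
      "pt e\<^sub>2 f\<^sub>1 = p3 \<odot>\<^bsub>TR\<^esub> t1 \<oplus>\<^bsub>TR\<^esub> q3 \<odot>\<^bsub>TR\<^esub> t2"
  shows "\<one> \<in> J"
proof -
  interpret J: ideal J R by (rule J)
  let ?Q = "R Quot J" and ?\<pi> = "\<lambda>x. J +>\<^bsub>R\<^esub> x"
  interpret Q: cring ?Q by (rule J.quotient_is_cring[OF A.R.cring_axioms])
  have \<pi>: "?\<pi> \<in> ring_hom R ?Q" by (rule J.rcos_ring_hom)
  have \<pi>0: "?\<pi> x = \<zero>\<^bsub>?Q\<^esub>" if "x \<in> J" for x
    using that J.a_rcos_const by (simp add: FactRing_def)
  have \<pi>c: "?\<pi> x \<in> carrier ?Q" if "x \<in> carrier R" for x
    by (rule ring_hom_closed[OF \<pi> that])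
  have zeros: "?\<pi> a = \<zero>\<^bsub>?Q\<^esub>" "?\<pi> b = \<zero>\<^bsub>?Q\<^esub>" "?\<pi> c = \<zero>\<^bsub>?Q\<^esub>" "?\<pi> a' = \<zero>\<^bsub>?Q\<^esub>" "?\<pi> c' = \<zero>\<^bsub>?Q\<^esub>"
      "?\<pi> d = \<zero>\<^bsub>?Q\<^esub>" "?\<pi> r = \<zero>\<^bsub>?Q\<^esub>"
    using coeffs \<pi>0 by blast+
  have ex: "\<exists>h. (\<forall>t\<in>carrier T. h t \<in> carrier ?Q) \<and>
      (\<forall>x\<in>carrier R. \<forall>y\<in>carrier R. \<forall>t\<in>carrier T. \<forall>t'\<in>carrier T.
        h (x \<odot>\<^bsub>TR\<^esub> t \<oplus>\<^bsub>TR\<^esub> y \<odot>\<^bsub>TR\<^esub> t') = ?\<pi> x \<otimes>\<^bsub>?Q\<^esub> h t \<oplus>\<^bsub>?Q\<^esub> ?\<pi> y \<otimes>\<^bsub>?Q\<^esub> h t') \<and>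
      h (pt e\<^sub>1 f\<^sub>1) = l11 \<and> h (pt e\<^sub>1 f\<^sub>2) = l12 \<and> h (pt e\<^sub>2 f\<^sub>1) = l21"
    if l: "l11 \<in> carrier ?Q" "l12 \<in> carrier ?Q" "l21 \<in> carrier ?Q" for l11 l12 l21
  proof -
    \<comment> \<open>All structure constants vanish modulo \<open>J\<close>, so both sides of every
      relation are zero and the values can be prescribed freely; the fourth one is set to
      zero.\<close>
    have "\<exists>h. (\<forall>t\<in>carrier T. h t \<in> carrier ?Q) \<and>
      (\<forall>t\<in>carrier T. \<forall>t'\<in>carrier T. h (t \<oplus>\<^bsub>TR\<^esub> t') = h t \<oplus>\<^bsub>?Q\<^esub> h t') \<and>
      (\<forall>x\<in>carrier R. \<forall>t\<in>carrier T. h (x \<odot>\<^bsub>TR\<^esub> t) = ?\<pi> x \<otimes>\<^bsub>?Q\<^esub> h t) \<and>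
      h (pt e\<^sub>1 f\<^sub>1) = l11 \<and> h (pt e\<^sub>1 f\<^sub>2) = l12 \<and> h (pt e\<^sub>2 f\<^sub>1) = l21 \<and> h (pt e\<^sub>2 f\<^sub>2) = \<zero>\<^bsub>?Q\<^esub>"
      by (rule tensor_functional[OF Q.cring_axioms \<pi> l Q.zero_closed])
        (simp_all only: zeros Q.l_null l Q.zero_closed Q.r_neg Q.minus_eq Q.minus_zero Q.l_zero)
    then obtain h where h0: "\<forall>t\<in>carrier T. h t \<in> carrier ?Q"
        "\<forall>t\<in>carrier T. \<forall>t'\<in>carrier T. h (t \<oplus>\<^bsub>TR\<^esub> t') = h t \<oplus>\<^bsub>?Q\<^esub> h t'"
        "\<forall>x\<in>carrier R. \<forall>t\<in>carrier T. h (x \<odot>\<^bsub>TR\<^esub> t) = ?\<pi> x \<otimes>\<^bsub>?Q\<^esub> h t"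
        "h (pt e\<^sub>1 f\<^sub>1) = l11" "h (pt e\<^sub>1 f\<^sub>2) = l12" "h (pt e\<^sub>2 f\<^sub>1) = l21"
      by (elim exE conjE) (rule that)
    note h = h0(1-3)[rule_format] h0(4-6)
    have "h (x \<odot>\<^bsub>TR\<^esub> t \<oplus>\<^bsub>TR\<^esub> y \<odot>\<^bsub>TR\<^esub> t') = ?\<pi> x \<otimes>\<^bsub>?Q\<^esub> h t \<oplus>\<^bsub>?Q\<^esub> ?\<pi> y \<otimes>\<^bsub>?Q\<^esub> h t'"
      if xy: "x \<in> carrier R" "y \<in> carrier R" "t \<in> carrier T" "t' \<in> carrier T" for x y t t'
    proof -
      have "x \<odot>\<^bsub>TR\<^esub> t \<in> carrier T" "y \<odot>\<^bsub>TR\<^esub> t' \<in> carrier T"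
        using TR.smult_closed[of x t] TR.smult_closed[of y t'] xy by (simp_all only: scalar_restriction_simps)
      then show ?thesis using h(2) h(3)[OF xy(1,3)] h(3)[OF xy(2,4)] by metis
    qed
    then show ?thesis
      by (intro exI[of _ h] conjI ballI h)
  qed
  obtain h1 where h1: "\<forall>t\<in>carrier T. h1 t \<in> carrier ?Q"
      "\<forall>x\<in>carrier R. \<forall>y\<in>carrier R. \<forall>t\<in>carrier T. \<forall>t'\<in>carrier T.
        h1 (x \<odot>\<^bsub>TR\<^esub> t \<oplus>\<^bsub>TR\<^esub> y \<odot>\<^bsub>TR\<^esub> t') = ?\<pi> x \<otimes>\<^bsub>?Q\<^esub> h1 t \<oplus>\<^bsub>?Q\<^esub> ?\<pi> y \<otimes>\<^bsub>?Q\<^esub> h1 t'"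
      "h1 (pt e\<^sub>1 f\<^sub>1) = \<one>\<^bsub>?Q\<^esub>" "h1 (pt e\<^sub>1 f\<^sub>2) = \<zero>\<^bsub>?Q\<^esub>" "h1 (pt e\<^sub>2 f\<^sub>1) = \<zero>\<^bsub>?Q\<^esub>"
    using ex[OF Q.one_closed Q.zero_closed Q.zero_closed] by (elim exE conjE) (rule that)
  obtain h2 where h2: "\<forall>t\<in>carrier T. h2 t \<in> carrier ?Q"
      "\<forall>x\<in>carrier R. \<forall>y\<in>carrier R. \<forall>t\<in>carrier T. \<forall>t'\<in>carrier T.
        h2 (x \<odot>\<^bsub>TR\<^esub> t \<oplus>\<^bsub>TR\<^esub> y \<odot>\<^bsub>TR\<^esub> t') = ?\<pi> x \<otimes>\<^bsub>?Q\<^esub> h2 t \<oplus>\<^bsub>?Q\<^esub> ?\<pi> y \<otimes>\<^bsub>?Q\<^esub> h2 t'"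
      "h2 (pt e\<^sub>1 f\<^sub>1) = \<zero>\<^bsub>?Q\<^esub>" "h2 (pt e\<^sub>1 f\<^sub>2) = \<one>\<^bsub>?Q\<^esub>" "h2 (pt e\<^sub>2 f\<^sub>1) = \<zero>\<^bsub>?Q\<^esub>"
    using ex[OF Q.zero_closed Q.one_closed Q.zero_closed] by (elim exE conjE) (rule that)
  obtain h3 where h3: "\<forall>t\<in>carrier T. h3 t \<in> carrier ?Q"
      "\<forall>x\<in>carrier R. \<forall>y\<in>carrier R. \<forall>t\<in>carrier T. \<forall>t'\<in>carrier T.
        h3 (x \<odot>\<^bsub>TR\<^esub> t \<oplus>\<^bsub>TR\<^esub> y \<odot>\<^bsub>TR\<^esub> t') = ?\<pi> x \<otimes>\<^bsub>?Q\<^esub> h3 t \<oplus>\<^bsub>?Q\<^esub> ?\<pi> y \<otimes>\<^bsub>?Q\<^esub> h3 t'"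
      "h3 (pt e\<^sub>1 f\<^sub>1) = \<zero>\<^bsub>?Q\<^esub>" "h3 (pt e\<^sub>1 f\<^sub>2) = \<zero>\<^bsub>?Q\<^esub>" "h3 (pt e\<^sub>2 f\<^sub>1) = \<one>\<^bsub>?Q\<^esub>"
    using ex[OF Q.zero_closed Q.zero_closed Q.one_closed] by (elim exE conjE) (rule that)
  have pqc: "p1 \<in> carrier R" "p2 \<in> carrier R" "p3 \<in> carrier R" "q1 \<in> carrier R" "q2 \<in> carrier R" "q3 \<in> carrier R"
    using pq by auto
  have "\<one>\<^bsub>?Q\<^esub> = \<zero>\<^bsub>?Q\<^esub>"
  proof (rule Q.no_rank2_factorization_of_identity)
    show "{?\<pi> p1, ?\<pi> p2, ?\<pi> p3, ?\<pi> q1, ?\<pi> q2, ?\<pi> q3, h1 t1, h2 t1, h3 t1, h1 t2, h2 t2, h3 t2} \<subseteq> carrier ?Q"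
      using \<pi>c pqc h1(1) h2(1) h3(1) t by simp
    show "?\<pi> p1 \<otimes>\<^bsub>?Q\<^esub> h1 t1 \<oplus>\<^bsub>?Q\<^esub> ?\<pi> q1 \<otimes>\<^bsub>?Q\<^esub> h1 t2 = \<one>\<^bsub>?Q\<^esub>"
      using h1(2)[rule_format, OF pqc(1,4) t] h1(3) unfolding z by metis
    show "?\<pi> p1 \<otimes>\<^bsub>?Q\<^esub> h2 t1 \<oplus>\<^bsub>?Q\<^esub> ?\<pi> q1 \<otimes>\<^bsub>?Q\<^esub> h2 t2 = \<zero>\<^bsub>?Q\<^esub>"
      using h2(2)[rule_format, OF pqc(1,4) t] h2(3) unfolding z by metis
    show "?\<pi> p1 \<otimes>\<^bsub>?Q\<^esub> h3 t1 \<oplus>\<^bsub>?Q\<^esub> ?\<pi> q1 \<otimes>\<^bsub>?Q\<^esub> h3 t2 = \<zero>\<^bsub>?Q\<^esub>"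
      using h3(2)[rule_format, OF pqc(1,4) t] h3(3) unfolding z by metis
    show "?\<pi> p2 \<otimes>\<^bsub>?Q\<^esub> h1 t1 \<oplus>\<^bsub>?Q\<^esub> ?\<pi> q2 \<otimes>\<^bsub>?Q\<^esub> h1 t2 = \<zero>\<^bsub>?Q\<^esub>"
      using h1(2)[rule_format, OF pqc(2,5) t] h1(4) unfolding z by metis
    show "?\<pi> p2 \<otimes>\<^bsub>?Q\<^esub> h2 t1 \<oplus>\<^bsub>?Q\<^esub> ?\<pi> q2 \<otimes>\<^bsub>?Q\<^esub> h2 t2 = \<one>\<^bsub>?Q\<^esub>"
      using h2(2)[rule_format, OF pqc(2,5) t] h2(4) unfolding z by metis
    show "?\<pi> p2 \<otimes>\<^bsub>?Q\<^esub> h3 t1 \<oplus>\<^bsub>?Q\<^esub> ?\<pi> q2 \<otimes>\<^bsub>?Q\<^esub> h3 t2 = \<zero>\<^bsub>?Q\<^esub>"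
      using h3(2)[rule_format, OF pqc(2,5) t] h3(4) unfolding z by metis
    show "?\<pi> p3 \<otimes>\<^bsub>?Q\<^esub> h3 t1 \<oplus>\<^bsub>?Q\<^esub> ?\<pi> q3 \<otimes>\<^bsub>?Q\<^esub> h3 t2 = \<one>\<^bsub>?Q\<^esub>"
      using h3(2)[rule_format, OF pqc(3,6) t] h3(5) unfolding z by metis
  qed
  then have "J +>\<^bsub>R\<^esub> \<one> = J" by (simp add: FactRing_def)
  then show ?thesis using J.a_rcos_self[OF A.R.one_closed] by simp
qed

end

subsection \<open>Unital pairs of good frames\<close>

lemma (in Module.algebra) basis2_one_shift:
  assumes \<alpha>: "basis2 R M \<one>\<^bsub>M\<^esub> \<alpha>" and x: "x \<in> carrier R"
  shows "basis2 R M \<one>\<^bsub>M\<^esub> (\<alpha> \<oplus>\<^bsub>M\<^esub> x \<odot>\<^bsub>M\<^esub> \<one>\<^bsub>M\<^esub>)"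
proof (rule basis2_change[OF \<alpha>, where a = \<one> and b = \<zero> and c = x and d = \<one>
      and a' = \<one> and b' = \<zero> and c' = "\<ominus> x" and d' = \<one>])
  have [simp]: "\<alpha> \<in> carrier M" using basis2_closed[OF \<alpha>] by simp
  show "\<one>\<^bsub>M\<^esub> = \<one> \<odot>\<^bsub>M\<^esub> \<one>\<^bsub>M\<^esub> \<oplus>\<^bsub>M\<^esub> \<zero> \<odot>\<^bsub>M\<^esub> \<alpha>" "\<alpha> \<oplus>\<^bsub>M\<^esub> x \<odot>\<^bsub>M\<^esub> \<one>\<^bsub>M\<^esub> = x \<odot>\<^bsub>M\<^esub> \<one>\<^bsub>M\<^esub> \<oplus>\<^bsub>M\<^esub> \<one> \<odot>\<^bsub>M\<^esub> \<alpha>"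
    "\<one>\<^bsub>M\<^esub> = \<one> \<odot>\<^bsub>M\<^esub> \<one>\<^bsub>M\<^esub> \<oplus>\<^bsub>M\<^esub> \<zero> \<odot>\<^bsub>M\<^esub> (\<alpha> \<oplus>\<^bsub>M\<^esub> x \<odot>\<^bsub>M\<^esub> \<one>\<^bsub>M\<^esub>)"
    "\<alpha> = (\<ominus> x) \<odot>\<^bsub>M\<^esub> \<one>\<^bsub>M\<^esub> \<oplus>\<^bsub>M\<^esub> \<one> \<odot>\<^bsub>M\<^esub> (\<alpha> \<oplus>\<^bsub>M\<^esub> x \<odot>\<^bsub>M\<^esub> \<one>\<^bsub>M\<^esub>)"
    using x by (simp_all add: M.a_comm smult_l_minus M.a_lcomm M.l_neg M.r_neg)
qed (use x in \<open>simp_all add: R.r_neg R.l_neg\<close>)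

context frame_pair
begin

interpretation A: Module.algebra R S by (rule algebra)
interpretation M: Module.module S M by (rule module_M)
interpretation N: Module.module S N by (rule module_N)

text \<open>Returns to the second frame element \<alpha> + r: adding \<open>r\<close> removes the
  coefficient -r on \<open>f\<^sub>2\<close> and turns \<open>d\<close> into b' = d + r.\<close>

lemma coprimitive_modules_if_frame_pair:
  assumes Idl: "Idl\<^bsub>R\<^esub> {a, b, c, a', d \<oplus> r, c', r} = carrier R"
  shows "coprimitive_modules R S M N"
proof -
  have [simp]: "\<alpha> \<in> carrier S" "e\<^sub>1 \<in> carrier M" "e\<^sub>2 \<in> carrier M" "f\<^sub>1 \<in> carrier N" "f\<^sub>2 \<in> carrier N"
    using basis2_closed[OF basis_S] basis2_closed[OF basis_M] basis2_closed[OF basis_N] by simp_all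
  note [simp] = closed
  have ae2: "\<alpha> \<odot>\<^bsub>M\<^esub> e\<^sub>2 = c \<odot>\<^bsub>scalar_restriction S M\<^esub> e\<^sub>1"
    using alpha_e2 by (simp add: A.smult_l_null)
  have ae1: "\<alpha> \<odot>\<^bsub>M\<^esub> e\<^sub>1 = (b \<odot>\<^bsub>scalar_restriction S M\<^esub> e\<^sub>1) \<ominus>\<^bsub>M\<^esub> (a \<odot>\<^bsub>scalar_restriction S M\<^esub> e\<^sub>2)"
    using alpha_e1 by (simp add: A.smult_l_minus M.smult_l_minus M.minus_eq)
  have af2: "(\<alpha> \<oplus>\<^bsub>S\<^esub> r \<odot>\<^bsub>S\<^esub> \<one>\<^bsub>S\<^esub>) \<odot>\<^bsub>N\<^esub> f\<^sub>2 = c' \<odot>\<^bsub>scalar_restriction S N\<^esub> f\<^sub>1"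
    using alpha_f2 by (simp add: N.smult_l_distr A.smult_l_minus N.smult_l_minus N.M.a_assoc N.M.l_neg)
  have af1: "(\<alpha> \<oplus>\<^bsub>S\<^esub> r \<odot>\<^bsub>S\<^esub> \<one>\<^bsub>S\<^esub>) \<odot>\<^bsub>N\<^esub> f\<^sub>1 =
      ((d \<oplus> r) \<odot>\<^bsub>scalar_restriction S N\<^esub> f\<^sub>1) \<ominus>\<^bsub>N\<^esub> (a' \<odot>\<^bsub>scalar_restriction S N\<^esub> f\<^sub>2)"
    using alpha_f1 by (simp add: N.smult_l_distr A.smult_l_minus A.smult_l_distr N.smult_l_minus N.minus_eq N.M.add.m_ac)
  have "good_frame R S M \<alpha> e\<^sub>1 e\<^sub>2"
    unfolding good_frame_def using basis_S basis_M ae2 closed(3) by blast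
  moreover have "good_frame R S N (\<alpha> \<oplus>\<^bsub>S\<^esub> r \<odot>\<^bsub>S\<^esub> \<one>\<^bsub>S\<^esub>) f\<^sub>1 f\<^sub>2"
    unfolding good_frame_def using A.basis2_one_shift[OF basis_S closed(7)] basis_N af2 closed(5) by blast
  moreover have "frame_coeffs R S M \<alpha> e\<^sub>1 e\<^sub>2 a b c"
    unfolding frame_coeffs_def using ae1 ae2 by (simp del: scalar_restriction_simps)
  moreover have "frame_coeffs R S N (\<alpha> \<oplus>\<^bsub>S\<^esub> r \<odot>\<^bsub>S\<^esub> \<one>\<^bsub>S\<^esub>) f\<^sub>1 f\<^sub>2 a' (d \<oplus> r) c'"
    unfolding frame_coeffs_def using af1 af2 by (simp del: scalar_restriction_simps)
  ultimately show ?thesis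
    unfolding coprimitive_modules_def using Idl closed(7)
    by - (rule exI[of _ \<alpha>], rule exI[of _ e\<^sub>1], rule exI[of _ e\<^sub>2], rule exI[of _ "\<alpha> \<oplus>\<^bsub>S\<^esub> r \<odot>\<^bsub>S\<^esub> \<one>\<^bsub>S\<^esub>"],
        rule exI[of _ f\<^sub>1], rule exI[of _ f\<^sub>2], rule exI[of _ r], rule exI[of _ a], rule exI[of _ b], rule exI[of _ c], rule exI[of _ a'], rule exI[of _ "d \<oplus> r"], rule exI[of _ c'], intro conjI refl, assumption+)
qed

end

text \<open>On the second module \<alpha> acts as \<alpha>' - r, so \<open>d\<close> is b' - r and
  the ideal condition is unchanged.\<close>

lemma coprimitive_modules_frame_pair:
  assumes algebra: "Module.algebra R S" and M: "Module.module S M" and N: "Module.module S N"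
    and cop: "coprimitive_modules R S M N"
  obtains \<alpha> e\<^sub>1 e\<^sub>2 f\<^sub>1 f\<^sub>2 a b c a' c' d r where "frame_pair R S M N \<alpha> e\<^sub>1 e\<^sub>2 f\<^sub>1 f\<^sub>2 a b c a' c' d r"
    "Idl\<^bsub>R\<^esub> {a, b, c, a', d \<oplus>\<^bsub>R\<^esub> r, c', r} = carrier R"
proof -
  interpret A: Module.algebra R S by (rule algebra)
  interpret M: Module.module S M by (rule M)
  interpret N: Module.module S N by (rule N)
  obtain \<alpha> e\<^sub>1 e\<^sub>2 \<alpha>' f\<^sub>1 f\<^sub>2 r a b c a' b' c' where fr: "good_frame R S M \<alpha> e\<^sub>1 e\<^sub>2" "good_frame R S N \<alpha>' f\<^sub>1 f\<^sub>2"
    and r: "r \<in> carrier R" and \<alpha>': "\<alpha>' = \<alpha> \<oplus>\<^bsub>S\<^esub> r \<odot>\<^bsub>S\<^esub> \<one>\<^bsub>S\<^esub>"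
    and co: "frame_coeffs R S M \<alpha> e\<^sub>1 e\<^sub>2 a b c" "frame_coeffs R S N \<alpha>' f\<^sub>1 f\<^sub>2 a' b' c'"
    and Idl: "Idl\<^bsub>R\<^esub> {a, b, c, a', b', c', r} = carrier R"
    using cop unfolding coprimitive_modules_def by (elim exE conjE) (rule that)
  have basis: "basis2 R S \<one>\<^bsub>S\<^esub> \<alpha>" "basis2 R (scalar_restriction S M) e\<^sub>1 e\<^sub>2" "basis2 R (scalar_restriction S N) f\<^sub>1 f\<^sub>2"
    using fr unfolding good_frame_def by blast+
  have [simp]: "\<alpha> \<in> carrier S" "e\<^sub>1 \<in> carrier M" "e\<^sub>2 \<in> carrier M" "f\<^sub>1 \<in> carrier N" "f\<^sub>2 \<in> carrier N"
    using basis2_closed[OF basis(1)] basis2_closed[OF basis(2)] basis2_closed[OF basis(3)] by simp_all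
  have cl [simp]: "a \<in> carrier R" "b \<in> carrier R" "c \<in> carrier R" "a' \<in> carrier R" "b' \<in> carrier R" "c' \<in> carrier R" "r \<in> carrier R"
    using co r unfolding frame_coeffs_def by auto
  have e1: "\<alpha> \<odot>\<^bsub>M\<^esub> e\<^sub>1 = ((b \<odot>\<^bsub>S\<^esub> \<one>\<^bsub>S\<^esub>) \<odot>\<^bsub>M\<^esub> e\<^sub>1) \<ominus>\<^bsub>M\<^esub> ((a \<odot>\<^bsub>S\<^esub> \<one>\<^bsub>S\<^esub>) \<odot>\<^bsub>M\<^esub> e\<^sub>2)"
    and e2: "\<alpha> \<odot>\<^bsub>M\<^esub> e\<^sub>2 = (c \<odot>\<^bsub>S\<^esub> \<one>\<^bsub>S\<^esub>) \<odot>\<^bsub>M\<^esub> e\<^sub>1"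
    and f1: "\<alpha>' \<odot>\<^bsub>N\<^esub> f\<^sub>1 = ((b' \<odot>\<^bsub>S\<^esub> \<one>\<^bsub>S\<^esub>) \<odot>\<^bsub>N\<^esub> f\<^sub>1) \<ominus>\<^bsub>N\<^esub> ((a' \<odot>\<^bsub>S\<^esub> \<one>\<^bsub>S\<^esub>) \<odot>\<^bsub>N\<^esub> f\<^sub>2)"
    and f2: "\<alpha>' \<odot>\<^bsub>N\<^esub> f\<^sub>2 = (c' \<odot>\<^bsub>S\<^esub> \<one>\<^bsub>S\<^esub>) \<odot>\<^bsub>N\<^esub> f\<^sub>1"
    using co unfolding frame_coeffs_def by simp_all
  have shift: "\<alpha> \<odot>\<^bsub>N\<^esub> f = \<alpha>' \<odot>\<^bsub>N\<^esub> f \<oplus>\<^bsub>N\<^esub> \<ominus>\<^bsub>N\<^esub> ((r \<odot>\<^bsub>S\<^esub> \<one>\<^bsub>S\<^esub>) \<odot>\<^bsub>N\<^esub> f)" if "f \<in> carrier N" for f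
    unfolding \<alpha>' using that by (simp add: N.smult_l_distr N.M.a_assoc N.M.r_neg)
  have "frame_pair R S M N \<alpha> e\<^sub>1 e\<^sub>2 f\<^sub>1 f\<^sub>2 a b c a' c' (b' \<oplus>\<^bsub>R\<^esub> \<ominus>\<^bsub>R\<^esub> r) r"
  proof (rule frame_pair.intro[OF algebra M N basis])
    show "\<alpha> \<odot>\<^bsub>N\<^esub> f\<^sub>1 = (b' \<oplus>\<^bsub>R\<^esub> \<ominus>\<^bsub>R\<^esub> r) \<odot>\<^bsub>scalar_restriction S N\<^esub> f\<^sub>1 \<oplus>\<^bsub>N\<^esub> (\<ominus>\<^bsub>R\<^esub> a') \<odot>\<^bsub>scalar_restriction S N\<^esub> f\<^sub>2"
      unfolding shift[OF \<open>f\<^sub>1 \<in> carrier N\<close>] f1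
      by (simp add: N.smult_l_distr A.smult_l_minus A.smult_l_distr N.smult_l_minus N.minus_eq N.M.add.m_ac)
    show "\<alpha> \<odot>\<^bsub>N\<^esub> f\<^sub>2 = c' \<odot>\<^bsub>scalar_restriction S N\<^esub> f\<^sub>1 \<oplus>\<^bsub>N\<^esub> (\<ominus>\<^bsub>R\<^esub> r) \<odot>\<^bsub>scalar_restriction S N\<^esub> f\<^sub>2"
      unfolding shift[OF \<open>f\<^sub>2 \<in> carrier N\<close>] f2 by (simp add: A.smult_l_minus N.smult_l_minus)
  qed (simp_all add: e1 e2 A.smult_l_minus M.smult_l_minus M.minus_eq A.smult_l_null)
  moreover have "(b' \<oplus>\<^bsub>R\<^esub> \<ominus>\<^bsub>R\<^esub> r) \<oplus>\<^bsub>R\<^esub> r = b'"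
    using A.R.a_assoc[of b' "\<ominus>\<^bsub>R\<^esub> r" r] by (simp add: A.R.l_neg)
  then have "Idl\<^bsub>R\<^esub> {a, b, c, a', (b' \<oplus>\<^bsub>R\<^esub> \<ominus>\<^bsub>R\<^esub> r) \<oplus>\<^bsub>R\<^esub> r, c', r} = carrier R"
    using Idl by (rule ssubst)
  ultimately show thesis by (rule that)
qed

text \<open>Let \<open>t\<close> be the coefficient of \<open>e\<^sub>2\<close> in the image of
  \<open>e\<^sub>2\<close> under \<alpha>. Replacing \<alpha> by \<alpha> - t removes it, so the
  given basis of \<open>M\<close> becomes part of a good frame. The basis of \<open>N\<close> is
  kept as well: its diagonal coefficient t' - t is -r for r = t - t'.\<close>

lemma frame_pair_exists:
  assumes algebra: "Module.algebra R S" and M: "Module.module S M" and N: "Module.module S N"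
    and \<alpha>: "basis2 R S \<one>\<^bsub>S\<^esub> \<alpha>"
    and e: "basis2 R (scalar_restriction S M) e\<^sub>1 e\<^sub>2" and f: "basis2 R (scalar_restriction S N) f\<^sub>1 f\<^sub>2"
  obtains \<alpha>\<^sub>1 a b c a' c' d r where "frame_pair R S M N \<alpha>\<^sub>1 e\<^sub>1 e\<^sub>2 f\<^sub>1 f\<^sub>2 a b c a' c' d r"
proof -
  interpret A: Module.algebra R S by (rule algebra)
  interpret M: Module.module S M by (rule M)
  interpret N: Module.module S N by (rule N)
  have [simp]: "\<alpha> \<in> carrier S" "e\<^sub>1 \<in> carrier M" "e\<^sub>2 \<in> carrier M" "f\<^sub>1 \<in> carrier N" "f\<^sub>2 \<in> carrier N"
    using basis2_closed[OF \<alpha>] basis2_closed[OF e] basis2_closed[OF f] by simp_all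
  have mem: "\<alpha> \<odot>\<^bsub>M\<^esub> e\<^sub>1 \<in> carrier (scalar_restriction S M)" "\<alpha> \<odot>\<^bsub>M\<^esub> e\<^sub>2 \<in> carrier (scalar_restriction S M)"
    "\<alpha> \<odot>\<^bsub>N\<^esub> f\<^sub>1 \<in> carrier (scalar_restriction S N)" "\<alpha> \<odot>\<^bsub>N\<^esub> f\<^sub>2 \<in> carrier (scalar_restriction S N)"
    by simp_all
  obtain p q where cl1 [simp]: "p \<in> carrier R" "q \<in> carrier R"
    and eq1: "\<alpha> \<odot>\<^bsub>M\<^esub> e\<^sub>1 = p \<odot>\<^bsub>scalar_restriction S M\<^esub> e\<^sub>1 \<oplus>\<^bsub>scalar_restriction S M\<^esub> q \<odot>\<^bsub>scalar_restriction S M\<^esub> e\<^sub>2"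
    using basis2_rep[OF e mem(1)] .
  obtain s t where cl2 [simp]: "s \<in> carrier R" "t \<in> carrier R"
    and eq2: "\<alpha> \<odot>\<^bsub>M\<^esub> e\<^sub>2 = s \<odot>\<^bsub>scalar_restriction S M\<^esub> e\<^sub>1 \<oplus>\<^bsub>scalar_restriction S M\<^esub> t \<odot>\<^bsub>scalar_restriction S M\<^esub> e\<^sub>2"
    using basis2_rep[OF e mem(2)] .
  obtain p' q' where cl3 [simp]: "p' \<in> carrier R" "q' \<in> carrier R"
    and eq3: "\<alpha> \<odot>\<^bsub>N\<^esub> f\<^sub>1 = p' \<odot>\<^bsub>scalar_restriction S N\<^esub> f\<^sub>1 \<oplus>\<^bsub>scalar_restriction S N\<^esub> q' \<odot>\<^bsub>scalar_restriction S N\<^esub> f\<^sub>2"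
    using basis2_rep[OF f mem(3)] .
  obtain s' t' where cl4 [simp]: "s' \<in> carrier R" "t' \<in> carrier R"
    and eq4: "\<alpha> \<odot>\<^bsub>N\<^esub> f\<^sub>2 = s' \<odot>\<^bsub>scalar_restriction S N\<^esub> f\<^sub>1 \<oplus>\<^bsub>scalar_restriction S N\<^esub> t' \<odot>\<^bsub>scalar_restriction S N\<^esub> f\<^sub>2"
    using basis2_rep[OF f mem(4)] .
  note cl = cl1 cl2 cl3 cl4 and eqs = eq1[unfolded scalar_restriction_simps] eq2[unfolded scalar_restriction_simps]
    eq3[unfolded scalar_restriction_simps] eq4[unfolded scalar_restriction_simps]
  have t: "\<ominus>\<^bsub>R\<^esub> t \<in> carrier R" by simp
  show thesis
  proof (rule that[of "\<alpha> \<oplus>\<^bsub>S\<^esub> (\<ominus>\<^bsub>R\<^esub> t) \<odot>\<^bsub>S\<^esub> \<one>\<^bsub>S\<^esub>" "\<ominus>\<^bsub>R\<^esub> q" "p \<oplus>\<^bsub>R\<^esub> \<ominus>\<^bsub>R\<^esub> t" s "\<ominus>\<^bsub>R\<^esub> q'" s'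
        "p' \<oplus>\<^bsub>R\<^esub> \<ominus>\<^bsub>R\<^esub> t" "t \<oplus>\<^bsub>R\<^esub> \<ominus>\<^bsub>R\<^esub> t'"], rule frame_pair.intro[OF algebra M N A.basis2_one_shift[OF \<alpha> t] e f])
    let ?\<alpha> = "\<alpha> \<oplus>\<^bsub>S\<^esub> (\<ominus>\<^bsub>R\<^esub> t) \<odot>\<^bsub>S\<^esub> \<one>\<^bsub>S\<^esub>"
    show "?\<alpha> \<odot>\<^bsub>M\<^esub> e\<^sub>1 = (p \<oplus>\<^bsub>R\<^esub> \<ominus>\<^bsub>R\<^esub> t) \<odot>\<^bsub>scalar_restriction S M\<^esub> e\<^sub>1 \<oplus>\<^bsub>M\<^esub> (\<ominus>\<^bsub>R\<^esub> (\<ominus>\<^bsub>R\<^esub> q)) \<odot>\<^bsub>scalar_restriction S M\<^esub> e\<^sub>2"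
      by (simp add: eqs M.smult_l_distr A.smult_l_minus A.smult_l_distr M.smult_l_minus M.M.add.m_ac)
    show "?\<alpha> \<odot>\<^bsub>M\<^esub> e\<^sub>2 = s \<odot>\<^bsub>scalar_restriction S M\<^esub> e\<^sub>1 \<oplus>\<^bsub>M\<^esub> \<zero>\<^bsub>R\<^esub> \<odot>\<^bsub>scalar_restriction S M\<^esub> e\<^sub>2"
      by (simp add: eqs M.smult_l_distr A.smult_l_minus A.smult_l_null M.smult_l_minus M.M.a_assoc M.M.r_neg)
    show "?\<alpha> \<odot>\<^bsub>N\<^esub> f\<^sub>1 = (p' \<oplus>\<^bsub>R\<^esub> \<ominus>\<^bsub>R\<^esub> t) \<odot>\<^bsub>scalar_restriction S N\<^esub> f\<^sub>1 \<oplus>\<^bsub>N\<^esub> (\<ominus>\<^bsub>R\<^esub> (\<ominus>\<^bsub>R\<^esub> q')) \<odot>\<^bsub>scalar_restriction S N\<^esub> f\<^sub>2"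
      by (simp add: eqs N.smult_l_distr A.smult_l_minus A.smult_l_distr N.smult_l_minus N.M.add.m_ac)
    show "?\<alpha> \<odot>\<^bsub>N\<^esub> f\<^sub>2 = s' \<odot>\<^bsub>scalar_restriction S N\<^esub> f\<^sub>1 \<oplus>\<^bsub>N\<^esub> (\<ominus>\<^bsub>R\<^esub> (t \<oplus>\<^bsub>R\<^esub> \<ominus>\<^bsub>R\<^esub> t')) \<odot>\<^bsub>scalar_restriction S N\<^esub> f\<^sub>2"
      by (simp add: eqs N.smult_l_distr A.smult_l_minus A.smult_l_distr N.smult_l_minus A.R.minus_add N.M.add.m_ac)
  qed (intro cl A.R.a_inv_closed A.R.a_closed)+
qed

lemma basis2_swap:
  assumes M: "Module.module R M" and e: "basis2 R M e\<^sub>1 e\<^sub>2"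
  shows "basis2 R M e\<^sub>2 e\<^sub>1"
proof -
  interpret Module.module R M by (rule M)
  show ?thesis
    by (rule basis2_change[OF e, where a = "\<zero>\<^bsub>R\<^esub>" and b = "\<one>\<^bsub>R\<^esub>" and c = "\<one>\<^bsub>R\<^esub>" and d = "\<zero>\<^bsub>R\<^esub>" and a' = "\<zero>\<^bsub>R\<^esub>" and b' = "\<one>\<^bsub>R\<^esub>" and c' = "\<one>\<^bsub>R\<^esub>" and d' = "\<zero>\<^bsub>R\<^esub>"])
      (use basis2_closed[OF e] in simp_all)
qed

text \<open>The transition matrix with rows (u, v) and (0, 1) is triangular with invertible
  diagonal, so its inverse can be written down.\<close>

lemma (in Module.module) basis2_unit_coefficient:
  assumes e: "basis2 R M e\<^sub>1 e\<^sub>2" and u: "u \<in> Units R" and v: "v \<in> carrier R"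
  shows "basis2 R M (u \<odot>\<^bsub>M\<^esub> e\<^sub>1 \<oplus>\<^bsub>M\<^esub> v \<odot>\<^bsub>M\<^esub> e\<^sub>2) e\<^sub>2"
proof -
  have cl [simp]: "u \<in> carrier R" "inv u \<in> carrier R" "v \<in> carrier R" "e\<^sub>1 \<in> carrier M" "e\<^sub>2 \<in> carrier M"
    using R.Units_closed[OF u] R.Units_inv_closed[OF u] v basis2_closed[OF e] by simp_all
  have e1: "e\<^sub>1 = inv u \<odot>\<^bsub>M\<^esub> (u \<odot>\<^bsub>M\<^esub> e\<^sub>1 \<oplus>\<^bsub>M\<^esub> v \<odot>\<^bsub>M\<^esub> e\<^sub>2) \<oplus>\<^bsub>M\<^esub> (\<ominus> (inv u \<otimes> v)) \<odot>\<^bsub>M\<^esub> e\<^sub>2"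
    using u by (simp add: smult_r_distr smult_l_minus M.a_assoc M.r_neg flip: smult_assoc1)
  show ?thesis
    by (rule basis2_change[OF e, where a = u and b = v and c = \<zero> and d = \<one>
        and a' = "inv u" and b' = "\<ominus> (inv u \<otimes> v)" and c' = \<zero> and d' = \<one>, OF _ refl _ e1])
      (use u in \<open>simp_all add: R.r_minus R.l_neg flip: R.m_assoc\<close>)
qed

text \<open>Compare the coefficients of \<open>s\<^sub>1\<close> in \<open>s\<^sub>1 = 1 s\<^sub>1 = u s\<^sub>1 s\<^sub>1 + v s\<^sub>2 s\<^sub>1\<close>.\<close>

lemma (in Module.algebra) one_coordinates_generate:
  assumes s: "basis2 R M s\<^sub>1 s\<^sub>2"
  obtains u v where "u \<in> carrier R" "v \<in> carrier R" "\<one>\<^bsub>M\<^esub> = u \<odot>\<^bsub>M\<^esub> s\<^sub>1 \<oplus>\<^bsub>M\<^esub> v \<odot>\<^bsub>M\<^esub> s\<^sub>2" "Idl\<^bsub>R\<^esub> {u, v} = carrier R"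
proof -
  have [simp]: "s\<^sub>1 \<in> carrier M" "s\<^sub>2 \<in> carrier M" using basis2_closed[OF s] by simp_all
  obtain u v where uv [simp]: "u \<in> carrier R" "v \<in> carrier R" and one: "\<one>\<^bsub>M\<^esub> = u \<odot>\<^bsub>M\<^esub> s\<^sub>1 \<oplus>\<^bsub>M\<^esub> v \<odot>\<^bsub>M\<^esub> s\<^sub>2"
    using basis2_rep[OF s, of "\<one>\<^bsub>M\<^esub>"] by auto
  obtain p q where pq [simp]: "p \<in> carrier R" "q \<in> carrier R" and s11: "s\<^sub>1 \<otimes>\<^bsub>M\<^esub> s\<^sub>1 = p \<odot>\<^bsub>M\<^esub> s\<^sub>1 \<oplus>\<^bsub>M\<^esub> q \<odot>\<^bsub>M\<^esub> s\<^sub>2"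
    using basis2_rep[OF s, of "s\<^sub>1 \<otimes>\<^bsub>M\<^esub> s\<^sub>1"] by auto
  obtain p' q' where pq' [simp]: "p' \<in> carrier R" "q' \<in> carrier R" and s21: "s\<^sub>2 \<otimes>\<^bsub>M\<^esub> s\<^sub>1 = p' \<odot>\<^bsub>M\<^esub> s\<^sub>1 \<oplus>\<^bsub>M\<^esub> q' \<odot>\<^bsub>M\<^esub> s\<^sub>2"
    using basis2_rep[OF s, of "s\<^sub>2 \<otimes>\<^bsub>M\<^esub> s\<^sub>1"] by auto
  have "\<one> \<odot>\<^bsub>M\<^esub> s\<^sub>1 \<oplus>\<^bsub>M\<^esub> \<zero> \<odot>\<^bsub>M\<^esub> s\<^sub>2 = \<one>\<^bsub>M\<^esub> \<otimes>\<^bsub>M\<^esub> s\<^sub>1"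
    by simp
  also have "\<dots> = u \<odot>\<^bsub>M\<^esub> (s\<^sub>1 \<otimes>\<^bsub>M\<^esub> s\<^sub>1) \<oplus>\<^bsub>M\<^esub> v \<odot>\<^bsub>M\<^esub> (s\<^sub>2 \<otimes>\<^bsub>M\<^esub> s\<^sub>1)"
    unfolding one by (simp add: l_distr smult_assoc2)
  also have "\<dots> = (u \<otimes> p \<oplus> v \<otimes> p') \<odot>\<^bsub>M\<^esub> s\<^sub>1 \<oplus>\<^bsub>M\<^esub> (u \<otimes> q \<oplus> v \<otimes> q') \<odot>\<^bsub>M\<^esub> s\<^sub>2"
    unfolding s11 s21 by (rule combine) simp_all
  finally have eq: "\<one> = u \<otimes> p \<oplus> v \<otimes> p'"
    by (rule basis2_unique(1)[OF s, rotated 4]) simp_all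
  interpret I: ideal "Idl\<^bsub>R\<^esub> {u, v}" R by (rule R.genideal_ideal) simp
  have "u \<in> Idl\<^bsub>R\<^esub> {u, v}" "v \<in> Idl\<^bsub>R\<^esub> {u, v}" using R.genideal_self[of "{u, v}"] by simp_all
  then have "\<one> \<in> Idl\<^bsub>R\<^esub> {u, v}"
    unfolding eq by (intro I.a_closed I.I_r_closed) simp_all
  then have "Idl\<^bsub>R\<^esub> {u, v} = carrier R" by (rule I.one_imp_carrier)
  then show thesis by (rule that[OF uv one])
qed

section \<open>Frames of sheaves\<close>

lemma (in module_presheaf) free2_on_basis2:
  assumes U: "openin X U" and free: "free2_on X S F U"
    and e: "basis2 (sections S U) (sections F U) e\<^sub>1 e\<^sub>2"
  shows "sheaf_basis2 X S F U e\<^sub>1 e\<^sub>2"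
  by (rule free2_on_sheaf_basis2[OF U free]) (rule basis2_sheaf_basis2[OF U _ e])

lemma (in Module.algebra) mult_right_linear:
  assumes "s \<in> carrier M" "m \<in> carrier M" "n \<in> carrier M" "x \<in> carrier R" "y \<in> carrier R"
  shows "s \<otimes>\<^bsub>M\<^esub> (x \<odot>\<^bsub>M\<^esub> m \<oplus>\<^bsub>M\<^esub> y \<odot>\<^bsub>M\<^esub> n) = x \<odot>\<^bsub>M\<^esub> (s \<otimes>\<^bsub>M\<^esub> m) \<oplus>\<^bsub>M\<^esub> y \<odot>\<^bsub>M\<^esub> (s \<otimes>\<^bsub>M\<^esub> n)"
proof -
  have swap: "s \<otimes>\<^bsub>M\<^esub> (x \<odot>\<^bsub>M\<^esub> m) = x \<odot>\<^bsub>M\<^esub> (s \<otimes>\<^bsub>M\<^esub> m)" if "x \<in> carrier R" "m \<in> carrier M" for x m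
    using smult_assoc2[OF that assms(1)] m_comm[of s "x \<odot>\<^bsub>M\<^esub> m"] m_comm[of s m] that assms(1) by simp
  show ?thesis
    using assms swap[OF assms(4,2)] swap[OF assms(5,3)] by (simp add: r_distr)
qed

text \<open>On the basis 1, \<alpha> of the algebra, multiplication by \<alpha> has the companion
  matrix of T^2 - v T - u. Pseudoregularity compares each module with the algebra, so
  \<open>u\<close> and \<open>v\<close> are the common values through which two modules are compared
  with each other.\<close>

lemma pseudoregular_trace_det:
  fixes \<O> :: "('x, 'r ring, 'r) presheaf"
  assumes \<O>: "ring_sheaf X \<O>" and S: "algebra_sheaf X \<O> S" and M: "pseudoregular X \<O> S M" and aff: "affine_open X \<O> U"
    and bS: "sheaf_basis2 X \<O> S U \<one>\<^bsub>sections S U\<^esub> \<alpha>"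
    and bM: "sheaf_basis2 X \<O> (scalar_restriction_sheaf S M) U e\<^sub>1 e\<^sub>2"
    and c: "{p, q, r, s, u, v} \<subseteq> carrier (sections \<O> U)"
    and \<alpha>\<alpha>: "\<alpha> \<otimes>\<^bsub>sections S U\<^esub> \<alpha> = u \<odot>\<^bsub>sections S U\<^esub> \<one>\<^bsub>sections S U\<^esub> \<oplus>\<^bsub>sections S U\<^esub> v \<odot>\<^bsub>sections S U\<^esub> \<alpha>"
    and e1: "\<alpha> \<odot>\<^bsub>sections M U\<^esub> e\<^sub>1 = p \<odot>\<^bsub>scalar_restriction (sections S U) (sections M U)\<^esub> e\<^sub>1 \<oplus>\<^bsub>sections M U\<^esub>
      r \<odot>\<^bsub>scalar_restriction (sections S U) (sections M U)\<^esub> e\<^sub>2"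
    and e2: "\<alpha> \<odot>\<^bsub>sections M U\<^esub> e\<^sub>2 = q \<odot>\<^bsub>scalar_restriction (sections S U) (sections M U)\<^esub> e\<^sub>1 \<oplus>\<^bsub>sections M U\<^esub>
      s \<odot>\<^bsub>scalar_restriction (sections S U) (sections M U)\<^esub> e\<^sub>2"
  shows "p \<oplus>\<^bsub>sections \<O> U\<^esub> s = v"
    and "(p \<otimes>\<^bsub>sections \<O> U\<^esub> s) \<ominus>\<^bsub>sections \<O> U\<^esub> (q \<otimes>\<^bsub>sections \<O> U\<^esub> r) = \<ominus>\<^bsub>sections \<O> U\<^esub> u"
proof -
  have ringS: "ring_sheaf X S" and modS: "module_sheaf X \<O> S"
    and alg: "\<And>V. openin X V \<Longrightarrow> Module.algebra (sections \<O> V) (sections S V)"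
    using S unfolding algebra_sheaf_def by blast+
  have modM: "module_sheaf X S M" using M unfolding pseudoregular_def by blast
  have U: "openin X U" using aff unfolding affine_open_def by blast
  interpret S: module_presheaf X S \<O> by (rule module_sheaf_module_presheaf[OF \<O> modS])
  interpret M: module_presheaf X M S by (rule module_sheaf_module_presheaf[OF ringS modM])
  interpret MR: module_presheaf X "scalar_restriction_sheaf S M" \<O>
    by (rule module_presheaf_scalar_restriction[OF \<O> S M.module_presheaf_axioms])
  interpret A: Module.algebra "sections \<O> U" "sections S U" by (rule alg[OF U])
  have \<alpha>: "\<alpha> \<in> carrier (sections S U)" using bS unfolding sheaf_basis2_def by blast
  have e: "e\<^sub>1 \<in> carrier (sections M U)" "e\<^sub>2 \<in> carrier (sections M U)" using bM unfolding sheaf_basis2_def by simp_all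
  have cl: "p \<in> carrier (sections \<O> U)" "q \<in> carrier (sections \<O> U)" "r \<in> carrier (sections \<O> U)"
    "s \<in> carrier (sections \<O> U)" "u \<in> carrier (sections \<O> U)" "v \<in> carrier (sections \<O> U)"
    using c by auto
  have \<alpha>_id: "restr S U U \<alpha> = \<alpha>" by (rule S.restr_id[OF U \<alpha>])
  have "sheaf_char_poly X \<O> S U (\<lambda>V y. restr S U V \<alpha> \<otimes>\<^bsub>sections S V\<^esub> y) =
      char_poly_matrix2 (sections \<O> U) \<zero>\<^bsub>sections \<O> U\<^esub> u \<one>\<^bsub>sections \<O> U\<^esub> v"
  proof (rule S.sheaf_char_poly_eq[OF U bS])
    show "{\<zero>\<^bsub>sections \<O> U\<^esub>, u, \<one>\<^bsub>sections \<O> U\<^esub>, v} \<subseteq> carrier (sections \<O> U)" using cl by simp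
    show "restr S U U \<alpha> \<otimes>\<^bsub>sections S U\<^esub> \<one>\<^bsub>sections S U\<^esub> =
        \<zero>\<^bsub>sections \<O> U\<^esub> \<odot>\<^bsub>sections S U\<^esub> \<one>\<^bsub>sections S U\<^esub> \<oplus>\<^bsub>sections S U\<^esub> \<one>\<^bsub>sections \<O> U\<^esub> \<odot>\<^bsub>sections S U\<^esub> \<alpha>"
      unfolding \<alpha>_id using \<alpha> by simp
    show "restr S U U \<alpha> \<otimes>\<^bsub>sections S U\<^esub> \<alpha> =
        u \<odot>\<^bsub>sections S U\<^esub> \<one>\<^bsub>sections S U\<^esub> \<oplus>\<^bsub>sections S U\<^esub> v \<odot>\<^bsub>sections S U\<^esub> \<alpha>"
      unfolding \<alpha>_id by (rule \<alpha>\<alpha>)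
  next
    fix V x y m n assume V: "openin X V" "V \<subseteq> U" and *: "x \<in> carrier (sections \<O> V)" "y \<in> carrier (sections \<O> V)"
      "m \<in> carrier (sections S V)" "n \<in> carrier (sections S V)"
    show "restr S U V \<alpha> \<otimes>\<^bsub>sections S V\<^esub> (x \<odot>\<^bsub>sections S V\<^esub> m \<oplus>\<^bsub>sections S V\<^esub> y \<odot>\<^bsub>sections S V\<^esub> n) =
        x \<odot>\<^bsub>sections S V\<^esub> (restr S U V \<alpha> \<otimes>\<^bsub>sections S V\<^esub> m) \<oplus>\<^bsub>sections S V\<^esub> y \<odot>\<^bsub>sections S V\<^esub> (restr S U V \<alpha> \<otimes>\<^bsub>sections S V\<^esub> n)"
      by (rule algebra.mult_right_linear[OF alg[OF V(1)] S.restr_closed[OF U V \<alpha>] *(3,4,1,2)])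
  next
    fix V m assume V: "openin X V" "V \<subseteq> U" and m: "m \<in> carrier (sections S U)"
    show "restr S U V \<alpha> \<otimes>\<^bsub>sections S V\<^esub> restr S U V m = restr S U V (restr S U U \<alpha> \<otimes>\<^bsub>sections S U\<^esub> m)"
      unfolding \<alpha>_id by (rule ring_hom_mult[OF M.S_restr_hom[OF U V] \<alpha> m, symmetric])
  qed
  moreover have "sheaf_char_poly X \<O> (scalar_restriction_sheaf S M) U (\<lambda>V m. restr S U V \<alpha> \<odot>\<^bsub>sections M V\<^esub> m) =
      char_poly_matrix2 (sections \<O> U) p q r s"
  proof (rule MR.sheaf_char_poly_eq[OF U bM])
    show "{p, q, r, s} \<subseteq> carrier (sections \<O> U)" using cl by simp
    show "restr S U U \<alpha> \<odot>\<^bsub>sections M U\<^esub> e\<^sub>1 = p \<odot>\<^bsub>sections (scalar_restriction_sheaf S M) U\<^esub> e\<^sub>1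
        \<oplus>\<^bsub>sections (scalar_restriction_sheaf S M) U\<^esub> r \<odot>\<^bsub>sections (scalar_restriction_sheaf S M) U\<^esub> e\<^sub>2"
      unfolding \<alpha>_id e1 by simp
    show "restr S U U \<alpha> \<odot>\<^bsub>sections M U\<^esub> e\<^sub>2 = q \<odot>\<^bsub>sections (scalar_restriction_sheaf S M) U\<^esub> e\<^sub>1
        \<oplus>\<^bsub>sections (scalar_restriction_sheaf S M) U\<^esub> s \<odot>\<^bsub>sections (scalar_restriction_sheaf S M) U\<^esub> e\<^sub>2"
      unfolding \<alpha>_id e2 by simp
  next
    fix V x y m n assume V: "openin X V" "V \<subseteq> U" and *: "x \<in> carrier (sections \<O> V)" "y \<in> carrier (sections \<O> V)"
      "m \<in> carrier (sections (scalar_restriction_sheaf S M) V)" "n \<in> carrier (sections (scalar_restriction_sheaf S M) V)"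
    have mn: "m \<in> carrier (sections M V)" "n \<in> carrier (sections M V)" using *(3,4) by simp_all
    show "restr S U V \<alpha> \<odot>\<^bsub>sections M V\<^esub> (x \<odot>\<^bsub>sections (scalar_restriction_sheaf S M) V\<^esub> m
          \<oplus>\<^bsub>sections (scalar_restriction_sheaf S M) V\<^esub> y \<odot>\<^bsub>sections (scalar_restriction_sheaf S M) V\<^esub> n) =
        x \<odot>\<^bsub>sections (scalar_restriction_sheaf S M) V\<^esub> (restr S U V \<alpha> \<odot>\<^bsub>sections M V\<^esub> m)
          \<oplus>\<^bsub>sections (scalar_restriction_sheaf S M) V\<^esub> y \<odot>\<^bsub>sections (scalar_restriction_sheaf S M) V\<^esub> (restr S U V \<alpha> \<odot>\<^bsub>sections M V\<^esub> n)"
      using smult_scalar_restriction_linear[OF alg[OF V(1)] M.module[OF V(1)] S.restr_closed[OF U V \<alpha>] mn *(1,2)] by simp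
  next
    fix V m assume V: "openin X V" "V \<subseteq> U" and "m \<in> carrier (sections (scalar_restriction_sheaf S M) U)"
    then have m: "m \<in> carrier (sections M U)" by simp
    show "restr S U V \<alpha> \<odot>\<^bsub>sections M V\<^esub> restr (scalar_restriction_sheaf S M) U V m =
        restr (scalar_restriction_sheaf S M) U V (restr S U U \<alpha> \<odot>\<^bsub>sections M U\<^esub> m)"
      unfolding \<alpha>_id using M.restr_smult[OF U V \<alpha> m] by simp
  qed
  moreover have "sheaf_char_poly X \<O> S U (\<lambda>V y. restr S U V \<alpha> \<otimes>\<^bsub>sections S V\<^esub> y) =
      sheaf_char_poly X \<O> (scalar_restriction_sheaf S M) U (\<lambda>V m. restr S U V \<alpha> \<odot>\<^bsub>sections M V\<^esub> m)"
    using M aff \<alpha> unfolding pseudoregular_def by blast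
  ultimately have "char_poly_matrix2 (sections \<O> U) p q r s =
      char_poly_matrix2 (sections \<O> U) \<zero>\<^bsub>sections \<O> U\<^esub> u \<one>\<^bsub>sections \<O> U\<^esub> v"
    by (simp only:)
  then have neg: "\<ominus>\<^bsub>sections \<O> U\<^esub> (p \<oplus>\<^bsub>sections \<O> U\<^esub> s) = \<ominus>\<^bsub>sections \<O> U\<^esub> (\<zero>\<^bsub>sections \<O> U\<^esub> \<oplus>\<^bsub>sections \<O> U\<^esub> v)"
    and det: "(p \<otimes>\<^bsub>sections \<O> U\<^esub> s) \<ominus>\<^bsub>sections \<O> U\<^esub> (q \<otimes>\<^bsub>sections \<O> U\<^esub> r) =
      (\<zero>\<^bsub>sections \<O> U\<^esub> \<otimes>\<^bsub>sections \<O> U\<^esub> v) \<ominus>\<^bsub>sections \<O> U\<^esub> (u \<otimes>\<^bsub>sections \<O> U\<^esub> \<one>\<^bsub>sections \<O> U\<^esub>)"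
    unfolding char_poly_matrix2_def by simp_all
  show "p \<oplus>\<^bsub>sections \<O> U\<^esub> s = v"
    using arg_cong[OF neg, of "\<lambda>x. \<ominus>\<^bsub>sections \<O> U\<^esub> x"] cl by simp
  show "(p \<otimes>\<^bsub>sections \<O> U\<^esub> s) \<ominus>\<^bsub>sections \<O> U\<^esub> (q \<otimes>\<^bsub>sections \<O> U\<^esub> r) = \<ominus>\<^bsub>sections \<O> U\<^esub> u"
    unfolding det using cl by (simp add: a_minus_def)
qed

section \<open>Two pseudoregular modules over a scheme\<close>

locale pseudoregular_pair =
  fixes X :: "'x topology" and \<O> :: "('x, 'r ring, 'r) presheaf" and S :: "('x, ('r, 's) module, 's) presheaf"
    and M :: "('x, ('s, 'm) module, 'm) presheaf" and N :: "('x, ('s, 'n) module, 'n) presheaf"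
  assumes scheme: "scheme X \<O>" and quadratic: "quadratic_algebra X \<O> S"
    and pseudoregular_M: "pseudoregular X \<O> S M" and pseudoregular_N: "pseudoregular X \<O> S N"
begin

abbreviation (input) "MR \<equiv> scalar_restriction_sheaf S M"
abbreviation (input) "NR \<equiv> scalar_restriction_sheaf S N"
abbreviation (input) "T \<equiv> tensor_presheaf S M N"
abbreviation (input) "TR \<equiv> scalar_restriction_sheaf S (tensor_presheaf S M N)"

lemma ring_sheaf_O: "ring_sheaf X \<O>" and local_ring_stalk: "x \<in> topspace X \<Longrightarrow> local_ring (stalk X \<O> x)"
  using scheme unfolding scheme_def locally_ringed_space_def by blast+

lemma algebra_sheaf_S: "algebra_sheaf X \<O> S" and locally_free2_S: "locally_free2 X \<O> S"
  using quadratic unfolding quadratic_algebra_def by blast+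

lemma ring_sheaf_S: "ring_sheaf X S" and module_sheaf_S: "module_sheaf X \<O> S"
  and algebra_S: "openin X U \<Longrightarrow> Module.algebra (sections \<O> U) (sections S U)"
  using algebra_sheaf_S unfolding algebra_sheaf_def by blast+

lemma module_sheaf_M: "module_sheaf X S M" and locally_free2_M: "locally_free2 X \<O> MR"
  using pseudoregular_M unfolding pseudoregular_def by blast+

lemma module_sheaf_N: "module_sheaf X S N" and locally_free2_N: "locally_free2 X \<O> NR"
  using pseudoregular_N unfolding pseudoregular_def by blast+

sublocale O: ring_sheaf_on X \<O>
  by (intro ring_sheaf_on.intro ring_sheaf_presheaf ring_sheaf_on_axioms.intro ring_sheaf_O)

sublocale S: module_presheaf X S \<O>
  by (rule module_sheaf_module_presheaf[OF ring_sheaf_O module_sheaf_S])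

sublocale M: module_presheaf X M S
  by (rule module_sheaf_module_presheaf[OF ring_sheaf_S module_sheaf_M])

sublocale N: module_presheaf X N S
  by (rule module_sheaf_module_presheaf[OF ring_sheaf_S module_sheaf_N])

sublocale T: module_presheaf X T S
  by (rule module_presheaf_tensor[OF M.module_presheaf_axioms N.module_presheaf_axioms])

sublocale MR: module_presheaf X MR \<O>
  by (rule module_presheaf_scalar_restriction[OF ring_sheaf_O algebra_sheaf_S M.module_presheaf_axioms])

sublocale NR: module_presheaf X NR \<O>
  by (rule module_presheaf_scalar_restriction[OF ring_sheaf_O algebra_sheaf_S N.module_presheaf_axioms])

sublocale TR: module_presheaf X TR \<O>
  by (rule module_presheaf_scalar_restriction[OF ring_sheaf_O algebra_sheaf_S T.module_presheaf_axioms])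

definition free_on where
  "free_on U \<longleftrightarrow> openin X U \<and> free2_on X \<O> S U \<and> free2_on X \<O> MR U \<and> free2_on X \<O> NR U"

lemma free_onD: "free_on U \<Longrightarrow> openin X U" "free_on U \<Longrightarrow> free2_on X \<O> S U"
    "free_on U \<Longrightarrow> free2_on X \<O> MR U" "free_on U \<Longrightarrow> free2_on X \<O> NR U"
  unfolding free_on_def by blast+

lemma free_on_mono: "free_on U \<Longrightarrow> openin X V \<Longrightarrow> V \<subseteq> U \<Longrightarrow> free_on V"
  unfolding free_on_def by (elim conjE) (intro conjI, assumption, (erule free2_on_mono; assumption)+)

abbreviation (input) "frame_on U \<equiv> frame_pair (sections \<O> U) (sections S U) (sections M U) (sections N U)"
abbreviation (input) "tensor_frame_on U \<equiv> tensor_frame (sections \<O> U) (sections S U) (sections M U) (sections N U)"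

text \<open>A frame consists of bases over \<open>U\<close> only; freeness of the sheaves on
  \<open>U\<close> makes them bases over all smaller open sets.\<close>

lemma frame_sheaf_basis2:
  assumes U: "free_on U" and fr: "frame_on U \<alpha> e\<^sub>1 e\<^sub>2 f\<^sub>1 f\<^sub>2 a b c a' c' d r"
  shows "sheaf_basis2 X \<O> S U \<one>\<^bsub>sections S U\<^esub> \<alpha>" "sheaf_basis2 X \<O> MR U e\<^sub>1 e\<^sub>2" "sheaf_basis2 X \<O> NR U f\<^sub>1 f\<^sub>2"
proof -
  interpret frame_pair "sections \<O> U" "sections S U" "sections M U" "sections N U" \<alpha> e\<^sub>1 e\<^sub>2 f\<^sub>1 f\<^sub>2 a b c a' c' d r by (rule fr)
  show "sheaf_basis2 X \<O> S U \<one>\<^bsub>sections S U\<^esub> \<alpha>"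
    by (rule S.free2_on_basis2[OF free_onD(1,2)[OF U] basis_S])
  show "sheaf_basis2 X \<O> MR U e\<^sub>1 e\<^sub>2"
    by (rule MR.free2_on_basis2[OF free_onD(1,3)[OF U]]) (use basis_M in simp)
  show "sheaf_basis2 X \<O> NR U f\<^sub>1 f\<^sub>2"
    by (rule NR.free2_on_basis2[OF free_onD(1,4)[OF U]]) (use basis_N in simp)
qed

text \<open>Both modules share the trace \<open>v\<close> and the determinant -u of \<alpha> on the
  algebra. Affineness of \<open>U\<close> enters because pseudoregularity speaks about affine open
  sets.\<close>

lemma tensor_frame_affine:
  assumes aff: "affine_open X \<O> U" and U: "free_on U" and fr: "frame_on U \<alpha> e\<^sub>1 e\<^sub>2 f\<^sub>1 f\<^sub>2 a b c a' c' d r"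
  shows "tensor_frame_on U \<alpha> e\<^sub>1 e\<^sub>2 f\<^sub>1 f\<^sub>2 a b c a' c' d r"
proof -
  interpret F: frame_pair "sections \<O> U" "sections S U" "sections M U" "sections N U" \<alpha> e\<^sub>1 e\<^sub>2 f\<^sub>1 f\<^sub>2 a b c a' c' d r by (rule fr)
  interpret A: Module.algebra "sections \<O> U" "sections S U" by (rule F.algebra)
  note closed [simp] = F.closed
  have \<alpha>: "\<alpha> \<otimes>\<^bsub>sections S U\<^esub> \<alpha> \<in> carrier (sections S U)" using basis2_closed[OF F.basis_S] by simp
  obtain u v where uv [simp]: "u \<in> carrier (sections \<O> U)" "v \<in> carrier (sections \<O> U)"
    and \<alpha>\<alpha>: "\<alpha> \<otimes>\<^bsub>sections S U\<^esub> \<alpha> = u \<odot>\<^bsub>sections S U\<^esub> \<one>\<^bsub>sections S U\<^esub> \<oplus>\<^bsub>sections S U\<^esub> v \<odot>\<^bsub>sections S U\<^esub> \<alpha>"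
    using basis2_rep[OF F.basis_S \<alpha>] .
  note bases = frame_sheaf_basis2[OF U fr]
  let ?R = "sections \<O> U"
  have cM: "{b, c, \<ominus>\<^bsub>?R\<^esub> a, \<zero>\<^bsub>?R\<^esub>, u, v} \<subseteq> carrier ?R" and cN: "{d, c', \<ominus>\<^bsub>?R\<^esub> a', \<ominus>\<^bsub>?R\<^esub> r, u, v} \<subseteq> carrier ?R"
    by simp_all
  note M = pseudoregular_trace_det[OF ring_sheaf_O algebra_sheaf_S pseudoregular_M aff bases(1,2) cM \<alpha>\<alpha> F.alpha_e1 F.alpha_e2]
  note N = pseudoregular_trace_det[OF ring_sheaf_O algebra_sheaf_S pseudoregular_N aff bases(1,3) cN \<alpha>\<alpha> F.alpha_f1 F.alpha_f2]
  have bv: "b = v" using M(1) by simp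
  have "d = (d \<oplus>\<^bsub>?R\<^esub> \<ominus>\<^bsub>?R\<^esub> r) \<oplus>\<^bsub>?R\<^esub> r"
    by (simp add: A.R.a_assoc A.R.l_neg)
  then have trace: "d = b \<oplus>\<^bsub>?R\<^esub> r" unfolding N(1) bv .
  have "c \<otimes>\<^bsub>?R\<^esub> a = \<ominus>\<^bsub>?R\<^esub> u" using M(2) by (simp add: A.R.minus_eq A.R.r_minus)
  also have "\<dots> = a' \<otimes>\<^bsub>?R\<^esub> c' \<ominus>\<^bsub>?R\<^esub> r \<otimes>\<^bsub>?R\<^esub> d"
    unfolding N(2)[symmetric]
    using A.R.m_comm[of d r] A.R.m_comm[of c' a'] by (simp add: A.R.minus_eq A.R.r_minus A.R.a_comm)
  finally have "a \<otimes>\<^bsub>?R\<^esub> c = a' \<otimes>\<^bsub>?R\<^esub> c' \<ominus>\<^bsub>?R\<^esub> r \<otimes>\<^bsub>?R\<^esub> d"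
    using A.R.m_comm[of a c] by simp
  then show ?thesis
    by (intro tensor_frame.intro tensor_frame_axioms.intro fr trace)
qed

text \<open>The bases restrict because the sheaves are free on \<open>U\<close>, and the other
  conditions are preserved by restriction maps. So \<open>V\<close> may be any open subset, in
  particular a neighbourhood, affine or not, on which an entry becomes a unit.\<close>

lemma tensor_frame_restr:
  assumes U: "free_on U" and V: "openin X V" "V \<subseteq> U"
    and fr: "tensor_frame_on U \<alpha> e\<^sub>1 e\<^sub>2 f\<^sub>1 f\<^sub>2 a b c a' c' d r"
  shows "tensor_frame_on V (restr S U V \<alpha>) (restr M U V e\<^sub>1) (restr M U V e\<^sub>2) (restr N U V f\<^sub>1) (restr N U V f\<^sub>2)
    (restr \<O> U V a) (restr \<O> U V b) (restr \<O> U V c) (restr \<O> U V a') (restr \<O> U V c') (restr \<O> U V d) (restr \<O> U V r)"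
proof -
  interpret F: tensor_frame "sections \<O> U" "sections S U" "sections M U" "sections N U" \<alpha> e\<^sub>1 e\<^sub>2 f\<^sub>1 f\<^sub>2 a b c a' c' d r by (rule fr)
  note oU = free_onD(1)[OF U]
  note UV = oU V
  note bases = frame_sheaf_basis2[OF U F.frame_pair_axioms]
  interpret RU: cring "sections \<O> U" by (rule O.cring_sections[OF oU])
  interpret RV: cring "sections \<O> V" by (rule O.cring_sections[OF V(1)])
  note hom = O.restr_hom[OF UV]
  have minus: "restr \<O> U V (\<ominus>\<^bsub>sections \<O> U\<^esub> x) = \<ominus>\<^bsub>sections \<O> V\<^esub> restr \<O> U V x" if "x \<in> carrier (sections \<O> U)" for x
    by (rule ring_hom_minus[OF hom RU.ring_axioms RV.ring_axioms that])
  have zero: "restr \<O> U V \<zero>\<^bsub>sections \<O> U\<^esub> = \<zero>\<^bsub>sections \<O> V\<^esub>"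
    by (rule ring_hom_zero[OF hom RU.ring_axioms RV.ring_axioms])
  note closed = F.closed
  note cl = closed RU.a_inv_closed[OF closed(1)] RU.a_inv_closed[OF closed(4)] RU.a_inv_closed[OF closed(7)] RU.zero_closed
  have eM: "e\<^sub>1 \<in> carrier (sections MR U)" "e\<^sub>2 \<in> carrier (sections MR U)" and fN: "f\<^sub>1 \<in> carrier (sections NR U)" "f\<^sub>2 \<in> carrier (sections NR U)"
    using F.e_closed F.f_closed by simp_all
  have combM: "restr M U V \<alpha>m = restr \<O> U V x \<odot>\<^bsub>scalar_restriction (sections S V) (sections M V)\<^esub> restr M U V e\<^sub>1 \<oplus>\<^bsub>sections M V\<^esub>
      restr \<O> U V y \<odot>\<^bsub>scalar_restriction (sections S V) (sections M V)\<^esub> restr M U V e\<^sub>2"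
    if "x \<in> carrier (sections \<O> U)" "y \<in> carrier (sections \<O> U)"
      "\<alpha>m = x \<odot>\<^bsub>scalar_restriction (sections S U) (sections M U)\<^esub> e\<^sub>1 \<oplus>\<^bsub>sections M U\<^esub> y \<odot>\<^bsub>scalar_restriction (sections S U) (sections M U)\<^esub> e\<^sub>2"
    for \<alpha>m x y
    using MR.restr_comb[OF UV eM that(1,2)] unfolding that(3)
    by (simp only: scalar_restriction_sheaf_simps scalar_restriction_simps(2))
  have combN: "restr N U V \<alpha>m = restr \<O> U V x \<odot>\<^bsub>scalar_restriction (sections S V) (sections N V)\<^esub> restr N U V f\<^sub>1 \<oplus>\<^bsub>sections N V\<^esub>
      restr \<O> U V y \<odot>\<^bsub>scalar_restriction (sections S V) (sections N V)\<^esub> restr N U V f\<^sub>2"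
    if "x \<in> carrier (sections \<O> U)" "y \<in> carrier (sections \<O> U)"
      "\<alpha>m = x \<odot>\<^bsub>scalar_restriction (sections S U) (sections N U)\<^esub> f\<^sub>1 \<oplus>\<^bsub>sections N U\<^esub> y \<odot>\<^bsub>scalar_restriction (sections S U) (sections N U)\<^esub> f\<^sub>2"
    for \<alpha>m x y
    using NR.restr_comb[OF UV fN that(1,2)] unfolding that(3)
    by (simp only: scalar_restriction_sheaf_simps scalar_restriction_simps(2))
  show ?thesis
  proof (intro tensor_frame.intro tensor_frame_axioms.intro frame_pair.intro)
    show "basis2 (sections \<O> V) (sections S V) \<one>\<^bsub>sections S V\<^esub> (restr S U V \<alpha>)"
      using bases(1) V ring_hom_one[OF M.S_restr_hom[OF UV]] unfolding sheaf_basis2_def by metis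
    show "basis2 (sections \<O> V) (scalar_restriction (sections S V) (sections M V)) (restr M U V e\<^sub>1) (restr M U V e\<^sub>2)"
      using bases(2) V unfolding sheaf_basis2_def scalar_restriction_sheaf_simps by blast
    show "basis2 (sections \<O> V) (scalar_restriction (sections S V) (sections N V)) (restr N U V f\<^sub>1) (restr N U V f\<^sub>2)"
      using bases(3) V unfolding sheaf_basis2_def scalar_restriction_sheaf_simps by blast
    show "restr S U V \<alpha> \<odot>\<^bsub>sections M V\<^esub> restr M U V e\<^sub>1 =
        restr \<O> U V b \<odot>\<^bsub>scalar_restriction (sections S V) (sections M V)\<^esub> restr M U V e\<^sub>1 \<oplus>\<^bsub>sections M V\<^esub>
        \<ominus>\<^bsub>sections \<O> V\<^esub> restr \<O> U V a \<odot>\<^bsub>scalar_restriction (sections S V) (sections M V)\<^esub> restr M U V e\<^sub>2"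
      using combM[OF cl(2) cl(8) F.alpha_e1] unfolding M.restr_smult[OF UV F.alpha_closed F.e_closed(1)] minus[OF closed(1)] .
    show "restr S U V \<alpha> \<odot>\<^bsub>sections M V\<^esub> restr M U V e\<^sub>2 =
        restr \<O> U V c \<odot>\<^bsub>scalar_restriction (sections S V) (sections M V)\<^esub> restr M U V e\<^sub>1 \<oplus>\<^bsub>sections M V\<^esub>
        \<zero>\<^bsub>sections \<O> V\<^esub> \<odot>\<^bsub>scalar_restriction (sections S V) (sections M V)\<^esub> restr M U V e\<^sub>2"
      using combM[OF cl(3) cl(11) F.alpha_e2] unfolding M.restr_smult[OF UV F.alpha_closed F.e_closed(2)] zero .
    show "restr S U V \<alpha> \<odot>\<^bsub>sections N V\<^esub> restr N U V f\<^sub>1 =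
        restr \<O> U V d \<odot>\<^bsub>scalar_restriction (sections S V) (sections N V)\<^esub> restr N U V f\<^sub>1 \<oplus>\<^bsub>sections N V\<^esub>
        \<ominus>\<^bsub>sections \<O> V\<^esub> restr \<O> U V a' \<odot>\<^bsub>scalar_restriction (sections S V) (sections N V)\<^esub> restr N U V f\<^sub>2"
      using combN[OF cl(6) cl(9) F.alpha_f1] unfolding N.restr_smult[OF UV F.alpha_closed F.f_closed(1)] minus[OF closed(4)] .
    show "restr S U V \<alpha> \<odot>\<^bsub>sections N V\<^esub> restr N U V f\<^sub>2 =
        restr \<O> U V c' \<odot>\<^bsub>scalar_restriction (sections S V) (sections N V)\<^esub> restr N U V f\<^sub>1 \<oplus>\<^bsub>sections N V\<^esub>
        \<ominus>\<^bsub>sections \<O> V\<^esub> restr \<O> U V r \<odot>\<^bsub>scalar_restriction (sections S V) (sections N V)\<^esub> restr N U V f\<^sub>2"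
      using combN[OF cl(5) cl(10) F.alpha_f2] unfolding N.restr_smult[OF UV F.alpha_closed F.f_closed(2)] minus[OF closed(7)] .
    show "restr \<O> U V d = restr \<O> U V b \<oplus>\<^bsub>sections \<O> V\<^esub> restr \<O> U V r"
      using arg_cong[OF F.trace, of "restr \<O> U V"] ring_hom_add[OF hom closed(2,7)] by simp
    have "restr \<O> U V (a' \<otimes>\<^bsub>sections \<O> U\<^esub> c' \<ominus>\<^bsub>sections \<O> U\<^esub> r \<otimes>\<^bsub>sections \<O> U\<^esub> d) =
        restr \<O> U V a' \<otimes>\<^bsub>sections \<O> V\<^esub> restr \<O> U V c' \<ominus>\<^bsub>sections \<O> V\<^esub> restr \<O> U V r \<otimes>\<^bsub>sections \<O> V\<^esub> restr \<O> U V d"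
      unfolding a_minus_def using closed by (simp add: ring_hom_add[OF hom] ring_hom_mult[OF hom] minus)
    then show "restr \<O> U V a \<otimes>\<^bsub>sections \<O> V\<^esub> restr \<O> U V c =
        restr \<O> U V a' \<otimes>\<^bsub>sections \<O> V\<^esub> restr \<O> U V c' \<ominus>\<^bsub>sections \<O> V\<^esub> restr \<O> U V r \<otimes>\<^bsub>sections \<O> V\<^esub> restr \<O> U V d"
      using arg_cong[OF F.pfaffian, of "restr \<O> U V"] ring_hom_mult[OF hom closed(1,3)] by simp
  qed (use algebra_S[OF V(1)] M.module[OF V(1)] N.module[OF V(1)] closed O.restr_closed[OF UV] in blast)+
qed

end

section \<open>The tensor sheaf near a point\<close>

context pseudoregular_pair
begin

abbreviation (input) "tensor_on U \<equiv> tensor_module (sections S U) (sections M U) (sections N U)"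
abbreviation (input) "pure_on U \<equiv> pure_tensor (sections S U) (sections M U) (sections N U)"
abbreviation (input) "TS \<equiv> scalar_restriction_sheaf S (tensor_sheaf X S M N)"

lemma restr_pure:
  assumes "openin X U" "openin X V" "V \<subseteq> U" "m \<in> carrier (sections M U)" "n \<in> carrier (sections N U)"
  shows "restr T U V (pure_on U m n) = pure_on V (restr M U V m) (restr N U V n)"
  by (rule tensor_presheaf_restr(3)[OF M.module_presheaf_axioms N.module_presheaf_axioms assms])

lemma pure_closed:
  assumes "openin X U" "m \<in> carrier (sections M U)" "n \<in> carrier (sections N U)"
  shows "pure_on U m n \<in> carrier (tensor_on U)"
  using tensor_pair.pure_tensor_closed[OF tensor_pair.intro[OF M.module[OF assms(1)] N.module[OF assms(1)]] assms(2,3)] .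

lemma module_sheaf_TS: "module_sheaf X \<O> TS"
  unfolding tensor_sheaf_def
  by (rule module_sheaf_scalar_restriction[OF ring_sheaf_O algebra_sheaf_S T.module_sheaf_sheafification])

text \<open>Restriction sends pure tensors to pure tensors, so bases of pure tensors over all
  \<open>V\<close> inside \<open>W\<close> form one basis of the presheaf on \<open>W\<close>, and
  \<open>free2_on_sheafification\<close> applies.\<close>

lemma free2_on_tensor_sheaf:
  assumes U: "openin X U" and W: "openin X W" "W \<subseteq> U"
    and mn: "m\<^sub>1 \<in> carrier (sections M U)" "m\<^sub>2 \<in> carrier (sections M U)" "n\<^sub>1 \<in> carrier (sections N U)" "n\<^sub>2 \<in> carrier (sections N U)"
    and basis: "\<And>V. openin X V \<Longrightarrow> V \<subseteq> W \<Longrightarrow> basis2 (sections \<O> V) (scalar_restriction (sections S V) (tensor_on V))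
      (pure_on V (restr M U V m\<^sub>1) (restr N U V n\<^sub>1)) (pure_on V (restr M U V m\<^sub>2) (restr N U V n\<^sub>2))"
  shows "free2_on X \<O> TS W"
proof -
  let ?t\<^sub>1 = "pure_on W (restr M U W m\<^sub>1) (restr N U W n\<^sub>1)" and ?t\<^sub>2 = "pure_on W (restr M U W m\<^sub>2) (restr N U W n\<^sub>2)"
  note UW = U W
  have mW: "restr M U W m\<^sub>1 \<in> carrier (sections M W)" "restr M U W m\<^sub>2 \<in> carrier (sections M W)"
    "restr N U W n\<^sub>1 \<in> carrier (sections N W)" "restr N U W n\<^sub>2 \<in> carrier (sections N W)"
    using M.restr_closed[OF UW] N.restr_closed[OF UW] mn by blast+
  have "sheaf_basis2 X \<O> TR W ?t\<^sub>1 ?t\<^sub>2"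
    unfolding sheaf_basis2_def
  proof (intro conjI allI impI)
    show "?t\<^sub>1 \<in> carrier (sections TR W)" "?t\<^sub>2 \<in> carrier (sections TR W)"
      using pure_closed[OF W(1) mW(1,3)] pure_closed[OF W(1) mW(2,4)] by simp_all
    fix V assume V: "openin X V \<and> V \<subseteq> W"
    have r: "restr T W V ?t\<^sub>1 = pure_on V (restr M U V m\<^sub>1) (restr N U V n\<^sub>1)"
      "restr T W V ?t\<^sub>2 = pure_on V (restr M U V m\<^sub>2) (restr N U V n\<^sub>2)"
      using restr_pure[OF W(1) conjunct1[OF V] conjunct2[OF V] mW(1,3)] restr_pure[OF W(1) conjunct1[OF V] conjunct2[OF V] mW(2,4)]
        M.restr_restr[OF U W(1) conjunct1[OF V] conjunct2[OF V] W(2)] N.restr_restr[OF U W(1) conjunct1[OF V] conjunct2[OF V] W(2)] mn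
      by simp_all
    show "basis2 (sections \<O> V) (sections TR V) (restr TR W V ?t\<^sub>1) (restr TR W V ?t\<^sub>2)"
      using basis[OF conjunct1[OF V] conjunct2[OF V]] by (simp add: r)
  qed
  then show ?thesis
    unfolding tensor_sheaf_def
    by (rule free2_on_sheafification[OF ring_sheaf_O algebra_sheaf_S T.module_presheaf_axioms W(1)])
qed

text \<open>The stalk at \<open>x\<close> is local, so among elements generating the unit ideal one
  becomes a unit near \<open>x\<close>; \<open>basis2_pure_tensors\<close> names, for each entry
  that can occur, two generators forming a basis.\<close>

lemma free2_on_tensor_sheaf_locally:
  assumes U: "free_on U" and fr: "tensor_frame_on U \<alpha> e\<^sub>1 e\<^sub>2 f\<^sub>1 f\<^sub>2 a b c a' c' d r"
    and Idl: "Idl\<^bsub>sections \<O> U\<^esub> {a, b, c, a', d \<oplus>\<^bsub>sections \<O> U\<^esub> r, c', r} = carrier (sections \<O> U)" and x: "x \<in> U"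
  shows "\<exists>W. openin X W \<and> x \<in> W \<and> free2_on X \<O> TS W"
proof -
  let ?R = "sections \<O> U"
  note oU = free_onD(1)[OF U]
  interpret F: tensor_frame "sections \<O> U" "sections S U" "sections M U" "sections N U" \<alpha> e\<^sub>1 e\<^sub>2 f\<^sub>1 f\<^sub>2 a b c a' c' d r by (rule fr)
  interpret R: cring ?R by (rule O.cring_sections[OF oU])
  let ?E = "{a, a', d, r, c', c}"
  have E: "?E \<subseteq> carrier ?R" using F.closed by simp
  interpret I: ideal "Idl\<^bsub>?R\<^esub> ?E" ?R by (rule R.genideal_ideal[OF E])
  have gens: "?E \<subseteq> Idl\<^bsub>?R\<^esub> ?E" by (rule R.genideal_self[OF E])
  \<comment> \<open>The elements \<open>b\<close> and d + r are combinations of the entries of the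
    alternating matrix, so the six entries alone generate the unit ideal and no case with
    \<open>b\<close> as the unit arises.\<close>
  have "b = d \<oplus>\<^bsub>?R\<^esub> \<ominus>\<^bsub>?R\<^esub> r"
    unfolding F.trace using F.closed by (simp add: R.a_assoc R.r_neg)
  then have "b \<in> Idl\<^bsub>?R\<^esub> ?E" using gens I.a_closed I.a_inv_closed by simp
  moreover have "d \<oplus>\<^bsub>?R\<^esub> r \<in> Idl\<^bsub>?R\<^esub> ?E" using gens I.a_closed by simp
  ultimately have "{a, b, c, a', d \<oplus>\<^bsub>?R\<^esub> r, c', r} \<subseteq> Idl\<^bsub>?R\<^esub> ?E" using gens by simp
  then have "carrier ?R \<subseteq> Idl\<^bsub>?R\<^esub> ?E"
    unfolding Idl[symmetric] by (rule R.genideal_minimal[OF I.ideal_axioms])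
  then have full: "Idl\<^bsub>?R\<^esub> ?E = carrier ?R"
    using I.a_subset by (rule equalityI[rotated])
  have "x \<in> topspace X" using openin_subset[OF oU] x by blast
  from O.local_unit[OF local_ring_stalk[OF this] oU x E full]
  obtain u W where u: "u \<in> ?E" and W: "openin X W" "x \<in> W" "W \<subseteq> U" and unit: "restr \<O> U W u \<in> Units (sections \<O> W)" .
  have unit_V: "restr \<O> U V u \<in> Units (sections \<O> V)" if V: "openin X V" "V \<subseteq> W" for V
    using O.restr_Units[OF W(1) V unit] unfolding O.restr_restr[OF oU W(1) V(1) V(2) W(3) subsetD[OF E u]] .
  have frV: "tensor_frame_on V (restr S U V \<alpha>) (restr M U V e\<^sub>1) (restr M U V e\<^sub>2) (restr N U V f\<^sub>1) (restr N U V f\<^sub>2)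
      (restr \<O> U V a) (restr \<O> U V b) (restr \<O> U V c) (restr \<O> U V a') (restr \<O> U V c') (restr \<O> U V d) (restr \<O> U V r)"
    if V: "openin X V" "V \<subseteq> W" for V
    by (rule tensor_frame_restr[OF U V(1) order_trans[OF V(2) W(3)] fr])
  note basis = tensor_frame.basis2_pure_tensors[OF frV]
  note free = free2_on_tensor_sheaf[OF oU W(1,3)]
  consider "u = a" | "u = a'" | "u = d" | "u = r" | "u = c'" | "u = c" using u by blast
  then have "free2_on X \<O> TS W"
  proof cases
    case 1 show ?thesis
      by (rule free[OF F.e_closed(1,1) F.f_closed(1,2)], rule basis(1)) (use unit_V 1 in simp_all)
  next
    case 2 show ?thesis
      by (rule free[OF F.e_closed(1,2) F.f_closed(1,1)], rule basis(2)) (use unit_V 2 in simp_all)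
  next
    case 3 show ?thesis
      by (rule free[OF F.e_closed(1,2) F.f_closed(1,2)], rule basis(3)) (use unit_V 3 in simp_all)
  next
    case 4 show ?thesis
      by (rule free[OF F.e_closed(1,2) F.f_closed(2,1)], rule basis(4)) (use unit_V 4 in simp_all)
  next
    case 5 show ?thesis
      by (rule free[OF F.e_closed(1,2) F.f_closed(2,2)], rule basis(5)) (use unit_V 5 in simp_all)
  next
    case 6 show ?thesis
      by (rule free[OF F.e_closed(2,2) F.f_closed(1,2)], rule basis(6)) (use unit_V 6 in simp_all)
  qed
  then show ?thesis using W(1,2) by blast
qed

text \<open>The coordinates of 1 generate the unit ideal, so near \<open>x\<close> one of them is a
  unit and 1 can replace the corresponding basis vector.\<close>

lemma unital_basis_locally:
  assumes U: "openin X U" "free2_on X \<O> S U" and x: "x \<in> U"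
  shows "\<exists>W \<alpha>. openin X W \<and> x \<in> W \<and> W \<subseteq> U \<and> sheaf_basis2 X \<O> S W \<one>\<^bsub>sections S W\<^esub> \<alpha>"
proof -
  let ?R = "sections \<O> U"
  obtain s\<^sub>1 s\<^sub>2 where s: "sheaf_basis2 X \<O> S U s\<^sub>1 s\<^sub>2" by (rule S.free2_on_sheaf_basis2[OF U])
  have sU: "basis2 ?R (sections S U) s\<^sub>1 s\<^sub>2" by (rule sheaf_basis2_basis2[OF S.presheaf_on_axioms s U(1)])
  interpret A: Module.algebra ?R "sections S U" by (rule algebra_S[OF U(1)])
  obtain u v where uv: "u \<in> carrier ?R" "v \<in> carrier ?R"
    and one: "\<one>\<^bsub>sections S U\<^esub> = u \<odot>\<^bsub>sections S U\<^esub> s\<^sub>1 \<oplus>\<^bsub>sections S U\<^esub> v \<odot>\<^bsub>sections S U\<^esub> s\<^sub>2"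
    and Idl: "Idl\<^bsub>?R\<^esub> {u, v} = carrier ?R"
    by (rule A.one_coordinates_generate[OF sU])
  have "x \<in> topspace X" using openin_subset[OF U(1)] x by blast
  from O.local_unit[OF local_ring_stalk[OF this] U(1) x _ Idl] uv
  obtain w W where w: "w \<in> {u, v}" and W: "openin X W" "x \<in> W" "W \<subseteq> U" and unit: "restr \<O> U W w \<in> Units (sections \<O> W)"
    by blast
  note UW = U(1) W(1,3)
  have sc: "s\<^sub>1 \<in> carrier (sections S U)" "s\<^sub>2 \<in> carrier (sections S U)" using basis2_closed[OF sU] by simp_all
  have uvW: "restr \<O> U W u \<in> carrier (sections \<O> W)" "restr \<O> U W v \<in> carrier (sections \<O> W)"
    using O.restr_closed[OF UW] uv by blast+
  have sW: "sheaf_basis2 X \<O> S W (restr S U W s\<^sub>1) (restr S U W s\<^sub>2)"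
    by (rule sheaf_basis2_mono[OF S.presheaf_on_axioms s UW])
  have sW': "basis2 (sections \<O> W) (sections S W) (restr S U W s\<^sub>1) (restr S U W s\<^sub>2)"
    by (rule sheaf_basis2_basis2[OF S.presheaf_on_axioms sW W(1)])
  have sWc: "restr S U W s\<^sub>1 \<in> carrier (sections S W)" "restr S U W s\<^sub>2 \<in> carrier (sections S W)"
    using basis2_closed[OF sW'] by simp_all
  interpret SW: Module.module "sections \<O> W" "sections S W" by (rule S.module[OF W(1)])
  have oneW: "\<one>\<^bsub>sections S W\<^esub> = restr \<O> U W u \<odot>\<^bsub>sections S W\<^esub> restr S U W s\<^sub>1 \<oplus>\<^bsub>sections S W\<^esub> restr \<O> U W v \<odot>\<^bsub>sections S W\<^esub> restr S U W s\<^sub>2"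
    using S.restr_comb[OF UW sc uv] ring_hom_one[OF M.S_restr_hom[OF UW]] unfolding one[symmetric] by simp
  have "\<exists>\<alpha>. basis2 (sections \<O> W) (sections S W) \<one>\<^bsub>sections S W\<^esub> \<alpha>"
  proof (cases "w = u")
    case True
    then have "restr \<O> U W u \<in> Units (sections \<O> W)" using unit by simp
    from SW.basis2_unit_coefficient[OF sW' this uvW(2)] show ?thesis
      unfolding oneW[symmetric] by blast
  next
    case False
    then have "restr \<O> U W v \<in> Units (sections \<O> W)" using w unit by simp
    from SW.basis2_unit_coefficient[OF basis2_swap[OF SW.module_axioms sW'] this uvW(1)]
    have "basis2 (sections \<O> W) (sections S W) \<one>\<^bsub>sections S W\<^esub> (restr S U W s\<^sub>1)"
      unfolding oneW using SW.M.a_comm[OF SW.smult_closed[OF uvW(2) sWc(2)] SW.smult_closed[OF uvW(1) sWc(1)]] by simp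
    then show ?thesis by blast
  qed
  then obtain \<alpha> where \<alpha>: "basis2 (sections \<O> W) (sections S W) \<one>\<^bsub>sections S W\<^esub> \<alpha>" ..
  have "sheaf_basis2 X \<O> S W \<one>\<^bsub>sections S W\<^esub> \<alpha>"
    by (rule S.basis2_sheaf_basis2[OF W(1) sW \<alpha>])
  then show ?thesis using W by blast
qed

text \<open>The sections \<open>g\<^sub>1\<close> and \<open>g\<^sub>2\<close> have germs at
  \<open>x\<close> coming from the presheaf, and an equation between germs already holds on some
  \<open>W\<close>. The conclusion covers every open subset of \<open>W\<close>, since the affine
  open set on which it is used is chosen later.\<close>

lemma tensor_sheaf_relation_locally:
  assumes U: "openin X U" and V: "openin X V" "x \<in> V" "V \<subseteq> U"
    and t: "t\<^sub>1 \<in> carrier (sections T V)" "t\<^sub>2 \<in> carrier (sections T V)"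
    and g: "g\<^sub>1 x = germ X T x V t\<^sub>1" "g\<^sub>2 x = germ X T x V t\<^sub>2"
    and z: "z \<in> carrier (sections T U)" and pq: "p \<in> carrier (sections \<O> U)" "q \<in> carrier (sections \<O> U)"
    and eq: "(\<lambda>y\<in>U. germ X T y U z) = p \<odot>\<^bsub>sections TS U\<^esub> g\<^sub>1 \<oplus>\<^bsub>sections TS U\<^esub> q \<odot>\<^bsub>sections TS U\<^esub> g\<^sub>2"
  obtains W where "openin X W" "x \<in> W" "W \<subseteq> V" "\<forall>Z. openin X Z \<and> Z \<subseteq> W \<longrightarrow>
    (\<exists>p'\<in>carrier (sections \<O> Z). \<exists>q'\<in>carrier (sections \<O> Z).
      restr T U Z z = p' \<odot>\<^bsub>sections TR Z\<^esub> restr T V Z t\<^sub>1 \<oplus>\<^bsub>sections TR Z\<^esub> q' \<odot>\<^bsub>sections TR Z\<^esub> restr T V Z t\<^sub>2)"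
proof -
  interpret A: Module.algebra "sections \<O> U" "sections S U" by (rule algebra_S[OF U])
  let ?\<pi> = "\<lambda>p. p \<odot>\<^bsub>sections S U\<^esub> \<one>\<^bsub>sections S U\<^esub>"
  let ?F = "sheafification X S T"
  note UV = U V(1,3)
  note VUx = V(1,3,2)
  have \<pi>: "?\<pi> p \<in> carrier (sections S U)" "?\<pi> q \<in> carrier (sections S U)" using pq by simp_all
  have \<pi>V: "restr S U V (?\<pi> p) \<in> carrier (sections S V)" "restr S U V (?\<pi> q) \<in> carrier (sections S V)"
    using T.S_restr_closed[OF UV] \<pi> by blast+
  have xU: "x \<in> U" using V by blast
  \<comment> \<open>The element of the presheaf whose germ at \<open>x\<close> is the value there of
    the right-hand side of \<open>eq\<close>.\<close>
  define w where "w = restr S U V (?\<pi> p) \<odot>\<^bsub>sections T V\<^esub> t\<^sub>1 \<oplus>\<^bsub>sections T V\<^esub> restr S U V (?\<pi> q) \<odot>\<^bsub>sections T V\<^esub> t\<^sub>2"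
  have pqV: "restr \<O> U V p \<in> carrier (sections \<O> V)" "restr \<O> U V q \<in> carrier (sections \<O> V)"
    using O.restr_closed[OF UV] pq by blast+
  have tR: "t\<^sub>1 \<in> carrier (sections TR V)" "t\<^sub>2 \<in> carrier (sections TR V)" using t by simp_all
  have w: "w = restr \<O> U V p \<odot>\<^bsub>sections TR V\<^esub> t\<^sub>1 \<oplus>\<^bsub>sections TR V\<^esub> restr \<O> U V q \<odot>\<^bsub>sections TR V\<^esub> t\<^sub>2"
    unfolding w_def algebra_sheaf_restr_scalar[OF algebra_sheaf_S UV pq(1)] algebra_sheaf_restr_scalar[OF algebra_sheaf_S UV pq(2)]
    by simp
  have wc: "w \<in> carrier (sections T V)"
    unfolding w_def by (intro T.add_closed T.smult_closed V(1) \<pi>V t)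
  have "germ X T x U z = (?\<pi> p \<odot>\<^bsub>sections ?F U\<^esub> g\<^sub>1 \<oplus>\<^bsub>sections ?F U\<^esub> ?\<pi> q \<odot>\<^bsub>sections ?F U\<^esub> g\<^sub>2) x"
    using fun_cong[OF eq, of x] xU by (simp add: tensor_sheaf_def)
  also have "\<dots> = germ X T x V w"
    unfolding w_def
    by (rule T.sheafification_add_germ[OF VUx]) (intro T.smult_closed V(1) \<pi>V t,
        intro T.smult_closed V(1) \<pi>V t, rule T.sheafification_smult_germ[OF U VUx t(1) \<pi>(1)], rule g(1),
        rule T.sheafification_smult_germ[OF U VUx t(2) \<pi>(2)], rule g(2))
  finally obtain W where W: "openin X W" "x \<in> W" "W \<subseteq> U \<inter> V" "restr T U W z = restr T V W w"
    by (rule T.germ_eqD[OF _ V(1,2) wc])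
  have WU: "W \<subseteq> U" "W \<subseteq> V" using W(3) by blast+
  have "\<exists>p'\<in>carrier (sections \<O> Z). \<exists>q'\<in>carrier (sections \<O> Z).
      restr T U Z z = p' \<odot>\<^bsub>sections TR Z\<^esub> restr T V Z t\<^sub>1 \<oplus>\<^bsub>sections TR Z\<^esub> q' \<odot>\<^bsub>sections TR Z\<^esub> restr T V Z t\<^sub>2"
    if Z: "openin X Z" "Z \<subseteq> W" for Z
  proof -
    have ZV: "Z \<subseteq> V" using Z WU by blast
    have "restr T U Z z = restr T W Z (restr T U W z)"
      by (rule T.restr_restr[OF U W(1) Z(1) Z(2) WU(1) z, symmetric])
    also have "\<dots> = restr T V Z w"
      unfolding W(4) by (rule T.restr_restr[OF V(1) W(1) Z(1) Z(2) WU(2) wc])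
    also have "\<dots> = restr \<O> V Z (restr \<O> U V p) \<odot>\<^bsub>sections TR Z\<^esub> restr T V Z t\<^sub>1 \<oplus>\<^bsub>sections TR Z\<^esub>
        restr \<O> V Z (restr \<O> U V q) \<odot>\<^bsub>sections TR Z\<^esub> restr T V Z t\<^sub>2"
      unfolding w using TR.restr_comb[OF V(1) Z(1) ZV tR pqV] by (simp only: scalar_restriction_sheaf_simps)
    finally show ?thesis
      using O.restr_closed[OF V(1) Z(1) ZV] pqV by blast
  qed
  then show thesis by (intro that[OF W(1,2) WU(2)]) blast
qed

text \<open>Two rounds of shrinking: on a first affine set all sheaves are free and a tensor frame
  exists; on a second one inside it, three generators are combinations of two elements of the
  presheaf. There \<open>one_in_ideal_if_rank2\<close> shows that the coprimitivity ideal contains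
  1.\<close>

lemma coprimitive_locally:
  assumes free: "locally_free2 X \<O> TS" and x: "x \<in> topspace X"
  shows "\<exists>U. x \<in> U \<and> affine_open X \<O> U \<and> free_on U \<and>
    coprimitive_modules (sections \<O> U) (sections S U) (sections M U) (sections N U)"
proof -
  obtain U\<^sub>0 where U0: "affine_open X \<O> U\<^sub>0" "x \<in> U\<^sub>0" using scheme x unfolding scheme_def by blast
  obtain U\<^sub>1 where U1: "openin X U\<^sub>1" "x \<in> U\<^sub>1" "free2_on X \<O> S U\<^sub>1"
    using locally_free2_S x unfolding locally_free2_def by blast
  obtain U\<^sub>2 where U2: "openin X U\<^sub>2" "x \<in> U\<^sub>2" "free2_on X \<O> MR U\<^sub>2"
    using locally_free2_M x unfolding locally_free2_def by blast
  obtain U\<^sub>3 where U3: "openin X U\<^sub>3" "x \<in> U\<^sub>3" "free2_on X \<O> NR U\<^sub>3"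
    using locally_free2_N x unfolding locally_free2_def by blast
  obtain U\<^sub>4 where U4: "openin X U\<^sub>4" "x \<in> U\<^sub>4" "free2_on X \<O> TS U\<^sub>4"
    using free x unfolding locally_free2_def by blast
  obtain W\<^sub>1 \<alpha> where W1: "openin X W\<^sub>1" "x \<in> W\<^sub>1" "W\<^sub>1 \<subseteq> U\<^sub>1" and \<alpha>: "sheaf_basis2 X \<O> S W\<^sub>1 \<one>\<^bsub>sections S W\<^sub>1\<^esub> \<alpha>"
    using unital_basis_locally[OF U1(1,3,2)] by (elim exE conjE) (rule that)
  have W: "openin X (W\<^sub>1 \<inter> U\<^sub>2 \<inter> U\<^sub>3 \<inter> U\<^sub>4)" "x \<in> W\<^sub>1 \<inter> U\<^sub>2 \<inter> U\<^sub>3 \<inter> U\<^sub>4"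
    using W1 U2 U3 U4 by (auto intro: openin_Int)
  \<comment> \<open>The set is taken affine so that \<open>tensor_frame_affine\<close> can supply
    the trace and Pfaffian identities.\<close>
  obtain V where V: "affine_open X \<O> V" "x \<in> V" "V \<subseteq> U\<^sub>0" "V \<subseteq> W\<^sub>1 \<inter> U\<^sub>2 \<inter> U\<^sub>3 \<inter> U\<^sub>4"
    by (rule affine_open_basis[OF ring_sheaf_O U0(1) W U0(2)])
  have oV: "openin X V" using V(1) unfolding affine_open_def by blast
  have sub: "V \<subseteq> W\<^sub>1" "V \<subseteq> U\<^sub>1" "V \<subseteq> U\<^sub>2" "V \<subseteq> U\<^sub>3" "V \<subseteq> U\<^sub>4" using V(4) W1(3) by blast+
  have free_V: "free_on V"
    unfolding free_on_def
    using oV free2_on_mono[OF U1(3,1) oV sub(2)] free2_on_mono[OF U2(3,1) oV sub(3)] free2_on_mono[OF U3(3,1) oV sub(4)]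
    by blast
  have basis_S: "basis2 (sections \<O> V) (sections S V) \<one>\<^bsub>sections S V\<^esub> (restr S W\<^sub>1 V \<alpha>)"
    using sheaf_basis2_basis2[OF S.presheaf_on_axioms sheaf_basis2_mono[OF S.presheaf_on_axioms \<alpha> W1(1) oV sub(1)] oV]
      ring_hom_one[OF M.S_restr_hom[OF W1(1) oV sub(1)]] by simp
  obtain e\<^sub>1 e\<^sub>2 where e: "sheaf_basis2 X \<O> MR V e\<^sub>1 e\<^sub>2"
    by (rule MR.free2_on_sheaf_basis2[OF free_onD(1,3)[OF free_V]])
  obtain f\<^sub>1 f\<^sub>2 where f: "sheaf_basis2 X \<O> NR V f\<^sub>1 f\<^sub>2"
    by (rule NR.free2_on_sheaf_basis2[OF free_onD(1,4)[OF free_V]])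
  have basis_M: "basis2 (sections \<O> V) (scalar_restriction (sections S V) (sections M V)) e\<^sub>1 e\<^sub>2"
    using sheaf_basis2_basis2[OF MR.presheaf_on_axioms e oV] by (simp only: scalar_restriction_sheaf_simps)
  have basis_N: "basis2 (sections \<O> V) (scalar_restriction (sections S V) (sections N V)) f\<^sub>1 f\<^sub>2"
    using sheaf_basis2_basis2[OF NR.presheaf_on_axioms f oV] by (simp only: scalar_restriction_sheaf_simps)
  obtain \<beta> a b c a' c' d r where "frame_on V \<beta> e\<^sub>1 e\<^sub>2 f\<^sub>1 f\<^sub>2 a b c a' c' d r"
    by (rule frame_pair_exists[OF algebra_S[OF oV] M.module[OF oV] N.module[OF oV] basis_S basis_M basis_N])
  then have fr: "tensor_frame_on V \<beta> e\<^sub>1 e\<^sub>2 f\<^sub>1 f\<^sub>2 a b c a' c' d r"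
    by (rule tensor_frame_affine[OF V(1) free_V])
  interpret F: tensor_frame "sections \<O> V" "sections S V" "sections M V" "sections N V" \<beta> e\<^sub>1 e\<^sub>2 f\<^sub>1 f\<^sub>2 a b c a' c' d r by (rule fr)
  interpret TS: module_presheaf X TS \<O>
    by (rule module_sheaf_module_presheaf[OF ring_sheaf_O module_sheaf_TS])
  obtain g\<^sub>1 g\<^sub>2 where g: "sheaf_basis2 X \<O> TS V g\<^sub>1 g\<^sub>2"
    by (rule TS.free2_on_sheaf_basis2[OF oV free2_on_mono[OF U4(3,1) oV sub(5)]])
  have gV: "basis2 (sections \<O> V) (sections TS V) g\<^sub>1 g\<^sub>2"
    by (rule sheaf_basis2_basis2[OF TS.presheaf_on_axioms g oV])
  have gc: "g\<^sub>1 \<in> carrier (sections (sheafification X S T) V)" "g\<^sub>2 \<in> carrier (sections (sheafification X S T) V)"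
    using basis2_closed[OF gV] by (simp_all add: tensor_sheaf_def)
  obtain Y t\<^sub>1 t\<^sub>2 where Y: "openin X Y" "x \<in> Y" "Y \<subseteq> V" and t: "t\<^sub>1 \<in> carrier (sections T Y)" "t\<^sub>2 \<in> carrier (sections T Y)"
    and gt: "\<forall>y\<in>Y. g\<^sub>1 y = germ X T y Y t\<^sub>1" "\<forall>y\<in>Y. g\<^sub>2 y = germ X T y Y t\<^sub>2"
    by (rule T.sheafification_local2[OF gc V(2)])
  \<comment> \<open>Each pure tensor is, as a section of the sheaf, a combination of the basis;
    germs at \<open>x\<close> turn this into a combination in the presheaf on a neighbourhood that
    depends on the tensor.\<close>
  have near: "\<exists>W. openin X W \<and> x \<in> W \<and> W \<subseteq> Y \<and> (\<forall>Z. openin X Z \<and> Z \<subseteq> W \<longrightarrow>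
      (\<exists>p'\<in>carrier (sections \<O> Z). \<exists>q'\<in>carrier (sections \<O> Z).
        pure_on Z (restr M V Z m) (restr N V Z n) = p' \<odot>\<^bsub>sections TR Z\<^esub> restr T Y Z t\<^sub>1 \<oplus>\<^bsub>sections TR Z\<^esub> q' \<odot>\<^bsub>sections TR Z\<^esub> restr T Y Z t\<^sub>2))"
    if m: "m \<in> carrier (sections M V)" and n: "n \<in> carrier (sections N V)" for m n
  proof -
    have z: "pure_on V m n \<in> carrier (sections T V)" using pure_closed[OF oV m n] by simp
    have "(\<lambda>y\<in>V. germ X T y V (pure_on V m n)) \<in> carrier (sections TS V)"
      using T.germ_section_closed[OF oV z] by (simp add: tensor_sheaf_def)
    then obtain p q where pq: "p \<in> carrier (sections \<O> V)" "q \<in> carrier (sections \<O> V)"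
      and eq: "(\<lambda>y\<in>V. germ X T y V (pure_on V m n)) = p \<odot>\<^bsub>sections TS V\<^esub> g\<^sub>1 \<oplus>\<^bsub>sections TS V\<^esub> q \<odot>\<^bsub>sections TS V\<^esub> g\<^sub>2"
      by (rule basis2_rep[OF gV])
    obtain W where W: "openin X W" "x \<in> W" "W \<subseteq> Y" "\<forall>Z. openin X Z \<and> Z \<subseteq> W \<longrightarrow>
      (\<exists>p'\<in>carrier (sections \<O> Z). \<exists>q'\<in>carrier (sections \<O> Z).
        restr T V Z (pure_on V m n) = p' \<odot>\<^bsub>sections TR Z\<^esub> restr T Y Z t\<^sub>1 \<oplus>\<^bsub>sections TR Z\<^esub> q' \<odot>\<^bsub>sections TR Z\<^esub> restr T Y Z t\<^sub>2)"
      by (rule tensor_sheaf_relation_locally[OF oV Y t bspec[OF gt(1) Y(2)] bspec[OF gt(2) Y(2)] z pq eq])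
    have "restr T V Z (pure_on V m n) = pure_on Z (restr M V Z m) (restr N V Z n)" if "openin X Z" "Z \<subseteq> W" for Z
      by (rule restr_pure[OF oV that(1) _ m n]) (use that W(3) Y(3) in blast)
    then show ?thesis
      using W by (intro exI[of _ W]) simp
  qed
  obtain W\<^sub>2 where W2: "openin X W\<^sub>2" "x \<in> W\<^sub>2" "W\<^sub>2 \<subseteq> Y" and r11: "\<forall>Z. openin X Z \<and> Z \<subseteq> W\<^sub>2 \<longrightarrow>
      (\<exists>p'\<in>carrier (sections \<O> Z). \<exists>q'\<in>carrier (sections \<O> Z). pure_on Z (restr M V Z e\<^sub>1) (restr N V Z f\<^sub>1) =
        p' \<odot>\<^bsub>sections TR Z\<^esub> restr T Y Z t\<^sub>1 \<oplus>\<^bsub>sections TR Z\<^esub> q' \<odot>\<^bsub>sections TR Z\<^esub> restr T Y Z t\<^sub>2)"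
    using near[OF F.e_closed(1) F.f_closed(1)] by (elim exE conjE) (rule that)
  obtain W\<^sub>3 where W3: "openin X W\<^sub>3" "x \<in> W\<^sub>3" "W\<^sub>3 \<subseteq> Y" and r12: "\<forall>Z. openin X Z \<and> Z \<subseteq> W\<^sub>3 \<longrightarrow>
      (\<exists>p'\<in>carrier (sections \<O> Z). \<exists>q'\<in>carrier (sections \<O> Z). pure_on Z (restr M V Z e\<^sub>1) (restr N V Z f\<^sub>2) =
        p' \<odot>\<^bsub>sections TR Z\<^esub> restr T Y Z t\<^sub>1 \<oplus>\<^bsub>sections TR Z\<^esub> q' \<odot>\<^bsub>sections TR Z\<^esub> restr T Y Z t\<^sub>2)"
    using near[OF F.e_closed(1) F.f_closed(2)] by (elim exE conjE) (rule that)
  obtain W\<^sub>4 where W4: "openin X W\<^sub>4" "x \<in> W\<^sub>4" "W\<^sub>4 \<subseteq> Y" and r21: "\<forall>Z. openin X Z \<and> Z \<subseteq> W\<^sub>4 \<longrightarrow>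
      (\<exists>p'\<in>carrier (sections \<O> Z). \<exists>q'\<in>carrier (sections \<O> Z). pure_on Z (restr M V Z e\<^sub>2) (restr N V Z f\<^sub>1) =
        p' \<odot>\<^bsub>sections TR Z\<^esub> restr T Y Z t\<^sub>1 \<oplus>\<^bsub>sections TR Z\<^esub> q' \<odot>\<^bsub>sections TR Z\<^esub> restr T Y Z t\<^sub>2)"
    using near[OF F.e_closed(2) F.f_closed(1)] by (elim exE conjE) (rule that)
  have W': "openin X (W\<^sub>2 \<inter> W\<^sub>3 \<inter> W\<^sub>4)" "x \<in> W\<^sub>2 \<inter> W\<^sub>3 \<inter> W\<^sub>4"
    using W2 W3 W4 by (auto intro: openin_Int)
  \<comment> \<open>The three neighbourhoods are intersected, and an affine set is chosen again
    because the cover in \<open>coprimitive\<close> is affine.\<close>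
  obtain Z where Z: "affine_open X \<O> Z" "x \<in> Z" "Z \<subseteq> V" "Z \<subseteq> W\<^sub>2 \<inter> W\<^sub>3 \<inter> W\<^sub>4"
    by (rule affine_open_basis[OF ring_sheaf_O V(1) W' V(2)])
  have oZ: "openin X Z" using Z(1) unfolding affine_open_def by blast
  have Zsub: "openin X Z \<and> Z \<subseteq> W\<^sub>2" "openin X Z \<and> Z \<subseteq> W\<^sub>3" "openin X Z \<and> Z \<subseteq> W\<^sub>4" "Z \<subseteq> Y"
    using oZ Z(4) W2(3) by blast+
  let ?\<rho> = "restr \<O> V Z" and ?R = "sections \<O> Z"
  interpret G: tensor_frame ?R "sections S Z" "sections M Z" "sections N Z" "restr S V Z \<beta>" "restr M V Z e\<^sub>1" "restr M V Z e\<^sub>2"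
    "restr N V Z f\<^sub>1" "restr N V Z f\<^sub>2" "?\<rho> a" "?\<rho> b" "?\<rho> c" "?\<rho> a'" "?\<rho> c'" "?\<rho> d" "?\<rho> r"
    by (rule tensor_frame_restr[OF free_V oZ Z(3) fr])
  interpret R: cring ?R by (rule O.cring_sections[OF oZ])
  \<comment> \<open>The seven elements of the coprimitivity condition, with b' = d + r; the ideal
    they generate also contains \<open>d\<close>.\<close>
  let ?E = "{?\<rho> a, ?\<rho> b, ?\<rho> c, ?\<rho> a', ?\<rho> d \<oplus>\<^bsub>?R\<^esub> ?\<rho> r, ?\<rho> c', ?\<rho> r}"
  have E: "?E \<subseteq> carrier ?R" using G.closed by simp
  interpret J: ideal "Idl\<^bsub>?R\<^esub> ?E" ?R by (rule R.genideal_ideal[OF E])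
  have gens: "?E \<subseteq> Idl\<^bsub>?R\<^esub> ?E" by (rule R.genideal_self[OF E])
  have "?\<rho> d = (?\<rho> d \<oplus>\<^bsub>?R\<^esub> ?\<rho> r) \<oplus>\<^bsub>?R\<^esub> \<ominus>\<^bsub>?R\<^esub> ?\<rho> r"
    using G.closed by (simp add: R.a_assoc R.r_neg)
  also have "\<dots> \<in> Idl\<^bsub>?R\<^esub> ?E"
    by (rule J.a_closed[OF _ J.a_inv_closed]) (use gens in simp_all)
  finally have coeffs: "{?\<rho> a, ?\<rho> b, ?\<rho> c, ?\<rho> a', ?\<rho> c', ?\<rho> d, ?\<rho> r} \<subseteq> Idl\<^bsub>?R\<^esub> ?E"
    using gens by simp
  have tZ: "restr T Y Z t\<^sub>1 \<in> carrier (tensor_on Z)" "restr T Y Z t\<^sub>2 \<in> carrier (tensor_on Z)"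
    using T.restr_closed[OF Y(1) oZ Zsub(4) t(1)] T.restr_closed[OF Y(1) oZ Zsub(4) t(2)] by simp_all
  have TRZ: "sections TR Z = scalar_restriction (sections S Z) (tensor_on Z)" by simp
  obtain p\<^sub>1 q\<^sub>1 where 1: "p\<^sub>1 \<in> carrier ?R" "q\<^sub>1 \<in> carrier ?R"
    "pure_on Z (restr M V Z e\<^sub>1) (restr N V Z f\<^sub>1) = p\<^sub>1 \<odot>\<^bsub>sections TR Z\<^esub> restr T Y Z t\<^sub>1 \<oplus>\<^bsub>sections TR Z\<^esub> q\<^sub>1 \<odot>\<^bsub>sections TR Z\<^esub> restr T Y Z t\<^sub>2"
    using mp[OF spec[OF r11] Zsub(1)] by (elim bexE) (rule that)
  obtain p\<^sub>2 q\<^sub>2 where 2: "p\<^sub>2 \<in> carrier ?R" "q\<^sub>2 \<in> carrier ?R"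
    "pure_on Z (restr M V Z e\<^sub>1) (restr N V Z f\<^sub>2) = p\<^sub>2 \<odot>\<^bsub>sections TR Z\<^esub> restr T Y Z t\<^sub>1 \<oplus>\<^bsub>sections TR Z\<^esub> q\<^sub>2 \<odot>\<^bsub>sections TR Z\<^esub> restr T Y Z t\<^sub>2"
    using mp[OF spec[OF r12] Zsub(2)] by (elim bexE) (rule that)
  obtain p\<^sub>3 q\<^sub>3 where 3: "p\<^sub>3 \<in> carrier ?R" "q\<^sub>3 \<in> carrier ?R"
    "pure_on Z (restr M V Z e\<^sub>2) (restr N V Z f\<^sub>1) = p\<^sub>3 \<odot>\<^bsub>sections TR Z\<^esub> restr T Y Z t\<^sub>1 \<oplus>\<^bsub>sections TR Z\<^esub> q\<^sub>3 \<odot>\<^bsub>sections TR Z\<^esub> restr T Y Z t\<^sub>2"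
    using mp[OF spec[OF r21] Zsub(3)] by (elim bexE) (rule that)
  have pq: "{p\<^sub>1, p\<^sub>2, p\<^sub>3, q\<^sub>1, q\<^sub>2, q\<^sub>3} \<subseteq> carrier ?R" using 1(1,2) 2(1,2) 3(1,2) by simp
  have "\<one>\<^bsub>?R\<^esub> \<in> Idl\<^bsub>?R\<^esub> ?E"
    by (rule G.one_in_ideal_if_rank2[OF J.ideal_axioms coeffs tZ pq 1(3)[unfolded TRZ] 2(3)[unfolded TRZ] 3(3)[unfolded TRZ]])
  then have "Idl\<^bsub>?R\<^esub> ?E = carrier ?R" by (rule J.one_imp_carrier)
  then have "coprimitive_modules ?R (sections S Z) (sections M Z) (sections N Z)"
    by (rule G.coprimitive_modules_if_frame_pair)
  then show ?thesis
    using Z(1,2) free_on_mono[OF free_V oZ Z(3)] by blast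
qed

end

theorem proposition6p2p1:
  fixes \<X> :: "'x topology"
    and \<O>\<^sub>X :: "('x, 'r ring, 'r) presheaf"
    and \<O>\<^sub>Y :: "('x, ('r, 's) module, 's) presheaf"
    and \<I> :: "('x, ('s, 'm) module, 'm) presheaf"
    and \<I>' :: "('x, ('s, 'n) module, 'n) presheaf"
  assumes "scheme \<X> \<O>\<^sub>X"
    and "quadratic_algebra \<X> \<O>\<^sub>X \<O>\<^sub>Y"
    and "pseudoregular \<X> \<O>\<^sub>X \<O>\<^sub>Y \<I>"
    and "pseudoregular \<X> \<O>\<^sub>X \<O>\<^sub>Y \<I>'"
  shows "locally_free2 \<X> \<O>\<^sub>X (scalar_restriction_sheaf \<O>\<^sub>Y (tensor_sheaf \<X> \<O>\<^sub>Y \<I> \<I>'))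
    \<longleftrightarrow> coprimitive \<X> \<O>\<^sub>X \<O>\<^sub>Y \<I> \<I>'"
proof -
  interpret pseudoregular_pair \<X> \<O>\<^sub>X \<O>\<^sub>Y \<I> \<I>'
    by (rule pseudoregular_pair.intro[OF assms])
  show ?thesis
  proof
    assume free: "locally_free2 \<X> \<O>\<^sub>X (scalar_restriction_sheaf \<O>\<^sub>Y (tensor_sheaf \<X> \<O>\<^sub>Y \<I> \<I>'))"
    \<comment> \<open>All suitable affine open sets are taken at once, so that only the covering
      property remains to be shown.\<close>
    define \<U> where "\<U> = {U. affine_open \<X> \<O>\<^sub>X U \<and> free_on U \<and>
      coprimitive_modules (sections \<O>\<^sub>X U) (sections \<O>\<^sub>Y U) (sections \<I> U) (sections \<I>' U)}"
    have "\<Union>\<U> = topspace \<X>"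
    proof
      show "\<Union>\<U> \<subseteq> topspace \<X>"
        unfolding \<U>_def using openin_subset free_onD(1) by blast
      show "topspace \<X> \<subseteq> \<Union>\<U>"
        unfolding \<U>_def using coprimitive_locally[OF free] by blast
    qed
    moreover have "\<forall>U\<in>\<U>. affine_open \<X> \<O>\<^sub>X U \<and> free2_on \<X> \<O>\<^sub>X \<O>\<^sub>Y U \<and>
        free2_on \<X> \<O>\<^sub>X (scalar_restriction_sheaf \<O>\<^sub>Y \<I>) U \<and> free2_on \<X> \<O>\<^sub>X (scalar_restriction_sheaf \<O>\<^sub>Y \<I>') U \<and>
        coprimitive_modules (sections \<O>\<^sub>X U) (sections \<O>\<^sub>Y U) (sections \<I> U) (sections \<I>' U)"
      unfolding \<U>_def free_on_def by blast
    ultimately show "coprimitive \<X> \<O>\<^sub>X \<O>\<^sub>Y \<I> \<I>'"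
      unfolding coprimitive_def by blast
  next
    assume "coprimitive \<X> \<O>\<^sub>X \<O>\<^sub>Y \<I> \<I>'"
    then obtain \<U> where cover: "\<Union>\<U> = topspace \<X>" and \<U>: "\<forall>U\<in>\<U>. affine_open \<X> \<O>\<^sub>X U \<and> free2_on \<X> \<O>\<^sub>X \<O>\<^sub>Y U \<and>
        free2_on \<X> \<O>\<^sub>X (scalar_restriction_sheaf \<O>\<^sub>Y \<I>) U \<and> free2_on \<X> \<O>\<^sub>X (scalar_restriction_sheaf \<O>\<^sub>Y \<I>') U \<and>
        coprimitive_modules (sections \<O>\<^sub>X U) (sections \<O>\<^sub>Y U) (sections \<I> U) (sections \<I>' U)"
      unfolding coprimitive_def by (elim exE conjE) (rule that)
    \<comment> \<open>On a member of the cover around \<open>x\<close>, coprimitivity supplies a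
      frame whose coefficients generate the unit ideal, and pseudoregularity turns it into a tensor
      frame.\<close>
    have "\<exists>W. openin \<X> W \<and> x \<in> W \<and> free2_on \<X> \<O>\<^sub>X TS W" if x: "x \<in> topspace \<X>" for x
    proof -
      obtain U where U: "U \<in> \<U>" "x \<in> U" using cover x by blast
      have aff: "affine_open \<X> \<O>\<^sub>X U"
        and cop: "coprimitive_modules (sections \<O>\<^sub>X U) (sections \<O>\<^sub>Y U) (sections \<I> U) (sections \<I>' U)"
        using bspec[OF \<U> U(1)] by blast+
      have oU: "openin \<X> U" using aff unfolding affine_open_def by blast
      have free: "free_on U" unfolding free_on_def using bspec[OF \<U> U(1)] oU by blast
      obtain \<alpha> e\<^sub>1 e\<^sub>2 f\<^sub>1 f\<^sub>2 a b c a' c' d r where fr: "frame_on U \<alpha> e\<^sub>1 e\<^sub>2 f\<^sub>1 f\<^sub>2 a b c a' c' d r"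
        and Idl: "Idl\<^bsub>sections \<O>\<^sub>X U\<^esub> {a, b, c, a', d \<oplus>\<^bsub>sections \<O>\<^sub>X U\<^esub> r, c', r} = carrier (sections \<O>\<^sub>X U)"
        by (rule coprimitive_modules_frame_pair[OF algebra_S[OF oU] M.module[OF oU] N.module[OF oU] cop])
      show ?thesis
        by (rule free2_on_tensor_sheaf_locally[OF free tensor_frame_affine[OF aff free fr] Idl U(2)])
    qed
    then show "locally_free2 \<X> \<O>\<^sub>X (scalar_restriction_sheaf \<O>\<^sub>Y (tensor_sheaf \<X> \<O>\<^sub>Y \<I> \<I>'))"
      unfolding locally_free2_def using module_sheaf_TS by blast
  qed
qed

end
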